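(* Let $C_0>0$. There exist $r_0,c,C>0$, depending only on $C_0$, such that the following holds. Let $M\ge0$ and let $q\in L^\infty(\mathbb R;\mathbb R)$ and $v\in L^\infty(\mathbb R;\mathbb R)$ satisfy \[ (-\Delta)^{1/4}v+qv=0\quad\text{in }\mathcal S'(\mathbb R),\qquad\|q\|_\infty\le M,\qquad\|v\|_\infty\le C_0 . \] If $|v(x_s)|\ge c_0$ at some $|x_s|\le2$, where $c_0\in(0,1]$, then \[ \|v\|_{L^\infty(-r,r)}\ge c\,r^{C(1+M^2+|\log c_0|)}\qquad(0<r<r_0). \] If the pointwise normalization is replaced by $\|v\|_{L^2(-2,2)}\ge K$ with $K\in(0,1]$, then \[ \|v\|_{L^\infty(-r,r)}\ge c\,r^{C(1+M^2+|\log K|)}\qquad(0<r<r_0), \] with the same dependence of the constants.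
   Context: $(-\Delta)^{1/4}$ is the fractional Laplacian on $\mathbb R$ with Fourier multiplier $|\xi|^{1/2}$, defined on bounded $v$ by $\langle(-\Delta)^{1/4}v,\phi\rangle=\int_{\mathbb R}v\,(-\Delta)^{1/4}\phi\,dx$ for Schwartz $\phi$. Bounded solutions have a (locally H\"older) continuous representative, and $v(x_s)$ refers to its value. *)

theory Defs
  imports "HOL-Probability.Essential_Supremum"
begin

definition vderiv :: "(real \<Rightarrow> complex) \<Rightarrow> real \<Rightarrow> complex" where
  "vderiv f = (\<lambda>x. vector_derivative f (at x))"

definition schwartz :: "(real \<Rightarrow> complex) \<Rightarrow> bool" where
  "schwartz \<phi> \<longleftrightarrow>
     (\<forall>m x. (vderiv ^^ m) \<phi> differentiable (at x)) \<and>
     (\<forall>k m. \<exists>B. \<forall>x. \<bar>x\<bar> ^ k * norm ((vderiv ^^ m) \<phi> x) \<le> B)"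

text \<open>The Fourier convention is the one for which \<open>-\<Delta>\<close> has symbol \<open>\<bar>\<xi>\<bar>\<^sup>2\<close>
  (angular frequency, factor \<open>1 / (2 * pi)\<close> in the inverse transform).\<close>

definition fourier :: "(real \<Rightarrow> complex) \<Rightarrow> real \<Rightarrow> complex" where
  "fourier f \<xi> = (LINT x|lborel. exp (- \<i> * complex_of_real (x * \<xi>)) * f x)"

definition inv_fourier :: "(real \<Rightarrow> complex) \<Rightarrow> real \<Rightarrow> complex" where
  "inv_fourier g x =
     complex_of_real (1 / (2 * pi)) * (LINT \<xi>|lborel. exp (\<i> * complex_of_real (x * \<xi>)) * g \<xi>)"

definition frac_lap :: "(real \<Rightarrow> complex) \<Rightarrow> real \<Rightarrow> complex" where
  "frac_lap \<phi> = inv_fourier (\<lambda>\<xi>. complex_of_real (\<bar>\<xi>\<bar> powr (1/2)) * fourier \<phi> \<xi>)"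

definition dist_of :: "(real \<Rightarrow> real) \<Rightarrow> (real \<Rightarrow> complex) \<Rightarrow> complex" where
  "dist_of f \<phi> = (LINT x|lebesgue. complex_of_real (f x) * \<phi> x)"

text \<open>The distribution \<open>(-\<Delta>)\<^sup>1\<^sup>/\<^sup>4 v\<close> of a bounded \<open>v\<close>. For Schwartz \<open>\<phi>\<close> the function
  \<open>frac_lap \<phi>\<close> is continuous and decays like \<open>\<bar>x\<bar>\<close> to the power \<open>-3/2\<close>, so the pairing
  is an absolutely convergent integral.\<close>

definition frac_lap_dist :: "(real \<Rightarrow> real) \<Rightarrow> (real \<Rightarrow> complex) \<Rightarrow> complex" where
  "frac_lap_dist v \<phi> = dist_of v (frac_lap \<phi>)"

definition solves :: "(real \<Rightarrow> real) \<Rightarrow> (real \<Rightarrow> real) \<Rightarrow> bool" where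
  "solves q v \<longleftrightarrow>
     (\<forall>\<phi>. schwartz \<phi> \<longrightarrow> frac_lap_dist v \<phi> + dist_of (\<lambda>x. q x * v x) \<phi> = 0)"

definition Linf_norm :: "real set \<Rightarrow> (real \<Rightarrow> real) \<Rightarrow> ereal" where
  "Linf_norm A f = esssup (lebesgue_on A) (\<lambda>x. ereal \<bar>f x\<bar>)"

definition Linf :: "real set \<Rightarrow> (real \<Rightarrow> real) set" where
  "Linf A = {f. f \<in> borel_measurable (lebesgue_on A) \<and> Linf_norm A f < \<infinity>}"

text \<open>Only used for essentially bounded functions on bounded intervals, where the integral
  is finite.\<close>

definition L2_norm_on :: "real set \<Rightarrow> (real \<Rightarrow> real) \<Rightarrow> real" where
  "L2_norm_on A f = sqrt (LINT x:A|lebesgue. (f x)\<^sup>2)"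

definition cont_rep :: "(real \<Rightarrow> real) \<Rightarrow> real \<Rightarrow> real" where
  "cont_rep v = (THE w. continuous_on UNIV w \<and> (AE x in lebesgue. w x = v x))"

text \<open>A continuous representative is unique, so \<open>cont_rep v\<close> is that representative as soon
  as one exists.\<close>

lemma cont_rep_eq:
  assumes w: "continuous_on UNIV w" "AE x in lebesgue. w x = v x"
  shows "cont_rep v = w"
  unfolding cont_rep_def
proof (rule the_equality)
  show "continuous_on UNIV w \<and> (AE x in lebesgue. w x = v x)"
    using w by simp
next
  fix u assume u: "continuous_on UNIV u \<and> (AE x in lebesgue. u x = v x)"
  let ?S = "{x. u x \<noteq> w x}"
  have op: "open ?S"
    using u w by (intro open_Collect_neq) auto
  have "AE x in lebesgue. u x = w x"
    using w(2) conjunct2[OF u] by eventually_elim simp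
  then have "?S \<in> null_sets lebesgue"
    using AE_iff_null_sets[of ?S lebesgue] op by auto
  then have "negligible ?S"
    by (simp add: negligible_iff_null_sets)
  then have "?S = {}"
    using op open_not_negligible by blast
  then show "u = w" by auto
qed

end

theory Submission
  imports Defs "HOL-Probability.Probability" "HOL-Real_Asymp.Real_Asymp"
begin

text \<open>
  The equation says \<open>(-\<Delta>) powr (1/4) v = f\<close> with \<open>\<bar>f\<bar> \<le> M \<bar>v\<bar>\<close>. Tested with Gaussians, it becomes a statement
  about the heat flow of \<open>v\<close>, because \<open>\<bar>\<xi>\<bar> powr (1/2)\<close> is a superposition of heat symbols; inverting the
  fractional time integration by Abel's method shows that \<open>v\<close> has a representative \<open>w\<close> with
  \<open>w x - w x' = c \<integral> f y (\<bar>y - x\<bar> powr (-1/2) - \<bar>y - x'\<bar> powr (-1/2)) dy\<close> for all \<open>x\<close> and \<open>x'\<close>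
  (\<open>riesz_representation\<close>). In particular \<open>w\<close> is Hoelder continuous with exponent \<open>1/2\<close>. From here
  on only this formula and the bounds on \<open>f\<close> and \<open>w\<close> are used.

  Suppose that \<open>\<bar>w\<bar> \<le> \<epsilon>\<close> on \<open>(-r, r)\<close>. The part of \<open>f\<close> inside this interval contributes at most a
  multiple of \<open>M \<epsilon>\<close>. For the part outside, the kernel is expanded in powers of \<open>x / y\<close> up to order
  \<open>N\<close>, so that \<open>w\<close> is a polynomial of degree below \<open>N\<close>, plus a remainder \<open>T\<close>, plus something
  small. The heart of the proof is the Carleman inequality for the remainder (\<open>carleman\<close>),
  \<open>\<integral> (T x)\<^sup>2 / x ^ (2 * N) dx \<le> (484 / N) \<integral> (f y)\<^sup>2 / \<bar>y\<bar> ^ (2 * N - 1) dy\<close>.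
  In logarithmic coordinates the operator is a convolution, and the claim is that its symbol is of
  size \<open>N powr (-1/2)\<close>. The Taylor coefficients of \<open>(1 - z) powr (-1/2)\<close> around the index \<open>N\<close> have this size, and
  up to this factor the kernel resembles that of the Hilbert transform, whose symbol is bounded
  although the kernel is not integrable. The cancellation that this needs is the exact identity
  \<open>partial_fraction_sum_zero\<close>; \<open>multiplier_sum_bound\<close> turns it into the bound for the symbol.

  Since \<open>f\<^sup>2 \<le> M\<^sup>2 w\<^sup>2\<close>, for \<open>N\<close> of order \<open>M\<^sup>2\<close> the contribution of \<open>r \<le> \<bar>y\<bar> \<le> 8\<close> to the right-hand
  side is absorbed by the left; this is where \<open>M\<^sup>2\<close> enters the exponent. The contribution of
  \<open>\<bar>y\<bar> > 8\<close> is of size \<open>64 powr (- N)\<close>, which beats the factor \<open>9\<^sup>N\<close> lost when the weight is removed on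
  \<open>[-3, 3]\<close>. The polynomial is estimated from its values near \<open>0\<close>: expanding to a higher order
  \<open>m\<close>, these values are of size \<open>M (\<epsilon> + 64 powr (- m))\<close>, and Lagrange interpolation loses only \<open>8\<^sup>m\<close>
  (\<open>coefficient_bound\<close>). Altogether (\<open>weighted_estimate\<close>, \<open>mass_splitting\<close>), a lower bound \<open>K\<close> for
  the \<open>L\<^sup>2\<close> norm of \<open>w\<close> on \<open>(-3, 3)\<close> implies, with a constant \<open>A\<close>,
  \<open>K\<^sup>2 \<le> \<epsilon>\<^sup>2 + 9\<^sup>N (192 (8\<^sup>m A M (\<epsilon> + 64 powr (- m)))\<^sup>2 / (r / 64) ^ (2 * N) + 8 C0\<^sup>2 64 powr (- N))\<close>.
  With \<open>N\<close> of order \<open>1 + M\<^sup>2 + \<bar>ln K\<bar>\<close> and \<open>m\<close> adapted to \<open>r\<close> and \<open>N\<close> this forces \<open>\<epsilon>\<close> to be at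
  least a constant times a fixed power of \<open>r\<^sup>N\<close> (\<open>choice_of_parameters\<close>). A lower bound for a point value
  yields one for the mass by Hoelder continuity (\<open>mass_from_point_value\<close>), at the cost of a logarithm
  of \<open>M\<close> in the exponent.
\<close>

section \<open>The heat kernel and its time derivative\<close>

definition heat :: "real \<Rightarrow> real \<Rightarrow> real" where
  "heat s z = exp (- z\<^sup>2 / (2 * s)) / sqrt (2 * pi * s)"

definition dheat :: "real \<Rightarrow> real \<Rightarrow> real" where
  "dheat s z = heat s z * (1 / (2 * s) - z\<^sup>2 / (2 * s\<^sup>2))"

lemma heat_measurable [measurable (raw)]:
  "f \<in> borel_measurable M \<Longrightarrow> g \<in> borel_measurable M \<Longrightarrow> (\<lambda>x. heat (f x) (g x)) \<in> borel_measurable M"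
  unfolding heat_def by simp

lemma dheat_measurable [measurable (raw)]:
  "f \<in> borel_measurable M \<Longrightarrow> g \<in> borel_measurable M \<Longrightarrow> (\<lambda>x. dheat (f x) (g x)) \<in> borel_measurable M"
  unfolding dheat_def by simp

lemma heat_eq_normal_density: "s > 0 \<Longrightarrow> heat s (y - x) = normal_density x (sqrt s) y"
  by (simp add: heat_def normal_density_def)

lemma heat_nonneg [simp]: "s > 0 \<Longrightarrow> 0 \<le> heat s z"
  by (simp add: heat_def)

lemma integrable_heat [simp]: "s > 0 \<Longrightarrow> integrable lborel (\<lambda>y. heat s (y - x))"
  by (simp add: heat_eq_normal_density)

lemma integral_heat [simp]: "s > 0 \<Longrightarrow> (\<integral>y. heat s (y - x) \<partial>lborel) = 1"
  by (simp add: heat_eq_normal_density)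

lemma nn_integral_heat [simp]: "s > 0 \<Longrightarrow> (\<integral>\<^sup>+y. ennreal (heat s (y - x)) \<partial>lborel) = 1"
  by (subst nn_integral_eq_integral) auto

lemma DERIV_heat_time:
  assumes "s > 0"
  shows "((\<lambda>s. heat s z) has_real_derivative - dheat s z) (at s)"
proof -
  define r where "r = sqrt (2 * pi * s)"
  have r: "r > 0" "r * r = 2 * pi * s" using assms by (auto simp: r_def)
  have "((\<lambda>s. exp (- z\<^sup>2 / (2 * s)) / sqrt (2 * pi * s)) has_real_derivative
      (exp (- z\<^sup>2 / (2 * s)) * (z\<^sup>2 * 2 / (2 * s)\<^sup>2) * r - exp (- z\<^sup>2 / (2 * s)) * (2 * pi * (inverse r / 2))) / (r * r)) (at s)"
    using assms unfolding r_def
    by (auto intro!: derivative_eq_intros simp: field_simps power2_eq_square mult_less_0_iff)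
  also have "(exp (- z\<^sup>2 / (2 * s)) * (z\<^sup>2 * 2 / (2 * s)\<^sup>2) * r - exp (- z\<^sup>2 / (2 * s)) * (2 * pi * (inverse r / 2))) / (r * r)
     = exp (- z\<^sup>2 / (2 * s)) * ((z\<^sup>2 * 2 / (2 * s)\<^sup>2) / r - (pi / (r * r)) / r)"
    using r(1) by (simp add: field_simps)
  also have "\<dots> = - dheat s z"
    unfolding dheat_def heat_def r_def[symmetric] r(2) using assms r(1) by (simp add: field_simps power2_eq_square)
  finally show ?thesis unfolding heat_def .
qed

lemma DERIV_heat_space:
  assumes "s > 0"
  shows "((\<lambda>z. heat s z) has_real_derivative - z / s * heat s z) (at z)"
  unfolding heat_def using assms
  by (auto intro!: derivative_eq_intros simp: field_simps power2_eq_square)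

lemma DERIV_dheat_space:
  assumes "s > 0"
  shows "((\<lambda>z. dheat s z) has_real_derivative (z ^ 3 / (2 * s ^ 3) - 3 * z / (2 * s\<^sup>2)) * heat s z) (at z)"
proof -
  have "((\<lambda>z. heat s z * (1 / (2 * s) - z\<^sup>2 / (2 * s\<^sup>2))) has_real_derivative
     (- z / s * heat s z) * (1 / (2 * s) - z\<^sup>2 / (2 * s\<^sup>2)) + (0 - 2 * z / (2 * s\<^sup>2)) * heat s z) (at z)"
    using assms by (intro DERIV_mult DERIV_heat_space DERIV_diff) (auto intro!: derivative_eq_intros simp: power2_eq_square)
  then show ?thesis unfolding dheat_def
    by (rule DERIV_cong)
      (use assms in \<open>simp add: field_simps power2_eq_square power3_eq_cube\<close>)
qed

text \<open>A polynomial in \<open>z\<^sup>2 / s\<close> times \<open>heat s z\<close> is bounded by a multiple of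
  \<open>heat (2 * s) z\<close>: doubling the variance leaves a spare factor \<open>exp (- z\<^sup>2 / (4 * s))\<close>, which
  swallows every power. All estimates of derivatives of the kernel below come from this.\<close>

lemma heat_double:
  assumes "s > 0"
  shows "heat s z = sqrt 2 * exp (- (z\<^sup>2 / s) / 4) * heat (2 * s) z"
proof -
  have "exp (- z\<^sup>2 / (2 * s)) = exp (- (z\<^sup>2 / s) / 4) * exp (- z\<^sup>2 / (2 * (2 * s)))"
    unfolding exp_add[symmetric] by (simp add: field_simps)
  moreover have "sqrt (2 * pi * (2 * s)) = sqrt 2 * sqrt (2 * pi * s)"
    by (simp add: real_sqrt_mult[symmetric] mult_ac)
  ultimately show ?thesis
    using assms by (simp add: heat_def)
qed

lemma power_exp_bounds:
  fixes x :: real assumes "x \<ge> 0"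
  shows "x * exp (- x) \<le> 1" "x\<^sup>2 * exp (- x) \<le> 2" "exp (- x) \<le> 1"
proof -
  have "1 + x \<le> exp x" by (rule exp_ge_add_one_self)
  moreover have "1 + x + x\<^sup>2 / 2 \<le> exp x"
    using exp_lower_Taylor_quadratic[OF assms] by simp
  ultimately have "x \<le> exp x" "x\<^sup>2 \<le> 2 * exp x" "1 \<le> exp x"
    using assms zero_le_power2[of x] by linarith+
  then show "x * exp (- x) \<le> 1" "x\<^sup>2 * exp (- x) \<le> 2" "exp (- x) \<le> 1"
    by (simp_all add: exp_minus divide_inverse[symmetric] pos_divide_le_eq inverse_le_1_iff)
qed

lemma poly_gauss_bound:
  assumes s: "s > 0" and P: "\<bar>P\<bar> \<le> (a + b * (z\<^sup>2 / s) + c * (z\<^sup>2 / s)\<^sup>2) * K"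
    and nn: "a \<ge> 0" "b \<ge> 0" "c \<ge> 0" "K \<ge> 0"
  shows "\<bar>P * heat s z\<bar> \<le> 2 * (a + 4 * b + 32 * c) * K * heat (2 * s) z"
proof -
  \<comment> \<open>The exponent of the factor that \<open>heat_double\<close> splits off.\<close>
  define x where "x = z\<^sup>2 / s / 4"
  have x: "x \<ge> 0" "z\<^sup>2 / s = 4 * x" using s by (simp_all add: x_def)
  note b = power_exp_bounds[OF x(1)]
  have "(a + b * (4 * x) + c * (4 * x)\<^sup>2) * exp (- x)
      = a * exp (-x) + 4 * b * (x * exp (-x)) + 16 * c * (x\<^sup>2 * exp (-x))"
    by (simp add: algebra_simps power2_eq_square)
  also have "\<dots> \<le> a * 1 + 4 * b * 1 + 16 * c * 2"
    using b nn by (intro add_mono mult_left_mono) auto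
  finally have 1: "(a + b * (4 * x) + c * (4 * x)\<^sup>2) * exp (- x) \<le> a + 4 * b + 32 * c" by simp
  have s2: "sqrt 2 \<le> 2" by (simp add: real_le_lsqrt)
  have "\<bar>P * heat s z\<bar> = \<bar>P\<bar> * exp (-x) * (sqrt 2 * heat (2 * s) z)"
    using s by (simp add: heat_double[OF s] abs_mult x_def)
  also have "\<dots> \<le> (a + b * (4 * x) + c * (4 * x)\<^sup>2) * K * exp (-x) * (sqrt 2 * heat (2 * s) z)"
    using P s by (intro mult_right_mono) (auto simp: x)
  also have "\<dots> = ((a + b * (4 * x) + c * (4 * x)\<^sup>2) * exp (-x)) * (K * (sqrt 2 * heat (2 * s) z))"
    by (simp add: mult_ac)
  also have "\<dots> \<le> (a + 4 * b + 32 * c) * (K * (2 * heat (2 * s) z))"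
    using 1 nn s s2 x by (intro mult_mono) auto
  also have "\<dots> = 2 * (a + 4 * b + 32 * c) * K * heat (2 * s) z" by simp
  finally show ?thesis .
qed

lemma dheat_bound: "s > 0 \<Longrightarrow> \<bar>dheat s z\<bar> \<le> 5 / s * heat (2 * s) z"
proof -
  assume s: "s > 0"
  have "\<bar>1 / (2 * s) - z\<^sup>2 / (2 * s\<^sup>2)\<bar> \<le> \<bar>1 / (2 * s)\<bar> + \<bar>z\<^sup>2 / (2 * s\<^sup>2)\<bar>"
    by (rule abs_triangle_ineq4)
  also have "\<dots> = (1/2 + 1/2 * (z\<^sup>2 / s) + 0 * (z\<^sup>2 / s)\<^sup>2) * (1 / s)"
    using s by (simp add: field_simps power2_eq_square)
  finally have "\<bar>(1 / (2 * s) - z\<^sup>2 / (2 * s\<^sup>2)) * heat s z\<bar> \<le> 2 * (1/2 + 4 * (1/2) + 32 * 0) * (1 / s) * heat (2 * s) z"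
    by (rule poly_gauss_bound[OF s]) (use s in auto)
  then show ?thesis by (simp add: dheat_def mult_ac)
qed

lemma abs_le_1_square: "\<bar>t::real\<bar> \<le> 1 + t\<^sup>2"
  using sum_power2_ge_zero[of "\<bar>t\<bar> - 1/2" 0] by (simp add: power2_eq_square algebra_simps)

lemma dheat_space_bound:
  assumes s: "s > 0"
  shows "\<bar>(z ^ 3 / (2 * s ^ 3) - 3 * z / (2 * s\<^sup>2)) * heat s z\<bar> \<le> 80 * s powr (-3/2) * heat (2 * s) z"
proof -
  define t where "t = z / sqrt s"
  have ss: "sqrt s > 0" "s = (sqrt s)\<^sup>2" using s by auto
  have z: "z = t * sqrt s" "z\<^sup>2 / s = t\<^sup>2" using ss by (auto simp: t_def power_divide)
  have pw: "s powr (-3/2) = 1 / (s * sqrt s)"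
    using s by (simp add: powr_minus powr_half_sqrt[symmetric] powr_mult_base field_simps powr_add[symmetric])
  have cube: "\<bar>t ^ 3\<bar> \<le> 1 + (t\<^sup>2)\<^sup>2"
  proof -
    have "\<bar>t^3\<bar> = \<bar>t\<bar> * t\<^sup>2" by (simp add: power3_eq_cube power2_eq_square abs_mult)
    also have "\<dots> \<le> 1 + (t\<^sup>2)\<^sup>2"
    proof (cases "\<bar>t\<bar> \<le> 1")
      case True
      then have "\<bar>t\<bar> * t\<^sup>2 \<le> 1 * 1" by (intro mult_mono) (auto simp: abs_square_le_1)
      then show ?thesis by (simp add: add_increasing2)
    next
      case False
      then have "\<bar>t\<bar> \<le> t\<^sup>2" by (metis linear mult_left_mono abs_ge_zero mult.right_neutral power2_abs power2_eq_square)
      then have "\<bar>t\<bar> * t\<^sup>2 \<le> t\<^sup>2 * t\<^sup>2" by (intro mult_right_mono) auto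
      then show ?thesis by (simp add: power2_eq_square)
    qed
    finally show ?thesis .
  qed
  have "z ^ 3 / (2 * s ^ 3) - 3 * z / (2 * s\<^sup>2) = (t^3/2 - 3 * t / 2) * (1 / (s * sqrt s))"
  proof -
    have "sqrt s * (sqrt s * x) = s * x" for x using s by (simp add: mult.assoc[symmetric])
    then show ?thesis using ss(1) s unfolding z(1)
      by (simp add: field_simps power2_eq_square power3_eq_cube \<open>\<And>x. sqrt s * (sqrt s * x) = s * x\<close>)
  qed
  then have "\<bar>z ^ 3 / (2 * s ^ 3) - 3 * z / (2 * s\<^sup>2)\<bar> = \<bar>t^3/2 - 3 * t / 2\<bar> * (1 / (s * sqrt s))"
    using s by (simp add: abs_mult)
  also have "\<dots> \<le> (2 + 3/2 * (z\<^sup>2 / s) + 1/2 * (z\<^sup>2/s)\<^sup>2) * (1 / (s * sqrt s))"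
    using s cube abs_le_1_square[of t] by (intro mult_right_mono) (auto simp: z(2))
  finally have "\<bar>(z ^ 3 / (2 * s ^ 3) - 3 * z / (2 * s\<^sup>2)) * heat s z\<bar>
     \<le> 2 * (2 + 4 * (3/2) + 32 * (1/2)) * (1 / (s * sqrt s)) * heat (2 * s) z"
    by (rule poly_gauss_bound[OF s]) (use s in auto)
  also have "\<dots> \<le> 80 * (1 / (s * sqrt s)) * heat (2 * s) z"
    using s by (intro mult_right_mono) auto
  finally show ?thesis unfolding pw .
qed

lemma heat_space_bound:
  assumes s: "s > 0"
  shows "\<bar>- z / s * heat s z\<bar> \<le> 10 * s powr (-1/2) * heat (2 * s) z"
proof -
  define t where "t = z / sqrt s"
  have ss: "sqrt s > 0" "s = (sqrt s)\<^sup>2" using s by auto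
  have z: "z = t * sqrt s" "z\<^sup>2 / s = t\<^sup>2" using ss by (auto simp: t_def power_divide)
  have pw: "s powr (-1/2) = 1 / sqrt s"
    using s by (simp add: powr_minus powr_half_sqrt[symmetric] field_simps)
  have "- z / s = - t * (1 / sqrt s)"
    using ss s unfolding z(1) by (simp add: field_simps power2_eq_square)
  then have "\<bar>- z / s\<bar> = \<bar>t\<bar> * (1 / sqrt s)" using s by (simp add: abs_mult)
  also have "\<dots> \<le> (1 + 1 * (z\<^sup>2/s) + 0 * (z\<^sup>2/s)\<^sup>2) * (1 / sqrt s)"
    using s abs_le_1_square[of t] by (intro mult_right_mono) (auto simp: z(2))
  finally have "\<bar>- z / s * heat s z\<bar> \<le> 2 * (1 + 4 * 1 + 32 * 0) * (1 / sqrt s) * heat (2 * s) z"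
    by (rule poly_gauss_bound[OF s]) (use s in auto)
  then show ?thesis unfolding pw by simp
qed

lemma nn_integral_shift:
  fixes f :: "real \<Rightarrow> ennreal"
  assumes [measurable]: "f \<in> borel_measurable borel"
  shows "(\<integral>\<^sup>+y. f (y + a) \<partial>lborel) = (\<integral>\<^sup>+y. f y \<partial>lborel)"
  using nn_integral_real_affine[of f 1 a] by (simp add: add.commute)

text \<open>By the fundamental theorem of calculus the difference of two translates is an average of
  translates of the derivative, and each of these has \<open>L\<^sup>1\<close> norm at most \<open>K\<close>.\<close>

lemma L1_translate:
  fixes \<phi> \<phi>' :: "real \<Rightarrow> real"
  assumes s: "s > 0" and K: "K \<ge> 0" and D: "\<And>z. (\<phi> has_real_derivative \<phi>' z) (at z)"
    and B: "\<And>z. \<bar>\<phi>' z\<bar> \<le> K * heat s z" and [measurable]: "\<phi>' \<in> borel_measurable borel"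
  shows "(\<integral>\<^sup>+y. ennreal \<bar>\<phi> (y - x) - \<phi> (y - x')\<bar> \<partial>lborel) \<le> ennreal (K * \<bar>x - x'\<bar>)"
proof -
  have main: "(\<integral>\<^sup>+y. ennreal \<bar>\<phi> (y - x) - \<phi> (y - x')\<bar> \<partial>lborel) \<le> ennreal (K * \<bar>x - x'\<bar>)"
    if le: "x \<le> x'" for x x'
  proof -
    have pt: "ennreal \<bar>\<phi> (y - x) - \<phi> (y - x')\<bar>
       \<le> (\<integral>\<^sup>+p. ennreal (K * heat s (y - p)) * indicator {x..x'} p \<partial>lborel)" for y
    proof -
      have hi: "((\<lambda>p. \<phi>' (y - p)) has_integral (- \<phi> (y - x')) - (- \<phi> (y - x))) {x..x'}"
      proof (rule fundamental_theorem_of_calculus[OF le])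
        fix p assume "p \<in> {x..x'}"
        have "((\<lambda>p. - \<phi> (y - p)) has_real_derivative \<phi>' (y - p)) (at p within {x..x'})"
          by (rule derivative_eq_intros DERIV_chain2[OF D] refl | simp)+
        then show "((\<lambda>p. - \<phi> (y - p)) has_vector_derivative \<phi>' (y - p)) (at p within {x..x'})"
          by (simp add: has_real_derivative_iff_has_vector_derivative)
      qed
      have ch: "continuous_on {x..x'} (\<lambda>p. K * heat s (y - p))"
        unfolding heat_def using s by (intro continuous_intros) auto
      then have hi2: "((\<lambda>p. K * heat s (y - p)) has_integral integral {x..x'} (\<lambda>p. K * heat s (y - p))) {x..x'}"
        by (intro integrable_integral integrable_continuous_real)
      have "\<bar>\<phi> (y - x) - \<phi> (y - x')\<bar> \<le> integral {x..x'} (\<lambda>p. K * heat s (y - p))"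
      proof -
        have "norm (integral {x..x'} (\<lambda>p. \<phi>' (y - p))) \<le> integral {x..x'} (\<lambda>p. K * heat s (y - p))"
          by (rule integral_norm_bound_integral) (use hi hi2 B in \<open>auto\<close>)
        moreover have "integral {x..x'} (\<lambda>p. \<phi>' (y - p)) = \<phi> (y - x) - \<phi> (y - x')"
          using hi by (simp add: integral_unique)
        ultimately show ?thesis by simp
      qed
      also have "ennreal (integral {x..x'} (\<lambda>p. K * heat s (y - p)))
          = (\<integral>\<^sup>+p. ennreal (K * heat s (y - p)) * indicator {x..x'} p \<partial>lborel)"
        by (rule nn_integral_has_integral_lebesgue'[symmetric, OF _ hi2]) (use K s in auto)
      finally show ?thesis by (simp add: ennreal_leI)
    qed
    have "(\<integral>\<^sup>+y. ennreal \<bar>\<phi> (y - x) - \<phi> (y - x')\<bar> \<partial>lborel)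
       \<le> (\<integral>\<^sup>+y. (\<integral>\<^sup>+p. ennreal (K * heat s (y - p)) * indicator {x..x'} p \<partial>lborel) \<partial>lborel)"
      by (intro nn_integral_mono pt)
    also have "\<dots> = (\<integral>\<^sup>+p. (\<integral>\<^sup>+y. ennreal (K * heat s (y - p)) * indicator {x..x'} p \<partial>lborel) \<partial>lborel)"
      by (rule lborel_pair.Fubini') measurable
    also have "\<dots> = (\<integral>\<^sup>+p. ennreal K * indicator {x..x'} p \<partial>lborel)"
      using K s by (intro nn_integral_cong) (simp add: nn_integral_multc nn_integral_cmult ennreal_mult')
    also have "\<dots> = ennreal (K * \<bar>x - x'\<bar>)"
      using le K by (simp add: nn_integral_cmult_indicator ennreal_mult')
    finally show ?thesis .
  qed
  show ?thesis
  proof (cases "x \<le> x'")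
    case True then show ?thesis by (rule main)
  next
    case False
    then show ?thesis using main[of x' x] by (simp add: abs_minus_commute)
  qed
qed

lemma heat_L1_translate:
  "s > 0 \<Longrightarrow> (\<integral>\<^sup>+y. ennreal \<bar>heat s (y - x) - heat s (y - x')\<bar> \<partial>lborel)
     \<le> ennreal (10 * s powr (-1/2) * \<bar>x - x'\<bar>)"
  by (rule L1_translate[OF _ _ DERIV_heat_space heat_space_bound]) auto

lemma dheat_L1_translate:
  "s > 0 \<Longrightarrow> (\<integral>\<^sup>+y. ennreal \<bar>dheat s (y - x) - dheat s (y - x')\<bar> \<partial>lborel)
     \<le> ennreal (80 * s powr (-3/2) * \<bar>x - x'\<bar>)"
  by (rule L1_translate[OF _ _ DERIV_dheat_space dheat_space_bound]) auto

lemma dheat_nn_integral: "s > 0 \<Longrightarrow> (\<integral>\<^sup>+y. ennreal \<bar>dheat s (y - x)\<bar> \<partial>lborel) \<le> ennreal (5 / s)"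
proof -
  assume s: "s > 0"
  have "(\<integral>\<^sup>+y. ennreal \<bar>dheat s (y - x)\<bar> \<partial>lborel) \<le> (\<integral>\<^sup>+y. ennreal (5 / s) * ennreal (heat (2 * s) (y - x)) \<partial>lborel)"
    using s dheat_bound[OF s] by (intro nn_integral_mono) (simp add: ennreal_mult[symmetric] ennreal_leI)
  also have "\<dots> = ennreal (5 / s)" using s by (simp add: nn_integral_cmult)
  finally show ?thesis .
qed

text \<open>The same argument in the time variable, where the derivative has \<open>L\<^sup>1\<close> norm at most \<open>5 / p\<close>
  at time \<open>p\<close>.\<close>

lemma heat_time_diff:
  assumes s: "s > 0" "t \<ge> 0"
  shows "(\<integral>\<^sup>+y. ennreal \<bar>heat s (y - x) - heat (s + t) (y - x)\<bar> \<partial>lborel) \<le> ennreal (5 * t / s)"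
proof -
  have pt: "ennreal \<bar>heat s z - heat (s + t) z\<bar>
       \<le> (\<integral>\<^sup>+p. ennreal \<bar>dheat p z\<bar> * indicator {s..s+t} p \<partial>lborel)" for z
  proof -
    have hi: "((\<lambda>p. dheat p z) has_integral (- heat (s+t) z) - (- heat s z)) {s..s+t}"
    proof (rule fundamental_theorem_of_calculus)
      fix p assume "p \<in> {s..s+t}"
      then have p: "p > 0" using s by auto
      have "((\<lambda>p. - heat p z) has_real_derivative dheat p z) (at p within {s..s+t})"
        by (rule derivative_eq_intros DERIV_subset[OF DERIV_heat_time[OF p]] refl | simp)+
      then show "((\<lambda>p. - heat p z) has_vector_derivative dheat p z) (at p within {s..s+t})"
        by (simp add: has_real_derivative_iff_has_vector_derivative)
    qed (use s in auto)
    have ch: "continuous_on {s..s+t} (\<lambda>p. \<bar>dheat p z\<bar>)"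
      unfolding heat_def dheat_def using s by (intro continuous_intros) auto
    then have hi2: "((\<lambda>p. \<bar>dheat p z\<bar>) has_integral integral {s..s+t} (\<lambda>p. \<bar>dheat p z\<bar>)) {s..s+t}"
      by (intro integrable_integral integrable_continuous_real)
    have "\<bar>heat s z - heat (s+t) z\<bar> \<le> integral {s..s+t} (\<lambda>p. \<bar>dheat p z\<bar>)"
    proof -
      have "norm (integral {s..s+t} (\<lambda>p. dheat p z)) \<le> integral {s..s+t} (\<lambda>p. \<bar>dheat p z\<bar>)"
        by (rule integral_norm_bound_integral) (use hi hi2 in auto)
      moreover have "integral {s..s+t} (\<lambda>p. dheat p z) = heat s z - heat (s+t) z"
        using hi by (simp add: integral_unique)
      ultimately show ?thesis by simp
    qed
    also have "ennreal (integral {s..s+t} (\<lambda>p. \<bar>dheat p z\<bar>))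
        = (\<integral>\<^sup>+p. ennreal \<bar>dheat p z\<bar> * indicator {s..s+t} p \<partial>lborel)"
      by (rule nn_integral_has_integral_lebesgue'[symmetric, OF _ hi2]) auto
    finally show ?thesis by (simp add: ennreal_leI)
  qed
  have "(\<integral>\<^sup>+y. ennreal \<bar>heat s (y - x) - heat (s + t) (y - x)\<bar> \<partial>lborel)
     \<le> (\<integral>\<^sup>+y. (\<integral>\<^sup>+p. ennreal \<bar>dheat p (y - x)\<bar> * indicator {s..s+t} p \<partial>lborel) \<partial>lborel)"
    by (intro nn_integral_mono pt)
  also have "\<dots> = (\<integral>\<^sup>+p. (\<integral>\<^sup>+y. ennreal \<bar>dheat p (y - x)\<bar> * indicator {s..s+t} p \<partial>lborel) \<partial>lborel)"
    by (rule lborel_pair.Fubini') measurable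
  also have "\<dots> \<le> (\<integral>\<^sup>+p. ennreal (5 / s) * indicator {s..s+t} p \<partial>lborel)"
  proof (intro nn_integral_mono)
    fix p
    show "(\<integral>\<^sup>+y. ennreal \<bar>dheat p (y - x)\<bar> * indicator {s..s+t} p \<partial>lborel) \<le> ennreal (5 / s) * indicator {s..s+t} p"
    proof (cases "p \<in> {s..s+t}")
      case True
      then have "(\<integral>\<^sup>+y. ennreal \<bar>dheat p (y - x)\<bar> \<partial>lborel) \<le> ennreal (5 / p)"
        using s by (intro dheat_nn_integral) auto
      also have "\<dots> \<le> ennreal (5 / s)" using True s by (intro ennreal_leI) (auto simp: field_simps)
      finally show ?thesis using True by simp
    qed simp
  qed
  also have "\<dots> = ennreal (5 * t / s)"
    using s by (simp add: nn_integral_cmult_indicator ennreal_mult'[symmetric])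
  finally show ?thesis .
qed

section \<open>The fractional Laplacian of a Gaussian\<close>

text \<open>Fractional powers of the time variable, cut off at \<open>0\<close>, so that integrals over the positive
  half-line and convolutions on it become integrals over the whole line.\<close>

definition pos_powr :: "real \<Rightarrow> real \<Rightarrow> real" where
  "pos_powr a t = (if t > 0 then t powr a else 0)"

lemma pos_powr_measurable [measurable (raw)]:
  "f \<in> borel_measurable M \<Longrightarrow> (\<lambda>x. pos_powr a (f x)) \<in> borel_measurable M"
  unfolding pos_powr_def by simp

lemma pos_powr_nonneg [simp]: "0 \<le> pos_powr a t" by (simp add: pos_powr_def)

lemma fourier_heat:
  assumes s: "s > 0"
  shows "(LINT x|lborel. exp (- \<i> * complex_of_real (x * \<xi>)) * complex_of_real (heat s x))
     = complex_of_real (exp (- s * \<xi>\<^sup>2 / 2))"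
proof -
  have h: "heat s (sqrt s * x) * sqrt s = std_normal_density x" for x
    using s by (simp add: heat_def std_normal_density_def power_mult_distrib real_sqrt_mult)
  have "(LINT x|lborel. exp (- \<i> * complex_of_real (x * \<xi>)) * complex_of_real (heat s x))
    = sqrt s *\<^sub>R (LINT x|lborel. exp (- \<i> * complex_of_real ((sqrt s * x) * \<xi>)) * complex_of_real (heat s (sqrt s * x)))"
    using lborel_integral_real_affine[of "sqrt s" "\<lambda>x. exp (- \<i> * complex_of_real (x * \<xi>)) * complex_of_real (heat s x)" 0] s
    by simp
  also have "\<dots> = (LINT x|lborel. sqrt s *\<^sub>R (exp (- \<i> * complex_of_real ((sqrt s * x) * \<xi>)) * complex_of_real (heat s (sqrt s * x))))"
    by (rule integral_scaleR_right[symmetric])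
  also have "\<dots> = (LINT x|lborel. std_normal_density x *\<^sub>R iexp ((- sqrt s * \<xi>) * x))"
  proof (rule Bochner_Integration.integral_cong[OF refl])
    fix x
    have "sqrt s *\<^sub>R (exp (- \<i> * complex_of_real ((sqrt s * x) * \<xi>)) * complex_of_real (heat s (sqrt s * x)))
      = complex_of_real (heat s (sqrt s * x) * sqrt s) * exp (- \<i> * complex_of_real ((sqrt s * x) * \<xi>))"
      by (simp add: scaleR_conv_of_real mult_ac)
    then show "sqrt s *\<^sub>R (exp (- \<i> * complex_of_real ((sqrt s * x) * \<xi>)) * complex_of_real (heat s (sqrt s * x)))
      = std_normal_density x *\<^sub>R iexp ((- sqrt s * \<xi>) * x)"
      unfolding h by (simp add: scaleR_conv_of_real mult_ac)
  qed
  also have "\<dots> = char std_normal_distribution (- sqrt s * \<xi>)"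
    unfolding char_def
    by (subst integral_density) (auto simp: )
  also have "\<dots> = complex_of_real (exp (- s * \<xi>\<^sup>2 / 2))"
    using s by (simp add: char_std_normal_distribution power_mult_distrib)
  finally show ?thesis .
qed

lemma inv_fourier_heat:
  assumes s: "s > 0"
  shows "(LINT \<xi>|lborel. exp (\<i> * complex_of_real (z * \<xi>)) * complex_of_real (exp (- s * \<xi>\<^sup>2 / 2)))
     = complex_of_real (2 * pi * heat s z)"
proof -
  have e: "exp (- s * \<xi>\<^sup>2 / 2) = sqrt (2 * pi / s) * heat (1 / s) \<xi>" for \<xi>
    using s by (simp add: heat_def real_sqrt_divide field_simps)
  have "(LINT \<xi>|lborel. exp (\<i> * complex_of_real (z * \<xi>)) * complex_of_real (exp (- s * \<xi>\<^sup>2 / 2)))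
    = (LINT \<xi>|lborel. complex_of_real (sqrt (2 * pi / s)) * (exp (- \<i> * complex_of_real (\<xi> * (-z))) * complex_of_real (heat (1 / s) \<xi>)))"
    unfolding e by (intro Bochner_Integration.integral_cong) (auto simp: mult_ac)
  also have "\<dots> = complex_of_real (sqrt (2 * pi / s)) * complex_of_real (exp (- (1/s) * (-z)\<^sup>2 / 2))"
    by (subst integral_mult_right_zero, subst fourier_heat) (use s in auto)
  also have "\<dots> = complex_of_real (2 * pi * heat s z)"
  proof -
    have "sqrt (2 * pi / s) = 2 * pi / sqrt (2 * pi * s)"
    proof -
      have "sqrt (2 * pi) * sqrt (2 * pi) = 2 * pi" by simp
      then show ?thesis using s by (simp add: real_sqrt_divide real_sqrt_mult field_simps del: real_sqrt_mult_self)
    qed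
    then show ?thesis by (simp add: heat_def field_simps)
  qed
  finally show ?thesis .
qed

lemma integrable_power_gauss:
  fixes s :: real
  assumes s: "s > 0"
  shows "integrable lborel (\<lambda>\<xi>. \<xi> ^ k * exp (- s * \<xi>\<^sup>2 / 2))"
proof -
  have e: "exp (- s * \<xi>\<^sup>2 / 2) = sqrt (2 * pi / s) * normal_density 0 (sqrt (1/s)) \<xi>" for \<xi>
    using s by (simp add: normal_density_def real_sqrt_divide field_simps)
  have "integrable lborel (\<lambda>x. sqrt (2 * pi / s) * (normal_density 0 (sqrt (1/s)) x * (x - 0) ^ k))"
    using s by (intro integrable_mult_right integrable_normal_moment) auto
  then show ?thesis unfolding e by (simp add: mult_ac)
qed

lemma integral_derivative_eq_0:
  fixes F :: "real \<Rightarrow> complex"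
  assumes "\<And>x. (F has_vector_derivative f x) (at x)" "\<And>x. isCont f x" "integrable lborel f"
    "(F \<longlongrightarrow> 0) at_top" "(F \<longlongrightarrow> 0) at_bot"
  shows "(LINT x|lborel. f x) = 0"
proof -
  have "(LBINT x=-\<infinity>..\<infinity>. f x) = 0 - 0"
    by (rule interval_integral_FTC_integrable[where F=F])
      (use assms in \<open>auto simp: set_integrable_def einterval_def ereal_tendsto_simps\<close>)
  then show ?thesis by (simp add: interval_lebesgue_integral_def einterval_def set_lebesgue_integral_def)
qed

text \<open>Two integrations by parts give the first and second moments of the Gaussian wave packet
  \<open>G\<close> in terms of its integral; the factor \<open>\<xi>\<^sup>2 / 2\<close> is the symbol of minus the time
  derivative of the heat kernel.\<close>

lemma inv_fourier_dheat:
  assumes s: "s > 0"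
  shows "(LINT \<xi>|lborel. exp (\<i> * complex_of_real (z * \<xi>)) * complex_of_real (\<xi>\<^sup>2 / 2 * exp (- s * \<xi>\<^sup>2 / 2)))
     = complex_of_real (2 * pi * dheat s z)"
proof -
  define G where "G = (\<lambda>\<xi>. exp (\<i> * complex_of_real (z * \<xi>)) * complex_of_real (exp (- s * \<xi>\<^sup>2 / 2)))"
  have G': "(G has_vector_derivative (\<i> * z - s * \<xi>) * G \<xi>) (at \<xi>)" for \<xi>
  proof -
    have 1: "((\<lambda>w::complex. exp (\<i> * (z * w)) * exp (- s * w\<^sup>2 / 2)) has_field_derivative
        (\<i> * z - s * w) * (exp (\<i> * (z * w)) * exp (- s * w\<^sup>2 / 2))) (at w)" for w :: complex
      by (auto intro!: derivative_eq_intros simp: algebra_simps)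
    have "((\<lambda>x. exp (\<i> * (z * complex_of_real x)) * exp (- s * (complex_of_real x)\<^sup>2 / 2)) has_vector_derivative
        (\<i> * z - s * \<xi>) * (exp (\<i> * (z * \<xi>)) * exp (- s * (complex_of_real \<xi>)\<^sup>2 / 2))) (at \<xi>)"
      using has_vector_derivative_real_field[OF 1[of "complex_of_real \<xi>"]] by simp
    then show ?thesis by (simp add: G_def exp_of_real[symmetric])
  qed
  have \<xi>G': "((\<lambda>\<xi>. complex_of_real \<xi> * G \<xi>) has_vector_derivative G \<xi> + complex_of_real \<xi> * ((\<i> * z - s * \<xi>) * G \<xi>)) (at \<xi>)" for \<xi>
    by (rule has_vector_derivative_eq_rhs, rule has_vector_derivative_mult[OF _ G'])
      (auto intro!: derivative_eq_intros)
  have contG: "isCont G \<xi>" for \<xi>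
    using G' has_vector_derivative_continuous by blast
  have nG: "norm (G \<xi>) = exp (- s * \<xi>\<^sup>2 / 2)" for \<xi>
    by (simp add: G_def norm_mult)
  have mG [measurable]: "G \<in> borel_measurable borel" unfolding G_def by measurable
  have iG: "integrable lborel (\<lambda>\<xi>. complex_of_real \<xi> ^ k * G \<xi>)" for k
  proof (rule Bochner_Integration.integrable_bound[OF integrable_power_gauss[OF s, of k]])
    show "AE x in lborel. norm (complex_of_real x ^ k * G x) \<le> norm (x ^ k * exp (- s * x\<^sup>2 / 2))"
      by (simp add: norm_mult norm_power nG power_abs abs_mult)
  qed measurable
  note i0 = iG[of 0, simplified] and i1 = iG[of 1, simplified] and i2 = iG[of 2]
  have lim: "(G \<longlongrightarrow> 0) at_top" "(G \<longlongrightarrow> 0) at_bot" "((\<lambda>\<xi>. complex_of_real \<xi> * G \<xi>) \<longlongrightarrow> 0) at_top" "((\<lambda>\<xi>. complex_of_real \<xi> * G \<xi>) \<longlongrightarrow> 0) at_bot"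
    by (rule tendsto_norm_zero_cancel, simp add: nG norm_mult, use s in real_asymp)+
  have "(LINT \<xi>|lborel. (\<i> * z - s * \<xi>) * G \<xi>) = 0"
    by (rule integral_derivative_eq_0[OF G'])
      (use i0 i1 lim contG in \<open>auto simp: left_diff_distrib mult.assoc intro!: Bochner_Integration.integrable_diff integrable_mult_right continuous_intros\<close>)
  moreover have "(LINT \<xi>|lborel. (\<i> * z - s * \<xi>) * G \<xi>) = \<i> * z * (LINT \<xi>|lborel. G \<xi>) - s * (LINT \<xi>|lborel. \<xi> * G \<xi>)"
    using i0 i1 by (simp add: left_diff_distrib mult.assoc)
  ultimately have A: "s * (LINT \<xi>|lborel. \<xi> * G \<xi>) = \<i> * z * (LINT \<xi>|lborel. G \<xi>)" by simp
  have eq: "G \<xi> + complex_of_real \<xi> * ((\<i> * z - s * \<xi>) * G \<xi>) = G \<xi> + \<i> * z * (\<xi> * G \<xi>) - s * (complex_of_real \<xi> ^ 2 * G \<xi>)" for \<xi>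
    by (simp add: algebra_simps power2_eq_square)
  have iI: "integrable lborel (\<lambda>\<xi>. G \<xi> + complex_of_real \<xi> * ((\<i> * z - s * \<xi>) * G \<xi>))"
    unfolding eq using i0 i1 i2
    by (intro Bochner_Integration.integrable_diff Bochner_Integration.integrable_add integrable_mult_right)
  have "(LINT \<xi>|lborel. G \<xi> + complex_of_real \<xi> * ((\<i> * z - s * \<xi>) * G \<xi>)) = 0"
    by (rule integral_derivative_eq_0[OF \<xi>G' _ iI]) (use lim contG in \<open>auto intro!: continuous_intros\<close>)
  moreover have "(LINT \<xi>|lborel. G \<xi> + complex_of_real \<xi> * ((\<i> * z - s * \<xi>) * G \<xi>))
     = (LINT \<xi>|lborel. G \<xi>) + \<i> * z * (LINT \<xi>|lborel. \<xi> * G \<xi>) - s * (LINT \<xi>|lborel. complex_of_real \<xi> ^ 2 * G \<xi>)"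
    unfolding eq using i0 i1 i2 by simp
  ultimately have B: "s * (LINT \<xi>|lborel. complex_of_real \<xi> ^ 2 * G \<xi>) = (LINT \<xi>|lborel. G \<xi>) + \<i> * z * (LINT \<xi>|lborel. \<xi> * G \<xi>)" by simp
  have G0: "(LINT \<xi>|lborel. G \<xi>) = complex_of_real (2 * pi * heat s z)"
    unfolding G_def by (rule inv_fourier_heat[OF s])
  have "s\<^sup>2 * (LINT \<xi>|lborel. complex_of_real \<xi> ^ 2 * G \<xi>) = s * (LINT \<xi>|lborel. G \<xi>) + \<i> * z * (s * (LINT \<xi>|lborel. \<xi> * G \<xi>))"
    using arg_cong[OF B, of "\<lambda>w. s * w"] by (simp add: algebra_simps power2_eq_square)
  also have "\<dots> = complex_of_real ((s - z\<^sup>2) * (2 * pi * heat s z))"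
    unfolding A G0 by (simp add: algebra_simps power2_eq_square)
  also have "\<dots> = complex_of_real (s\<^sup>2 * (2 * (2 * pi * dheat s z)))"
  proof -
    have "s\<^sup>2 * (2 * (1 / (2 * s) - z\<^sup>2 / (2 * s\<^sup>2))) = s - z\<^sup>2" using s by (simp add: field_simps power2_eq_square)
    moreover have "s\<^sup>2 * (2 * (2 * pi * dheat s z)) = (s\<^sup>2 * (2 * (1 / (2 * s) - z\<^sup>2 / (2 * s\<^sup>2)))) * (2 * pi * heat s z)"
      unfolding dheat_def by (simp only: mult_ac)
    ultimately have "(s - z\<^sup>2) * (2 * pi * heat s z) = s\<^sup>2 * (2 * (2 * pi * dheat s z))" by (simp only:)
    then show ?thesis by (simp only:)
  qed
  finally have C: "(LINT \<xi>|lborel. complex_of_real \<xi> ^ 2 * G \<xi>) = complex_of_real (2 * (2 * pi * dheat s z))"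
    using s by simp
  have "(LINT \<xi>|lborel. exp (\<i> * complex_of_real (z * \<xi>)) * complex_of_real (\<xi>\<^sup>2 / 2 * exp (- s * \<xi>\<^sup>2 / 2)))
     = (LINT \<xi>|lborel. (1/2) * (complex_of_real \<xi> ^ 2 * G \<xi>))"
    by (intro Bochner_Integration.integral_cong) (auto simp: G_def)
  also have "\<dots> = complex_of_real (2 * pi * dheat s z)"
    by (subst integral_mult_right_zero, subst C) simp
  finally show ?thesis .
qed

lemma nn_integral_pos_powr_exp:
  assumes "a > -1" "l > 0"
  shows "(\<integral>\<^sup>+t. ennreal (pos_powr a t * exp (- l * t)) \<partial>lborel) = ennreal (Gamma (a + 1) * l powr (- (a + 1)))"
proof -
  have "(\<integral>\<^sup>+t. ennreal (t powr (a + 1 - 1) / exp t) * indicator {0..} t \<partial>lborel) = ennreal (Gamma (a + 1))"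
    by (rule nn_integral_has_integral_lebesgue'[OF _ Gamma_integral_real]) (use assms in auto)
  also have "(\<integral>\<^sup>+t. ennreal (t powr (a + 1 - 1) / exp t) * indicator {0..} t \<partial>lborel)
     = (\<integral>\<^sup>+t. ennreal (pos_powr a t * exp (- t)) \<partial>lborel)"
    by (intro nn_integral_cong) (auto simp: pos_powr_def indicator_def exp_minus field_simps)
  also have "\<dots> = ennreal l * (\<integral>\<^sup>+t. ennreal (pos_powr a (l * t) * exp (- (l * t))) \<partial>lborel)"
    using nn_integral_real_affine[of "\<lambda>t. ennreal (pos_powr a t * exp (- t))" l 0] assms by simp
  also have "(\<integral>\<^sup>+t. ennreal (pos_powr a (l * t) * exp (- (l * t))) \<partial>lborel)
     = (\<integral>\<^sup>+t. ennreal (l powr a) * ennreal (pos_powr a t * exp (- l * t)) \<partial>lborel)"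
    using assms by (intro nn_integral_cong) (auto simp: pos_powr_def powr_mult zero_less_mult_iff ennreal_mult[symmetric])
  also have "\<dots> = ennreal (l powr a) * (\<integral>\<^sup>+t. ennreal (pos_powr a t * exp (- l * t)) \<partial>lborel)"
    by (rule nn_integral_cmult) measurable
  finally have *: "ennreal (Gamma (a + 1)) = ennreal (l powr (a + 1)) * (\<integral>\<^sup>+t. ennreal (pos_powr a t * exp (- l * t)) \<partial>lborel)"
    using assms by (simp add: mult.assoc[symmetric] ennreal_mult[symmetric] powr_mult_base add.commute)
  have "ennreal (Gamma (a + 1) * l powr (- (a + 1))) = ennreal (Gamma (a + 1)) * ennreal (l powr (- (a + 1)))"
    using assms by (intro ennreal_mult) (auto intro: Gamma_real_nonneg)
  also have "\<dots> = ennreal (l powr (a + 1)) * ennreal (l powr (- (a + 1))) * (\<integral>\<^sup>+t. ennreal (pos_powr a t * exp (- l * t)) \<partial>lborel)"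
    unfolding * by (simp add: mult_ac)
  also have "ennreal (l powr (a + 1)) * ennreal (l powr (- (a + 1))) = 1"
    using assms by (simp add: ennreal_mult[symmetric] powr_add[symmetric])
  finally show ?thesis by simp
qed

text \<open>The normalisation in \<open>\<lambda> powr (1/4) = (\<integral> t powr (-1/4) exp (- \<lambda> t) dt) * \<lambda> / \<Gamma>(3/4)\<close> at \<open>\<lambda> = \<xi>\<^sup>2 / 2\<close>, whose
  left-hand side is \<open>2 powr (-1/4)\<close> times \<open>\<bar>\<xi>\<bar> powr (1/2)\<close>.\<close>

definition laplace_const :: real where "laplace_const = 2 powr (1/4) / Gamma (3/4)"

lemma laplace_const_pos: "laplace_const > 0" by (simp add: laplace_const_def)

lemma sqrt_multiplier:
  "has_bochner_integral lborel (\<lambda>t. laplace_const * (pos_powr (-1/4) t * exp (- (\<xi>\<^sup>2/2) * t)) * (\<xi>\<^sup>2/2)) (\<bar>\<xi>\<bar> powr (1/2))"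
proof (cases "\<xi> = 0")
  case True then show ?thesis by (simp add: has_bochner_integral_zero)
next
  case False
  define l where "l = \<xi>\<^sup>2 / 2"
  have l: "l > 0" using False by (simp add: l_def)
  have "has_bochner_integral lborel (\<lambda>t. pos_powr (-1/4) t * exp (- l * t)) (Gamma (-1/4 + 1) * l powr (- (-1/4 + 1)))"
    by (rule has_bochner_integral_nn_integral[OF _ _ _ nn_integral_pos_powr_exp]) (use l in \<open>auto intro: Gamma_real_nonneg\<close>)
  then have "has_bochner_integral lborel (\<lambda>t. laplace_const * (pos_powr (-1/4) t * exp (- l * t)) * l) (laplace_const * (Gamma (-1/4 + 1) * l powr (- (-1/4 + 1))) * l)"
    by (intro has_bochner_integral_mult_left has_bochner_integral_mult_right) auto
  moreover have "laplace_const * (Gamma (-1/4 + 1) * l powr (- (-1/4 + 1))) * l = \<bar>\<xi>\<bar> powr (1/2)"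
  proof -
    have "l powr (-3/4) * l = l powr (1/4)" using l by (simp add: powr_mult_base mult.commute)
    moreover have "l powr (1/4) * 2 powr (1/4) = \<bar>\<xi>\<bar> powr (1/2)"
    proof -
      have "l powr (1/4) * 2 powr (1/4) = (\<bar>\<xi>\<bar> powr 2) powr (1/4)"
        using l False by (simp add: powr_mult[symmetric] l_def)
      also have "\<dots> = \<bar>\<xi>\<bar> powr (1/2)" unfolding powr_powr by simp
      finally show ?thesis .
    qed
    moreover have "laplace_const * Gamma (3/4) = 2 powr (1/4)"
      using less_imp_neq[OF Gamma_real_pos[of "3/4"]] by (simp add: laplace_const_def)
    moreover have "laplace_const * (Gamma (-1/4 + 1) * l powr (- (-1/4 + 1))) * l = (laplace_const * Gamma (3/4)) * (l powr (-3/4) * l)"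
      by simp
    ultimately show ?thesis by (metis mult.commute)
  qed
  ultimately show ?thesis by (simp add: l_def)
qed

text \<open>Subordination: the multiplier \<open>\<bar>\<xi>\<bar> powr (1/2)\<close> is a superposition of the symbols
  \<open>\<xi>\<^sup>2 / 2 * exp (- t \<xi>\<^sup>2 / 2)\<close>, and on a Gaussian each of these only shifts the time by \<open>t\<close>.\<close>

lemma frac_lap_heat:
  assumes s: "s > 0"
  shows "frac_lap (\<lambda>y. complex_of_real (heat s (y - x))) y
    = complex_of_real (laplace_const * (\<integral>t. pos_powr (-1/4) t * dheat (s + t) (y - x) \<partial>lborel))"
proof -
  define z where "z = y - x"
  have four: "fourier (\<lambda>y. complex_of_real (heat s (y - x))) \<xi>
     = exp (- \<i> * complex_of_real (x * \<xi>)) * complex_of_real (exp (- s * \<xi>\<^sup>2 / 2))" for \<xi>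
  proof -
    have "fourier (\<lambda>y. complex_of_real (heat s (y - x))) \<xi>
      = (LINT y|lborel. exp (- \<i> * complex_of_real ((x + 1 * y) * \<xi>)) * complex_of_real (heat s ((x + 1 * y) - x)))"
      unfolding fourier_def by (subst lborel_integral_real_affine[of 1 _ x]) auto
    also have "\<dots> = (LINT y|lborel. exp (- \<i> * complex_of_real (x * \<xi>)) * (exp (- \<i> * complex_of_real (y * \<xi>)) * complex_of_real (heat s y)))"
      by (intro Bochner_Integration.integral_cong) (auto simp: algebra_simps exp_add[symmetric] mult_exp_exp)
    finally show ?thesis by (simp only: integral_mult_right_zero fourier_heat[OF s])
  qed
  \<comment> \<open>Integrating over \<open>t\<close> first produces the multiplier, integrating over \<open>\<xi>\<close> first the heat kernel.\<close>
  define F where "F = (\<lambda>(\<xi>, t). (laplace_const * (pos_powr (-1/4) t * exp (- (\<xi>\<^sup>2/2) * t)) * (\<xi>\<^sup>2/2)) *\<^sub>R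
      (exp (\<i> * complex_of_real (z * \<xi>)) * complex_of_real (exp (- s * \<xi>\<^sup>2 / 2))))"
  have Fm [measurable]: "F \<in> borel_measurable (lborel \<Otimes>\<^sub>M lborel)"
    unfolding F_def by measurable
  have inner: "has_bochner_integral lborel (\<lambda>t. F (\<xi>, t))
    (\<bar>\<xi>\<bar> powr (1/2) *\<^sub>R (exp (\<i> * complex_of_real (z * \<xi>)) * complex_of_real (exp (- s * \<xi>\<^sup>2 / 2))))" for \<xi>
    unfolding F_def by (simp only: prod.case) (intro has_bochner_integral_scaleR_left sqrt_multiplier)
  have innern: "has_bochner_integral lborel (\<lambda>t. norm (F (\<xi>, t)))
    (\<bar>\<xi>\<bar> powr (1/2) * exp (- s * \<xi>\<^sup>2 / 2))" for \<xi>
  proof -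
    have "norm (F (\<xi>, t)) = (laplace_const * (pos_powr (-1/4) t * exp (- (\<xi>\<^sup>2/2) * t)) * (\<xi>\<^sup>2/2)) * exp (- s * \<xi>\<^sup>2 / 2)" for t
      using laplace_const_pos by (simp add: F_def norm_mult abs_mult)
    then show ?thesis using has_bochner_integral_mult_left[of "exp (- s * \<xi>\<^sup>2 / 2)", OF sqrt_multiplier[of \<xi>]] by (simp only:)
  qed
  have "integrable lborel (\<lambda>\<xi>. \<bar>\<xi>\<bar> powr (1/2) * exp (- s * \<xi>\<^sup>2 / 2))"
  proof (rule Bochner_Integration.integrable_bound)
    show "integrable lborel (\<lambda>\<xi>. \<xi> ^ 0 * exp (- s * \<xi>\<^sup>2 / 2) + \<xi> ^ 2 * exp (- s * \<xi>\<^sup>2 / 2))"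
      by (intro Bochner_Integration.integrable_add integrable_power_gauss s)
    have "\<bar>\<xi>\<bar> powr (1/2) \<le> 1 + \<xi>\<^sup>2" for \<xi> :: real
    proof (cases "\<bar>\<xi>\<bar> \<le> 1")
      case True
      then have "\<bar>\<xi>\<bar> powr (1/2) \<le> 1" by (intro powr_le1) auto
      then show ?thesis using zero_le_power2[of \<xi>] by linarith
    next
      case False
      then have "\<bar>\<xi>\<bar> powr (1/2) \<le> \<bar>\<xi>\<bar> powr 2" by (intro powr_mono) auto
      then show ?thesis using False by simp
    qed
    then have "\<bar>\<xi>\<bar> powr (1/2) * exp (- s * \<xi>\<^sup>2 / 2) \<le> (1 + \<xi>\<^sup>2) * exp (- s * \<xi>\<^sup>2 / 2)" for \<xi> :: real
      by (intro mult_right_mono) auto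
    then show "AE \<xi> in lborel. norm (\<bar>\<xi>\<bar> powr (1/2) * exp (- s * \<xi>\<^sup>2 / 2)) \<le> norm (\<xi> ^ 0 * exp (- s * \<xi>\<^sup>2 / 2) + \<xi> ^ 2 * exp (- s * \<xi>\<^sup>2 / 2))"
      by (intro AE_I2) (simp add: distrib_right)
  qed measurable
  then have Fi: "integrable (lborel \<Otimes>\<^sub>M lborel) F"
    by (intro lborel_pair.Fubini_integrable)
      (auto simp: has_bochner_integral_integral_eq[OF innern] intro!: has_bochner_integral_integrable inner[THEN integrable.intros])
  have "frac_lap (\<lambda>y. complex_of_real (heat s (y - x))) y = complex_of_real (1 / (2 * pi)) * (LINT \<xi>|lborel. (LINT t|lborel. F (\<xi>, t)))"
    unfolding frac_lap_def inv_fourier_def four has_bochner_integral_integral_eq[OF inner]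
    by (intro arg_cong2[where f="(*)"] refl Bochner_Integration.integral_cong)
      (auto simp: z_def scaleR_conv_of_real algebra_simps exp_add exp_diff exp_minus field_simps)
  also have "(LINT \<xi>|lborel. (LINT t|lborel. F (\<xi>, t))) = (LINT t|lborel. (LINT \<xi>|lborel. F (\<xi>, t)))"
    using lborel_pair.Fubini_integral[of "\<lambda>\<xi> t. F (\<xi>, t)"] Fi by simp
  also have "\<dots> = (LINT t|lborel. complex_of_real (2 * pi * laplace_const * (pos_powr (-1/4) t * dheat (s + t) z)))"
  proof (rule Bochner_Integration.integral_cong[OF refl])
    fix t :: real
    show "(LINT \<xi>|lborel. F (\<xi>, t)) = complex_of_real (2 * pi * laplace_const * (pos_powr (-1/4) t * dheat (s + t) z))"
    proof (cases "t > 0")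
      case True
      then have st: "s + t > 0" using s by simp
      have "(LINT \<xi>|lborel. F (\<xi>, t)) = (LINT \<xi>|lborel. complex_of_real (laplace_const * pos_powr (-1/4) t) *
          (exp (\<i> * complex_of_real (z * \<xi>)) * complex_of_real (\<xi>\<^sup>2 / 2 * exp (- (s + t) * \<xi>\<^sup>2 / 2))))"
      proof (rule Bochner_Integration.integral_cong[OF refl])
        fix \<xi> :: real
        have "exp (- (s + t) * \<xi>\<^sup>2 / 2) = exp (- (\<xi>\<^sup>2/2) * t) * exp (- s * \<xi>\<^sup>2 / 2)"
          unfolding exp_add[symmetric] by (simp add: field_simps)
        then show "F (\<xi>, t) = complex_of_real (laplace_const * pos_powr (-1/4) t) *
          (exp (\<i> * complex_of_real (z * \<xi>)) * complex_of_real (\<xi>\<^sup>2 / 2 * exp (- (s + t) * \<xi>\<^sup>2 / 2)))"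
          by (simp add: F_def scaleR_conv_of_real mult_ac)
      qed
      also have "\<dots> = complex_of_real (laplace_const * pos_powr (-1/4) t) * complex_of_real (2 * pi * dheat (s + t) z)"
        by (simp only: integral_mult_right_zero inv_fourier_dheat[OF st])
      finally show ?thesis by (simp add: mult_ac)
    qed (simp add: F_def pos_powr_def)
  qed
  also have "\<dots> = complex_of_real (2 * pi * laplace_const * (LINT t|lborel. pos_powr (-1/4) t * dheat (s + t) z))"
    by (simp only: integral_complex_of_real integral_mult_right_zero)
  finally show ?thesis by (simp add: z_def)
qed

section \<open>Gaussians as test functions\<close>

lemma poly_heat_bounded:
  "s > 0 \<Longrightarrow> \<exists>B. \<forall>z. \<bar>poly Q z * heat s z\<bar> \<le> B"
proof (induction Q arbitrary: s)
  case 0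
  then show ?case by auto
next
  case (pCons a Q)
  have "\<exists>B. \<forall>z. \<bar>poly Q z * heat (2 * s) z\<bar> \<le> B"
    by (rule pCons.IH) (use pCons.prems in simp)
  then obtain B where B: "\<And>z. \<bar>poly Q z * heat (2 * s) z\<bar> \<le> B" by blast
  have h: "heat s z \<le> 1 / sqrt (2 * pi * s)" for z
    using pCons.prems by (simp add: heat_def divide_right_mono)
  have "\<bar>poly (pCons a Q) z * heat s z\<bar> \<le> \<bar>a\<bar> * (1 / sqrt (2 * pi * s)) + s * (10 * s powr (-1/2)) * B" for z
  proof -
    have "\<bar>z * heat s z\<bar> = s * \<bar>- z / s * heat s z\<bar>" using pCons.prems by (simp add: abs_mult)
    also have "\<dots> \<le> s * (10 * s powr (-1/2) * heat (2 * s) z)"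
      using pCons.prems by (intro mult_left_mono heat_space_bound) auto
    finally have 1: "\<bar>z * heat s z\<bar> * \<bar>poly Q z\<bar> \<le> s * (10 * s powr (-1/2) * heat (2 * s) z) * \<bar>poly Q z\<bar>"
      by (rule mult_right_mono) auto
    also have "\<dots> = s * (10 * s powr (-1/2)) * \<bar>poly Q z * heat (2 * s) z\<bar>"
      using pCons.prems by (simp add: abs_mult mult_ac)
    also have "\<dots> \<le> s * (10 * s powr (-1/2)) * B"
      using pCons.prems by (intro mult_left_mono B) auto
    finally have 2: "\<bar>z * heat s z\<bar> * \<bar>poly Q z\<bar> \<le> s * (10 * s powr (-1/2)) * B" .
    have "\<bar>poly (pCons a Q) z * heat s z\<bar> = \<bar>a * heat s z + (z * heat s z) * poly Q z\<bar>"
      by (simp add: algebra_simps)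
    also have "\<dots> \<le> \<bar>a\<bar> * heat s z + \<bar>z * heat s z\<bar> * \<bar>poly Q z\<bar>"
      using pCons.prems abs_triangle_ineq[of "a * heat s z" "(z * heat s z) * poly Q z"] by (simp add: abs_mult)
    also have "\<bar>a\<bar> * heat s z \<le> \<bar>a\<bar> * (1 / sqrt (2 * pi * s))" by (intro mult_left_mono h) auto
    finally show ?thesis using 2 by linarith
  qed
  then show ?case by blast
qed

lemma vderiv_poly_heat:
  assumes s: "s > 0"
  shows "((\<lambda>y. complex_of_real (poly P (y - x) * heat s (y - x))) has_vector_derivative
     complex_of_real (poly (pderiv P - smult (1/s) (pCons 0 P)) (y - x) * heat s (y - x))) (at y)"
proof -
  have "((\<lambda>y. poly P (y - x) * heat s (y - x)) has_real_derivative
     (poly (pderiv P - smult (1/s) (pCons 0 P)) (y - x) * heat s (y - x))) (at y)"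
    by (rule derivative_eq_intros DERIV_chain2[OF poly_DERIV] DERIV_chain2[OF DERIV_heat_space[OF s]] refl)+
      (simp add: algebra_simps add_divide_distrib diff_divide_distrib)
  then show ?thesis
    by (intro has_vector_derivative_of_real) (simp add: has_real_derivative_iff_has_vector_derivative)
qed

text \<open>Every derivative of a Gaussian is a polynomial times the Gaussian, and the weight
  \<open>\<bar>y\<bar>\<^sup>k\<close> is dominated by the polynomial \<open>(1 + y\<^sup>2)\<^sup>k\<close>.\<close>

lemma schwartz_heat:
  assumes s: "s > 0"
  shows "schwartz (\<lambda>y. complex_of_real (heat s (y - x)))"
proof -
  define T where "T = (\<lambda>P. pderiv P - smult (1/s) (pCons 0 P))"
  define g where "g = (\<lambda>P y. complex_of_real (poly P (y - x) * heat s (y - x)))"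
  have D: "(g P has_vector_derivative g (T P) y) (at y)" for P y
    unfolding g_def T_def by (rule vderiv_poly_heat[OF s])
  have vd: "vderiv (g P) = g (T P)" for P
    unfolding vderiv_def using D by (auto intro!: ext vector_derivative_at)
  have it: "(vderiv ^^ m) (g P) = g ((T ^^ m) P)" for m P
    by (induction m) (simp_all add: vd)
  have g1: "(\<lambda>y. complex_of_real (heat s (y - x))) = g 1" by (simp add: g_def)
  show ?thesis unfolding schwartz_def g1 it
  proof (intro conjI allI)
    fix m y show "g ((T ^^ m) 1) differentiable at y"
      using D by (rule differentiableI_vector)
  next
    fix k m
    define R where "R = (1 + [:x, 1:]\<^sup>2) ^ k"
    obtain B where B: "\<And>z. \<bar>poly (R * (T ^^ m) 1) z * heat s z\<bar> \<le> B"
      using poly_heat_bounded[OF s] by blast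
    have "\<bar>y\<bar> ^ k * cmod (g ((T ^^ m) 1) y) \<le> B" for y
    proof -
      have "\<bar>y\<bar> ^ k \<le> (1 + y\<^sup>2) ^ k" using abs_le_1_square[of y] by (intro power_mono) auto
      also have "\<dots> = \<bar>poly R (y - x)\<bar>" by (simp add: R_def poly_power algebra_simps)
      finally have "\<bar>y\<bar> ^ k * cmod (g ((T ^^ m) 1) y) \<le> \<bar>poly R (y - x)\<bar> * cmod (g ((T ^^ m) 1) y)"
        by (rule mult_right_mono) auto
      also have "\<dots> = \<bar>poly (R * (T ^^ m) 1) (y - x) * heat s (y - x)\<bar>"
        unfolding g_def norm_of_real by (simp add: abs_mult)
      also have "\<dots> \<le> B" by (rule B)
      finally show ?thesis .
    qed
    then show "\<exists>B. \<forall>y. \<bar>y\<bar> ^ k * cmod (g ((T ^^ m) 1) y) \<le> B" by blast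
  qed
qed

lemma integrable_pos_powr_at_0:
  assumes "a > -1"
  shows "integrable lborel (\<lambda>t. pos_powr a t * indicator {..1} t)"
proof (rule Bochner_Integration.integrable_bound)
  have "(\<integral>\<^sup>+t. ennreal (pos_powr a t * exp (- 1 * t)) \<partial>lborel) < \<infinity>"
    by (subst nn_integral_pos_powr_exp) (use assms in auto)
  then have "integrable lborel (\<lambda>t. pos_powr a t * exp (- 1 * t))"
    by (intro integrableI_nonneg) auto
  then show "integrable lborel (\<lambda>t. exp 1 * (pos_powr a t * exp (- 1 * t)))" by simp
  have "pos_powr a t * 1 \<le> pos_powr a t * (exp 1 * exp (- 1 * t))" if "t \<le> 1" for t
    using that by (intro mult_left_mono) (auto simp: exp_add[symmetric])
  then show "AE t in lborel. norm (pos_powr a t * indicator {..1} t) \<le> norm (exp 1 * (pos_powr a t * exp (- 1 * t)))"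
    by (intro AE_I2) (auto simp: indicator_def mult_ac)
qed measurable

lemma integrable_powr_at_top:
  fixes a c :: real
  assumes "a < -1" "c > 0"
  shows "integrable lborel (\<lambda>t::real. t powr a * indicator {c..} t)"
proof -
  have "(\<integral>\<^sup>+t. ennreal (t powr a) * indicator {c..} t \<partial>lborel) = ennreal (0 - c powr (a + 1) / (a + 1))"
  proof (rule nn_integral_FTC_atLeast)
    show "((\<lambda>t. t powr (a + 1) / (a + 1)) \<longlongrightarrow> 0) at_top"
      using assms by real_asymp
    show "((\<lambda>t. t powr (a + 1) / (a + 1)) has_real_derivative t powr a) (at t)" if "c \<le> t" for t
      using that assms by (auto intro!: derivative_eq_intros)
  qed auto
  then have "(\<integral>\<^sup>+t. ennreal (t powr a * indicator {c..} t) \<partial>lborel) < \<infinity>"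
    by (simp add: ennreal_mult'' ennreal_indicator)
  then show ?thesis by (intro integrableI_nonneg) auto
qed

lemma integrable_pos_powr_mix:
  assumes "a > -1" "b \<le> 0" "a + b < -1" "s > 0"
  shows "integrable lborel (\<lambda>t. pos_powr a t * (s + t) powr b)"
proof (rule Bochner_Integration.integrable_bound)
  show "integrable lborel (\<lambda>t. s powr b * (pos_powr a t * indicator {..1} t) + t powr (a + b) * indicator {1..} t)"
    by (intro Bochner_Integration.integrable_add integrable_mult_right integrable_pos_powr_at_0 integrable_powr_at_top) (use assms in auto)
  have "pos_powr a t * (s + t) powr b \<le> s powr b * (pos_powr a t * indicator {..1} t) + t powr (a + b) * indicator {1..} t" for t
  proof (cases "t > 0")
    case True
    have 1: "(s + t) powr b \<le> s powr b" "(s + t) powr b \<le> t powr b"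
      using True assms by (auto intro!: powr_mono2')
    show ?thesis
    proof (cases "t \<le> 1")
      case t1: True
      have "pos_powr a t * (s + t) powr b \<le> pos_powr a t * s powr b" by (intro mult_left_mono 1) auto
      also have "\<dots> = s powr b * (pos_powr a t * indicator {..1} t)" using t1 by simp
      also have "\<dots> \<le> s powr b * (pos_powr a t * indicator {..1} t) + t powr (a + b) * indicator {1..} t" by simp
      finally show ?thesis .
    next
      case False
      have "pos_powr a t * (s + t) powr b \<le> pos_powr a t * t powr b" by (intro mult_left_mono 1) auto
      then show ?thesis using False by (simp add: pos_powr_def powr_add)
    qed
  qed (simp add: pos_powr_def)
  then show "AE t in lborel. norm (pos_powr a t * (s + t) powr b) \<le> norm (s powr b * (pos_powr a t * indicator {..1} t) + t powr (a + b) * indicator {1..} t)"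
    by (intro AE_I2) (simp add: abs_of_nonneg)
qed measurable

lemma integrable_pair_bound:
  fixes F :: "real \<Rightarrow> real \<Rightarrow> real"
  assumes F: "(\<lambda>(t, y). F t y) \<in> borel_measurable (lborel \<Otimes>\<^sub>M lborel)"
    and B: "\<And>t. (\<integral>\<^sup>+y. ennreal \<bar>F t y\<bar> \<partial>lborel) \<le> ennreal (g t)" and g: "integrable lborel g" "\<And>t. 0 \<le> g t"
  shows "integrable (lborel \<Otimes>\<^sub>M lborel) (\<lambda>(t, y). F t y)"
proof (rule integrableI_bounded[OF F])
  have "(\<integral>\<^sup>+p. ennreal (norm (case p of (t, y) \<Rightarrow> F t y)) \<partial>(lborel \<Otimes>\<^sub>M lborel))
     = (\<integral>\<^sup>+t. (\<integral>\<^sup>+y. ennreal \<bar>F t y\<bar> \<partial>lborel) \<partial>lborel)"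
    using F by (subst lborel.nn_integral_fst[symmetric]) auto
  also have "\<dots> \<le> (\<integral>\<^sup>+t. ennreal (g t) \<partial>lborel)" by (intro nn_integral_mono B)
  also have "\<dots> < \<infinity>" using g by (subst nn_integral_eq_integral) auto
  finally show "(\<integral>\<^sup>+p. ennreal (norm (case p of (t, y) \<Rightarrow> F t y)) \<partial>(lborel \<Otimes>\<^sub>M lborel)) < \<infinity>" .
qed

lemma nn_integral_bounded_factor:
  fixes v k :: "real \<Rightarrow> real"
  assumes "\<And>y. \<bar>v y\<bar> \<le> b" and [measurable]: "k \<in> borel_measurable borel"
  shows "(\<integral>\<^sup>+y. ennreal \<bar>v y * k y\<bar> \<partial>lborel) \<le> ennreal b * (\<integral>\<^sup>+y. ennreal \<bar>k y\<bar> \<partial>lborel)"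
proof -
  have b: "b \<ge> 0" using assms(1)[of 0] by linarith
  have "(\<integral>\<^sup>+y. ennreal \<bar>v y * k y\<bar> \<partial>lborel) \<le> (\<integral>\<^sup>+y. ennreal b * ennreal \<bar>k y\<bar> \<partial>lborel)"
    using assms(1) b by (intro nn_integral_mono) (auto simp: abs_mult ennreal_mult[symmetric] intro!: ennreal_leI mult_right_mono)
  then show ?thesis by (simp add: nn_integral_cmult)
qed

lemma integral_bounded_factor:
  fixes v k :: "real \<Rightarrow> real"
  assumes v: "\<And>y. \<bar>v y\<bar> \<le> b" and [measurable]: "v \<in> borel_measurable borel" "k \<in> borel_measurable borel"
    and K: "(\<integral>\<^sup>+y. ennreal \<bar>k y\<bar> \<partial>lborel) \<le> ennreal K" and K0: "K \<ge> 0"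
  shows "integrable lborel (\<lambda>y. v y * k y)" "\<bar>\<integral>y. v y * k y \<partial>lborel\<bar> \<le> b * K"
proof -
  have b: "b \<ge> 0" using v[of 0] by linarith
  have 1: "(\<integral>\<^sup>+y. ennreal \<bar>v y * k y\<bar> \<partial>lborel) \<le> ennreal (b * K)"
    by (rule order_trans[OF nn_integral_bounded_factor[OF v]])
      (use K b in \<open>auto simp: ennreal_mult' intro!: mult_left_mono\<close>)
  show i: "integrable lborel (\<lambda>y. v y * k y)"
    by (rule integrableI_bounded) (use 1 in \<open>auto intro: order.strict_trans1[OF 1]\<close>)
  have "ennreal \<bar>\<integral>y. v y * k y \<partial>lborel\<bar> \<le> ennreal (\<integral>y. \<bar>v y * k y\<bar> \<partial>lborel)"
    by (intro ennreal_leI) simp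
  also have "\<dots> = (\<integral>\<^sup>+y. ennreal \<bar>v y * k y\<bar> \<partial>lborel)"
    using i by (subst nn_integral_eq_integral) auto
  also note 1
  finally show "\<bar>\<integral>y. v y * k y \<partial>lborel\<bar> \<le> b * K" using b K0 by simp
qed

text \<open>The equation \<open>(-\<Delta>) powr (1/4) v = f\<close> is tested with Gaussians only. For those the fractional
  Laplacian is explicit and in particular Borel; restricting the assumption \<open>E\<close> to test functions
  with this property is what allows the Lebesgue integrals of the distributional pairing to be
  replaced by integrals over Borel functions.\<close>

lemma weak_equation_heat:
  fixes v f :: "real \<Rightarrow> real"
  assumes v: "\<And>y. \<bar>v y\<bar> \<le> b" and [measurable]: "v \<in> borel_measurable borel" "f \<in> borel_measurable borel"
    and E: "\<And>\<phi>. schwartz \<phi> \<Longrightarrow> frac_lap \<phi> \<in> borel_measurable borel \<Longrightarrow>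
       (LINT x|lborel. complex_of_real (v x) * frac_lap \<phi> x) = (LINT x|lborel. complex_of_real (f x) * \<phi> x)"
    and s: "s > 0"
  shows "(\<integral>y. f y * heat s (y - x) \<partial>lborel)
     = laplace_const * (\<integral>t. pos_powr (-1/4) t * (\<integral>y. v y * dheat (s + t) (y - x) \<partial>lborel) \<partial>lborel)"
    and "integrable lborel (\<lambda>t. pos_powr (-1/4) t * (\<integral>y. v y * dheat (s + t) (y - x) \<partial>lborel))"
proof -
  have b: "b \<ge> 0" using v[of 0] by linarith
  define F where "F = (\<lambda>t y. pos_powr (-1/4) t * (v y * dheat (s + t) (y - x)))"
  have Fm: "(\<lambda>(t, y). F t y) \<in> borel_measurable (lborel \<Otimes>\<^sub>M lborel)"
    unfolding F_def by measurable
  have Fi: "integrable (lborel \<Otimes>\<^sub>M lborel) (\<lambda>(t, y). F t y)"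
  proof (rule integrable_pair_bound[OF Fm])
    show "integrable lborel (\<lambda>t. b * 5 * (pos_powr (-1/4) t * (s + t) powr (-1)))"
      by (intro integrable_mult_right integrable_pos_powr_mix) (use s in auto)
    show "0 \<le> b * 5 * (pos_powr (-1/4) t * (s + t) powr (-1))" for t using b by auto
    show "(\<integral>\<^sup>+y. ennreal \<bar>F t y\<bar> \<partial>lborel) \<le> ennreal (b * 5 * (pos_powr (-1/4) t * (s + t) powr (-1)))" for t
    proof (cases "t > 0")
      case True
      have "(\<integral>\<^sup>+y. ennreal \<bar>F t y\<bar> \<partial>lborel) = ennreal (pos_powr (-1/4) t) * (\<integral>\<^sup>+y. ennreal \<bar>v y * dheat (s + t) (y - x)\<bar> \<partial>lborel)"
        by (simp add: F_def abs_mult ennreal_mult nn_integral_cmult)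
      also have "\<dots> \<le> ennreal (pos_powr (-1/4) t) * (ennreal b * ennreal (5 / (s + t)))"
        using True s by (intro mult_left_mono order_trans[OF nn_integral_bounded_factor[OF v]] dheat_nn_integral) auto
      also have "\<dots> = ennreal (pos_powr (-1/4) t * (b * (5 / (s + t))))"
        using True s b by (simp add: ennreal_mult del: times_divide_eq_right)
      also have "pos_powr (-1/4) t * (b * (5 / (s + t))) = b * 5 * (pos_powr (-1/4) t * (s + t) powr (-1))"
        using True s by (simp add: powr_minus_divide)
      finally show ?thesis .
    qed (simp add: F_def pos_powr_def)
  qed
  have in1: "(\<integral>t. F t y \<partial>lborel) = v y * (\<integral>t. pos_powr (-1/4) t * dheat (s + t) (y - x) \<partial>lborel)" for y
  proof -
    have "(\<integral>t. F t y \<partial>lborel) = (\<integral>t. v y * (pos_powr (-1/4) t * dheat (s + t) (y - x)) \<partial>lborel)"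
      unfolding F_def by (simp add: mult_ac)
    then show ?thesis by (simp only: integral_mult_right_zero)
  qed
  have in2: "(\<integral>y. F t y \<partial>lborel) = pos_powr (-1/4) t * (\<integral>y. v y * dheat (s + t) (y - x) \<partial>lborel)" for t
    unfolding F_def by (simp only: integral_mult_right_zero)
  have Fub: "(\<integral>y. (\<integral>t. F t y \<partial>lborel) \<partial>lborel) = (\<integral>t. (\<integral>y. F t y \<partial>lborel) \<partial>lborel)"
    by (rule lborel_pair.Fubini_integral[OF Fi])
  have "(\<lambda>y. complex_of_real (laplace_const * (\<integral>t. pos_powr (-1/4) t * dheat (s + t) (y - x) \<partial>lborel))) \<in> borel_measurable borel"
    by measurable
  then have fm: "frac_lap (\<lambda>y. complex_of_real (heat s (y - x))) \<in> borel_measurable borel"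
    by (simp add: frac_lap_heat[OF s, abs_def])
  have "complex_of_real (\<integral>y. f y * heat s (y - x) \<partial>lborel) = (LINT y|lborel. complex_of_real (f y) * complex_of_real (heat s (y - x)))"
    by (simp only: of_real_mult[symmetric] integral_complex_of_real)
  also have "\<dots> = (LINT y|lborel. complex_of_real (v y) * frac_lap (\<lambda>y. complex_of_real (heat s (y - x))) y)"
    by (rule E[symmetric, OF schwartz_heat[OF s] fm])
  also have "\<dots> = (LINT y|lborel. complex_of_real (laplace_const * (\<integral>t. F t y \<partial>lborel)))"
    unfolding frac_lap_heat[OF s] in1 by (intro Bochner_Integration.integral_cong) (auto simp: mult_ac)
  also have "\<dots> = complex_of_real (laplace_const * (\<integral>y. (\<integral>t. F t y \<partial>lborel) \<partial>lborel))"
    by (simp only: integral_complex_of_real integral_mult_right_zero)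
  finally show "(\<integral>y. f y * heat s (y - x) \<partial>lborel)
     = laplace_const * (\<integral>t. pos_powr (-1/4) t * (\<integral>y. v y * dheat (s + t) (y - x) \<partial>lborel) \<partial>lborel)"
    unfolding Fub in2 of_real_eq_iff .
  show "integrable lborel (\<lambda>t. pos_powr (-1/4) t * (\<integral>y. v y * dheat (s + t) (y - x) \<partial>lborel))"
    unfolding in2[symmetric] by (rule lborel_pair.integrable_fst[OF Fi])
qed

section \<open>Abel inversion\<close>

definition beta_const :: real where "beta_const = Beta (1/4) (3/4)"

lemma beta_const_pos: "beta_const > 0" by (simp add: beta_const_def Beta_def Gamma_real_pos)

lemma nn_integral_beta:
  assumes q: "q > 0"
  shows "(\<integral>\<^sup>+p. ennreal (pos_powr (-3/4) p * pos_powr (-1/4) (q - p)) \<partial>lborel) = ennreal beta_const"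
proof -
  have "(\<integral>\<^sup>+t. ennreal (t powr (1/4 - 1) * (1 - t) powr (3/4 - 1)) * indicator {0..1} t \<partial>lborel) = ennreal beta_const"
    unfolding beta_const_def by (rule nn_integral_has_integral_lebesgue'[OF _ has_integral_Beta_real]) auto
  also have "(\<integral>\<^sup>+t. ennreal (t powr (1/4 - 1) * (1 - t) powr (3/4 - 1)) * indicator {0..1} t \<partial>lborel)
    = (\<integral>\<^sup>+t. ennreal (pos_powr (-3/4) t * pos_powr (-1/4) (1 - t)) \<partial>lborel)"
    by (intro nn_integral_cong) (auto simp: pos_powr_def indicator_def)
  finally have 1: "(\<integral>\<^sup>+t. ennreal (pos_powr (-3/4) t * pos_powr (-1/4) (1 - t)) \<partial>lborel) = ennreal beta_const" .
  have "(\<integral>\<^sup>+p. ennreal (pos_powr (-3/4) p * pos_powr (-1/4) (q - p)) \<partial>lborel)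
    = ennreal q * (\<integral>\<^sup>+t. ennreal (pos_powr (-3/4) (q * t) * pos_powr (-1/4) (q - q * t)) \<partial>lborel)"
    using nn_integral_real_affine[of "\<lambda>p. ennreal (pos_powr (-3/4) p * pos_powr (-1/4) (q - p))" q 0] q by simp
  also have "\<dots> = ennreal q * (\<integral>\<^sup>+t. ennreal (1/q) * ennreal (pos_powr (-3/4) t * pos_powr (-1/4) (1 - t)) \<partial>lborel)"
  proof (intro arg_cong2[where f="(*)"] refl nn_integral_cong)
    fix t
    have "pos_powr (-3/4) (q * t) * pos_powr (-1/4) (q - q * t) = (1/q) * (pos_powr (-3/4) t * pos_powr (-1/4) (1 - t))"
    proof (cases "0 < t \<and> t < 1")
      case True
      have "q - q * t = q * (1 - t)" by (simp add: algebra_simps)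
      moreover have "q powr (-3/4) * q powr (-1/4) = 1 / q"
        using q by (simp add: powr_add[symmetric] powr_minus_divide)
      moreover have "pos_powr (-3/4) (q * t) * pos_powr (-1/4) (q * (1 - t))
          = (q powr (-3/4) * q powr (-1/4)) * (pos_powr (-3/4) t * pos_powr (-1/4) (1 - t))"
        using True q by (simp add: pos_powr_def powr_mult)
      ultimately show ?thesis by (simp only:)
    next
      case False
      then have "q * t \<le> 0 \<or> q - q * t \<le> 0" using q by (auto simp: not_less mult_le_0_iff)
      then show ?thesis using False q by (auto simp: pos_powr_def)
    qed
    then show "ennreal (pos_powr (-3/4) (q * t) * pos_powr (-1/4) (q - q * t)) = ennreal (1/q) * ennreal (pos_powr (-3/4) t * pos_powr (-1/4) (1 - t))"
      using q by (simp add: ennreal_mult[symmetric])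
  qed
  also have "\<dots> = ennreal q * (ennreal (1/q) * ennreal beta_const)"
    using 1 by (simp add: nn_integral_cmult)
  also have "\<dots> = ennreal beta_const"
    using q beta_const_pos by (simp add: ennreal_mult[symmetric])
  finally show ?thesis .
qed

lemma has_bochner_integral_beta:
  assumes q: "q > 0"
  shows "has_bochner_integral lborel (\<lambda>p. pos_powr (-3/4) p * pos_powr (-1/4) (q - p)) beta_const"
  by (rule has_bochner_integral_nn_integral[OF _ _ _ nn_integral_beta[OF q]]) (use beta_const_pos in auto)

text \<open>With \<open>q = p + t\<close> the inner weight is the Beta integral
  \<open>\<integral> p powr (-3/4) (q - p) powr (-1/4) dp\<close> over \<open>(0, q)\<close>, which does not depend on \<open>q\<close> because the two
  exponents add up to \<open>-1\<close>. This is Abel's method of composing two fractional integrations to a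
  full one.\<close>

lemma abel_integral:
  fixes h :: "real \<Rightarrow> real"
  assumes [measurable]: "h \<in> borel_measurable borel" and hi: "integrable lborel (\<lambda>q. indicator {0<..} q * h q)"
  shows "(\<integral>p. pos_powr (-3/4) p * (\<integral>t. pos_powr (-1/4) t * h (p + t) \<partial>lborel) \<partial>lborel)
     = beta_const * (\<integral>q. indicator {0<..} q * h q \<partial>lborel)"
proof -
  define F where "F = (\<lambda>q p. (pos_powr (-3/4) p * pos_powr (-1/4) (q - p)) * h q)"
  have Fm: "(\<lambda>(q, p). F q p) \<in> borel_measurable (lborel \<Otimes>\<^sub>M lborel)"
    unfolding F_def by measurable
  have z: "pos_powr (-3/4) p * pos_powr (-1/4) (q - p) = 0" if "q \<le> 0" for p q
    using that by (auto simp: pos_powr_def)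
  have Fi: "integrable (lborel \<Otimes>\<^sub>M lborel) (\<lambda>(q, p). F q p)"
  proof (rule integrable_pair_bound[OF Fm])
    show "integrable lborel (\<lambda>q. beta_const * \<bar>indicator {0<..} q * h q\<bar>)" using hi by auto
    show "0 \<le> beta_const * \<bar>indicator {0<..} q * h q\<bar>" for q using beta_const_pos by auto
    show "(\<integral>\<^sup>+p. ennreal \<bar>F q p\<bar> \<partial>lborel) \<le> ennreal (beta_const * \<bar>indicator {0<..} q * h q\<bar>)" for q
    proof (cases "q > 0")
      case True
      have "(\<integral>\<^sup>+p. ennreal \<bar>F q p\<bar> \<partial>lborel) = (\<integral>\<^sup>+p. ennreal (pos_powr (-3/4) p * pos_powr (-1/4) (q - p)) * ennreal \<bar>h q\<bar> \<partial>lborel)"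
        unfolding F_def by (intro nn_integral_cong) (simp add: abs_mult ennreal_mult)
      also have "\<dots> = ennreal beta_const * ennreal \<bar>h q\<bar>"
        using nn_integral_beta[OF True] by (subst nn_integral_multc) auto
      finally show ?thesis using True beta_const_pos by (simp add: ennreal_mult)
    next
      case False
      then have "F q p = 0" for p using z[of q p] by (auto simp: F_def)
      then show ?thesis by simp
    qed
  qed
  have "(\<integral>p. pos_powr (-3/4) p * (\<integral>t. pos_powr (-1/4) t * h (p + t) \<partial>lborel) \<partial>lborel) = (\<integral>p. (\<integral>q. F q p \<partial>lborel) \<partial>lborel)"
  proof (rule Bochner_Integration.integral_cong[OF refl])
    fix p
    have "(\<integral>q. F q p \<partial>lborel) = (\<integral>t. F (p + t) p \<partial>lborel)"
      by (subst lborel_integral_real_affine[of 1 _ p]) auto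
    also have "\<dots> = (\<integral>t. pos_powr (-3/4) p * (pos_powr (-1/4) t * h (p + t)) \<partial>lborel)"
      by (simp add: F_def mult_ac)
    finally show "pos_powr (-3/4) p * (\<integral>t. pos_powr (-1/4) t * h (p + t) \<partial>lborel) = (\<integral>q. F q p \<partial>lborel)"
      by (simp only: integral_mult_right_zero)
  qed
  also have "\<dots> = (\<integral>q. (\<integral>p. F q p \<partial>lborel) \<partial>lborel)"
    by (rule lborel_pair.Fubini_integral[OF Fi])
  also have "\<dots> = (\<integral>q. beta_const * (indicator {0<..} q * h q) \<partial>lborel)"
  proof (rule Bochner_Integration.integral_cong[OF refl])
    fix q
    show "(\<integral>p. F q p \<partial>lborel) = beta_const * (indicator {0<..} q * h q)"
    proof (cases "q > 0")
      case True
      then show ?thesis unfolding F_def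
        using has_bochner_integral_integral_eq[OF has_bochner_integral_beta[OF True]]
        by (subst integral_mult_left_zero) simp
    next
      case False
      then have "F q p = 0" for p using z[of q p] by (auto simp: F_def)
      then show ?thesis using False by simp
    qed
  qed
  finally show ?thesis by (simp only: integral_mult_right_zero)
qed

lemma heat_le: "s > 0 \<Longrightarrow> heat s z \<le> s powr (-1/2)"
proof -
  assume s: "s > 0"
  have "heat s z \<le> 1 / sqrt (2 * pi * s)" using s by (simp add: heat_def divide_right_mono)
  also have "\<dots> \<le> 1 / sqrt s"
  proof (intro divide_left_mono)
    have "1 * s \<le> (2 * pi) * s" using s pi_gt3 by (intro mult_right_mono) auto
    then show "sqrt s \<le> sqrt (2 * pi * s)" by simp
  qed (use s in auto)
  also have "\<dots> = s powr (-1/2)" using s by (simp add: powr_minus_divide powr_half_sqrt)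
  finally show ?thesis .
qed

lemma has_bochner_integral_dheat:
  assumes s: "s > 0"
  shows "has_bochner_integral lborel (\<lambda>q. indicator {0<..} q * dheat (s + q) z) (heat s z)"
proof -
  have i: "integrable lborel (\<lambda>q. indicator {0<..} q * dheat (s + q) z)"
  proof (rule Bochner_Integration.integrable_bound)
    show "integrable lborel (\<lambda>q. 5 * (pos_powr 0 q * (s + q) powr (-3/2)))"
      by (intro integrable_mult_right integrable_pos_powr_mix) (use s in auto)
    have "\<bar>dheat (s + q) z\<bar> \<le> 5 * (s + q) powr (-3/2)" if "q > 0" for q
    proof -
      have "\<bar>dheat (s + q) z\<bar> \<le> 5 / (s + q) * heat (2 * (s + q)) z" using s that by (intro dheat_bound) auto
      also have "\<dots> \<le> 5 / (s + q) * (2 * (s + q)) powr (-1/2)"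
        using s that by (intro mult_left_mono heat_le) auto
      also have "\<dots> \<le> 5 / (s + q) * (s + q) powr (-1/2)"
        using s that by (intro mult_left_mono powr_mono2') auto
      also have "5 / (s + q) = 5 * (s + q) powr (-1)" using s that by (simp add: powr_minus_divide)
      also have "5 * (s + q) powr (-1) * (s + q) powr (-1/2) = 5 * (s + q) powr (-1 + -1/2)"
        by (simp only: powr_add mult.assoc)
      finally show ?thesis by simp
    qed
    then show "AE q in lborel. norm (indicator {0<..} q * dheat (s + q) z) \<le> norm (5 * (pos_powr 0 q * (s + q) powr (-3/2)))"
      using s by (intro AE_I2) (auto simp: indicator_def pos_powr_def)
  qed measurable
  have "(LBINT q=0..\<infinity>. dheat (s + q) z) = 0 - (- heat s z)"
  proof (rule interval_integral_FTC_integrable[where F="\<lambda>q. - heat (s + q) z"])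
    fix q :: real assume "0 < ereal q"
    then have q: "s + q > 0" using s by simp
    have "((\<lambda>q. heat (s + q) z) has_real_derivative - dheat (s + q) z * 1) (at q)"
      by (rule DERIV_chain2[where f="\<lambda>r. heat r z" and g="\<lambda>q. s + q"])
        (auto intro!: DERIV_heat_time q derivative_eq_intros)
    from DERIV_minus[OF this] have "((\<lambda>q. - heat (s + q) z) has_real_derivative dheat (s + q) z) (at q)" by simp
    then show "((\<lambda>q. - heat (s + q) z) has_vector_derivative dheat (s + q) z) (at q)"
      by (simp add: has_real_derivative_iff_has_vector_derivative)
    show "isCont (\<lambda>q. dheat (s + q) z) q"
      unfolding dheat_def heat_def using q by (intro continuous_intros) auto
  next
    show "set_integrable lborel (einterval 0 \<infinity>) (\<lambda>q. dheat (s + q) z)"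
      using i by (simp add: set_integrable_def einterval_def greaterThan_def zero_ereal_def)
    have "isCont (\<lambda>q. - heat (s + q) z) 0" unfolding heat_def using s by (intro continuous_intros) auto
    then have "((\<lambda>q. - heat (s + q) z) \<longlongrightarrow> - heat s z) (at_right 0)"
      unfolding isCont_def by (auto intro: filterlim_mono at_within_le_at)
    then show "(((\<lambda>q. - heat (s + q) z) \<circ> real_of_ereal) \<longlongrightarrow> - heat s z) (at_right 0)"
      unfolding zero_ereal_def by (simp add: ereal_tendsto_simps)
    have "((\<lambda>q. - heat (s + q) z) \<longlongrightarrow> 0) at_top"
    proof (rule Lim_null_comparison)
      show "eventually (\<lambda>q. norm (- heat (s + q) z) \<le> (s + q) powr (-1/2)) at_top"
        using eventually_gt_at_top[of 0] by eventually_elim (use s heat_le in auto)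
      show "((\<lambda>q. (s + q) powr (-1/2)) \<longlongrightarrow> 0) at_top" by real_asymp
    qed
    then show "(((\<lambda>q. - heat (s + q) z) \<circ> real_of_ereal) \<longlongrightarrow> 0) (at_left \<infinity>)"
      by (simp add: ereal_tendsto_simps)
  qed simp
  then have "(\<integral>q. indicator {0<..} q * dheat (s + q) z \<partial>lborel) = heat s z"
    by (simp add: interval_lebesgue_integral_def einterval_def set_lebesgue_integral_def greaterThan_def zero_ereal_def)
  with i show ?thesis by (simp add: has_bochner_integral_iff)
qed

text \<open>Integrating the Gaussian form of the equation against \<open>p powr (-3/4)\<close> composes the power \<open>1/4\<close> of
  the generator with its inverse, and the time integral of \<open>dheat\<close> returns the heat kernel.
  Since \<open>f\<close> is merely bounded, \<open>p powr (-3/4)\<close> is not integrable against it at infinity; the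
  difference of two base points gains the missing factor \<open>p powr (-1/2)\<close>.\<close>

lemma abel_inversion:
  fixes v f :: "real \<Rightarrow> real"
  assumes v: "\<And>y. \<bar>v y\<bar> \<le> b" and f: "\<And>y. \<bar>f y\<bar> \<le> b'" and [measurable]: "v \<in> borel_measurable borel" "f \<in> borel_measurable borel"
    and E: "\<And>\<phi>. schwartz \<phi> \<Longrightarrow> frac_lap \<phi> \<in> borel_measurable borel \<Longrightarrow>
       (LINT x|lborel. complex_of_real (v x) * frac_lap \<phi> x) = (LINT x|lborel. complex_of_real (f x) * \<phi> x)"
    and s: "s > 0"
  shows "(\<integral>p. pos_powr (-3/4) p * (\<integral>y. f y * (heat (s + p) (y - x) - heat (s + p) (y - x')) \<partial>lborel) \<partial>lborel)
     = laplace_const * beta_const * (\<integral>y. v y * (heat s (y - x) - heat s (y - x')) \<partial>lborel)"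
proof -
  have b: "b \<ge> 0" using v[of 0] by linarith
  \<comment> \<open>Minus the time derivative of the smoothed difference, at time \<open>s + q\<close>.\<close>
  define U where "U = (\<lambda>q. \<integral>y. v y * (dheat (s + q) (y - x) - dheat (s + q) (y - x')) \<partial>lborel)"
  have Um [measurable]: "U \<in> borel_measurable borel" unfolding U_def by measurable
  have vd: "integrable lborel (\<lambda>y. v y * dheat r (y - x))" if "r > 0" for r x
    by (rule integral_bounded_factor(1)[OF v _ _ dheat_nn_integral]) (use that in auto)
  have fh: "integrable lborel (\<lambda>y. f y * heat r (y - x))" if "r > 0" for r x
    by (rule integral_bounded_factor(1)[OF f, where K=1]) (use that in auto)
  have Udiff: "U q = (\<integral>y. v y * dheat (s + q) (y - x) \<partial>lborel) - (\<integral>y. v y * dheat (s + q) (y - x') \<partial>lborel)" if "q > - s" for q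
    unfolding U_def using vd[of "s + q"] that by (simp add: right_diff_distrib)
  have nnD: "(\<integral>\<^sup>+y. ennreal \<bar>dheat (s + q) (y - x) - dheat (s + q) (y - x')\<bar> \<partial>lborel) \<le> ennreal (80 * (s + q) powr (-3/2) * \<bar>x - x'\<bar>)" if "q > 0" for q
    by (rule dheat_L1_translate) (use that s in auto)
  define F where "F = (\<lambda>q y. indicator {0<..} q * (v y * (dheat (s + q) (y - x) - dheat (s + q) (y - x'))))"
  have Fm: "(\<lambda>(q, y). F q y) \<in> borel_measurable (lborel \<Otimes>\<^sub>M lborel)"
    unfolding F_def by measurable
  have Fi: "integrable (lborel \<Otimes>\<^sub>M lborel) (\<lambda>(q, y). F q y)"
  proof (rule integrable_pair_bound[OF Fm])
    show "integrable lborel (\<lambda>q. (b * (80 * \<bar>x - x'\<bar>)) * (pos_powr 0 q * (s + q) powr (-3/2)))"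
      by (intro integrable_mult_right integrable_pos_powr_mix) (use s in auto)
    show "0 \<le> (b * (80 * \<bar>x - x'\<bar>)) * (pos_powr 0 q * (s + q) powr (-3/2))" for q using b by auto
    show "(\<integral>\<^sup>+y. ennreal \<bar>F q y\<bar> \<partial>lborel) \<le> ennreal ((b * (80 * \<bar>x - x'\<bar>)) * (pos_powr 0 q * (s + q) powr (-3/2)))" for q
    proof (cases "q > 0")
      case True
      have "(\<integral>\<^sup>+y. ennreal \<bar>F q y\<bar> \<partial>lborel) = (\<integral>\<^sup>+y. ennreal \<bar>v y * (dheat (s + q) (y - x) - dheat (s + q) (y - x'))\<bar> \<partial>lborel)"
        using True by (simp add: F_def)
      also have "\<dots> \<le> ennreal b * ennreal (80 * (s + q) powr (-3/2) * \<bar>x - x'\<bar>)"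
        by (rule order_trans[OF nn_integral_bounded_factor[OF v] mult_left_mono[OF nnD[OF True]]]) auto
      also have "\<dots> = ennreal ((b * (80 * \<bar>x - x'\<bar>)) * (pos_powr 0 q * (s + q) powr (-3/2)))"
        using True b s by (simp add: ennreal_mult'[symmetric] pos_powr_def mult_ac)
      finally show ?thesis .
    qed (simp add: F_def)
  qed
  have in1: "(\<integral>y. F q y \<partial>lborel) = indicator {0<..} q * U q" for q
    unfolding F_def U_def by (simp only: integral_mult_right_zero)
  have Ui: "integrable lborel (\<lambda>q. indicator {0<..} q * U q)"
    unfolding in1[symmetric] by (rule lborel_pair.integrable_fst[OF Fi])
  have in2: "(\<integral>q. F q y \<partial>lborel) = v y * (heat s (y - x) - heat s (y - x'))" for y
  proof -
    have "has_bochner_integral lborel (\<lambda>q. v y * (indicator {0<..} q * dheat (s + q) (y - x) - indicator {0<..} q * dheat (s + q) (y - x')))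
       (v y * (heat s (y - x) - heat s (y - x')))"
      by (intro has_bochner_integral_mult_right has_bochner_integral_diff has_bochner_integral_dheat s)
    then show ?thesis unfolding F_def
      by (subst has_bochner_integral_integral_eq[symmetric], assumption) (simp add: algebra_simps)
  qed
  \<comment> \<open>The fundamental theorem of calculus in \<open>q\<close>, carried out under the integral over \<open>y\<close>.\<close>
  have UV: "(\<integral>q. indicator {0<..} q * U q \<partial>lborel) = (\<integral>y. v y * (heat s (y - x) - heat s (y - x')) \<partial>lborel)"
    unfolding in1[symmetric] in2[symmetric] by (rule lborel_pair.Fubini_integral[OF Fi, symmetric])
  have step: "(\<integral>y. f y * (heat (s + p) (y - x) - heat (s + p) (y - x')) \<partial>lborel)
     = laplace_const * (\<integral>t. pos_powr (-1/4) t * U (p + t) \<partial>lborel)" if p: "p > 0" for p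
  proof -
    have sp: "s + p > 0" using s p by simp
    have W: "(\<integral>y. f y * heat (s + p) (y - z) \<partial>lborel) = laplace_const * (\<integral>t. pos_powr (-1/4) t * (\<integral>y. v y * dheat (s + p + t) (y - z) \<partial>lborel) \<partial>lborel)" for z
      by (rule weak_equation_heat(1)[OF v assms(3,4) E sp])
    have W2: "integrable lborel (\<lambda>t. pos_powr (-1/4) t * (\<integral>y. v y * dheat (s + p + t) (y - z) \<partial>lborel))" for z
      by (rule weak_equation_heat(2)[OF v assms(3,4) E sp])
    have "(\<integral>y. f y * (heat (s + p) (y - x) - heat (s + p) (y - x')) \<partial>lborel)
      = (\<integral>y. f y * heat (s + p) (y - x) \<partial>lborel) - (\<integral>y. f y * heat (s + p) (y - x') \<partial>lborel)"
      using fh[OF sp] by (simp add: right_diff_distrib)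
    also have "\<dots> = laplace_const * ((\<integral>t. pos_powr (-1/4) t * (\<integral>y. v y * dheat (s + p + t) (y - x) \<partial>lborel) \<partial>lborel)
       - (\<integral>t. pos_powr (-1/4) t * (\<integral>y. v y * dheat (s + p + t) (y - x') \<partial>lborel) \<partial>lborel))"
      unfolding W by (simp only: right_diff_distrib)
    also have "\<dots> = laplace_const * (\<integral>t. pos_powr (-1/4) t * (\<integral>y. v y * dheat (s + p + t) (y - x) \<partial>lborel)
       - pos_powr (-1/4) t * (\<integral>y. v y * dheat (s + p + t) (y - x') \<partial>lborel) \<partial>lborel)"
      by (rule arg_cong[where f="(*) laplace_const"], rule Bochner_Integration.integral_diff[symmetric])
        (rule W2)+
    also have "\<dots> = laplace_const * (\<integral>t. pos_powr (-1/4) t * U (p + t) \<partial>lborel)"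
    proof (intro arg_cong2[where f="(*)"] refl Bochner_Integration.integral_cong)
      fix t
      show "pos_powr (-1/4) t * (\<integral>y. v y * dheat (s + p + t) (y - x) \<partial>lborel)
       - pos_powr (-1/4) t * (\<integral>y. v y * dheat (s + p + t) (y - x') \<partial>lborel) = pos_powr (-1/4) t * U (p + t)"
      proof (cases "t > 0")
        case True
        then show ?thesis using p s by (subst Udiff) (auto simp: right_diff_distrib add.assoc)
      qed (simp add: pos_powr_def)
    qed
    finally show ?thesis .
  qed
  have "(\<integral>p. pos_powr (-3/4) p * (\<integral>y. f y * (heat (s + p) (y - x) - heat (s + p) (y - x')) \<partial>lborel) \<partial>lborel)
    = (\<integral>p. laplace_const * (pos_powr (-3/4) p * (\<integral>t. pos_powr (-1/4) t * U (p + t) \<partial>lborel)) \<partial>lborel)"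
  proof (intro Bochner_Integration.integral_cong refl)
    fix p
    show "pos_powr (-3/4) p * (\<integral>y. f y * (heat (s + p) (y - x) - heat (s + p) (y - x')) \<partial>lborel)
      = laplace_const * (pos_powr (-3/4) p * (\<integral>t. pos_powr (-1/4) t * U (p + t) \<partial>lborel))"
      by (cases "p > 0") (simp_all add: step pos_powr_def)
  qed
  also have "\<dots> = laplace_const * (beta_const * (\<integral>q. indicator {0<..} q * U q \<partial>lborel))"
    by (simp only: integral_mult_right_zero abel_integral[OF Um Ui])
  finally show ?thesis unfolding UV by simp
qed

section \<open>The Riesz potential representation\<close>

lemma heat_L1_diff_min:
  assumes s: "s > 0"
  shows "(\<integral>\<^sup>+y. ennreal \<bar>heat s (y - x) - heat s (y - x')\<bar> \<partial>lborel)
    \<le> ennreal (min 2 (10 * s powr (-1/2) * \<bar>x - x'\<bar>))"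
proof -
  have "(\<integral>\<^sup>+y. ennreal \<bar>heat s (y - x) - heat s (y - x')\<bar> \<partial>lborel)
     \<le> (\<integral>\<^sup>+y. ennreal (heat s (y - x)) + ennreal (heat s (y - x')) \<partial>lborel)"
    using s by (intro nn_integral_mono) (simp add: ennreal_plus[symmetric] abs_diff_le_iff order_trans[OF abs_triangle_ineq4] del: ennreal_plus)
  also have "\<dots> = ennreal 2" using s by (simp add: nn_integral_add)
  finally show ?thesis using heat_L1_translate[OF s, of x x'] by (auto simp: min_def)
qed

text \<open>The bound \<open>2\<close> is used for small times and the gradient bound for large times; \<open>h\<close> is the
  distance of the two base points.\<close>

definition riesz_majorant :: "real \<Rightarrow> real \<Rightarrow> real" where
  "riesz_majorant h p = 2 * (pos_powr (-3/4) p * indicator {..1} p) + 10 * h * (p powr (-5/4) * indicator {1..} p)"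

lemma riesz_majorant_integrable: "integrable lborel (riesz_majorant h)"
  unfolding riesz_majorant_def
  by (intro Bochner_Integration.integrable_add integrable_mult_right integrable_pos_powr_at_0 integrable_powr_at_top) auto

lemma riesz_majorant_nonneg: "h \<ge> 0 \<Longrightarrow> riesz_majorant h p \<ge> 0"
  by (auto simp: riesz_majorant_def)

lemma riesz_majorant_bound:
  assumes "p > 0" "s \<ge> 0" "h \<ge> 0"
  shows "pos_powr (-3/4) p * min 2 (10 * (s + p) powr (-1/2) * h) \<le> riesz_majorant h p"
proof (cases "p \<le> 1")
  case True
  have "pos_powr (-3/4) p * min 2 (10 * (s + p) powr (-1/2) * h) \<le> pos_powr (-3/4) p * 2" by (intro mult_left_mono) auto
  then show ?thesis using True assms by (auto simp: riesz_majorant_def mult_ac indicator_def)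
next
  case False
  have "(s + p) powr (-1/2) \<le> p powr (-1/2)" using assms by (intro powr_mono2') auto
  then have "pos_powr (-3/4) p * min 2 (10 * (s + p) powr (-1/2) * h) \<le> pos_powr (-3/4) p * (10 * p powr (-1/2) * h)"
    using assms by (intro mult_left_mono min.coboundedI2 mult_right_mono) auto
  also have "\<dots> = 10 * h * (p powr (-3/4) * p powr (-1/2))" using assms by (simp add: pos_powr_def)
  also have "p powr (-3/4) * p powr (-1/2) = p powr (-5/4)" unfolding powr_add[symmetric] by simp
  finally show ?thesis using False by (auto simp: riesz_majorant_def indicator_def)
qed

text \<open>Dominated convergence as the regularisation time tends to \<open>0\<close>: the majorant is uniform
  in \<open>\<sigma> n\<close>, and pointwise in \<open>p\<close> the time modulus of continuity applies.\<close>

lemma heat_limit: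
  fixes f :: "real \<Rightarrow> real"
  assumes f: "\<And>y. \<bar>f y\<bar> \<le> b" and [measurable]: "f \<in> borel_measurable borel"
    and \<sigma>: "\<And>n. \<sigma> n > 0" "\<sigma> \<longlonglongrightarrow> 0"
  shows "(\<lambda>n. \<integral>p. pos_powr (-3/4) p * (\<integral>y. f y * (heat (\<sigma> n + p) (y - x) - heat (\<sigma> n + p) (y - x')) \<partial>lborel) \<partial>lborel)
    \<longlonglongrightarrow> (\<integral>p. pos_powr (-3/4) p * (\<integral>y. f y * (heat p (y - x) - heat p (y - x')) \<partial>lborel) \<partial>lborel)"
proof -
  have b: "b \<ge> 0" using f[of 0] by linarith
  define \<Phi> where "\<Phi> = (\<lambda>p. \<integral>y. f y * (heat p (y - x) - heat p (y - x')) \<partial>lborel)"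
  have [measurable]: "\<Phi> \<in> borel_measurable borel" unfolding \<Phi>_def by measurable
  have \<Phi>b: "\<bar>\<Phi> p\<bar> \<le> b * min 2 (10 * p powr (-1/2) * \<bar>x - x'\<bar>)" if "p > 0" for p
    unfolding \<Phi>_def by (rule integral_bounded_factor(2)[OF f _ _ heat_L1_diff_min[OF that]]) auto
  have fh: "integrable lborel (\<lambda>y. f y * heat r (y - x))" if "r > 0" for r x
    by (rule integral_bounded_factor(1)[OF f, where K=1]) (use that in auto)
  have \<Phi>d: "\<bar>\<Phi> (p + s) - \<Phi> p\<bar> \<le> 2 * (b * (5 * s / p))" if "p > 0" "s > 0" for p s
  proof -
    have e: "\<bar>(\<integral>y. f y * (heat p (y - x) - heat (p + s) (y - x)) \<partial>lborel)\<bar> \<le> b * (5 * s / p)" for x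
      by (rule integral_bounded_factor(2)[OF f _ _ heat_time_diff]) (use that in auto)
    have "\<Phi> (p + s) - \<Phi> p = (\<integral>y. f y * (heat p (y - x') - heat (p + s) (y - x')) \<partial>lborel)
       - (\<integral>y. f y * (heat p (y - x) - heat (p + s) (y - x)) \<partial>lborel)"
      unfolding \<Phi>_def using fh[of p] fh[of "p + s"] that by (simp add: right_diff_distrib)
    then show ?thesis using e[of x] e[of x'] by linarith
  qed
  have "(\<lambda>n. \<integral>p. pos_powr (-3/4) p * \<Phi> (\<sigma> n + p) \<partial>lborel) \<longlonglongrightarrow> (\<integral>p. pos_powr (-3/4) p * \<Phi> p \<partial>lborel)"
  proof (rule integral_dominated_convergence)
    show "integrable lborel (\<lambda>p. b * riesz_majorant \<bar>x - x'\<bar> p)"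
      by (intro integrable_mult_right riesz_majorant_integrable)
    show "AE p in lborel. norm (pos_powr (-3/4) p * \<Phi> (\<sigma> n + p)) \<le> b * riesz_majorant \<bar>x - x'\<bar> p" for n
    proof (intro AE_I2)
      fix p
      show "norm (pos_powr (-3/4) p * \<Phi> (\<sigma> n + p)) \<le> b * riesz_majorant \<bar>x - x'\<bar> p"
      proof (cases "p > 0")
        case True
        have "norm (pos_powr (-3/4) p * \<Phi> (\<sigma> n + p)) = pos_powr (-3/4) p * \<bar>\<Phi> (\<sigma> n + p)\<bar>" by (simp add: abs_mult)
        also have "\<dots> \<le> pos_powr (-3/4) p * (b * min 2 (10 * (\<sigma> n + p) powr (-1/2) * \<bar>x - x'\<bar>))"
          using True \<sigma>(1)[of n] by (intro mult_left_mono \<Phi>b) auto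
        also have "\<dots> = b * (pos_powr (-3/4) p * min 2 (10 * (\<sigma> n + p) powr (-1/2) * \<bar>x - x'\<bar>))" by (simp only: mult_ac)
        also have "\<dots> \<le> b * riesz_majorant \<bar>x - x'\<bar> p"
          using True \<sigma>(1)[of n] b by (intro mult_left_mono riesz_majorant_bound) auto
        finally show ?thesis .
      qed (use b riesz_majorant_nonneg[of "\<bar>x - x'\<bar>" p] in \<open>simp add: pos_powr_def\<close>)
    qed
    show "AE p in lborel. (\<lambda>n. pos_powr (-3/4) p * \<Phi> (\<sigma> n + p)) \<longlonglongrightarrow> pos_powr (-3/4) p * \<Phi> p"
    proof (intro AE_I2)
      fix p
      show "(\<lambda>n. pos_powr (-3/4) p * \<Phi> (\<sigma> n + p)) \<longlonglongrightarrow> pos_powr (-3/4) p * \<Phi> p"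
      proof (cases "p > 0")
        case True
        have "(\<lambda>n. \<Phi> (\<sigma> n + p) - \<Phi> p) \<longlonglongrightarrow> 0"
        proof (rule Lim_null_comparison)
          show "eventually (\<lambda>n. norm (\<Phi> (\<sigma> n + p) - \<Phi> p) \<le> 2 * (b * (5 * \<sigma> n / p))) sequentially"
            using \<Phi>d[OF True \<sigma>(1)] by (auto simp: add.commute)
          show "(\<lambda>n. 2 * (b * (5 * \<sigma> n / p))) \<longlonglongrightarrow> 0"
            by (rule tendsto_eq_intros \<sigma>(2) refl | use True in simp)+
        qed
        then show ?thesis by (intro tendsto_mult_left) (simp add: LIM_zero_iff)
      qed (simp add: pos_powr_def)
    qed
  qed measurable
  then show ?thesis by (simp add: \<Phi>_def)
qed

definition riesz_const :: real where "riesz_const = (\<integral>p. pos_powr (-3/4) p * heat p 1 \<partial>lborel)"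

lemma integrable_riesz: "integrable lborel (\<lambda>p. pos_powr (-3/4) p * heat p 1)"
proof (rule Bochner_Integration.integrable_bound)
  show "integrable lborel (riesz_majorant 1)" by (rule riesz_majorant_integrable)
  have "pos_powr (-3/4) p * heat p 1 \<le> riesz_majorant 1 p" for p
  proof (cases "p > 0")
    case True
    show ?thesis
    proof (cases "p \<le> 1")
      case p1: True
      have s1: "sqrt p \<le> 1" using p1 by simp
      have "(1 / (2 * p)) * exp (- (1 / (2 * p))) \<le> 1" by (rule power_exp_bounds) (use True in auto)
      then have "exp (- (1 / (2 * p))) \<le> 2 * p" using True by (simp add: field_simps)
      then have "heat p 1 \<le> 2 * p / sqrt (2 * pi * p)" using True by (simp add: heat_def divide_right_mono)
      also have "\<dots> \<le> 2 * p / sqrt p"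
      proof (intro divide_left_mono)
        have "1 * p \<le> (2 * pi) * p" using True pi_gt3 by (intro mult_right_mono) auto
        then show "sqrt p \<le> sqrt (2 * pi * p)" by simp
      qed (use True in auto)
      also have "\<dots> = 2 * sqrt p" using True real_div_sqrt[of p] by (simp only: times_divide_eq_right[symmetric])
      also have "\<dots> \<le> 2" using s1 by simp
      finally have "pos_powr (-3/4) p * heat p 1 \<le> pos_powr (-3/4) p * 2" by (intro mult_left_mono) auto
      then show ?thesis using p1 by (auto simp: riesz_majorant_def indicator_def mult_ac)
    next
      case False
      have "pos_powr (-3/4) p * heat p 1 \<le> pos_powr (-3/4) p * p powr (-1/2)" using True by (intro mult_left_mono heat_le) auto
      also have "\<dots> = p powr (-5/4)" using True by (simp add: pos_powr_def powr_add[symmetric])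
      also have "\<dots> \<le> 10 * p powr (-5/4)" by simp
      finally show ?thesis using False by (auto simp: riesz_majorant_def indicator_def)
    qed
  qed (simp add: pos_powr_def riesz_majorant_nonneg)
  then show "AE p in lborel. norm (pos_powr (-3/4) p * heat p 1) \<le> norm (riesz_majorant 1 p)"
  proof (intro AE_I2)
    fix p :: real
    have "0 \<le> pos_powr (-3/4) p * heat p 1" by (cases "p > 0") (auto simp: pos_powr_def)
    then show "norm (pos_powr (-3/4) p * heat p 1) \<le> norm (riesz_majorant 1 p)"
      using \<open>\<And>p. pos_powr (-3/4) p * heat p 1 \<le> riesz_majorant 1 p\<close>[of p] by simp
  qed
qed measurable

text \<open>By the scaling \<open>p = z\<^sup>2 p'\<close> the integral is a multiple of \<open>\<bar>z\<bar> powr (-1/2)\<close>, the Riesz kernel of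
  \<open>(-\<Delta>) powr (1/4)\<close> on the line.\<close>

lemma has_bochner_integral_riesz:
  assumes z: "z \<noteq> 0"
  shows "has_bochner_integral lborel (\<lambda>p. pos_powr (-3/4) p * heat p z) (riesz_const * \<bar>z\<bar> powr (-1/2))"
proof -
  have z2: "z\<^sup>2 > 0" using z by simp
  have 1: "has_bochner_integral lborel (\<lambda>p. pos_powr (-3/4) p * heat p 1) riesz_const"
    unfolding riesz_const_def by (rule has_bochner_integral_integrable[OF integrable_riesz])
  have "has_bochner_integral lborel (\<lambda>p. (\<bar>z\<bar> powr (-3/2) / \<bar>z\<bar>) * (pos_powr (-3/4) p * heat p 1)) ((\<bar>z\<bar> powr (-3/2) / \<bar>z\<bar>) * riesz_const)"
    by (intro has_bochner_integral_mult_right 1)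
  moreover have "(\<bar>z\<bar> powr (-3/2) / \<bar>z\<bar>) * (pos_powr (-3/4) p * heat p 1) = pos_powr (-3/4) (0 + z\<^sup>2 * p) * heat (0 + z\<^sup>2 * p) z" for p
  proof (cases "p > 0")
    case True
    have "(z\<^sup>2) powr (-3/4) = (\<bar>z\<bar> powr 2) powr (-3/4)" using z by simp
    also have "\<dots> = \<bar>z\<bar> powr (-3/2)" unfolding powr_powr by simp
    finally have a: "pos_powr (-3/4) (z\<^sup>2 * p) = \<bar>z\<bar> powr (-3/2) * pos_powr (-3/4) p"
      using True z2 by (simp add: pos_powr_def powr_mult)
    have "sqrt (2 * pi * (z\<^sup>2 * p)) = \<bar>z\<bar> * sqrt (2 * pi * p)" by (simp add: real_sqrt_mult mult_ac)
    then have h: "heat (z\<^sup>2 * p) z = heat p 1 / \<bar>z\<bar>" using z by (simp add: heat_def)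
    show ?thesis unfolding add_0 a h by simp
  next
    case False
    then have "\<not> z\<^sup>2 * p > 0" using z2 by (simp add: zero_less_mult_iff)
    then show ?thesis using False by (simp add: pos_powr_def)
  qed
  ultimately have "has_bochner_integral lborel (\<lambda>p. pos_powr (-3/4) (0 + z\<^sup>2 * p) * heat (0 + z\<^sup>2 * p) z) ((\<bar>z\<bar> powr (-3/2) / \<bar>z\<bar>) * riesz_const)"
    by (simp only:)
  also have "(\<bar>z\<bar> powr (-3/2) / \<bar>z\<bar>) * riesz_const = (riesz_const * \<bar>z\<bar> powr (-1/2)) /\<^sub>R \<bar>z\<^sup>2\<bar>"
  proof -
    have "\<bar>z\<bar> powr (-3/2) / \<bar>z\<bar> = \<bar>z\<bar> powr (-3/2) * \<bar>z\<bar> powr (-1)" using z by (simp add: powr_minus_divide)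
    also have "\<dots> = \<bar>z\<bar> powr (-1/2) * \<bar>z\<bar> powr (-2)" unfolding powr_add[symmetric] by simp
    also have "\<bar>z\<bar> powr (-2) = inverse (z\<^sup>2)" using z by (simp add: powr_minus)
    finally show ?thesis by (simp add: mult_ac)
  qed
  finally show ?thesis
    using lborel_has_bochner_integral_real_affine_iff[of "z\<^sup>2" "\<lambda>p. pos_powr (-3/4) p * heat p z" _ 0] z2 by simp
qed

lemma riesz_const_pos: "riesz_const > 0"
proof -
  have nn: "0 \<le> pos_powr (-3/4) p * heat p 1" for p by (cases "p > 0") (auto simp: pos_powr_def)
  have "riesz_const \<noteq> 0"
  proof
    assume "riesz_const = 0"
    then have "AE p in lborel. pos_powr (-3/4) p * heat p 1 = 0"
      unfolding riesz_const_def using integral_nonneg_eq_0_iff_AE[OF integrable_riesz] nn by auto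
    then have "AE p in lborel. \<not> (p \<in> {0<..<1::real})"
      by eventually_elim (auto simp: pos_powr_def heat_def)
    then have "emeasure lborel {0<..<1::real} = 0"
      by (subst (asm) AE_iff_measurable[where N="{0<..<1}"]) auto
    then show False by simp
  qed
  moreover have "riesz_const \<ge> 0" unfolding riesz_const_def using nn by (intro integral_nonneg_AE AE_I2)
  ultimately show ?thesis by simp
qed

text \<open>The difference of two translates of the Riesz kernel decays like \<open>\<bar>y\<bar> powr (-3/2)\<close>, so it can be
  integrated against a bounded function, which the kernel itself cannot.\<close>

definition riesz_diff :: "real \<Rightarrow> real \<Rightarrow> real \<Rightarrow> real" where
  "riesz_diff x x' y = \<bar>y - x\<bar> powr (-1/2) - \<bar>y - x'\<bar> powr (-1/2)"

lemma riesz_diff_measurable [measurable]: "riesz_diff x x' \<in> borel_measurable borel"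
  unfolding riesz_diff_def by measurable

lemma riesz_fubini:
  fixes f :: "real \<Rightarrow> real"
  assumes f: "\<And>y. \<bar>f y\<bar> \<le> b" and [measurable]: "f \<in> borel_measurable borel"
  shows "integrable lborel (\<lambda>y. f y * riesz_diff x x' y)"
    and "(\<integral>p. pos_powr (-3/4) p * (\<integral>y. f y * (heat p (y - x) - heat p (y - x')) \<partial>lborel) \<partial>lborel)
      = riesz_const * (\<integral>y. f y * riesz_diff x x' y \<partial>lborel)"
proof -
  have b: "b \<ge> 0" using f[of 0] by linarith
  define F where "F = (\<lambda>p y. pos_powr (-3/4) p * (f y * (heat p (y - x) - heat p (y - x'))))"
  have Fm: "(\<lambda>(p, y). F p y) \<in> borel_measurable (lborel \<Otimes>\<^sub>M lborel)"
    unfolding F_def by measurable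
  have Fi: "integrable (lborel \<Otimes>\<^sub>M lborel) (\<lambda>(p, y). F p y)"
  proof (rule integrable_pair_bound[OF Fm])
    show "integrable lborel (\<lambda>p. b * riesz_majorant \<bar>x - x'\<bar> p)" by (intro integrable_mult_right riesz_majorant_integrable)
    show "0 \<le> b * riesz_majorant \<bar>x - x'\<bar> p" for p using b by (simp add: riesz_majorant_nonneg)
    show "(\<integral>\<^sup>+y. ennreal \<bar>F p y\<bar> \<partial>lborel) \<le> ennreal (b * riesz_majorant \<bar>x - x'\<bar> p)" for p
    proof (cases "p > 0")
      case True
      have "(\<integral>\<^sup>+y. ennreal \<bar>F p y\<bar> \<partial>lborel) = ennreal (pos_powr (-3/4) p) * (\<integral>\<^sup>+y. ennreal \<bar>f y * (heat p (y - x) - heat p (y - x'))\<bar> \<partial>lborel)"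
        by (simp add: F_def abs_mult ennreal_mult nn_integral_cmult)
      also have "\<dots> \<le> ennreal (pos_powr (-3/4) p) * (ennreal b * ennreal (min 2 (10 * p powr (-1/2) * \<bar>x - x'\<bar>)))"
        by (intro mult_left_mono order_trans[OF nn_integral_bounded_factor[OF f] mult_left_mono[OF heat_L1_diff_min[OF True]]]) auto
      also have "\<dots> = ennreal (b * (pos_powr (-3/4) p * min 2 (10 * (0 + p) powr (-1/2) * \<bar>x - x'\<bar>)))"
        using b by (simp add: ennreal_mult mult_ac)
      also have "\<dots> \<le> ennreal (b * riesz_majorant \<bar>x - x'\<bar> p)"
        using b True by (intro ennreal_leI mult_left_mono riesz_majorant_bound) auto
      finally show ?thesis .
    qed (simp add: F_def pos_powr_def)
  qed
  have in1: "(\<integral>y. F p y \<partial>lborel) = pos_powr (-3/4) p * (\<integral>y. f y * (heat p (y - x) - heat p (y - x')) \<partial>lborel)" for p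
    unfolding F_def by (simp only: integral_mult_right_zero)
  have in2: "(\<integral>p. F p y \<partial>lborel) = riesz_const * (f y * riesz_diff x x' y)" if "y \<noteq> x" "y \<noteq> x'" for y
  proof -
    have "has_bochner_integral lborel (\<lambda>p. f y * (pos_powr (-3/4) p * heat p (y - x) - pos_powr (-3/4) p * heat p (y - x')))
       (f y * (riesz_const * \<bar>y - x\<bar> powr (-1/2) - riesz_const * \<bar>y - x'\<bar> powr (-1/2)))"
      by (intro has_bochner_integral_mult_right has_bochner_integral_diff has_bochner_integral_riesz) (use that in auto)
    then have "(\<integral>p. f y * (pos_powr (-3/4) p * heat p (y - x) - pos_powr (-3/4) p * heat p (y - x')) \<partial>lborel)
       = f y * (riesz_const * \<bar>y - x\<bar> powr (-1/2) - riesz_const * \<bar>y - x'\<bar> powr (-1/2))"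
      by (rule has_bochner_integral_integral_eq)
    then show ?thesis unfolding F_def riesz_diff_def by (simp add: algebra_simps)
  qed
  have ae: "AE y in lborel. (\<integral>p. F p y \<partial>lborel) = riesz_const * (f y * riesz_diff x x' y)"
    using AE_lborel_singleton[of x] AE_lborel_singleton[of x'] by eventually_elim (rule in2)
  have i2: "integrable lborel (\<lambda>y. (\<integral>p. F p y \<partial>lborel))" by (rule lborel_pair.integrable_snd[OF Fi])
  have "integrable lborel (\<lambda>y. riesz_const * (f y * riesz_diff x x' y))"
    by (rule integrable_cong_AE_imp[OF i2 _ ae]) measurable
  then show "integrable lborel (\<lambda>y. f y * riesz_diff x x' y)" using riesz_const_pos by simp
  have "(\<integral>p. pos_powr (-3/4) p * (\<integral>y. f y * (heat p (y - x) - heat p (y - x')) \<partial>lborel) \<partial>lborel) = (\<integral>y. (\<integral>p. F p y \<partial>lborel) \<partial>lborel)"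
    unfolding in1[symmetric] by (rule lborel_pair.Fubini_integral[OF Fi, symmetric])
  also have "\<dots> = (\<integral>y. riesz_const * (f y * riesz_diff x x' y) \<partial>lborel)"
    by (rule integral_cong_AE[OF _ _ ae]) (use borel_measurable_integrable[OF i2] in auto)
  finally show "(\<integral>p. pos_powr (-3/4) p * (\<integral>y. f y * (heat p (y - x) - heat p (y - x')) \<partial>lborel) \<partial>lborel)
      = riesz_const * (\<integral>y. f y * riesz_diff x x' y \<partial>lborel)"
    by (simp only: integral_mult_right_zero)
qed

text \<open>After adding \<open>b\<close> and cutting off to a bounded interval, both functions become densities of
  finite measures that agree on half-lines; such measures are equal.\<close>

lemma AE_eq_of_interval_integrals:
  fixes u v :: "real \<Rightarrow> real"
  assumes u: "\<And>y. \<bar>u y\<bar> \<le> b" and v: "\<And>y. \<bar>v y\<bar> \<le> b"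
    and [measurable]: "u \<in> borel_measurable borel" "v \<in> borel_measurable borel"
    and eq: "\<And>a c. a < c \<Longrightarrow> (\<integral>x. indicator {a<..c} x * u x \<partial>lborel) = (\<integral>x. indicator {a<..c} x * v x \<partial>lborel)"
  shows "AE x in lborel. u x = v x"
proof -
  have ii: "integrable lborel (\<lambda>x. indicator {a<..c} x * (b + w x))"
    if "\<And>y. \<bar>w y\<bar> \<le> b" "w \<in> borel_measurable borel" for w and a c :: real
  proof (rule Bochner_Integration.integrable_bound[of _ "\<lambda>x. 2 * b * indicator {a<..c} x"])
    show "integrable lborel (\<lambda>x. 2 * b * indicator {a<..c} x)" by (cases "a \<le> c") auto
    have "\<bar>b + w x\<bar> \<le> \<bar>2 * b\<bar>" for x using that(1)[of x] by linarith
    then show "AE x in lborel. norm (indicator {a<..c} x * (b + w x)) \<le> norm (2 * b * indicator {a<..c} x)"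
      by (intro AE_I2) (auto simp: indicator_def)
  qed (use that(2) in measurable)
  have iw: "integrable lborel (\<lambda>x. indicator {a<..c} x * w x)"
    if "\<And>y. \<bar>w y\<bar> \<le> b" "w \<in> borel_measurable borel" for w and a c :: real
  proof (rule Bochner_Integration.integrable_bound[of _ "\<lambda>x. b * indicator {a<..c} x"])
    show "integrable lborel (\<lambda>x. b * indicator {a<..c} x)" by (cases "a \<le> c") auto
    have "\<bar>w x\<bar> \<le> \<bar>b\<bar>" for x using that(1)[of x] by linarith
    then show "AE x in lborel. norm (indicator {a<..c} x * w x) \<le> norm (b * indicator {a<..c} x)"
      by (intro AE_I2) (auto simp: indicator_def)
  qed (use that(2) in measurable)
  have loc: "AE x in lborel. ennreal (indicator {-real n<..real n} x * (b + u x)) = ennreal (indicator {-real n<..real n} x * (b + v x))" for n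
  proof -
    let ?M = "\<lambda>w. density lborel (\<lambda>x. ennreal (indicator {-real n<..real n} x * (b + w x)))"
    have em: "emeasure (?M w) {t<..} = ennreal (\<integral>x. indicator {max (- real n) t<..real n} x * (b + w x) \<partial>lborel)"
      if w: "\<And>y. \<bar>w y\<bar> \<le> b" and [measurable]: "w \<in> borel_measurable borel" for w t
    proof -
      have "emeasure (?M w) {t<..} = (\<integral>\<^sup>+x. ennreal (indicator {-real n<..real n} x * (b + w x)) * indicator {t<..} x \<partial>lborel)"
        by (subst emeasure_density) auto
      also have "\<dots> = (\<integral>\<^sup>+x. ennreal (indicator {max (- real n) t<..real n} x * (b + w x)) \<partial>lborel)"
        by (intro nn_integral_cong) (auto simp: indicator_def)
      also have "\<dots> = ennreal (\<integral>x. indicator {max (- real n) t<..real n} x * (b + w x) \<partial>lborel)"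
      proof (rule nn_integral_eq_integral)
        have "0 \<le> b + w x" for x using w[of x] by linarith
        then show "AE x in lborel. 0 \<le> indicator {max (- real n) t<..real n} x * (b + w x)" by auto
      qed (rule ii, use w in auto)
      finally show ?thesis .
    qed
    have "?M u = ?M v"
    proof (rule measure_eqI_lessThan)
      show "emeasure (?M u) {t<..} < \<infinity>" for t by (subst em) (use u in auto)
      show "emeasure (?M u) {t<..} = emeasure (?M v) {t<..}" for t
      proof -
        let ?a = "max (- real n) t"
        have "(\<integral>x. indicator {?a<..real n} x * u x \<partial>lborel) = (\<integral>x. indicator {?a<..real n} x * v x \<partial>lborel)"
        proof (cases "?a < real n")
          case True then show ?thesis by (rule eq)
        next
          case False
          then have "indicator {?a<..real n} x = (0::real)" for x by (auto simp: indicator_def)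
          then show ?thesis by simp
        qed
        moreover have "(\<integral>x. indicator {?a<..real n} x * (b + w x) \<partial>lborel)
           = (\<integral>x. indicator {?a<..real n} x * b \<partial>lborel) + (\<integral>x. indicator {?a<..real n} x * w x \<partial>lborel)"
          if w: "\<And>y. \<bar>w y\<bar> \<le> b" "w \<in> borel_measurable borel" for w
        proof -
          have "integrable lborel (\<lambda>x. indicator {?a<..real n} x * b)" by (cases "?a \<le> real n") auto
          then show ?thesis unfolding distrib_left using iw[OF w] by (rule Bochner_Integration.integral_add)
        qed
        ultimately show ?thesis using u v by (simp add: em)
      qed
    qed auto
    then show ?thesis by (intro sigma_finite_measure.density_unique[OF sigma_finite_lborel]) auto
  qed
  have "AE x in lborel. \<forall>n. ennreal (indicator {-real n<..real n} x * (b + u x)) = ennreal (indicator {-real n<..real n} x * (b + v x))"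
    using loc by (simp add: AE_all_countable)
  then show ?thesis
  proof eventually_elim
    fix x assume *: "\<forall>n. ennreal (indicator {-real n<..real n} x * (b + u x)) = ennreal (indicator {-real n<..real n} x * (b + v x))"
    obtain n :: nat where n: "\<bar>x\<bar> < real n" using reals_Archimedean2 by blast
    have "0 \<le> b + u x" "0 \<le> b + v x" using u[of x] v[of x] by linarith+
    moreover have "x \<in> {-real n<..real n}" using n by auto
    ultimately show "u x = v x" using *[rule_format, of n] by simp
  qed
qed

lemma heat_abs_moment:
  assumes s: "s > 0"
  shows "integrable lborel (\<lambda>t. \<bar>t\<bar> * heat s t)" "(\<integral>t. \<bar>t\<bar> * heat s t \<partial>lborel) \<le> 10 * sqrt s"
proof -
  have bd: "\<bar>t\<bar> * heat s t \<le> 10 * sqrt s * heat (2 * s) t" for t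
  proof -
    have "\<bar>t\<bar> * heat s t = s * \<bar>- t / s * heat s t\<bar>" using s by (simp add: abs_mult)
    also have "\<dots> \<le> s * (10 * s powr (-1/2) * heat (2 * s) t)" using s by (intro mult_left_mono heat_space_bound) auto
    also have "s * (10 * s powr (-1/2) * heat (2 * s) t) = 10 * (s / sqrt s) * heat (2 * s) t"
      using s by (simp add: powr_minus_divide powr_half_sqrt)
    also have "s / sqrt s = sqrt s" using s by (simp add: real_div_sqrt)
    finally show ?thesis .
  qed
  have i2: "integrable lborel (\<lambda>t. 10 * sqrt s * heat (2 * s) t)" using integrable_heat[of "2 * s" 0] s by simp
  show i: "integrable lborel (\<lambda>t. \<bar>t\<bar> * heat s t)"
    by (rule Bochner_Integration.integrable_bound[OF i2]) (use bd s in \<open>auto simp: abs_mult\<close>)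
  have "(\<integral>t. \<bar>t\<bar> * heat s t \<partial>lborel) \<le> (\<integral>t. 10 * sqrt s * heat (2 * s) t \<partial>lborel)"
    by (rule integral_mono[OF i i2 bd])
  also have "\<dots> = 10 * sqrt s" using integral_heat[of "2 * s" 0] s by simp
  finally show "(\<integral>t. \<bar>t\<bar> * heat s t \<partial>lborel) \<le> 10 * sqrt s" .
qed

text \<open>Moving the convolution onto the interval turns the difference into integrals of \<open>v\<close>
  near the two endpoints, over pieces of length \<open>2 * \<bar>t\<bar>\<close>, averaged with weight \<open>heat s t\<close>; the first absolute moment
  of the Gaussian is of order \<open>sqrt s\<close>.\<close>

lemma heat_smoothing_on_intervals:
  fixes v :: "real \<Rightarrow> real"
  assumes v: "\<And>y. \<bar>v y\<bar> \<le> b" and [measurable]: "v \<in> borel_measurable borel" and s: "s > 0" and ac: "a < c"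
  shows "\<bar>(\<integral>x. indicator {a<..c} x * (\<integral>y. v y * heat s (y - x) \<partial>lborel) \<partial>lborel)
     - (\<integral>x. indicator {a<..c} x * v x \<partial>lborel)\<bar> \<le> 40 * b * sqrt s"
proof -
  have b: "b \<ge> 0" using v[of 0] by linarith
  define F where "F = (\<lambda>x t. indicator {a<..c} x * (v (x + t) * heat s t))"
  have Fm: "(\<lambda>(x, t). F x t) \<in> borel_measurable (lborel \<Otimes>\<^sub>M lborel)"
    unfolding F_def by measurable
  have Fi: "integrable (lborel \<Otimes>\<^sub>M lborel) (\<lambda>(x, t). F x t)"
  proof (rule integrable_pair_bound[OF Fm])
    show "integrable lborel (\<lambda>x. b * indicator {a<..c} x)" using ac by auto
    show "0 \<le> b * indicator {a<..c} x" for x :: real using b by auto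
    show "(\<integral>\<^sup>+t. ennreal \<bar>F x t\<bar> \<partial>lborel) \<le> ennreal (b * indicator {a<..c} x)" for x
    proof -
      have "(\<integral>\<^sup>+t. ennreal \<bar>F x t\<bar> \<partial>lborel) = indicator {a<..c} x * (\<integral>\<^sup>+t. ennreal \<bar>v (x + t) * heat s t\<bar> \<partial>lborel)"
        by (simp add: F_def abs_mult indicator_def)
      also have "\<dots> \<le> indicator {a<..c} x * (ennreal b * (\<integral>\<^sup>+t. ennreal \<bar>heat s t\<bar> \<partial>lborel))"
        by (intro mult_left_mono nn_integral_bounded_factor v) auto
      also have "\<dots> = ennreal (b * indicator {a<..c} x)"
        using s nn_integral_heat[of s 0] by (simp add: indicator_def)
      finally show ?thesis .
    qed
  qed
  have in1: "indicator {a<..c} x * (\<integral>y. v y * heat s (y - x) \<partial>lborel) = (\<integral>t. F x t \<partial>lborel)" for x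
  proof -
    have "(\<integral>y. v y * heat s (y - x) \<partial>lborel) = (\<integral>t. v (x + t) * heat s t \<partial>lborel)"
      by (subst lborel_integral_real_affine[of 1 _ x]) auto
    then show ?thesis by (simp only: F_def integral_mult_right_zero)
  qed
  define I where "I = (\<lambda>t. \<integral>x. indicator {a<..c} x * v (x + t) \<partial>lborel)"
  have in2: "(\<integral>x. F x t \<partial>lborel) = heat s t * I t" for t
  proof -
    have "(\<integral>x. F x t \<partial>lborel) = (\<integral>x. heat s t * (indicator {a<..c} x * v (x + t)) \<partial>lborel)"
      unfolding F_def by (simp add: mult_ac)
    then show ?thesis by (simp only: I_def integral_mult_right_zero)
  qed
  have iw: "integrable lborel (\<lambda>x. indicator {a'<..c'} x * v x)" for a' c'
  proof (rule Bochner_Integration.integrable_bound[of _ "\<lambda>x. b * indicator {a'<..c'} x"])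
    show "integrable lborel (\<lambda>x. b * indicator {a'<..c'} x)" by (cases "a' \<le> c'") auto
    show "AE x in lborel. norm (indicator {a'<..c'} x * v x) \<le> norm (b * indicator {a'<..c'} x)"
      using v b by (intro AE_I2) (auto simp: indicator_def)
  qed measurable
  have Id: "\<bar>I t - I 0\<bar> \<le> 4 * b * \<bar>t\<bar>" for t
  proof -
    have It: "I t = (\<integral>x. indicator {a + t<..c + t} x * v x \<partial>lborel)"
      unfolding I_def by (subst (2) lborel_integral_real_affine[of 1 _ t]) (auto simp: indicator_def add.commute intro!: Bochner_Integration.integral_cong)
    have I0: "I 0 = (\<integral>x. indicator {a<..c} x * v x \<partial>lborel)" unfolding I_def by simp
    have Idiff: "I t - I 0 = (\<integral>x. indicator {a + t<..c + t} x * v x - indicator {a<..c} x * v x \<partial>lborel)"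
      unfolding It I0 by (rule Bochner_Integration.integral_diff[symmetric]) (rule iw)+
    have "\<bar>I t - I 0\<bar> \<le> (\<integral>x. b * (indicator {a - \<bar>t\<bar>..a + \<bar>t\<bar>} x + indicator {c - \<bar>t\<bar>..c + \<bar>t\<bar>} x) \<partial>lborel)"
      unfolding Idiff
    proof (rule integral_abs_bound_integral)
      show "integrable lborel (\<lambda>x. indicator {a + t<..c + t} x * v x - indicator {a<..c} x * v x)"
        by (intro Bochner_Integration.integrable_diff iw)
      show "integrable lborel (\<lambda>x. b * (indicator {a - \<bar>t\<bar>..a + \<bar>t\<bar>} x + indicator {c - \<bar>t\<bar>..c + \<bar>t\<bar>} x))"
        by auto
      fix x
      have "\<bar>indicator {a + t<..c + t} x * v x - indicator {a<..c} x * v x\<bar>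
         = \<bar>v x\<bar> * \<bar>indicator {a + t<..c + t} x - indicator {a<..c} x\<bar>"
        by (simp add: abs_mult[symmetric] algebra_simps)
      also have "\<dots> \<le> b * (indicator {a - \<bar>t\<bar>..a + \<bar>t\<bar>} x + indicator {c - \<bar>t\<bar>..c + \<bar>t\<bar>} x)"
        using v[of x] b by (intro mult_mono) (auto simp: indicator_def)
      finally show "\<bar>indicator {a + t<..c + t} x * v x - indicator {a<..c} x * v x\<bar>
        \<le> b * (indicator {a - \<bar>t\<bar>..a + \<bar>t\<bar>} x + indicator {c - \<bar>t\<bar>..c + \<bar>t\<bar>} x)" .
    qed
    also have "\<dots> = 4 * b * \<bar>t\<bar>" by simp
    finally show ?thesis .
  qed
  have [measurable]: "I \<in> borel_measurable borel" unfolding I_def by measurable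
  have iI: "integrable lborel (\<lambda>t. heat s t * I t)"
    unfolding in2[symmetric] by (rule lborel_pair.integrable_snd[OF Fi])
  have ih: "integrable lborel (heat s)" "(\<integral>t. heat s t \<partial>lborel) = 1"
    using integrable_heat[of s 0] integral_heat[of s 0] s by simp_all
  have "(\<integral>x. indicator {a<..c} x * (\<integral>y. v y * heat s (y - x) \<partial>lborel) \<partial>lborel) = (\<integral>t. heat s t * I t \<partial>lborel)"
    unfolding in1 in2[symmetric] by (rule lborel_pair.Fubini_integral[OF Fi, symmetric])
  moreover have "(\<integral>x. indicator {a<..c} x * v x \<partial>lborel) = (\<integral>t. heat s t * I 0 \<partial>lborel)"
    using ih by (simp add: I_def)
  ultimately have D: "(\<integral>x. indicator {a<..c} x * (\<integral>y. v y * heat s (y - x) \<partial>lborel) \<partial>lborel)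
     - (\<integral>x. indicator {a<..c} x * v x \<partial>lborel) = (\<integral>t. heat s t * I t - heat s t * I 0 \<partial>lborel)"
    using iI ih by simp
  have "\<bar>\<integral>t. heat s t * I t - heat s t * I 0 \<partial>lborel\<bar> \<le> (\<integral>t. 4 * b * (\<bar>t\<bar> * heat s t) \<partial>lborel)"
  proof (rule integral_abs_bound_integral)
    show "integrable lborel (\<lambda>t. heat s t * I t - heat s t * I 0)" using iI ih by simp
    show "integrable lborel (\<lambda>t. 4 * b * (\<bar>t\<bar> * heat s t))" using heat_abs_moment(1)[OF s] by simp
    fix t
    have "\<bar>heat s t * I t - heat s t * I 0\<bar> = heat s t * \<bar>I t - I 0\<bar>"
      using s by (simp add: right_diff_distrib[symmetric] abs_mult)
    also have "\<dots> \<le> heat s t * (4 * b * \<bar>t\<bar>)" using s by (intro mult_left_mono Id) auto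
    finally show "\<bar>heat s t * I t - heat s t * I 0\<bar> \<le> 4 * b * (\<bar>t\<bar> * heat s t)" by (simp only: mult_ac)
  qed
  also have "\<dots> \<le> 4 * b * (10 * sqrt s)"
    using mult_left_mono[OF heat_abs_moment(2)[OF s], of "4 * b"] b by simp
  finally show ?thesis unfolding D by simp
qed

definition fundamental_const :: real where "fundamental_const = riesz_const / (laplace_const * beta_const)"

text \<open>The differences of the smoothed functions \<open>S s x\<close> converge by Abel inversion as \<open>s\<close> tends
  to \<open>0\<close>. They leave one additive constant free, which is fixed along a subsequence on which the
  bounded sequence of values at \<open>0\<close> converges; the limit \<open>w\<close> agrees with \<open>v\<close> almost everywhere
  because smoothing does not change integrals over intervals in the limit.\<close>

theorem riesz_representation:
  fixes v f :: "real \<Rightarrow> real"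
  assumes v: "\<And>y. \<bar>v y\<bar> \<le> b" and f: "\<And>y. \<bar>f y\<bar> \<le> b'" and vm [measurable]: "v \<in> borel_measurable borel" and fm [measurable]: "f \<in> borel_measurable borel"
    and E: "\<And>\<phi>. schwartz \<phi> \<Longrightarrow> frac_lap \<phi> \<in> borel_measurable borel \<Longrightarrow>
       (LINT x|lborel. complex_of_real (v x) * frac_lap \<phi> x) = (LINT x|lborel. complex_of_real (f x) * \<phi> x)"
  obtains w where "\<And>x. \<bar>w x\<bar> \<le> b" "\<And>x x'. w x - w x' = fundamental_const * (\<integral>y. f y * riesz_diff x x' y \<partial>lborel)"
    "w \<in> borel_measurable borel" "AE x in lborel. w x = v x"
proof -
  have b: "b \<ge> 0" using v[of 0] by linarith
  define S where "S = (\<lambda>s x. \<integral>y. v y * heat s (y - x) \<partial>lborel)"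
  have Sb: "\<bar>S s x\<bar> \<le> b" if "s > 0" for s x
    unfolding S_def using integral_bounded_factor(2)[OF v, where k="\<lambda>y. heat s (y - x)" and K=1] that by simp
  have vh: "integrable lborel (\<lambda>y. v y * heat r (y - x))" if "r > 0" for r x
    by (rule integral_bounded_factor(1)[OF v, where K=1]) (use that in auto)
  have Sm [measurable]: "S s \<in> borel_measurable borel" for s unfolding S_def by measurable
  have lim: "(\<lambda>n. S (\<sigma> n) x - S (\<sigma> n) x') \<longlonglongrightarrow> fundamental_const * (\<integral>y. f y * riesz_diff x x' y \<partial>lborel)"
    if \<sigma>: "\<And>n. \<sigma> n > 0" "\<sigma> \<longlonglongrightarrow> 0" for x x' \<sigma>
  proof -
    have kb: "laplace_const * beta_const > 0" using laplace_const_pos beta_const_pos by auto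
    have e: "S (\<sigma> n) x - S (\<sigma> n) x' = (\<integral>p. pos_powr (-3/4) p * (\<integral>y. f y * (heat (\<sigma> n + p) (y - x) - heat (\<sigma> n + p) (y - x')) \<partial>lborel) \<partial>lborel) / (laplace_const * beta_const)" for n
    proof -
      have "S (\<sigma> n) x - S (\<sigma> n) x' = (\<integral>y. v y * (heat (\<sigma> n) (y - x) - heat (\<sigma> n) (y - x')) \<partial>lborel)"
        unfolding S_def using vh[OF \<sigma>(1)] by (simp add: right_diff_distrib)
      moreover have A: "(\<integral>p. pos_powr (-3/4) p * (\<integral>y. f y * (heat (\<sigma> n + p) (y - x) - heat (\<sigma> n + p) (y - x')) \<partial>lborel) \<partial>lborel)
         = laplace_const * beta_const * (\<integral>y. v y * (heat (\<sigma> n) (y - x) - heat (\<sigma> n) (y - x')) \<partial>lborel)"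
        by (rule abel_inversion[OF v f vm fm E \<sigma>(1)])
      ultimately show ?thesis unfolding A using laplace_const_pos beta_const_pos by auto
    qed
    have "(\<lambda>n. S (\<sigma> n) x - S (\<sigma> n) x') \<longlonglongrightarrow> (riesz_const * (\<integral>y. f y * riesz_diff x x' y \<partial>lborel)) / (laplace_const * beta_const)"
      unfolding e riesz_fubini(2)[OF f fm, symmetric]
      by (intro tendsto_divide tendsto_const heat_limit[OF f fm \<sigma>]) (use laplace_const_pos beta_const_pos in auto)
    then show ?thesis by (simp add: fundamental_const_def)
  qed
  define \<sigma>0 where "\<sigma>0 = (\<lambda>n. 1 / (real n + 1))"
  have \<sigma>0: "\<sigma>0 n > 0" "\<sigma>0 \<longlonglongrightarrow> 0" for n
    unfolding \<sigma>0_def by (simp, real_asymp)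
  have "bounded (range (\<lambda>n. S (\<sigma>0 n) 0))"
    unfolding bounded_iff using Sb[OF \<sigma>0(1)] by auto
  \<comment> \<open>The additive constant that the difference formula leaves undetermined.\<close>
  then obtain l r where r: "strict_mono (r :: nat \<Rightarrow> nat)" "((\<lambda>n. S (\<sigma>0 n) 0) \<circ> r) \<longlonglongrightarrow> l"
    using bounded_imp_convergent_subsequence by blast
  define \<sigma> where "\<sigma> = \<sigma>0 \<circ> r"
  have \<sigma>: "\<And>n. \<sigma> n > 0" "\<sigma> \<longlonglongrightarrow> 0"
    using \<sigma>0(1) LIMSEQ_subseq_LIMSEQ[OF \<sigma>0(2) r(1)] by (auto simp: \<sigma>_def)
  have l: "(\<lambda>n. S (\<sigma> n) 0) \<longlonglongrightarrow> l" using r(2) by (simp add: \<sigma>_def comp_def)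
  define w where "w = (\<lambda>x. l + fundamental_const * (\<integral>y. f y * riesz_diff x 0 y \<partial>lborel))"
  have Sw: "(\<lambda>n. S (\<sigma> n) x) \<longlonglongrightarrow> w x" for x
    using tendsto_add[OF l lim[OF \<sigma>, of x 0]] by (simp add: w_def)
  have wb: "\<bar>w x\<bar> \<le> b" for x
    by (rule tendsto_upperbound[OF tendsto_rabs[OF Sw]]) (use Sb[OF \<sigma>(1)] in auto)
  have wd: "w x - w x' = fundamental_const * (\<integral>y. f y * riesz_diff x x' y \<partial>lborel)" for x x'
    using LIMSEQ_unique[OF tendsto_diff[OF Sw Sw] lim[OF \<sigma>]] .
  have wm: "w \<in> borel_measurable borel"
    by (rule borel_measurable_LIMSEQ_real[OF Sw]) measurable
  have "AE x in lborel. w x = v x"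
  proof (rule AE_eq_of_interval_integrals[OF wb v wm vm])
    fix a c :: real assume ac: "a < c"
    have 1: "(\<lambda>n. \<integral>x. indicator {a<..c} x * S (\<sigma> n) x \<partial>lborel) \<longlonglongrightarrow> (\<integral>x. indicator {a<..c} x * w x \<partial>lborel)"
    proof (rule integral_dominated_convergence[where w="\<lambda>x. b * indicator {a<..c} x"])
      show "integrable lborel (\<lambda>x. b * indicator {a<..c} x)" using ac by auto
      show "AE x in lborel. (\<lambda>n. indicator {a<..c} x * S (\<sigma> n) x) \<longlonglongrightarrow> indicator {a<..c} x * w x"
        by (intro AE_I2 tendsto_mult_left Sw)
      show "AE x in lborel. norm (indicator {a<..c} x * S (\<sigma> n) x) \<le> b * indicator {a<..c} x" for n
        using Sb[OF \<sigma>(1)] by (intro AE_I2) (auto simp: indicator_def)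
    qed (use wm in measurable)
    have 2: "(\<lambda>n. \<integral>x. indicator {a<..c} x * S (\<sigma> n) x \<partial>lborel) \<longlonglongrightarrow> (\<integral>x. indicator {a<..c} x * v x \<partial>lborel)"
    proof -
      have "(\<lambda>n. (\<integral>x. indicator {a<..c} x * S (\<sigma> n) x \<partial>lborel) - (\<integral>x. indicator {a<..c} x * v x \<partial>lborel)) \<longlonglongrightarrow> 0"
      proof (rule Lim_null_comparison)
        show "eventually (\<lambda>n. norm ((\<integral>x. indicator {a<..c} x * S (\<sigma> n) x \<partial>lborel) - (\<integral>x. indicator {a<..c} x * v x \<partial>lborel)) \<le> 40 * b * sqrt (\<sigma> n)) sequentially"
          unfolding S_def using heat_smoothing_on_intervals[OF v vm \<sigma>(1) ac] by auto
        show "(\<lambda>n. 40 * b * sqrt (\<sigma> n)) \<longlonglongrightarrow> 0"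
          by (rule tendsto_eq_intros \<sigma>(2) refl | simp)+
      qed
      then show ?thesis by (simp add: LIM_zero_iff)
    qed
    show "(\<integral>x. indicator {a<..c} x * w x \<partial>lborel) = (\<integral>x. indicator {a<..c} x * v x \<partial>lborel)"
      by (rule LIMSEQ_unique[OF 1 2])
  qed
  with wb wd wm show ?thesis by (rule that)
qed

section \<open>Fourier multiplier inequalities\<close>

definition fourier_real :: "(real \<Rightarrow> real) \<Rightarrow> real \<Rightarrow> complex" where
  "fourier_real F \<eta> = (LINT s|lborel. complex_of_real (F s) * iexp (- (\<eta> * s)))"

lemma fourier_real_measurable [measurable]:
  assumes [measurable]: "F \<in> borel_measurable borel"
  shows "fourier_real F \<in> borel_measurable borel"
  unfolding fourier_real_def by measurable

lemma fourier_real_integrable: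
  assumes F: "integrable lborel F"
  shows "integrable lborel (\<lambda>s. complex_of_real (F s) * iexp (- (\<eta> * s)))"
proof -
  have [measurable]: "F \<in> borel_measurable borel" using borel_measurable_integrable[OF F] by simp
  show ?thesis
    by (rule Bochner_Integration.integrable_bound[OF F]) (auto simp: norm_mult)
qed

lemma fourier_real_norm_le:
  assumes F: "integrable lborel F"
  shows "norm (fourier_real F \<eta>) \<le> (\<integral>s. \<bar>F s\<bar> \<partial>lborel)"
proof -
  have "norm (fourier_real F \<eta>) \<le> (\<integral>s. norm (complex_of_real (F s) * iexp (- (\<eta> * s))) \<partial>lborel)"
    unfolding fourier_real_def by (rule integral_norm_bound)
  also have "\<dots> = (\<integral>s. \<bar>F s\<bar> \<partial>lborel)" by (simp add: norm_mult)
  finally show ?thesis .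
qed

lemma integrable_pair_mult:
  fixes A B :: "real \<Rightarrow> real"
  assumes A: "integrable lborel A" and B: "integrable lborel B"
  shows "integrable (lborel \<Otimes>\<^sub>M lborel) (\<lambda>(x, y). A x * B y)"
proof -
  have [measurable]: "A \<in> borel_measurable borel" "B \<in> borel_measurable borel"
    using borel_measurable_integrable[OF A] borel_measurable_integrable[OF B] by simp_all
  have IB: "(\<integral>y. \<bar>B y\<bar> \<partial>lborel) \<ge> 0" by simp
  show ?thesis
  proof (rule integrable_pair_bound)
    show "integrable lborel (\<lambda>x. \<bar>A x\<bar> * (\<integral>y. \<bar>B y\<bar> \<partial>lborel))" using A by simp
    show "0 \<le> \<bar>A x\<bar> * (\<integral>y. \<bar>B y\<bar> \<partial>lborel)" for x using IB by simp
    show "(\<integral>\<^sup>+y. ennreal \<bar>A x * B y\<bar> \<partial>lborel) \<le> ennreal (\<bar>A x\<bar> * (\<integral>y. \<bar>B y\<bar> \<partial>lborel))" for x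
    proof -
      have "(\<integral>\<^sup>+y. ennreal \<bar>A x * B y\<bar> \<partial>lborel) = ennreal \<bar>A x\<bar> * (\<integral>\<^sup>+y. ennreal \<bar>B y\<bar> \<partial>lborel)"
        by (simp add: abs_mult ennreal_mult nn_integral_cmult)
      also have "(\<integral>\<^sup>+y. ennreal \<bar>B y\<bar> \<partial>lborel) = ennreal (\<integral>y. \<bar>B y\<bar> \<partial>lborel)"
        using B by (intro nn_integral_eq_integral) auto
      finally show ?thesis using IB by (simp add: ennreal_mult)
    qed
  qed measurable
qed

lemma integrable_gauss: "e > 0 \<Longrightarrow> integrable lborel (\<lambda>\<eta>::real. exp (- e * \<eta>\<^sup>2 / 2))"
  using integrable_power_gauss[of e 0] by simp

text \<open>Plancherel's identity with a Gaussian cut-off. Writing out the squared modulus of the transform as a double integral, the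
  frequency integral is the inverse transform of a Gaussian. The cut-off makes every integral
  absolutely convergent for \<open>F\<close> in \<open>L\<^sup>1\<close>.\<close>

lemma gauss_pairing:
  assumes F: "integrable lborel F" and e: "e > 0"
  shows "(LINT \<eta>|lborel. complex_of_real ((norm (fourier_real F \<eta>))\<^sup>2 * exp (- e * \<eta>\<^sup>2 / 2)))
    = complex_of_real (2 * pi * (\<integral>s. F s * (\<integral>u. F u * heat e (u - s) \<partial>lborel) \<partial>lborel))"
proof -
  have [measurable]: "F \<in> borel_measurable borel" using borel_measurable_integrable[OF F] by simp
  define G where "G = (\<lambda>\<eta>. exp (- e * \<eta>\<^sup>2 / 2))"
  have [measurable]: "G \<in> borel_measurable borel" unfolding G_def by measurable
  have G: "integrable lborel G" unfolding G_def by (rule integrable_gauss[OF e])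
  define K where "K = (\<integral>s. \<bar>F s\<bar> \<partial>lborel)"
  have K: "norm (fourier_real F \<eta>) \<le> K" "K \<ge> 0" for \<eta> unfolding K_def by (rule fourier_real_norm_le[OF F]) simp
  have cn: "cnj (fourier_real F \<eta>) = (LINT s|lborel. complex_of_real (F s) * iexp (\<eta> * s))" for \<eta>
  proof -
    have "cnj (fourier_real F \<eta>) = (LINT s|lborel. cnj (complex_of_real (F s) * iexp (- (\<eta> * s))))"
      unfolding fourier_real_def by (rule Bochner_Integration.integral_cnj[symmetric])
    then show ?thesis by (simp add: exp_cnj)
  qed
  define P where "P = (\<lambda>\<eta> s. (complex_of_real (F s) * iexp (\<eta> * s)) * (fourier_real F \<eta> * complex_of_real (G \<eta>)))"
  have Pi: "integrable (lborel \<Otimes>\<^sub>M lborel) (\<lambda>(\<eta>, s). P \<eta> s)"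
  proof (rule Bochner_Integration.integrable_bound)
    show "integrable (lborel \<Otimes>\<^sub>M lborel) (\<lambda>(\<eta>, s). (K * G \<eta>) * F s)"
      by (rule integrable_pair_mult) (use F G in auto)
    show "AE p in lborel \<Otimes>\<^sub>M lborel. norm (case p of (\<eta>, s) \<Rightarrow> P \<eta> s) \<le> norm (case p of (\<eta>, s) \<Rightarrow> (K * G \<eta>) * F s)"
    proof (intro AE_I2, clarify)
      fix \<eta> s
      have "norm (P \<eta> s) = norm (fourier_real F \<eta>) * (G \<eta> * \<bar>F s\<bar>)" by (simp add: P_def norm_mult G_def)
      also have "\<dots> \<le> K * (G \<eta> * \<bar>F s\<bar>)" by (intro mult_right_mono K) (auto simp: G_def)
      finally show "norm (P \<eta> s) \<le> norm (K * G \<eta> * F s)" using K(2) by (simp add: abs_mult G_def)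
    qed
  qed (unfold P_def, measurable)
  define Q where "Q = (\<lambda>s \<eta> u. (complex_of_real (F u) * iexp (- (\<eta> * u))) * (iexp (\<eta> * s) * complex_of_real (G \<eta>)))"
  have Qi: "integrable (lborel \<Otimes>\<^sub>M lborel) (\<lambda>(\<eta>, u). Q s \<eta> u)" for s
  proof (rule Bochner_Integration.integrable_bound)
    show "integrable (lborel \<Otimes>\<^sub>M lborel) (\<lambda>(\<eta>, u). G \<eta> * F u)"
      by (rule integrable_pair_mult) (use F G in auto)
    show "AE p in lborel \<Otimes>\<^sub>M lborel. norm (case p of (\<eta>, u) \<Rightarrow> Q s \<eta> u) \<le> norm (case p of (\<eta>, u) \<Rightarrow> G \<eta> * F u)"
      by (intro AE_I2) (auto simp: Q_def norm_mult abs_mult)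
  qed (unfold Q_def, measurable)
  have inner: "(LINT \<eta>|lborel. iexp (\<eta> * s) * (fourier_real F \<eta> * complex_of_real (G \<eta>))) = complex_of_real (2 * pi * (\<integral>u. F u * heat e (u - s) \<partial>lborel))" for s
  proof -
    have "(LINT \<eta>|lborel. iexp (\<eta> * s) * (fourier_real F \<eta> * complex_of_real (G \<eta>))) = (LINT \<eta>|lborel. (LINT u|lborel. Q s \<eta> u))"
    proof (intro Bochner_Integration.integral_cong refl)
      fix \<eta>
      have "(LINT u|lborel. Q s \<eta> u) = fourier_real F \<eta> * (iexp (\<eta> * s) * complex_of_real (G \<eta>))"
        unfolding Q_def by (simp only: integral_mult_left_zero fourier_real_def)
      then show "iexp (\<eta> * s) * (fourier_real F \<eta> * complex_of_real (G \<eta>)) = (LINT u|lborel. Q s \<eta> u)" by (simp add: mult_ac)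
    qed
    also have "\<dots> = (LINT u|lborel. (LINT \<eta>|lborel. Q s \<eta> u))"
      by (rule lborel_pair.Fubini_integral[OF Qi, symmetric])
    also have "\<dots> = (LINT u|lborel. complex_of_real (2 * pi * (F u * heat e (u - s))))"
    proof (intro Bochner_Integration.integral_cong refl)
      fix u
      have "(LINT \<eta>|lborel. Q s \<eta> u) = (LINT \<eta>|lborel. complex_of_real (F u) * (exp (\<i> * complex_of_real ((s - u) * \<eta>)) * complex_of_real (exp (- e * \<eta>\<^sup>2 / 2))))"
      proof (intro Bochner_Integration.integral_cong refl)
        fix \<eta>
        have "iexp (- (\<eta> * u)) * iexp (\<eta> * s) = exp (\<i> * complex_of_real ((s - u) * \<eta>))"
          unfolding exp_add[symmetric] by (simp add: algebra_simps)
        moreover have "Q s \<eta> u = complex_of_real (F u) * ((iexp (- (\<eta> * u)) * iexp (\<eta> * s)) * complex_of_real (exp (- e * \<eta>\<^sup>2 / 2)))"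
          by (simp only: Q_def G_def mult.assoc)
        ultimately show "Q s \<eta> u = complex_of_real (F u) * (exp (\<i> * complex_of_real ((s - u) * \<eta>)) * complex_of_real (exp (- e * \<eta>\<^sup>2 / 2)))"
          by (simp only:)
      qed
      also have "\<dots> = complex_of_real (F u) * complex_of_real (2 * pi * heat e (s - u))"
        by (simp only: integral_mult_right_zero inv_fourier_heat[OF e])
      also have "heat e (s - u) = heat e (u - s)" by (simp add: heat_def power2_commute)
      finally show "(LINT \<eta>|lborel. Q s \<eta> u) = complex_of_real (2 * pi * (F u * heat e (u - s)))" by (simp add: mult_ac)
    qed
    also have "\<dots> = complex_of_real (2 * pi * (\<integral>u. F u * heat e (u - s) \<partial>lborel))"
      by (simp only: integral_complex_of_real integral_mult_right_zero)
    finally show ?thesis .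
  qed
  have "(LINT \<eta>|lborel. complex_of_real ((norm (fourier_real F \<eta>))\<^sup>2 * exp (- e * \<eta>\<^sup>2 / 2))) = (LINT \<eta>|lborel. (LINT s|lborel. P \<eta> s))"
  proof (intro Bochner_Integration.integral_cong refl)
    fix \<eta>
    have "(LINT s|lborel. P \<eta> s) = cnj (fourier_real F \<eta>) * (fourier_real F \<eta> * complex_of_real (G \<eta>))"
      unfolding P_def cn by (simp only: integral_mult_left_zero)
    also have "\<dots> = (fourier_real F \<eta> * cnj (fourier_real F \<eta>)) * complex_of_real (G \<eta>)" by (simp add: mult_ac)
    finally show "complex_of_real ((norm (fourier_real F \<eta>))\<^sup>2 * exp (- e * \<eta>\<^sup>2 / 2)) = (LINT s|lborel. P \<eta> s)"
      by (simp add: complex_norm_square[symmetric] G_def)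
  qed
  also have "\<dots> = (LINT s|lborel. (LINT \<eta>|lborel. P \<eta> s))"
    by (rule lborel_pair.Fubini_integral[OF Pi, symmetric])
  also have "\<dots> = (LINT s|lborel. complex_of_real (2 * pi * (F s * (\<integral>u. F u * heat e (u - s) \<partial>lborel))))"
  proof (intro Bochner_Integration.integral_cong refl)
    fix s
    have "(LINT \<eta>|lborel. P \<eta> s) = (LINT \<eta>|lborel. complex_of_real (F s) * (iexp (\<eta> * s) * (fourier_real F \<eta> * complex_of_real (G \<eta>))))"
      by (simp add: P_def mult_ac)
    also have "\<dots> = complex_of_real (F s) * complex_of_real (2 * pi * (\<integral>u. F u * heat e (u - s) \<partial>lborel))"
      by (simp only: integral_mult_right_zero inner)
    finally show "(LINT \<eta>|lborel. P \<eta> s) = complex_of_real (2 * pi * (F s * (\<integral>u. F u * heat e (u - s) \<partial>lborel)))"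
      by (simp add: mult_ac)
  qed
  also have "\<dots> = complex_of_real (2 * pi * (\<integral>s. F s * (\<integral>u. F u * heat e (u - s) \<partial>lborel) \<partial>lborel))"
    by (simp only: integral_complex_of_real integral_mult_right_zero)
  finally show ?thesis .
qed

lemma gauss_pairing_real:
  assumes F: "integrable lborel F" and e: "e > 0"
  shows "(\<integral>\<eta>. (norm (fourier_real F \<eta>))\<^sup>2 * exp (- e * \<eta>\<^sup>2 / 2) \<partial>lborel)
    = 2 * pi * (\<integral>s. F s * (\<integral>u. F u * heat e (u - s) \<partial>lborel) \<partial>lborel)"
  using gauss_pairing[OF F e] by (simp only: integral_complex_of_real of_real_eq_iff)

lemma fourier_real_gauss_integrable:
  assumes F: "integrable lborel F" and e: "e > 0"
  shows "integrable lborel (\<lambda>\<eta>. (norm (fourier_real F \<eta>))\<^sup>2 * exp (- e * \<eta>\<^sup>2 / 2))"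
proof -
  have [measurable]: "F \<in> borel_measurable borel" using borel_measurable_integrable[OF F] by simp
  define K where "K = (\<integral>s. \<bar>F s\<bar> \<partial>lborel)"
  have K: "norm (fourier_real F \<eta>) \<le> K" "K \<ge> 0" for \<eta> unfolding K_def by (rule fourier_real_norm_le[OF F]) simp
  show ?thesis
  proof (rule Bochner_Integration.integrable_bound)
    show "integrable lborel (\<lambda>\<eta>. K\<^sup>2 * exp (- e * \<eta>\<^sup>2 / 2))" using integrable_gauss[OF e] by simp
    have "(norm (fourier_real F \<eta>))\<^sup>2 \<le> K\<^sup>2" for \<eta> using K by (intro power_mono) auto
    then show "AE \<eta> in lborel. norm ((norm (fourier_real F \<eta>))\<^sup>2 * exp (- e * \<eta>\<^sup>2 / 2)) \<le> norm (K\<^sup>2 * exp (- e * \<eta>\<^sup>2 / 2))"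
      by (intro AE_I2) (auto simp: abs_mult intro!: mult_right_mono)
  qed measurable
qed

text \<open>Schur's test: \<open>2 \<bar>F s\<bar> \<bar>F u\<bar> \<le> (F s)\<^sup>2 + (F u)\<^sup>2\<close>, and the kernel is symmetric with total mass
  \<open>1\<close> in each variable.\<close>

lemma heat_quadratic_form_le:
  assumes F: "integrable lborel F" and F2: "integrable lborel (\<lambda>s. (F s)\<^sup>2)" and e: "e > 0"
  shows "(\<integral>s. F s * (\<integral>u. F u * heat e (u - s) \<partial>lborel) \<partial>lborel) \<le> (\<integral>s. (F s)\<^sup>2 \<partial>lborel)"
proof -
  have [measurable]: "F \<in> borel_measurable borel" using borel_measurable_integrable[OF F] by simp
  define I where "I = (\<integral>\<^sup>+s. ennreal ((F s)\<^sup>2) \<partial>lborel)"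
  have I: "I = ennreal (\<integral>s. (F s)\<^sup>2 \<partial>lborel)" unfolding I_def using F2 by (intro nn_integral_eq_integral) auto
  have sym: "heat e (u - s) = heat e (s - u)" for u s by (simp add: heat_def power2_commute)
  define D where "D = (\<integral>\<^sup>+s. (\<integral>\<^sup>+u. ennreal ((F s)\<^sup>2 * heat e (u - s)) \<partial>lborel) \<partial>lborel)"
  have D1: "D = I"
    unfolding D_def I_def
  proof (intro nn_integral_cong)
    fix s
    have "(\<integral>\<^sup>+u. ennreal ((F s)\<^sup>2 * heat e (u - s)) \<partial>lborel) = (\<integral>\<^sup>+u. ennreal ((F s)\<^sup>2) * ennreal (heat e (u - s)) \<partial>lborel)"
      using e by (simp add: ennreal_mult)
    then show "(\<integral>\<^sup>+u. ennreal ((F s)\<^sup>2 * heat e (u - s)) \<partial>lborel) = ennreal ((F s)\<^sup>2)"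
      using e by (simp add: nn_integral_cmult)
  qed
  have D2: "(\<integral>\<^sup>+s. (\<integral>\<^sup>+u. ennreal ((F u)\<^sup>2 * heat e (u - s)) \<partial>lborel) \<partial>lborel) = I"
  proof -
    have "(\<integral>\<^sup>+s. (\<integral>\<^sup>+u. ennreal ((F u)\<^sup>2 * heat e (u - s)) \<partial>lborel) \<partial>lborel)
      = (\<integral>\<^sup>+u. (\<integral>\<^sup>+s. ennreal ((F u)\<^sup>2 * heat e (u - s)) \<partial>lborel) \<partial>lborel)"
      by (rule lborel_pair.Fubini') measurable
    also have "\<dots> = D" unfolding D_def by (intro nn_integral_cong) (simp only: sym)
    finally show ?thesis using D1 by simp
  qed
  have sum: "(\<integral>\<^sup>+s. (\<integral>\<^sup>+u. ennreal (2 * (\<bar>F s\<bar> * (\<bar>F u\<bar> * heat e (u - s)))) \<partial>lborel) \<partial>lborel) \<le> I + I"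
  proof -
    have "(\<integral>\<^sup>+s. (\<integral>\<^sup>+u. ennreal (2 * (\<bar>F s\<bar> * (\<bar>F u\<bar> * heat e (u - s)))) \<partial>lborel) \<partial>lborel)
      \<le> (\<integral>\<^sup>+s. (\<integral>\<^sup>+u. ennreal ((F s)\<^sup>2 * heat e (u - s)) + ennreal ((F u)\<^sup>2 * heat e (u - s)) \<partial>lborel) \<partial>lborel)"
    proof (intro nn_integral_mono)
      fix s u
      have "2 * (\<bar>F s\<bar> * \<bar>F u\<bar>) \<le> (F s)\<^sup>2 + (F u)\<^sup>2"
        using zero_le_power2[of "\<bar>F s\<bar> - \<bar>F u\<bar>"] unfolding power2_diff by simp
      then have "2 * (\<bar>F s\<bar> * \<bar>F u\<bar>) * heat e (u - s) \<le> ((F s)\<^sup>2 + (F u)\<^sup>2) * heat e (u - s)"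
        using e by (intro mult_right_mono) auto
      then show "ennreal (2 * (\<bar>F s\<bar> * (\<bar>F u\<bar> * heat e (u - s)))) \<le> ennreal ((F s)\<^sup>2 * heat e (u - s)) + ennreal ((F u)\<^sup>2 * heat e (u - s))"
        using e by (simp add: ennreal_plus[symmetric] distrib_right mult.assoc ennreal_leI del: ennreal_plus)
    qed
    also have "\<dots> = D + (\<integral>\<^sup>+s. (\<integral>\<^sup>+u. ennreal ((F u)\<^sup>2 * heat e (u - s)) \<partial>lborel) \<partial>lborel)"
      unfolding D_def by (subst nn_integral_add[symmetric]) (auto intro!: nn_integral_cong simp: nn_integral_add)
    finally show ?thesis using D1 D2 by simp
  qed
  have "(\<integral>s. F s * (\<integral>u. F u * heat e (u - s) \<partial>lborel) \<partial>lborel) * 2 \<le> 2 * (\<integral>s. (F s)\<^sup>2 \<partial>lborel)"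
  proof (cases "integrable lborel (\<lambda>s. F s * (\<integral>u. F u * heat e (u - s) \<partial>lborel))")
    case False
    then have "(\<integral>s. F s * (\<integral>u. F u * heat e (u - s) \<partial>lborel) \<partial>lborel) = 0" by (rule not_integrable_integral_eq)
    then show ?thesis by simp
  next
    case True
    have "ennreal (2 * \<bar>\<integral>s. F s * (\<integral>u. F u * heat e (u - s) \<partial>lborel) \<partial>lborel\<bar>)
       = 2 * ennreal (norm (\<integral>s. F s * (\<integral>u. F u * heat e (u - s) \<partial>lborel) \<partial>lborel))"
      by (simp add: ennreal_mult)
    also have "\<dots> \<le> 2 * (\<integral>\<^sup>+s. ennreal (norm (F s * (\<integral>u. F u * heat e (u - s) \<partial>lborel))) \<partial>lborel)"
      by (intro mult_left_mono integral_norm_bound_ennreal True) auto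
    also have "\<dots> \<le> 2 * (\<integral>\<^sup>+s. (\<integral>\<^sup>+u. ennreal (\<bar>F s\<bar> * (\<bar>F u\<bar> * heat e (u - s))) \<partial>lborel) \<partial>lborel)"
    proof (intro mult_left_mono nn_integral_mono)
      fix s
      have i: "integrable lborel (\<lambda>u. F u * heat e (u - s))"
      proof (rule Bochner_Integration.integrable_bound[of _ "\<lambda>u. e powr (-1/2) * F u"])
        show "AE u in lborel. norm (F u * heat e (u - s)) \<le> norm (e powr (-1/2) * F u)"
          using e heat_le[OF e] by (intro AE_I2) (auto simp: abs_mult mult.commute[of "e powr _"] intro!: mult_left_mono)
      qed (use F in auto)
      have "ennreal (norm (F s * (\<integral>u. F u * heat e (u - s) \<partial>lborel))) = ennreal \<bar>F s\<bar> * ennreal (norm (\<integral>u. F u * heat e (u - s) \<partial>lborel))"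
        by (simp add: abs_mult ennreal_mult)
      also have "\<dots> \<le> ennreal \<bar>F s\<bar> * (\<integral>\<^sup>+u. ennreal (norm (F u * heat e (u - s))) \<partial>lborel)"
        by (intro mult_left_mono integral_norm_bound_ennreal i) auto
      also have "\<dots> = (\<integral>\<^sup>+u. ennreal (\<bar>F s\<bar> * (\<bar>F u\<bar> * heat e (u - s))) \<partial>lborel)"
        using e by (subst nn_integral_cmult[symmetric]) (auto simp: ennreal_mult abs_mult)
      finally show "ennreal (norm (F s * (\<integral>u. F u * heat e (u - s) \<partial>lborel))) \<le> \<dots>" .
    qed auto
    also have "\<dots> = (\<integral>\<^sup>+s. (\<integral>\<^sup>+u. ennreal (2 * (\<bar>F s\<bar> * (\<bar>F u\<bar> * heat e (u - s)))) \<partial>lborel) \<partial>lborel)"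
      using e by (simp add: ennreal_mult nn_integral_cmult)
    also have "\<dots> \<le> ennreal (2 * (\<integral>s. (F s)\<^sup>2 \<partial>lborel))" using sum unfolding I by (simp add: ennreal_plus[symmetric] del: ennreal_plus)
    finally have "2 * \<bar>\<integral>s. F s * (\<integral>u. F u * heat e (u - s) \<partial>lborel) \<partial>lborel\<bar> \<le> 2 * (\<integral>s. (F s)\<^sup>2 \<partial>lborel)"
      by (subst (asm) ennreal_le_iff) auto
    then show ?thesis by linarith
  qed
  then show ?thesis by simp
qed

lemma heat_approx_identity:
  assumes H: "integrable lborel H" and Hc: "continuous_on UNIV H" and Hb: "\<And>s. \<bar>H s\<bar> \<le> b"
    and \<sigma>: "\<And>n. \<sigma> n > 0" "\<sigma> \<longlonglongrightarrow> 0"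
  shows "(\<lambda>n. \<integral>s. H s * (\<integral>u. H u * heat (\<sigma> n) (u - s) \<partial>lborel) \<partial>lborel) \<longlonglongrightarrow> (\<integral>s. (H s)\<^sup>2 \<partial>lborel)"
proof -
  have [measurable]: "H \<in> borel_measurable borel" using borel_measurable_integrable[OF H] by simp
  have b: "b \<ge> 0" using Hb[of 0] by linarith
  have Q: "(\<integral>u. H u * heat (\<sigma> n) (u - s) \<partial>lborel) = (\<integral>t. H (s + sqrt (\<sigma> n) * t) * heat 1 t \<partial>lborel)" for n s
  proof -
    have "(\<integral>u. H u * heat (\<sigma> n) (u - s) \<partial>lborel) = sqrt (\<sigma> n) * (\<integral>t. H (s + sqrt (\<sigma> n) * t) * heat (\<sigma> n) (sqrt (\<sigma> n) * t) \<partial>lborel)"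
      using \<sigma>(1)[of n] by (subst lborel_integral_real_affine[of "sqrt (\<sigma> n)" _ s]) auto
    also have "\<dots> = (\<integral>t. sqrt (\<sigma> n) * (H (s + sqrt (\<sigma> n) * t) * heat (\<sigma> n) (sqrt (\<sigma> n) * t)) \<partial>lborel)"
      by (rule integral_mult_right_zero[symmetric])
    also have "\<dots> = (\<integral>t. H (s + sqrt (\<sigma> n) * t) * heat 1 t \<partial>lborel)"
      using \<sigma>(1)[of n] by (intro Bochner_Integration.integral_cong) (auto simp: heat_def power_mult_distrib real_sqrt_mult)
    finally show ?thesis .
  qed
  have i1: "integrable lborel (heat 1)" "(\<integral>t. heat 1 t \<partial>lborel) = 1" using integrable_heat[of 1 0] integral_heat[of 1 0] by simp_all
  have Ql: "(\<lambda>n. \<integral>u. H u * heat (\<sigma> n) (u - s) \<partial>lborel) \<longlonglongrightarrow> H s" for s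
  proof -
    have "(\<lambda>n. \<integral>t. H (s + sqrt (\<sigma> n) * t) * heat 1 t \<partial>lborel) \<longlonglongrightarrow> (\<integral>t. H s * heat 1 t \<partial>lborel)"
    proof (rule integral_dominated_convergence[where w="\<lambda>t. b * heat 1 t"])
      show "integrable lborel (\<lambda>t. b * heat 1 t)" using i1 by simp
      show "AE t in lborel. norm (H (s + sqrt (\<sigma> n) * t) * heat 1 t) \<le> b * heat 1 t" for n
        using Hb by (intro AE_I2) (auto simp: abs_mult intro!: mult_right_mono)
      show "AE t in lborel. (\<lambda>n. H (s + sqrt (\<sigma> n) * t) * heat 1 t) \<longlonglongrightarrow> H s * heat 1 t"
      proof (intro AE_I2 tendsto_mult_right)
        fix t
        have "(\<lambda>n. s + sqrt (\<sigma> n) * t) \<longlonglongrightarrow> s + sqrt 0 * t"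
          by (intro tendsto_intros \<sigma>(2))
        then have "(\<lambda>n. s + sqrt (\<sigma> n) * t) \<longlonglongrightarrow> s" by simp
        moreover have "isCont H s" using Hc by (simp add: continuous_on_eq_continuous_at)
        ultimately show "(\<lambda>n. H (s + sqrt (\<sigma> n) * t)) \<longlonglongrightarrow> H s" by (rule isCont_tendsto_compose[rotated])
      qed
    qed measurable
    then show ?thesis using i1 by (simp add: Q)
  qed
  have Qb: "\<bar>\<integral>u. H u * heat (\<sigma> n) (u - s) \<partial>lborel\<bar> \<le> b" for n s
    using integral_bounded_factor(2)[OF Hb, where k="\<lambda>u. heat (\<sigma> n) (u - s)" and K=1] \<sigma>(1)[of n] by simp
  have "(\<lambda>n. \<integral>s. H s * (\<integral>u. H u * heat (\<sigma> n) (u - s) \<partial>lborel) \<partial>lborel) \<longlonglongrightarrow> (\<integral>s. H s * H s \<partial>lborel)"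
  proof (rule integral_dominated_convergence[where w="\<lambda>s. \<bar>H s\<bar> * b"])
    show "integrable lborel (\<lambda>s. \<bar>H s\<bar> * b)" using H by simp
    show "AE s in lborel. norm (H s * (\<integral>u. H u * heat (\<sigma> n) (u - s) \<partial>lborel)) \<le> \<bar>H s\<bar> * b" for n
      using Qb by (intro AE_I2) (auto simp: abs_mult intro!: mult_left_mono)
    show "AE s in lborel. (\<lambda>n. H s * (\<integral>u. H u * heat (\<sigma> n) (u - s) \<partial>lborel)) \<longlonglongrightarrow> H s * H s"
      by (intro AE_I2 tendsto_mult_left Ql)
  qed measurable
  then show ?thesis by (simp add: power2_eq_square)
qed

text \<open>A pointwise inequality between squared Fourier transforms passes to the \<open>L\<^sup>2\<close> norms. With the
  cut-off the two sides are Gaussian quadratic forms: the ones of \<open>F\<close> and \<open>G\<close> are at most the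
  full norms, and the one of \<open>H\<close> tends to the full norm because \<open>H\<close> is bounded and
  continuous.\<close>

lemma fourier_multiplier_L2:
  assumes H: "integrable lborel H" and Hc: "continuous_on UNIV H" and Hb: "\<And>s. \<bar>H s\<bar> \<le> b"
    and F: "integrable lborel F" "integrable lborel (\<lambda>s. (F s)\<^sup>2)"
    and G: "integrable lborel G" "integrable lborel (\<lambda>s. (G s)\<^sup>2)"
    and B: "B \<ge> 0" "\<And>\<eta>. (norm (fourier_real H \<eta>))\<^sup>2 \<le> B * ((norm (fourier_real F \<eta>))\<^sup>2 + (norm (fourier_real G \<eta>))\<^sup>2)"
  shows "(\<integral>s. (H s)\<^sup>2 \<partial>lborel) \<le> B * ((\<integral>s. (F s)\<^sup>2 \<partial>lborel) + (\<integral>s. (G s)\<^sup>2 \<partial>lborel))"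
proof (rule LIMSEQ_le_const2)
  define \<sigma> where "\<sigma> = (\<lambda>n. 1 / (real n + 1))"
  have \<sigma>: "\<sigma> n > 0" "\<sigma> \<longlonglongrightarrow> 0" for n
    unfolding \<sigma>_def by (simp, real_asymp)
  show "(\<lambda>n. \<integral>s. H s * (\<integral>u. H u * heat (\<sigma> n) (u - s) \<partial>lborel) \<partial>lborel) \<longlonglongrightarrow> (\<integral>s. (H s)\<^sup>2 \<partial>lborel)"
    by (rule heat_approx_identity[OF H Hc Hb \<sigma>])
  have "(\<integral>s. H s * (\<integral>u. H u * heat e (u - s) \<partial>lborel) \<partial>lborel) \<le> B * ((\<integral>s. (F s)\<^sup>2 \<partial>lborel) + (\<integral>s. (G s)\<^sup>2 \<partial>lborel))" if e: "e > 0" for e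
  proof -
    have "2 * pi * (\<integral>s. H s * (\<integral>u. H u * heat e (u - s) \<partial>lborel) \<partial>lborel) = (\<integral>\<eta>. (norm (fourier_real H \<eta>))\<^sup>2 * exp (- e * \<eta>\<^sup>2 / 2) \<partial>lborel)"
      by (rule gauss_pairing_real[OF H e, symmetric])
    also have "\<dots> \<le> (\<integral>\<eta>. B * ((norm (fourier_real F \<eta>))\<^sup>2 * exp (- e * \<eta>\<^sup>2 / 2) + (norm (fourier_real G \<eta>))\<^sup>2 * exp (- e * \<eta>\<^sup>2 / 2)) \<partial>lborel)"
    proof (rule integral_mono)
      show "integrable lborel (\<lambda>\<eta>. (norm (fourier_real H \<eta>))\<^sup>2 * exp (- e * \<eta>\<^sup>2 / 2))" by (rule fourier_real_gauss_integrable[OF H e])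
      show "integrable lborel (\<lambda>\<eta>. B * ((norm (fourier_real F \<eta>))\<^sup>2 * exp (- e * \<eta>\<^sup>2 / 2) + (norm (fourier_real G \<eta>))\<^sup>2 * exp (- e * \<eta>\<^sup>2 / 2)))"
        by (intro integrable_mult_right Bochner_Integration.integrable_add fourier_real_gauss_integrable F G e)
      fix \<eta>
      have "(norm (fourier_real H \<eta>))\<^sup>2 * exp (- e * \<eta>\<^sup>2 / 2) \<le> B * ((norm (fourier_real F \<eta>))\<^sup>2 + (norm (fourier_real G \<eta>))\<^sup>2) * exp (- e * \<eta>\<^sup>2 / 2)"
        by (intro mult_right_mono B) auto
      then show "(norm (fourier_real H \<eta>))\<^sup>2 * exp (- e * \<eta>\<^sup>2 / 2) \<le> B * ((norm (fourier_real F \<eta>))\<^sup>2 * exp (- e * \<eta>\<^sup>2 / 2) + (norm (fourier_real G \<eta>))\<^sup>2 * exp (- e * \<eta>\<^sup>2 / 2))"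
        by (simp only: distrib_right mult.assoc)
    qed
    also have "\<dots> = B * ((\<integral>\<eta>. (norm (fourier_real F \<eta>))\<^sup>2 * exp (- e * \<eta>\<^sup>2 / 2) \<partial>lborel) + (\<integral>\<eta>. (norm (fourier_real G \<eta>))\<^sup>2 * exp (- e * \<eta>\<^sup>2 / 2) \<partial>lborel))"
      by (simp only: integral_mult_right_zero Bochner_Integration.integral_add[OF fourier_real_gauss_integrable[OF F(1) e] fourier_real_gauss_integrable[OF G(1) e]])
    also have "\<dots> \<le> B * (2 * pi * (\<integral>s. (F s)\<^sup>2 \<partial>lborel) + 2 * pi * (\<integral>s. (G s)\<^sup>2 \<partial>lborel))"
      unfolding gauss_pairing_real[OF F(1) e] gauss_pairing_real[OF G(1) e]
      by (intro mult_left_mono add_mono heat_quadratic_form_le F G e B(1)) auto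
    also have "\<dots> = 2 * pi * (B * ((\<integral>s. (F s)\<^sup>2 \<partial>lborel) + (\<integral>s. (G s)\<^sup>2 \<partial>lborel)))" by (simp add: algebra_simps)
    finally show ?thesis by (rule mult_left_le_imp_le) simp
  qed
  then show "\<exists>N. \<forall>n\<ge>N. (\<integral>s. H s * (\<integral>u. H u * heat (\<sigma> n) (u - s) \<partial>lborel) \<partial>lborel) \<le> B * ((\<integral>s. (F s)\<^sup>2 \<partial>lborel) + (\<integral>s. (G s)\<^sup>2 \<partial>lborel))"
    using \<sigma>(1) by blast
qed

lemma fourier_real_convolution:
  assumes k: "integrable lborel k" and F: "integrable lborel F"
  shows "integrable lborel (\<lambda>u. \<integral>s. k (u - s) * F s \<partial>lborel)"
    and "fourier_real (\<lambda>u. \<integral>s. k (u - s) * F s \<partial>lborel) \<eta> = fourier_real k \<eta> * fourier_real F \<eta>"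
proof -
  have [measurable]: "k \<in> borel_measurable borel" "F \<in> borel_measurable borel"
    using borel_measurable_integrable[OF k] borel_measurable_integrable[OF F] by simp_all
  have ri: "integrable (lborel \<Otimes>\<^sub>M lborel) (\<lambda>(s, u). k (u - s) * F s)"
  proof (rule integrable_pair_bound)
    show "integrable lborel (\<lambda>s. (\<integral>u. \<bar>k u\<bar> \<partial>lborel) * \<bar>F s\<bar>)" using F by simp
    show "0 \<le> (\<integral>u. \<bar>k u\<bar> \<partial>lborel) * \<bar>F s\<bar>" for s by simp
    show "(\<integral>\<^sup>+u. ennreal \<bar>k (u - s) * F s\<bar> \<partial>lborel) \<le> ennreal ((\<integral>u. \<bar>k u\<bar> \<partial>lborel) * \<bar>F s\<bar>)" for s
    proof -
      have "(\<integral>\<^sup>+u. ennreal \<bar>k (u - s) * F s\<bar> \<partial>lborel) = (\<integral>\<^sup>+u. ennreal \<bar>k (u - s)\<bar> \<partial>lborel) * ennreal \<bar>F s\<bar>"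
        by (simp add: abs_mult ennreal_mult nn_integral_multc)
      also have "(\<integral>\<^sup>+u. ennreal \<bar>k (u - s)\<bar> \<partial>lborel) = (\<integral>\<^sup>+u. ennreal \<bar>k u\<bar> \<partial>lborel)"
        using nn_integral_shift[of "\<lambda>u. ennreal \<bar>k u\<bar>" "-s"] by simp
      also have "\<dots> = ennreal (\<integral>u. \<bar>k u\<bar> \<partial>lborel)" using k by (intro nn_integral_eq_integral) auto
      finally show ?thesis by (simp add: ennreal_mult)
    qed
  qed measurable
  show "integrable lborel (\<lambda>u. \<integral>s. k (u - s) * F s \<partial>lborel)"
    by (rule lborel_pair.integrable_snd[OF ri])
  define P where "P = (\<lambda>s u. complex_of_real (k (u - s) * F s) * iexp (- (\<eta> * u)))"
  have Pi: "integrable (lborel \<Otimes>\<^sub>M lborel) (\<lambda>(s, u). P s u)"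
    by (rule Bochner_Integration.integrable_bound[OF ri]) (unfold P_def, measurable, auto simp: norm_mult abs_mult)
  have "fourier_real (\<lambda>u. \<integral>s. k (u - s) * F s \<partial>lborel) \<eta> = (LINT u|lborel. (LINT s|lborel. P s u))"
    unfolding fourier_real_def P_def by (simp only: integral_mult_left_zero integral_complex_of_real)
  also have "\<dots> = (LINT s|lborel. (LINT u|lborel. P s u))" by (rule lborel_pair.Fubini_integral[OF Pi])
  also have "\<dots> = (LINT s|lborel. fourier_real k \<eta> * (complex_of_real (F s) * iexp (- (\<eta> * s))))"
  proof (intro Bochner_Integration.integral_cong refl)
    fix s
    have "(LINT u|lborel. P s u) = (LINT u|lborel. P s (s + 1 * u))"
      by (subst lborel_integral_real_affine[of 1 _ s]) auto
    also have "\<dots> = (LINT u|lborel. (complex_of_real (k u) * iexp (- (\<eta> * u))) * (complex_of_real (F s) * iexp (- (\<eta> * s))))"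
      by (intro Bochner_Integration.integral_cong refl) (simp add: P_def algebra_simps exp_add exp_diff exp_minus field_simps)
    also have "\<dots> = fourier_real k \<eta> * (complex_of_real (F s) * iexp (- (\<eta> * s)))"
      by (simp only: integral_mult_left_zero fourier_real_def)
    finally show "(LINT u|lborel. P s u) = fourier_real k \<eta> * (complex_of_real (F s) * iexp (- (\<eta> * s)))" .
  qed
  also have "\<dots> = fourier_real k \<eta> * fourier_real F \<eta>" by (simp only: integral_mult_right_zero fourier_real_def)
  finally show "fourier_real (\<lambda>u. \<integral>s. k (u - s) * F s \<partial>lborel) \<eta> = fourier_real k \<eta> * fourier_real F \<eta>" .
qed

section \<open>Taylor remainders of the inverse square root\<close>

text \<open>The Taylor coefficients of \<open>(1 - z) powr (-1/2)\<close>, that is \<open>binom(2k, k) / 4\<^sup>k\<close>, of size \<open>k powr (-1/2)\<close>.\<close>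

fun inv_sqrt_coeff :: "nat \<Rightarrow> real" where
  "inv_sqrt_coeff 0 = 1"
| "inv_sqrt_coeff (Suc k) = inv_sqrt_coeff k * (2 * real k + 1) / (2 * real k + 2)"

declare inv_sqrt_coeff.simps(2) [simp del]

lemma inv_sqrt_coeff_pos: "inv_sqrt_coeff k > 0" by (induction k) (auto simp: inv_sqrt_coeff.simps(2))

lemma inv_sqrt_coeff_rec: "(real k + 1) * inv_sqrt_coeff (Suc k) = (real k + 1/2) * inv_sqrt_coeff k"
  by (simp add: inv_sqrt_coeff.simps(2) field_simps)

lemma inv_sqrt_coeff_Suc_le: "inv_sqrt_coeff (Suc k) \<le> inv_sqrt_coeff k"
  using inv_sqrt_coeff_pos[of k] by (simp add: inv_sqrt_coeff.simps(2) field_simps)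

lemma inv_sqrt_coeff_antimono: "m \<le> n \<Longrightarrow> inv_sqrt_coeff n \<le> inv_sqrt_coeff m"
  by (rule lift_Suc_antimono_le[of inv_sqrt_coeff]) (use inv_sqrt_coeff_Suc_le in auto)

lemma inv_sqrt_coeff_sq: "(inv_sqrt_coeff k)\<^sup>2 * (2 * real k + 1) \<le> 1"
proof (induction k)
  case (Suc k)
  have "(inv_sqrt_coeff (Suc k))\<^sup>2 * (2 * real (Suc k) + 1) = ((inv_sqrt_coeff k)\<^sup>2 * (2 * real k + 1)) * ((2 * real k + 1) * (2 * real k + 3) / (2 * real k + 2)\<^sup>2)"
    by (simp add: inv_sqrt_coeff.simps(2) power_divide power_mult_distrib) (simp add: power2_eq_square algebra_simps)
  also have "\<dots> \<le> 1 * 1"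
  proof (intro mult_mono Suc)
    have "(2 * real k + 1) * (2 * real k + 3) \<le> (2 * real k + 2)\<^sup>2" by (simp add: power2_eq_square algebra_simps)
    then show "(2 * real k + 1) * (2 * real k + 3) / (2 * real k + 2)\<^sup>2 \<le> 1" by (simp add: pos_divide_le_eq)
  qed auto
  finally show ?case by simp
qed simp

lemma inv_sqrt_coeff_le: "inv_sqrt_coeff k \<le> 1 / sqrt (2 * real k + 1)"
proof -
  have "(inv_sqrt_coeff k * sqrt (2 * real k + 1))\<^sup>2 \<le> 1" using inv_sqrt_coeff_sq[of k] by (simp add: power_mult_distrib)
  then have "inv_sqrt_coeff k * sqrt (2 * real k + 1) \<le> 1" using power2_le_imp_le[of "inv_sqrt_coeff k * sqrt (2 * real k + 1)" 1] by simp
  then show ?thesis by (simp add: field_simps)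
qed

lemma inv_sqrt_coeff_le_1: "inv_sqrt_coeff k \<le> 1" using inv_sqrt_coeff_antimono[of 0 k] by simp

lemma inv_sqrt_coeff_tendsto_0: "inv_sqrt_coeff \<longlonglongrightarrow> 0"
proof (rule Lim_null_comparison)
  show "eventually (\<lambda>k. norm (inv_sqrt_coeff k) \<le> 1 / sqrt (2 * real k + 1)) sequentially"
    using inv_sqrt_coeff_le inv_sqrt_coeff_pos by (auto simp: less_imp_le)
  show "(\<lambda>k. 1 / sqrt (2 * real k + 1)) \<longlonglongrightarrow> 0" by real_asymp
qed

lemma inv_sqrt_coeff_gbinomial: "inv_sqrt_coeff k = (-1) ^ k * ((-1/2::real) gchoose k)"
proof (induction k)
  case (Suc k)
  define g where "g = ((-1/2::real) gchoose k)"
  define g' where "g' = ((-1/2::real) gchoose Suc k)"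
  have "-1/2 * g = real k * g + real (Suc k) * g'"
    unfolding g_def g'_def by (rule gbinomial_mult_1)
  then have "g' = - (g * (2 * real k + 1) / (2 * real k + 2))" by (simp add: field_simps)
  then show ?case using Suc unfolding g_def[symmetric] g'_def[symmetric] by (simp add: inv_sqrt_coeff.simps(2))
qed simp

lemma inv_sqrt_coeff_sums:
  assumes "\<bar>z\<bar> < 1"
  shows "(\<lambda>k. inv_sqrt_coeff k * z ^ k) sums (1 - z) powr (-1/2)"
proof -
  have "(\<lambda>n. ((-1/2) gchoose n) * (-z) ^ n) sums (1 + (-z)) powr (-1/2)"
    by (rule gen_binomial_real) (use assms in simp)
  moreover have "((-1/2) gchoose n) * (-z) ^ n = inv_sqrt_coeff n * z ^ n" for n
  proof -
    have "(-z) ^ n = (-1) ^ n * z ^ n" by (rule power_minus)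
    then show ?thesis by (simp add: inv_sqrt_coeff_gbinomial)
  qed
  ultimately show ?thesis by simp
qed

text \<open>The remainder of the Taylor polynomial of degree below \<open>N\<close>. The absolute value makes the
  function meaningful on both sides of the singularity \<open>z = 1\<close>, as is needed for
  \<open>\<bar>y - x\<bar> powr (-1/2) = \<bar>y\<bar> powr (-1/2) \<bar>1 - x / y\<bar> powr (-1/2)\<close>.\<close>

definition inv_sqrt_rem :: "nat \<Rightarrow> real \<Rightarrow> real" where
  "inv_sqrt_rem N z = \<bar>1 - z\<bar> powr (-1/2) - (\<Sum>k<N. inv_sqrt_coeff k * z ^ k)"

lemma inv_sqrt_rem_measurable [measurable]: "inv_sqrt_rem N \<in> borel_measurable borel" unfolding inv_sqrt_rem_def by measurable

lemma inv_sqrt_rem_tail: "\<bar>z\<bar> < 1 \<Longrightarrow> (\<lambda>i. inv_sqrt_coeff (N + i) * z ^ (N + i)) sums inv_sqrt_rem N z"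
  using sums_split_initial_segment[OF inv_sqrt_coeff_sums, of z N] unfolding inv_sqrt_rem_def by (simp add: add.commute)

lemma inv_sqrt_rem_small: "\<bar>z\<bar> \<le> 1/2 \<Longrightarrow> \<bar>inv_sqrt_rem N z\<bar> \<le> 2 * \<bar>z\<bar> ^ N"
proof -
  assume z: "\<bar>z\<bar> \<le> 1/2"
  have s: "(\<lambda>i. inv_sqrt_coeff (N + i) * z ^ (N + i)) sums inv_sqrt_rem N z" by (rule inv_sqrt_rem_tail) (use z in auto)
  have g: "(\<lambda>i. \<bar>z\<bar> ^ N * (1/2) ^ i) sums (\<bar>z\<bar> ^ N * 2)"
    using sums_mult[OF geometric_sums[of "1/2::real"], of "\<bar>z\<bar> ^ N"] by simp
  have le: "norm (inv_sqrt_coeff (N + i) * z ^ (N + i)) \<le> \<bar>z\<bar> ^ N * (1/2) ^ i" for i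
  proof -
    have "norm (inv_sqrt_coeff (N + i) * z ^ (N + i)) = inv_sqrt_coeff (N + i) * (\<bar>z\<bar> ^ N * \<bar>z\<bar> ^ i)"
      using inv_sqrt_coeff_pos[of "N + i"] by (simp add: abs_mult power_add power_abs)
    also have "\<dots> \<le> 1 * (\<bar>z\<bar> ^ N * (1/2) ^ i)"
      using z by (intro mult_mono inv_sqrt_coeff_le_1 power_mono) auto
    finally show ?thesis by simp
  qed
  have "norm (\<Sum>i. inv_sqrt_coeff (N + i) * z ^ (N + i)) \<le> (\<Sum>i. \<bar>z\<bar> ^ N * (1/2) ^ i)"
    by (rule norm_suminf_le[OF le sums_summable[OF g]])
  then show ?thesis using sums_unique[OF s] sums_unique[OF g] by simp
qed

text \<open>The function \<open>(1 + z) powr (-1/2)\<close> solves \<open>u / 2 + (1 + z) u' = 0\<close>; its Taylor polynomial solves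
  this equation up to a single term of top degree.\<close>

lemma inv_sqrt_coeff_poly_ode:
  "N \<ge> 1 \<Longrightarrow> (\<Sum>k<N. (-1) ^ k * inv_sqrt_coeff k * z ^ k) / 2 + (1 + z) * (\<Sum>k<N. (-1) ^ k * inv_sqrt_coeff k * (real k * z ^ (k - 1)))
    = (-1) ^ (N - 1) * (real N * inv_sqrt_coeff N * z ^ (N - 1))"
proof (induction N rule: nat_induct_at_least)
  case base
  then show ?case by (simp add: inv_sqrt_coeff.simps(2))
next
  case (Suc N)
  obtain m where m: "N = Suc m" using Suc.hyps by (cases N) auto
  have "(\<Sum>k<Suc N. (-1) ^ k * inv_sqrt_coeff k * z ^ k) / 2 + (1 + z) * (\<Sum>k<Suc N. (-1) ^ k * inv_sqrt_coeff k * (real k * z ^ (k - 1)))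
    = ((\<Sum>k<N. (-1) ^ k * inv_sqrt_coeff k * z ^ k) / 2 + (1 + z) * (\<Sum>k<N. (-1) ^ k * inv_sqrt_coeff k * (real k * z ^ (k - 1))))
      + ((-1) ^ N * inv_sqrt_coeff N * z ^ N / 2 + (1 + z) * ((-1) ^ N * inv_sqrt_coeff N * (real N * z ^ (N - 1))))"
    by (simp add: algebra_simps add_divide_distrib)
  also have "\<dots> = (-1) ^ (N - 1) * (real N * inv_sqrt_coeff N * z ^ (N - 1)) + ((-1) ^ N * inv_sqrt_coeff N * z ^ N / 2 + (1 + z) * ((-1) ^ N * inv_sqrt_coeff N * (real N * z ^ (N - 1))))"
    by (simp only: Suc.IH)
  also have "\<dots> = (-1) ^ N * ((real N + 1/2) * inv_sqrt_coeff N) * z ^ N"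
    unfolding m by (simp only: diff_Suc_1 power_Suc) (simp add: algebra_simps)
  also have "\<dots> = (-1) ^ N * ((real N + 1) * inv_sqrt_coeff (Suc N)) * z ^ N" by (simp only: inv_sqrt_coeff_rec)
  finally show ?case by (simp add: mult_ac add.commute)
qed

text \<open>On the negative half-line there is no singularity and the estimate holds for all \<open>z\<close>, far
  beyond the radius of convergence: \<open>1 - sqrt (1 + t) * p t\<close> vanishes at \<open>0\<close> and, by the
  differential equation of the Taylor polynomial \<open>p\<close>, its derivative is explicit.\<close>

lemma inv_sqrt_rem_neg:
  assumes z: "z \<ge> 0"
  shows "\<bar>inv_sqrt_rem N (- z)\<bar> \<le> inv_sqrt_coeff N * z ^ N"
proof (cases "N = 0")
  case True
  have "(1 + z) powr (-1/2) \<le> 1 powr (-1/2)" using z by (intro powr_mono2') auto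
  then show ?thesis using True z by (simp add: inv_sqrt_rem_def)
next
  case False
  then have N: "N \<ge> 1" by simp
  define p where "p = (\<lambda>t. \<Sum>k<N. (-1) ^ k * inv_sqrt_coeff k * t ^ k :: real)"
  define p' where "p' = (\<lambda>t. \<Sum>k<N. (-1) ^ k * inv_sqrt_coeff k * (real k * t ^ (k - 1)) :: real)"
  have Dp: "(p has_real_derivative p' t) (at t)" for t
    unfolding p_def p'_def by (auto intro!: derivative_eq_intros sum.cong)
  define \<phi> where "\<phi> = (\<lambda>t. 1 - sqrt (1 + t) * p t)"
  define \<phi>' where "\<phi>' = (\<lambda>t. - ((-1) ^ (N - 1) * (real N * inv_sqrt_coeff N * t ^ (N - 1))) / sqrt (1 + t))"
  have D\<phi>: "(\<phi> has_real_derivative \<phi>' t) (at t)" if t: "t \<ge> 0" for t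
  proof -
    obtain q where q: "sqrt (1 + t) = q" by blast
    have sq: "q > 0" "1 + t = q * q" using t unfolding q[symmetric] by auto
    have "(\<phi> has_real_derivative 0 - ((inverse (sqrt (1 + t)) / 2 * 1) * p t + p' t * sqrt (1 + t))) (at t)"
      unfolding \<phi>_def using t
      by (intro DERIV_diff DERIV_const DERIV_mult Dp DERIV_chain2[where f=sqrt] DERIV_real_sqrt)
         (auto intro!: derivative_eq_intros)
    moreover have "0 - ((inverse (sqrt (1 + t)) / 2 * 1) * p t + p' t * sqrt (1 + t)) = - (p t / 2 + (1 + t) * p' t) / sqrt (1 + t)"
      unfolding q unfolding sq(2) using sq(1) by (simp add: field_simps)
    moreover have "p t / 2 + (1 + t) * p' t = (-1) ^ (N - 1) * (real N * inv_sqrt_coeff N * t ^ (N - 1))"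
      unfolding p_def p'_def by (rule inv_sqrt_coeff_poly_ode[OF N])
    ultimately show ?thesis by (simp only: \<phi>'_def)
  qed
  have \<phi>0: "\<phi> 0 = 0"
    using N by (simp add: \<phi>_def p_def lessThan_atLeast0 sum.atLeast_Suc_lessThan zero_power)
  have b: "\<bar>\<phi>' t\<bar> \<le> inv_sqrt_coeff N * (real N * t ^ (N - 1))" if "t \<ge> 0" for t
  proof -
    have "\<bar>\<phi>' t\<bar> = (real N * inv_sqrt_coeff N * t ^ (N - 1)) / sqrt (1 + t)"
      using that inv_sqrt_coeff_pos[of N] by (simp add: \<phi>'_def abs_mult power_abs)
    also have "\<dots> \<le> (real N * inv_sqrt_coeff N * t ^ (N - 1)) / 1"
      using that inv_sqrt_coeff_pos[of N] by (intro divide_left_mono) auto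
    finally show ?thesis by (simp add: mult_ac)
  qed
  have up: "\<sigma> * \<phi> z \<le> inv_sqrt_coeff N * z ^ N" if \<sigma>: "\<sigma> = 1 \<or> \<sigma> = -1" for \<sigma> :: real
  proof -
    have "(\<lambda>t. inv_sqrt_coeff N * t ^ N - \<sigma> * \<phi> t) 0 \<le> (\<lambda>t. inv_sqrt_coeff N * t ^ N - \<sigma> * \<phi> t) z"
    proof (rule DERIV_nonneg_imp_nondecreasing[OF z])
      fix t assume t: "0 \<le> t" "t \<le> z"
      have "((\<lambda>t. inv_sqrt_coeff N * t ^ N - \<sigma> * \<phi> t) has_real_derivative inv_sqrt_coeff N * (real N * t ^ (N - 1)) - \<sigma> * \<phi>' t) (at t)"
        using D\<phi>[OF t(1)] by (auto intro!: derivative_eq_intros)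
      moreover have "0 \<le> inv_sqrt_coeff N * (real N * t ^ (N - 1)) - \<sigma> * \<phi>' t"
        using b[OF t(1)] \<sigma> by auto
      ultimately show "\<exists>y. ((\<lambda>t. inv_sqrt_coeff N * t ^ N - \<sigma> * \<phi> t) has_real_derivative y) (at t) \<and> 0 \<le> y" by blast
    qed
    then show ?thesis using \<phi>0 N by (simp add: zero_power)
  qed
  have \<phi>b: "\<bar>\<phi> z\<bar> \<le> inv_sqrt_coeff N * z ^ N" using up[of 1] up[of "-1"] by linarith
  have Rphi: "inv_sqrt_rem N (- z) = \<phi> z / sqrt (1 + z)"
  proof -
    have "(\<Sum>k<N. inv_sqrt_coeff k * (- z) ^ k) = p z"
      unfolding p_def by (intro sum.cong refl) (subst power_minus, simp)
    moreover have "\<bar>1 - (- z)\<bar> powr (-1/2) = 1 / sqrt (1 + z)"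
      using z by (simp add: powr_minus_divide powr_half_sqrt)
    moreover have "sqrt (1 + z) > 0" using z by simp
    ultimately show ?thesis unfolding inv_sqrt_rem_def \<phi>_def by (simp add: field_simps)
  qed
  have "\<bar>inv_sqrt_rem N (- z)\<bar> = \<bar>\<phi> z\<bar> / sqrt (1 + z)" unfolding Rphi using z by simp
  also have "\<dots> \<le> \<bar>\<phi> z\<bar> / 1" using z by (intro divide_left_mono) auto
  finally show ?thesis using \<phi>b by simp
qed

text \<open>The variant with one power less, which is the better one for \<open>z > 1\<close>.\<close>

lemma inv_sqrt_rem_neg_weak:
  assumes z: "z \<ge> 0" and N: "N \<ge> 1"
  shows "\<bar>inv_sqrt_rem N (- z)\<bar> \<le> 2 * inv_sqrt_coeff (N - 1) * z ^ (N - 1)"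
proof -
  obtain m where m: "N = Suc m" using N by (cases N) auto
  have "inv_sqrt_rem N (- z) = inv_sqrt_rem m (- z) - inv_sqrt_coeff m * (- z) ^ m" unfolding m inv_sqrt_rem_def by simp
  moreover have "\<bar>inv_sqrt_coeff m * (- z) ^ m\<bar> = inv_sqrt_coeff m * z ^ m" using z inv_sqrt_coeff_pos[of m] by (simp add: abs_mult power_abs)
  ultimately show ?thesis using inv_sqrt_rem_neg[OF z, of m] m by simp
qed

section \<open>Cancellation in a partial fraction sum\<close>

lemma inv_sqrt_coeff_over_summable:
  fixes b :: real
  assumes "\<And>k. real k + b \<noteq> 0"
  shows "summable (\<lambda>k. inv_sqrt_coeff k / (real k + b))"
proof (rule summable_comparison_test_ev)
  obtain n0 :: nat where n0: "real n0 > 2 * \<bar>b\<bar> + 1" using reals_Archimedean2 by blast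
  show "eventually (\<lambda>k. norm (inv_sqrt_coeff k / (real k + b)) \<le> 2 * real k powr (-3/2)) sequentially"
    using eventually_ge_at_top[of n0]
  proof eventually_elim
    case (elim k)
    have k: "real k > 2 * \<bar>b\<bar> + 1" using elim n0 by (meson less_le_trans of_nat_le_iff)
    then have kb: "real k + b \<ge> real k / 2" by linarith
    have kp: "real k > 0" using k by linarith
    have "inv_sqrt_coeff k \<le> 1 / sqrt (2 * real k + 1)" by (rule inv_sqrt_coeff_le)
    also have "\<dots> \<le> 1 / sqrt (real k)" using kp by (intro divide_left_mono) auto
    finally have a: "inv_sqrt_coeff k \<le> 1 / sqrt (real k)" .
    have "norm (inv_sqrt_coeff k / (real k + b)) = inv_sqrt_coeff k / (real k + b)" using kb kp inv_sqrt_coeff_pos[of k] by simp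
    also have "\<dots> \<le> (1 / sqrt (real k)) / (real k / 2)"
      using a kb kp inv_sqrt_coeff_pos[of k] by (intro frac_le) auto
    also have "\<dots> = 2 * (real k powr (-1/2) * real k powr (-1))"
      using kp by (simp add: powr_minus_divide powr_half_sqrt)
    also have "\<dots> = 2 * real k powr (-3/2)" unfolding powr_add[symmetric] by simp
    finally show ?case .
  qed
  show "summable (\<lambda>k. 2 * real k powr (-3/2))" by (intro summable_mult) (simp add: summable_real_powr_iff)
qed

text \<open>Telescoping \<open>k * a\<^sub>k / (k + b)\<close> and using the recursion of the coefficients \<open>a\<^sub>k\<close>. The sum is
  the Beta function \<open>Beta b (1/2)\<close>, and this is its functional equation, which stays valid at
  negative \<open>b\<close>, where the integral diverges.\<close>

lemma partial_fraction_sum_shift: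
  fixes b :: real
  assumes b: "\<And>k. real k + b \<noteq> 0"
  shows "b * (\<Sum>k. inv_sqrt_coeff k / (real k + b)) = (b + 1/2) * (\<Sum>k. inv_sqrt_coeff k / (real k + (b + 1)))"
proof -
  have b1: "real k + (b + 1) \<noteq> 0" for k using b[of "Suc k"] by (simp add: add_ac)
  \<comment> \<open>Multiplied by \<open>b\<close>, a summand is \<open>a\<^sub>k - D k\<close>; multiplied by \<open>b + 1/2\<close>, a shifted one is \<open>a\<^sub>k - D (k + 1)\<close>.\<close>
  define D where "D = (\<lambda>k. real k * inv_sqrt_coeff k / (real k + b))"
  have "D \<longlonglongrightarrow> 0"
  proof -
    have "(\<lambda>k. real k / (real k + b)) \<longlonglongrightarrow> 1" by real_asymp
    from tendsto_mult[OF inv_sqrt_coeff_tendsto_0 this] show ?thesis by (simp add: D_def mult_ac)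
  qed
  from telescope_sums[OF this] have "(\<lambda>k. D (Suc k) - D k) sums (0 - D 0)" .
  moreover have "D (Suc k) - D k = b * (inv_sqrt_coeff k / (real k + b)) - (b + 1/2) * (inv_sqrt_coeff k / (real k + (b + 1)))" for k
  proof -
    have "b * (inv_sqrt_coeff k / (real k + b)) = inv_sqrt_coeff k - D k" using b[of k] by (simp add: D_def field_simps)
    moreover have "(b + 1/2) * (inv_sqrt_coeff k / (real k + (b + 1))) = inv_sqrt_coeff k - D (Suc k)"
    proof -
      have "D (Suc k) = ((real k + 1) * inv_sqrt_coeff (Suc k)) / (real k + (b + 1))" by (simp add: D_def add_ac)
      also have "\<dots> = ((real k + 1/2) * inv_sqrt_coeff k) / (real k + (b + 1))" by (simp only: inv_sqrt_coeff_rec)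
      finally show ?thesis using b1[of k] by (simp add: field_simps)
    qed
    ultimately show ?thesis by simp
  qed
  ultimately have "(\<lambda>k. b * (inv_sqrt_coeff k / (real k + b)) - (b + 1/2) * (inv_sqrt_coeff k / (real k + (b + 1)))) sums 0"
    by (simp add: D_def)
  moreover have "(\<lambda>k. b * (inv_sqrt_coeff k / (real k + b)) - (b + 1/2) * (inv_sqrt_coeff k / (real k + (b + 1)))) sums
     (b * (\<Sum>k. inv_sqrt_coeff k / (real k + b)) - (b + 1/2) * (\<Sum>k. inv_sqrt_coeff k / (real k + (b + 1))))"
    by (intro sums_diff sums_mult summable_sums inv_sqrt_coeff_over_summable b b1)
  ultimately show ?thesis using sums_unique2 by fastforce
qed

lemma half_int_neq: "real k + (1/2 - real N) \<noteq> 0"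
proof
  assume "real k + (1/2 - real N) = 0"
  then have "2 * real k + 1 = 2 * real N" by simp
  then have "real (2 * k + 1) = real (2 * N)" by simp
  then have "2 * k + 1 = 2 * N" by (simp only: of_nat_eq_iff)
  then show False by presburger
qed

text \<open>At \<open>b = -1/2\<close> the factor \<open>b + 1/2\<close> of the functional equation vanishes, and the zero
  propagates to all smaller half-integers.\<close>

lemma partial_fraction_sum_zero: "N \<ge> 1 \<Longrightarrow> (\<Sum>k. inv_sqrt_coeff k / (real k + (1/2 - real N))) = 0"
proof (induction N rule: nat_induct_at_least)
  case base
  show ?case using partial_fraction_sum_shift[of "1/2 - real 1", OF half_int_neq] by simp
next
  case (Suc N)
  have "(1/2 - real (Suc N)) * (\<Sum>k. inv_sqrt_coeff k / (real k + (1/2 - real (Suc N))))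
     = (1/2 - real (Suc N) + 1/2) * (\<Sum>k. inv_sqrt_coeff k / (real k + (1/2 - real (Suc N) + 1)))"
    by (rule partial_fraction_sum_shift) (rule half_int_neq)
  also have "1/2 - real (Suc N) + 1 = 1/2 - real N" by simp
  finally have "(1/2 - real (Suc N)) * (\<Sum>k. inv_sqrt_coeff k / (real k + (1/2 - real (Suc N)))) = 0" using Suc.IH by simp
  then show ?case by simp
qed

text \<open>The decay rates of the exponentials into which the kernels below are decomposed.\<close>

definition half_shift :: "nat \<Rightarrow> real" where "half_shift i = real i + 1/2"

lemma half_shift_pos [simp]: "half_shift i > 0" by (simp add: half_shift_def)

text \<open>The vanishing sum, split at \<open>k = N\<close>: the positive and negative parts cancel exactly. Without
  this cancellation the zero frequency of the kernel below would cost a factor \<open>ln N\<close>.\<close>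

lemma inv_sqrt_coeff_balance:
  assumes N: "N \<ge> 1"
  shows "summable (\<lambda>i. inv_sqrt_coeff (N + i) / half_shift i)" "(\<Sum>i. inv_sqrt_coeff (N + i) / half_shift i) = (\<Sum>i<N. inv_sqrt_coeff (N - Suc i) / half_shift i)"
proof -
  let ?f = "\<lambda>k. inv_sqrt_coeff k / (real k + (1/2 - real N))"
  have s: "summable ?f" by (rule inv_sqrt_coeff_over_summable[OF half_int_neq])
  have e: "?f (i + N) = inv_sqrt_coeff (N + i) / half_shift i" for i by (simp add: half_shift_def add_ac)
  have "summable (\<lambda>i. ?f (i + N))" by (rule iffD2[OF summable_iff_shift s])
  then show s2: "summable (\<lambda>i. inv_sqrt_coeff (N + i) / half_shift i)" by (simp only: e)
  have Z: "(\<Sum>i. ?f (i + N)) + (\<Sum>i<N. ?f i) = 0"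
    using suminf_split_initial_segment[OF s, of N] partial_fraction_sum_zero[OF N] by simp
  have "(\<Sum>i<N. ?f i) = (\<Sum>i<N. ?f (N - Suc i))" by (rule sum.nat_diff_reindex[symmetric])
  also have "\<dots> = (\<Sum>i<N. - (inv_sqrt_coeff (N - Suc i) / half_shift i))"
  proof (intro sum.cong refl)
    fix i assume "i \<in> {..<N}"
    then have "real (N - Suc i) + (1/2 - real N) = - half_shift i" by (simp add: half_shift_def of_nat_diff)
    then show "?f (N - Suc i) = - (inv_sqrt_coeff (N - Suc i) / half_shift i)" by simp
  qed
  also have "\<dots> = - (\<Sum>i<N. inv_sqrt_coeff (N - Suc i) / half_shift i)" by (rule sum_negf)
  finally have S: "(\<Sum>i<N. ?f i) = - (\<Sum>i<N. inv_sqrt_coeff (N - Suc i) / half_shift i)" .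
  show "(\<Sum>i. inv_sqrt_coeff (N + i) / half_shift i) = (\<Sum>i<N. inv_sqrt_coeff (N - Suc i) / half_shift i)"
    using Z unfolding S e by simp
qed

text \<open>The summands are of size \<open>i powr (-3/2)\<close>, which is dominated by the telescoping differences of
  \<open>(2 i - 1) powr (-1/2)\<close>.\<close>

lemma inv_sqrt_coeff_tail_bound:
  assumes N: "N \<ge> 1"
  shows "(\<Sum>i. inv_sqrt_coeff (N + (i + N)) / half_shift (i + N)) \<le> 2 / sqrt (2 * real N - 1)"
proof -
  define f where "f = (\<lambda>i. - 2 / sqrt (2 * real (i + N) - 1))"
  have "f \<longlonglongrightarrow> 0" unfolding f_def by real_asymp
  from telescope_sums[OF this] have t: "(\<lambda>i. f (Suc i) - f i) sums (0 - f 0)" .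
  have le: "inv_sqrt_coeff (N + (i + N)) / half_shift (i + N) \<le> f (Suc i) - f i" for i
  proof -
    define x where "x = 2 * real (i + N)"
    have x: "x \<ge> 2" using N by (simp add: x_def)
    define p where "p = sqrt (x + 1)"
    define m where "m = sqrt (x - 1)"
    have pm: "p > 0" "m > 0" "m \<le> p" "p * p = x + 1" "m * m = x - 1" using x by (auto simp: p_def m_def)
    have "inv_sqrt_coeff (N + (i + N)) \<le> inv_sqrt_coeff (i + N)" by (rule inv_sqrt_coeff_antimono) simp
    also have "\<dots> \<le> 1 / p" using inv_sqrt_coeff_le[of "i + N"] by (simp add: p_def x_def)
    finally have "inv_sqrt_coeff (N + (i + N)) / half_shift (i + N) \<le> (1 / p) / ((x + 1) / 2)"
      using inv_sqrt_coeff_pos[of "N + (i + N)"] pm(1) by (intro frac_le) (auto simp: half_shift_def x_def intro: less_imp_le)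
    also have "\<dots> = 2 / (p * (p * p))" unfolding pm(4) using x pm by (simp add: field_simps)
    also have "\<dots> \<le> 2 * (1 / m - 1 / p)"
    proof -
      have "(p - m) * (p + m) = 2" using pm by (simp add: algebra_simps)
      then have "p - m = 2 / (p + m)" using pm(1-3) by (simp add: field_simps)
      moreover have "1 / m - 1 / p = (p - m) / (m * p)" using pm(1,2) by (simp add: field_simps)
      ultimately have 1: "1 / m - 1 / p = 2 / ((p + m) * (m * p))" by simp
      have 2: "2 / ((p + p) * (p * p)) \<le> 2 / ((p + m) * (m * p))"
        using pm(1-3) by (intro divide_left_mono mult_mono mult_pos_pos add_pos_pos) auto
      have 3: "2 / (p * (p * p)) = 2 * (2 / ((p + p) * (p * p)))" using pm(1) by (simp add: field_simps)
      show ?thesis unfolding 1 3 using 2 by (intro mult_left_mono) auto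
    qed
    also have "\<dots> = f (Suc i) - f i" by (simp add: f_def p_def m_def x_def algebra_simps)
    finally show ?thesis .
  qed
  have s: "summable (\<lambda>i. inv_sqrt_coeff (N + (i + N)) / half_shift (i + N))"
    using inv_sqrt_coeff_balance(1)[OF N] summable_iff_shift[of "\<lambda>i. inv_sqrt_coeff (N + i) / half_shift i" N] by simp
  have "(\<Sum>i. inv_sqrt_coeff (N + (i + N)) / half_shift (i + N)) \<le> (\<Sum>i. f (Suc i) - f i)"
    by (rule suminf_le[OF le s sums_summable[OF t]])
  also have "\<dots> = 2 / sqrt (2 * real N - 1)" using sums_unique[OF t] by (simp add: f_def)
  finally show ?thesis .
qed

text \<open>A Riemann sum of the Poisson kernel, bounded uniformly in \<open>\<eta>\<close> by telescoping.\<close>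

lemma poisson_kernel_sum_bound: "(\<Sum>i<N. \<bar>\<eta>\<bar> / ((half_shift i)\<^sup>2 + \<eta>\<^sup>2)) \<le> 2"
proof (cases "\<eta> = 0")
  case False
  define h where "h = \<bar>\<eta>\<bar>"
  have h: "h > 0" using False by (simp add: h_def)
  have le: "h / ((half_shift i)\<^sup>2 + \<eta>\<^sup>2) \<le> 2 * h * (1 / (real i + h) - 1 / (real (Suc i) + h))" for i
  proof -
    have "(real i + h) * (real (Suc i) + h) \<le> (half_shift i + h)\<^sup>2"
      by (simp add: half_shift_def power2_eq_square algebra_simps)
    also have "\<dots> \<le> 2 * ((half_shift i)\<^sup>2 + h\<^sup>2)"
      using zero_le_power2[of "half_shift i - h"] by (simp add: power2_eq_square algebra_simps)
    finally have a: "(real i + h) * (real (Suc i) + h) \<le> 2 * ((half_shift i)\<^sup>2 + \<eta>\<^sup>2)" by (simp add: h_def)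
    have "h / ((half_shift i)\<^sup>2 + \<eta>\<^sup>2) = 2 * h / (2 * ((half_shift i)\<^sup>2 + \<eta>\<^sup>2))"
      by (rule mult_divide_mult_cancel_left[symmetric]) simp
    also have "\<dots> \<le> 2 * h / ((real i + h) * (real (Suc i) + h))"
    proof (intro divide_left_mono mult_pos_pos a)
      show "0 < (half_shift i)\<^sup>2 + \<eta>\<^sup>2" using half_shift_pos[of i] by (intro add_pos_nonneg zero_less_power) auto
    qed (use h in auto)
    also have "\<dots> = 2 * h * (1 / (real i + h) - 1 / (real (Suc i) + h))"
      using h by (simp add: field_simps)
    finally show ?thesis .
  qed
  have "(\<Sum>i<N. h / ((half_shift i)\<^sup>2 + \<eta>\<^sup>2)) \<le> (\<Sum>i<N. 2 * h * (1 / (real i + h) - 1 / (real (Suc i) + h)))"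
    by (intro sum_mono le)
  also have "\<dots> = 2 * h * (\<Sum>i<N. 1 / (real i + h) - 1 / (real (Suc i) + h))" by (simp only: sum_distrib_left)
  also have "(\<Sum>i<N. 1 / (real i + h) - 1 / (real (Suc i) + h)) = 1 / (real 0 + h) - 1 / (real N + h)"
    by (rule sum_lessThan_telescope')
  also have "2 * h * \<dots> = 2 - 2 * h / (real N + h)" using h by (simp add: right_diff_distrib)
  also have "\<dots> \<le> 2" using h by simp
  finally show ?thesis by (simp add: h_def)
qed simp

text \<open>The exponentials on the two sides of the origin have the Fourier transforms
  \<open>1 / (c \<plusminus> i \<eta>)\<close>. For indices below \<open>N\<close> they are paired: replacing \<open>c - i \<eta>\<close> by
  \<open>c + i \<eta>\<close> costs a Poisson kernel times a coefficient of size \<open>N powr (-1/2)\<close>, and what remains are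
  the positive differences of the coefficients, whose weighted sum is by the balance identity equal
  to the tail over \<open>i \<ge> N\<close>. So everything is of size \<open>N powr (-1/2)\<close>.\<close>

lemma multiplier_sum_bound:
  assumes N: "N \<ge> 1"
  shows "norm ((\<Sum>i. complex_of_real (inv_sqrt_coeff (N + i)) / (complex_of_real (half_shift i) - \<i> * complex_of_real \<eta>))
      - (\<Sum>i<N. complex_of_real (inv_sqrt_coeff (N - Suc i)) / (complex_of_real (half_shift i) + \<i> * complex_of_real \<eta>))) \<le> 8 / sqrt (real N)"
proof -
  define f where "f = (\<lambda>i. complex_of_real (inv_sqrt_coeff (N + i)) / (complex_of_real (half_shift i) - \<i> * complex_of_real \<eta>))"
  define g where "g = (\<lambda>i. complex_of_real (inv_sqrt_coeff (N - Suc i)) / (complex_of_real (half_shift i) + \<i> * complex_of_real \<eta>))"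
  have cn: "half_shift i \<le> norm (complex_of_real (half_shift i) + \<i> * complex_of_real \<eta>)" "half_shift i \<le> norm (complex_of_real (half_shift i) - \<i> * complex_of_real \<eta>)" for i
    using complex_Re_le_cmod[of "complex_of_real (half_shift i) + \<i> * complex_of_real \<eta>"]
      complex_Re_le_cmod[of "complex_of_real (half_shift i) - \<i> * complex_of_real \<eta>"] by simp_all
  have nz: "complex_of_real (half_shift i) + \<i> * complex_of_real \<eta> \<noteq> 0" "complex_of_real (half_shift i) - \<i> * complex_of_real \<eta> \<noteq> 0" for i
    using cn[of i] half_shift_pos[of i] by (metis norm_zero not_less)+
  have fle: "norm (f i) \<le> inv_sqrt_coeff (N + i) / half_shift i" for i
    unfolding f_def norm_divide norm_of_real using inv_sqrt_coeff_pos[of "N + i"] cn[of i] by (intro frac_le) auto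
  have sf: "summable f" by (rule summable_comparison_test'[OF inv_sqrt_coeff_balance(1)[OF N]]) (use fle in auto)
  have s2: "summable (\<lambda>i. inv_sqrt_coeff (N + (i + N)) / half_shift (i + N))"
    using inv_sqrt_coeff_balance(1)[OF N] summable_iff_shift[of "\<lambda>i. inv_sqrt_coeff (N + i) / half_shift i" N] by simp
  define T where "T = (\<Sum>i. inv_sqrt_coeff (N + (i + N)) / half_shift (i + N))"
  have tail: "norm (\<Sum>i. f (i + N)) \<le> T"
    unfolding T_def by (rule norm_suminf_le[OF fle s2])
  \<comment> \<open>The excess of the coefficients below \<open>N\<close> over those above, summed up, is the tail beyond \<open>2 N\<close>.\<close>
  have bal: "(\<Sum>i<N. (inv_sqrt_coeff (N - Suc i) - inv_sqrt_coeff (N + i)) / half_shift i) = T"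
  proof -
    have "(\<Sum>i. inv_sqrt_coeff (N + i) / half_shift i) = T + (\<Sum>i<N. inv_sqrt_coeff (N + i) / half_shift i)"
      unfolding T_def by (rule suminf_split_initial_segment[OF inv_sqrt_coeff_balance(1)[OF N]])
    then show ?thesis using inv_sqrt_coeff_balance(2)[OF N] by (simp add: diff_divide_distrib sum_subtractf)
  qed
  \<comment> \<open>Below \<open>N\<close> the two fractions are compared: a Poisson kernel plus a difference of coefficients.\<close>
  have head: "norm (f i - g i) \<le> 2 / sqrt (2 * real N + 1) * (\<bar>\<eta>\<bar> / ((half_shift i)\<^sup>2 + \<eta>\<^sup>2)) + (inv_sqrt_coeff (N - Suc i) - inv_sqrt_coeff (N + i)) / half_shift i" if i: "i < N" for i
  proof -
    let ?p = "complex_of_real (half_shift i) + \<i> * complex_of_real \<eta>" and ?m = "complex_of_real (half_shift i) - \<i> * complex_of_real \<eta>"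
    have pm: "?m * ?p = complex_of_real ((half_shift i)\<^sup>2 + \<eta>\<^sup>2)" by (simp add: algebra_simps power2_eq_square)
    have "f i - g i = complex_of_real (inv_sqrt_coeff (N + i)) * (1 / ?m - 1 / ?p) - complex_of_real (inv_sqrt_coeff (N - Suc i) - inv_sqrt_coeff (N + i)) / ?p"
    proof -
      have gen: "A / m - B / p = A * (1 / m - 1 / p) - (B - A) / p" for A B m p :: complex
        by (simp add: right_diff_distrib diff_divide_distrib)
      show ?thesis unfolding f_def g_def of_real_diff by (rule gen)
    qed
    also have "1 / ?m - 1 / ?p = 2 * \<i> * complex_of_real \<eta> / (?m * ?p)"
    proof -
      have "1 / m - 1 / p = (p - m) / (m * p)" if "m \<noteq> 0" "p \<noteq> 0" for m p :: complex
        using that by (simp add: field_simps)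
      from this[OF nz(2)[of i] nz(1)[of i]] show ?thesis by simp
    qed
    finally have e: "f i - g i = complex_of_real (inv_sqrt_coeff (N + i)) * (2 * \<i> * complex_of_real \<eta> / complex_of_real ((half_shift i)\<^sup>2 + \<eta>\<^sup>2)) - complex_of_real (inv_sqrt_coeff (N - Suc i) - inv_sqrt_coeff (N + i)) / ?p"
      unfolding pm .
    have d0: "inv_sqrt_coeff (N - Suc i) - inv_sqrt_coeff (N + i) \<ge> 0" using inv_sqrt_coeff_antimono[of "N - Suc i" "N + i"] i by simp
    have acN: "inv_sqrt_coeff (N + i) \<le> 1 / sqrt (2 * real N + 1)"
      using inv_sqrt_coeff_antimono[of N "N + i"] inv_sqrt_coeff_le[of N] by simp
    have "norm (f i - g i) \<le> norm (complex_of_real (inv_sqrt_coeff (N + i)) * (2 * \<i> * complex_of_real \<eta> / complex_of_real ((half_shift i)\<^sup>2 + \<eta>\<^sup>2))) + norm (complex_of_real (inv_sqrt_coeff (N - Suc i) - inv_sqrt_coeff (N + i)) / ?p)"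
      unfolding e by (rule norm_triangle_ineq4)
    also have "norm (complex_of_real (inv_sqrt_coeff (N + i)) * (2 * \<i> * complex_of_real \<eta> / complex_of_real ((half_shift i)\<^sup>2 + \<eta>\<^sup>2))) = inv_sqrt_coeff (N + i) * (2 * \<bar>\<eta>\<bar> / ((half_shift i)\<^sup>2 + \<eta>\<^sup>2))"
      unfolding norm_mult norm_divide norm_of_real using inv_sqrt_coeff_pos[of "N + i"] by simp
    also have "\<dots> \<le> (1 / sqrt (2 * real N + 1)) * (2 * \<bar>\<eta>\<bar> / ((half_shift i)\<^sup>2 + \<eta>\<^sup>2))"
      by (intro mult_right_mono acN) auto
    also have "\<dots> = 2 / sqrt (2 * real N + 1) * (\<bar>\<eta>\<bar> / ((half_shift i)\<^sup>2 + \<eta>\<^sup>2))" by simp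
    also have "norm (complex_of_real (inv_sqrt_coeff (N - Suc i) - inv_sqrt_coeff (N + i)) / ?p) \<le> (inv_sqrt_coeff (N - Suc i) - inv_sqrt_coeff (N + i)) / half_shift i"
      unfolding norm_divide norm_of_real using d0 cn[of i] by (intro frac_le) auto
    finally show ?thesis by simp
  qed
  have "(\<Sum>i. f i) - (\<Sum>i<N. g i) = (\<Sum>i. f (i + N)) + (\<Sum>i<N. f i - g i)"
    using suminf_split_initial_segment[OF sf, of N] by (simp add: sum_subtractf)
  then have "norm ((\<Sum>i. f i) - (\<Sum>i<N. g i)) \<le> norm (\<Sum>i. f (i + N)) + norm (\<Sum>i<N. f i - g i)"
    by (simp add: norm_triangle_ineq)
  also have "norm (\<Sum>i<N. f i - g i) \<le> (\<Sum>i<N. 2 / sqrt (2 * real N + 1) * (\<bar>\<eta>\<bar> / ((half_shift i)\<^sup>2 + \<eta>\<^sup>2)) + (inv_sqrt_coeff (N - Suc i) - inv_sqrt_coeff (N + i)) / half_shift i)"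
    by (rule order_trans[OF norm_sum sum_mono[OF head]]) auto
  also have "\<dots> = 2 / sqrt (2 * real N + 1) * (\<Sum>i<N. \<bar>\<eta>\<bar> / ((half_shift i)\<^sup>2 + \<eta>\<^sup>2)) + T"
    by (simp only: sum.distrib bal sum_distrib_left)
  also have "2 / sqrt (2 * real N + 1) * (\<Sum>i<N. \<bar>\<eta>\<bar> / ((half_shift i)\<^sup>2 + \<eta>\<^sup>2)) \<le> 2 / sqrt (2 * real N + 1) * 2"
    by (intro mult_left_mono poisson_kernel_sum_bound) auto
  also have "\<dots> \<le> 4 / sqrt (real N)"
  proof -
    have "4 / sqrt (2 * real N + 1) \<le> 4 / sqrt (real N)" using N by (intro divide_left_mono) auto
    then show ?thesis by simp
  qed
  finally have "norm ((\<Sum>i. f i) - (\<Sum>i<N. g i)) \<le> 4 / sqrt (real N) + 2 * T" using tail by simp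
  also have "T \<le> 2 / sqrt (2 * real N - 1)" unfolding T_def by (rule inv_sqrt_coeff_tail_bound[OF N])
  also have "\<dots> \<le> 2 / sqrt (real N)" using N by (intro divide_left_mono) auto
  finally show ?thesis unfolding f_def g_def by simp
qed

section \<open>The Carleman inequality in logarithmic coordinates\<close>

definition exp_tail :: "real \<Rightarrow> real \<Rightarrow> real" where "exp_tail c u = pos_powr 0 u * exp (- c * u)"

lemma exp_tail_measurable [measurable]: "exp_tail c \<in> borel_measurable borel" unfolding exp_tail_def by measurable

lemma exp_tail_nonneg [simp]: "exp_tail c u \<ge> 0" by (simp add: exp_tail_def)

lemma exp_tail_integral: "c > 0 \<Longrightarrow> has_bochner_integral lborel (exp_tail c) (1 / c)"
proof -
  assume c: "c > 0"
  have "has_bochner_integral lborel (\<lambda>u. pos_powr 0 u * exp (- c * u)) (Gamma (0 + 1) * c powr (- (0 + 1)))"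
    by (rule has_bochner_integral_nn_integral[OF _ _ _ nn_integral_pos_powr_exp]) (use c in auto)
  then show ?thesis using c by (simp add: exp_tail_def[abs_def] powr_minus_divide)
qed

lemma has_bochner_integral_reflect:
  fixes f :: "real \<Rightarrow> real"
  shows "has_bochner_integral lborel f x \<Longrightarrow> has_bochner_integral lborel (\<lambda>u. f (- u)) x"
  using lborel_has_bochner_integral_real_affine_iff[of "-1" f x 0] by simp

lemma fourier_real_reflect: "fourier_real (\<lambda>u. F (- u)) \<eta> = fourier_real F (- \<eta>)"
  unfolding fourier_real_def by (subst lborel_integral_real_affine[of "-1" _ 0]) auto

lemma fourier_real_exp_tail:
  assumes c: "c > 0"
  shows "fourier_real (exp_tail c) \<eta> = 1 / (complex_of_real c + \<i> * complex_of_real \<eta>)"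
proof -
  define l where "l = complex_of_real c + \<i> * complex_of_real \<eta>"
  have l0: "l \<noteq> 0" "Re l = c" using c by (auto simp: l_def complex_eq_iff)
  have e: "complex_of_real (exp (- c * u)) * iexp (- (\<eta> * u)) = exp (- l * complex_of_real u)" for u
    unfolding exp_of_real[symmetric] exp_add[symmetric] by (simp add: l_def algebra_simps)
  have D: "((\<lambda>u. - exp (- l * complex_of_real u) / l) has_vector_derivative exp (- l * complex_of_real u)) (at u)" for u
  proof -
    have "((\<lambda>w. - exp (- l * w) / l) has_field_derivative exp (- l * w)) (at w)" for w
      using l0 by (auto intro!: derivative_eq_intros)
    from has_vector_derivative_real_field[OF this[of "complex_of_real u"]] show ?thesis by simp
  qed
  have i: "integrable lborel (\<lambda>u. complex_of_real (exp_tail c u) * iexp (- (\<eta> * u)))"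
    by (rule fourier_real_integrable) (rule integrable.intros[OF exp_tail_integral[OF c]])
  have ind: "complex_of_real (exp_tail c u) * iexp (- (\<eta> * u)) = indicator {0<..} u *\<^sub>R exp (- l * complex_of_real u)" for u
    unfolding e[symmetric] by (simp add: exp_tail_def pos_powr_def indicator_def)
  have "(LBINT u=0..\<infinity>. exp (- l * complex_of_real u)) = 0 - (- 1 / l)"
  proof (rule interval_integral_FTC_integrable[where F="\<lambda>u. - exp (- l * complex_of_real u) / l"])
    show "((\<lambda>u. - exp (- l * complex_of_real u) / l) has_vector_derivative exp (- l * complex_of_real u)) (at u)" for u by (rule D)
    show "isCont (\<lambda>u. exp (- l * complex_of_real u)) u" for u by (intro continuous_intros)
    show "set_integrable lborel (einterval 0 \<infinity>) (\<lambda>u. exp (- l * complex_of_real u))"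
      using i unfolding ind by (simp add: set_integrable_def einterval_def greaterThan_def zero_ereal_def)
    have "isCont (\<lambda>u. - exp (- l * complex_of_real u) / l) 0" using l0 by (intro continuous_intros) auto
    then have "((\<lambda>u. - exp (- l * complex_of_real u) / l) \<longlongrightarrow> - 1 / l) (at_right 0)"
      unfolding isCont_def by (auto intro: filterlim_mono at_within_le_at)
    then show "(((\<lambda>u. - exp (- l * complex_of_real u) / l) \<circ> real_of_ereal) \<longlongrightarrow> - 1 / l) (at_right 0)"
      unfolding zero_ereal_def by (simp add: ereal_tendsto_simps)
    have "((\<lambda>u. - exp (- l * complex_of_real u) / l) \<longlongrightarrow> 0) at_top"
    proof (rule tendsto_norm_zero_cancel)
      have "norm (- exp (- l * complex_of_real u) / l) = exp (- c * u) / norm l" for u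
        using l0 by (simp add: norm_divide)
      moreover have "((\<lambda>u. exp (- c * u) / norm l) \<longlongrightarrow> 0) at_top" using c l0 by real_asymp
      ultimately show "((\<lambda>u. norm (- exp (- l * complex_of_real u) / l)) \<longlongrightarrow> 0) at_top" by simp
    qed
    then show "(((\<lambda>u. - exp (- l * complex_of_real u) / l) \<circ> real_of_ereal) \<longlongrightarrow> 0) (at_left \<infinity>)"
      by (simp add: ereal_tendsto_simps)
  qed simp
  then have "(LINT u|lborel. indicator {0<..} u *\<^sub>R exp (- l * complex_of_real u)) = 1 / l"
    by (simp add: interval_lebesgue_integral_def einterval_def set_lebesgue_integral_def greaterThan_def zero_ereal_def)
  then show ?thesis unfolding fourier_real_def ind by (simp add: l_def)
qed

lemma fourier_real_add:
  assumes F: "integrable lborel F" and G: "integrable lborel G"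
  shows "fourier_real (\<lambda>u. F u + G u) \<eta> = fourier_real F \<eta> + fourier_real G \<eta>"
  unfolding fourier_real_def of_real_add distrib_right
  by (rule Bochner_Integration.integral_add[OF fourier_real_integrable[OF F] fourier_real_integrable[OF G]])

lemma fourier_real_diff:
  assumes F: "integrable lborel F" and G: "integrable lborel G"
  shows "fourier_real (\<lambda>u. F u - G u) \<eta> = fourier_real F \<eta> - fourier_real G \<eta>"
  unfolding fourier_real_def of_real_diff left_diff_distrib
  by (rule Bochner_Integration.integral_diff[OF fourier_real_integrable[OF F] fourier_real_integrable[OF G]])

lemma fourier_real_cmult: "fourier_real (\<lambda>u. a * F u) \<eta> = complex_of_real a * fourier_real F \<eta>"
  unfolding fourier_real_def by (simp add: mult.assoc)

lemma fourier_real_sum: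
  assumes "\<And>i. i \<in> I \<Longrightarrow> integrable lborel (F i)"
  shows "fourier_real (\<lambda>u. \<Sum>i\<in>I. F i u) \<eta> = (\<Sum>i\<in>I. fourier_real (F i) \<eta>)"
  unfolding fourier_real_def of_real_sum sum_distrib_right
  by (rule Bochner_Integration.integral_sum) (rule fourier_real_integrable[OF assms])

lemma fourier_real_cong_AE:
  assumes "AE u in lborel. F u = G u" and [measurable]: "F \<in> borel_measurable borel" "G \<in> borel_measurable borel"
  shows "fourier_real F \<eta> = fourier_real G \<eta>"
  unfolding fourier_real_def by (rule integral_cong_AE) (use assms(1) in auto)

lemma fourier_real_suminf:
  assumes F: "\<And>i. integrable lborel (F i)" and s1: "\<And>u. summable (\<lambda>i. \<bar>F i u\<bar>)"
    and s2: "summable (\<lambda>i. \<integral>u. \<bar>F i u\<bar> \<partial>lborel)"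
  shows "integrable lborel (\<lambda>u. \<Sum>i. F i u)" "fourier_real (\<lambda>u. \<Sum>i. F i u) \<eta> = (\<Sum>i. fourier_real (F i) \<eta>)"
proof -
  show "integrable lborel (\<lambda>u. \<Sum>i. F i u)"
    by (rule integrable_suminf) (use F s1 s2 in auto)
  have s3: "summable (\<lambda>i. F i u)" for u using s1 by (rule summable_rabs_cancel)
  have "fourier_real (\<lambda>u. \<Sum>i. F i u) \<eta> = (LINT u|lborel. (\<Sum>i. complex_of_real (F i u) * iexp (- (\<eta> * u))))"
    unfolding fourier_real_def
    by (intro Bochner_Integration.integral_cong refl)
      (subst suminf_mult2[symmetric], auto intro: summable_of_real s3 simp: suminf_of_real[OF s3])
  also have "\<dots> = (\<Sum>i. fourier_real (F i) \<eta>)"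
    unfolding fourier_real_def
  proof (rule integral_suminf)
    show "integrable lborel (\<lambda>u. complex_of_real (F i u) * iexp (- (\<eta> * u)))" for i by (rule fourier_real_integrable[OF F])
  qed (use s1 s2 in \<open>simp_all add: norm_mult\<close>)
  finally show "fourier_real (\<lambda>u. \<Sum>i. F i u) \<eta> = (\<Sum>i. fourier_real (F i) \<eta>)" .
qed

text \<open>In the coordinates \<open>\<bar>x\<bar> = exp u\<close> and \<open>\<bar>y\<bar> = exp s\<close> the operator with kernel
  \<open>\<bar>y\<bar> powr (-1/2) * inv_sqrt_rem N (x / y)\<close>, conjugated by the weights, is a convolution in \<open>u - s\<close>.
  There is one kernel for \<open>x\<close> and \<open>y\<close> of the same sign and one for opposite signs.\<close>

definition same_side_kernel :: "nat \<Rightarrow> real \<Rightarrow> real" where "same_side_kernel N u = exp (- (real N - 1/2) * u) * inv_sqrt_rem N (exp u)"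
definition opposite_kernel :: "nat \<Rightarrow> real \<Rightarrow> real" where "opposite_kernel N u = exp (- (real N - 1/2) * u) * inv_sqrt_rem N (- exp u)"

lemma same_side_kernel_measurable [measurable]: "same_side_kernel N \<in> borel_measurable borel" unfolding same_side_kernel_def by measurable
lemma opposite_kernel_measurable [measurable]: "opposite_kernel N \<in> borel_measurable borel" unfolding opposite_kernel_def by measurable

lemma opposite_kernel_bound:
  assumes N: "N \<ge> 1"
  shows "\<bar>opposite_kernel N u\<bar> \<le> 2 * inv_sqrt_coeff (N - 1) * exp (- \<bar>u\<bar> / 2)"
proof (cases "u \<le> 0")
  case True
  have "\<bar>opposite_kernel N u\<bar> = exp (- (real N - 1/2) * u) * \<bar>inv_sqrt_rem N (- exp u)\<bar>" by (simp add: opposite_kernel_def abs_mult)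
  also have "\<dots> \<le> exp (- (real N - 1/2) * u) * (inv_sqrt_coeff N * exp u ^ N)" by (intro mult_left_mono inv_sqrt_rem_neg) auto
  also have "\<dots> = inv_sqrt_coeff N * (exp (- (real N - 1/2) * u) * exp (real N * u))" by (simp add: exp_of_nat_mult)
  also have "\<dots> = inv_sqrt_coeff N * exp (- \<bar>u\<bar> / 2)" unfolding exp_add[symmetric] using True by (simp add: algebra_simps)
  also have "\<dots> \<le> 2 * inv_sqrt_coeff (N - 1) * exp (- \<bar>u\<bar> / 2)"
    using inv_sqrt_coeff_antimono[of "N - 1" N] inv_sqrt_coeff_pos[of "N - 1"] by (intro mult_right_mono) auto
  finally show ?thesis .
next
  case False
  have "\<bar>opposite_kernel N u\<bar> = exp (- (real N - 1/2) * u) * \<bar>inv_sqrt_rem N (- exp u)\<bar>" by (simp add: opposite_kernel_def abs_mult)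
  also have "\<dots> \<le> exp (- (real N - 1/2) * u) * (2 * inv_sqrt_coeff (N - 1) * exp u ^ (N - 1))" by (intro mult_left_mono inv_sqrt_rem_neg_weak N) auto
  also have "\<dots> = 2 * inv_sqrt_coeff (N - 1) * (exp (- (real N - 1/2) * u) * exp (real (N - 1) * u))" by (simp add: exp_of_nat_mult)
  also have "\<dots> = 2 * inv_sqrt_coeff (N - 1) * exp (- \<bar>u\<bar> / 2)" unfolding exp_add[symmetric] using False N by (simp add: of_nat_diff algebra_simps)
  finally show ?thesis by simp
qed

lemma inv_sqrt_coeff_pred_le: "N \<ge> 1 \<Longrightarrow> inv_sqrt_coeff (N - 1) \<le> 1 / sqrt (real N)"
proof -
  assume N: "N \<ge> 1"
  have "inv_sqrt_coeff (N - 1) \<le> 1 / sqrt (2 * real (N - 1) + 1)" by (rule inv_sqrt_coeff_le)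
  also have "\<dots> \<le> 1 / sqrt (real N)" using N by (intro divide_left_mono) (auto simp: of_nat_diff)
  finally show ?thesis .
qed

text \<open>The \<open>L\<^sup>1\<close> norm of this kernel is already of size \<open>N powr (-1/2)\<close>.\<close>

lemma opposite_kernel_ft:
  assumes N: "N \<ge> 1"
  shows "integrable lborel (opposite_kernel N)" "norm (fourier_real (opposite_kernel N) \<eta>) \<le> 8 / sqrt (real N)"
proof -
  have h: "has_bochner_integral lborel (\<lambda>u. 2 * inv_sqrt_coeff (N - 1) * (exp_tail (1/2) u + exp_tail (1/2) (- u))) (2 * inv_sqrt_coeff (N - 1) * (1 / (1/2) + 1 / (1/2)))"
    by (intro has_bochner_integral_mult_right has_bochner_integral_add has_bochner_integral_reflect exp_tail_integral) auto
  have le: "AE u in lborel. \<bar>opposite_kernel N u\<bar> \<le> 2 * inv_sqrt_coeff (N - 1) * (exp_tail (1/2) u + exp_tail (1/2) (- u))"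
    using AE_lborel_singleton[of 0]
  proof eventually_elim
    case (elim u)
    then have "exp (- \<bar>u\<bar> / 2) = exp_tail (1/2) u + exp_tail (1/2) (- u)" by (auto simp: exp_tail_def pos_powr_def abs_if)
    then show ?case using opposite_kernel_bound[OF N, of u] by simp
  qed
  show i: "integrable lborel (opposite_kernel N)"
    by (rule Bochner_Integration.integrable_bound[OF integrable.intros[OF h]]) (use le inv_sqrt_coeff_pos[of "N - 1"] in auto)
  have "norm (fourier_real (opposite_kernel N) \<eta>) \<le> (\<integral>u. \<bar>opposite_kernel N u\<bar> \<partial>lborel)" by (rule fourier_real_norm_le[OF i])
  also have "\<dots> \<le> (\<integral>u. 2 * inv_sqrt_coeff (N - 1) * (exp_tail (1/2) u + exp_tail (1/2) (- u)) \<partial>lborel)"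
    by (rule integral_mono_AE) (use i le integrable.intros[OF h] in auto)
  also have "\<dots> = 8 * inv_sqrt_coeff (N - 1)" using has_bochner_integral_integral_eq[OF h] by simp
  also have "\<dots> \<le> 8 / sqrt (real N)" using inv_sqrt_coeff_pred_le[OF N] by simp
  finally show "norm (fourier_real (opposite_kernel N) \<eta>) \<le> 8 / sqrt (real N)" .
qed

text \<open>Here the \<open>L\<^sup>1\<close> norm is too large, since near the origin the kernel resembles \<open>N powr (-1/2) / u\<close>, the
  kernel of the Hilbert transform. It is decomposed into the singular part \<open>A\<close>, which lives on
  \<open>u > 0\<close> at the scale \<open>1 / N\<close> and has a small \<open>L\<^sup>1\<close> norm, the Taylor polynomial \<open>P\<close> on
  \<open>u > 0\<close> and the tail of the power series \<open>Q\<close> on \<open>u < 0\<close>. The transforms of \<open>Q\<close> and \<open>P\<close>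
  are the two sums that nearly cancel.\<close>

lemma same_side_kernel_ft:
  assumes N: "N \<ge> 1"
  shows "integrable lborel (same_side_kernel N)" "norm (fourier_real (same_side_kernel N) \<eta>) \<le> 11 / sqrt (real N)"
proof -
  \<comment> \<open>The part of the kernel to the right of the singularity, without the Taylor polynomial.\<close>
  define A where "A = (\<lambda>u. indicator {0<..} u * (exp (- (real N - 1/2) * u) * (exp u - 1) powr (-1/2)))"
  have [measurable]: "A \<in> borel_measurable borel" unfolding A_def by measurable
  have hA: "has_bochner_integral lborel (\<lambda>u. pos_powr (-1/2) u * exp (- (real N - 1/2) * u)) (Gamma (-1/2 + 1) * (real N - 1/2) powr (- (-1/2 + 1)))"
    by (rule has_bochner_integral_nn_integral[OF _ _ _ nn_integral_pos_powr_exp]) (use N in \<open>auto intro: Gamma_real_nonneg\<close>)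
  have Ale: "\<bar>A u\<bar> \<le> pos_powr (-1/2) u * exp (- (real N - 1/2) * u)" for u
  proof (cases "u > 0")
    case True
    have "u \<le> exp u - 1" using exp_ge_add_one_self[of u] by linarith
    then have "(exp u - 1) powr (-1/2) \<le> u powr (-1/2)" using True by (intro powr_mono2') auto
    then show ?thesis using True by (simp add: A_def pos_powr_def)
  qed (simp add: A_def)
  have Ai: "integrable lborel A"
    by (rule Bochner_Integration.integrable_bound[OF integrable.intros[OF hA]]) (use Ale in auto)
  have Aft: "norm (fourier_real A \<eta>) \<le> 3 / sqrt (real N)"
  proof -
    have "norm (fourier_real A \<eta>) \<le> (\<integral>u. \<bar>A u\<bar> \<partial>lborel)" by (rule fourier_real_norm_le[OF Ai])
    also have "\<dots> \<le> (\<integral>u. pos_powr (-1/2) u * exp (- (real N - 1/2) * u) \<partial>lborel)"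
      by (rule integral_mono) (use Ai Ale integrable.intros[OF hA] in auto)
    also have "\<dots> = sqrt pi * (real N - 1/2) powr (-1/2)"
      unfolding has_bochner_integral_integral_eq[OF hA] by (simp add: Gamma_one_half_real)
    also have "\<dots> \<le> 2 * (real N / 2) powr (-1/2)"
    proof (intro mult_mono powr_mono2')
      show "sqrt pi \<le> 2" using pi_less_4 by (intro real_le_lsqrt) auto
    qed (use N in auto)
    also have "\<dots> = 2 * sqrt 2 / sqrt (real N)"
      using N by (simp add: powr_minus_divide powr_half_sqrt real_sqrt_divide)
    also have "\<dots> \<le> 3 / sqrt (real N)"
    proof (intro divide_right_mono)
      have "sqrt 2 \<le> 3/2" by (rule real_le_lsqrt) (auto simp: power2_eq_square)
      then show "2 * sqrt 2 \<le> 3" by simp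
    qed auto
    finally show ?thesis .
  qed
  define P where "P = (\<lambda>u. \<Sum>i<N. inv_sqrt_coeff (N - Suc i) * exp_tail (half_shift i) u)"
  define Q where "Q = (\<lambda>u. \<Sum>i. inv_sqrt_coeff (N + i) * exp_tail (half_shift i) (- u))"
  have ei: "integrable lborel (exp_tail (half_shift i))" for i by (rule integrable.intros[OF exp_tail_integral]) simp
  have hr: "has_bochner_integral lborel (\<lambda>u. exp_tail (half_shift i) (- u)) (1 / half_shift i)" for i
    by (intro has_bochner_integral_reflect exp_tail_integral) simp
  have eri: "integrable lborel (\<lambda>u. exp_tail (half_shift i) (- u))" for i by (rule integrable.intros[OF hr])
  have reflected: "fourier_real (\<lambda>u. exp_tail (half_shift i) (- u)) \<eta> = 1 / (complex_of_real (half_shift i) - \<i> * complex_of_real \<eta>)" for i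
    using fourier_real_reflect[of "exp_tail (half_shift i)" \<eta>] fourier_real_exp_tail[of "half_shift i" "- \<eta>"] by simp
  have Pi: "integrable lborel P" unfolding P_def by (intro Bochner_Integration.integrable_sum integrable_mult_right ei)
  have Pft: "fourier_real P \<eta> = (\<Sum>i<N. complex_of_real (inv_sqrt_coeff (N - Suc i)) / (complex_of_real (half_shift i) + \<i> * complex_of_real \<eta>))"
    unfolding P_def by (subst fourier_real_sum) (auto simp: fourier_real_cmult fourier_real_exp_tail ei)
  have Qi: "integrable lborel Q" and Qft: "fourier_real Q \<eta> = (\<Sum>i. complex_of_real (inv_sqrt_coeff (N + i)) / (complex_of_real (half_shift i) - \<i> * complex_of_real \<eta>))"
  proof -
    have a1: "integrable lborel (\<lambda>u. inv_sqrt_coeff (N + i) * exp_tail (half_shift i) (- u))" for i by (intro integrable_mult_right eri)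
    have a2: "summable (\<lambda>i. \<bar>inv_sqrt_coeff (N + i) * exp_tail (half_shift i) (- u)\<bar>)" for u
    proof (cases "u < 0")
      case True
      show ?thesis
      proof (rule summable_comparison_test')
        show "summable (\<lambda>i. exp u ^ i)" using True by (intro summable_geometric) auto
        show "norm \<bar>inv_sqrt_coeff (N + i) * exp_tail (half_shift i) (- u)\<bar> \<le> exp u ^ i" if "i \<ge> 0" for i
        proof -
          have "norm \<bar>inv_sqrt_coeff (N + i) * exp_tail (half_shift i) (- u)\<bar> = inv_sqrt_coeff (N + i) * exp (half_shift i * u)"
            using True inv_sqrt_coeff_pos[of "N + i"] by (simp add: exp_tail_def pos_powr_def abs_mult)
          also have "\<dots> \<le> 1 * exp (real i * u)"
            using True by (intro mult_mono inv_sqrt_coeff_le_1) (auto simp: half_shift_def distrib_right)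
          finally show ?thesis by (simp add: exp_of_nat_mult)
        qed
      qed
    qed (simp add: exp_tail_def pos_powr_def)
    have "(\<integral>u. \<bar>inv_sqrt_coeff (N + i) * exp_tail (half_shift i) (- u)\<bar> \<partial>lborel) = inv_sqrt_coeff (N + i) / half_shift i" for i
    proof -
      have "(\<integral>u. \<bar>inv_sqrt_coeff (N + i) * exp_tail (half_shift i) (- u)\<bar> \<partial>lborel) = (\<integral>u. inv_sqrt_coeff (N + i) * exp_tail (half_shift i) (- u) \<partial>lborel)"
        using inv_sqrt_coeff_pos[of "N + i"] by (simp add: abs_mult)
      also have "\<dots> = inv_sqrt_coeff (N + i) * (1 / half_shift i)"
        by (simp only: integral_mult_right_zero has_bochner_integral_integral_eq[OF hr])
      finally show ?thesis by simp
    qed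
    then have a3: "summable (\<lambda>i. \<integral>u. \<bar>inv_sqrt_coeff (N + i) * exp_tail (half_shift i) (- u)\<bar> \<partial>lborel)"
      using inv_sqrt_coeff_balance(1)[OF N] by simp
    show "integrable lborel Q" unfolding Q_def by (rule fourier_real_suminf(1)[OF a1 a2 a3])
    show "fourier_real Q \<eta> = (\<Sum>i. complex_of_real (inv_sqrt_coeff (N + i)) / (complex_of_real (half_shift i) - \<i> * complex_of_real \<eta>))"
      unfolding Q_def fourier_real_suminf(2)[OF a1 a2 a3] by (simp add: fourier_real_cmult reflected)
  qed
  have dec: "same_side_kernel N u = (A u + Q u) - P u" if u0: "u \<noteq> 0" for u
  proof (cases "u > 0")
    case True
    have Q0: "Q u = 0" using True by (simp add: Q_def exp_tail_def pos_powr_def)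
    have e: "exp (- (real N - 1/2) * u) * exp u ^ (N - Suc i) = exp_tail (half_shift i) u" if "i < N" for i
    proof -
      have "exp (- (real N - 1/2) * u) * exp u ^ (N - Suc i) = exp (- (real N - 1/2) * u + real (N - Suc i) * u)"
        by (simp only: exp_add exp_of_nat_mult)
      also have "- (real N - 1/2) * u + real (N - Suc i) * u = - half_shift i * u"
        using that by (simp add: half_shift_def of_nat_diff algebra_simps)
      finally show ?thesis using True by (simp add: exp_tail_def pos_powr_def)
    qed
    have "exp (- (real N - 1/2) * u) * (\<Sum>k<N. inv_sqrt_coeff k * exp u ^ k) = exp (- (real N - 1/2) * u) * (\<Sum>i<N. inv_sqrt_coeff (N - Suc i) * exp u ^ (N - Suc i))"
      by (subst sum.nat_diff_reindex[symmetric]) simp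
    also have "\<dots> = (\<Sum>i<N. inv_sqrt_coeff (N - Suc i) * (exp (- (real N - 1/2) * u) * exp u ^ (N - Suc i)))"
      by (simp only: sum_distrib_left mult.left_commute)
    also have "\<dots> = P u" unfolding P_def by (intro sum.cong refl) (simp only: e lessThan_iff)
    finally have PP: "exp (- (real N - 1/2) * u) * (\<Sum>k<N. inv_sqrt_coeff k * exp u ^ k) = P u" .
    have "\<bar>1 - exp u\<bar> = exp u - 1" using True by simp
    then show ?thesis using True Q0 unfolding same_side_kernel_def inv_sqrt_rem_def right_diff_distrib PP A_def by simp
  next
    case False
    then have u: "u < 0" using u0 by simp
    have A0: "A u = 0" "P u = 0" using u by (simp_all add: A_def P_def exp_tail_def pos_powr_def)
    have "(\<lambda>i. inv_sqrt_coeff (N + i) * exp u ^ (N + i)) sums inv_sqrt_rem N (exp u)" by (rule inv_sqrt_rem_tail) (use u in simp)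
    then have "(\<lambda>i. exp (- (real N - 1/2) * u) * (inv_sqrt_coeff (N + i) * exp u ^ (N + i))) sums same_side_kernel N u"
      unfolding same_side_kernel_def by (rule sums_mult)
    moreover have "exp (- (real N - 1/2) * u) * exp u ^ (N + i) = exp_tail (half_shift i) (- u)" for i
    proof -
      have "exp (- (real N - 1/2) * u) * exp u ^ (N + i) = exp (- (real N - 1/2) * u + real (N + i) * u)"
        by (simp only: exp_add exp_of_nat_mult)
      also have "- (real N - 1/2) * u + real (N + i) * u = - half_shift i * (- u)" by (simp add: half_shift_def algebra_simps)
      finally show ?thesis using u by (simp add: exp_tail_def pos_powr_def)
    qed
    moreover have "exp (- (real N - 1/2) * u) * (inv_sqrt_coeff (N + i) * exp u ^ (N + i)) = inv_sqrt_coeff (N + i) * (exp (- (real N - 1/2) * u) * exp u ^ (N + i))" for i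
      by (rule mult.left_commute)
    ultimately have "(\<lambda>i. inv_sqrt_coeff (N + i) * exp_tail (half_shift i) (- u)) sums same_side_kernel N u" by (simp only:)
    then show ?thesis using A0 by (simp add: Q_def sums_unique)
  qed
  have [measurable]: "P \<in> borel_measurable borel" "Q \<in> borel_measurable borel"
    using borel_measurable_integrable[OF Pi] borel_measurable_integrable[OF Qi] by simp_all
  have ae: "AE u in lborel. same_side_kernel N u = (A u + Q u) - P u"
    using AE_lborel_singleton[of 0] by eventually_elim (rule dec)
  have AQP: "integrable lborel (\<lambda>u. (A u + Q u) - P u)" using Ai Qi Pi by simp
  have ae': "AE u in lborel. (A u + Q u) - P u = same_side_kernel N u" using ae by eventually_elim simp
  show "integrable lborel (same_side_kernel N)"
    by (rule integrable_cong_AE_imp[OF AQP _ ae']) measurable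
  have "fourier_real (same_side_kernel N) \<eta> = fourier_real (\<lambda>u. (A u + Q u) - P u) \<eta>"
    by (rule fourier_real_cong_AE[OF ae]) measurable
  also have "\<dots> = fourier_real A \<eta> + (fourier_real Q \<eta> - fourier_real P \<eta>)" using Ai Qi Pi by (simp add: fourier_real_add fourier_real_diff)
  finally have "norm (fourier_real (same_side_kernel N) \<eta>) \<le> norm (fourier_real A \<eta>) + norm (fourier_real Q \<eta> - fourier_real P \<eta>)" by (simp add: norm_triangle_ineq)
  also have "norm (fourier_real Q \<eta> - fourier_real P \<eta>) \<le> 8 / sqrt (real N)"
    unfolding Qft Pft by (rule multiplier_sum_bound[OF N])
  finally show "norm (fourier_real (same_side_kernel N) \<eta>) \<le> 11 / sqrt (real N)" using Aft by simp
qed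

lemma integrable_square_bounded:
  fixes K :: "real \<Rightarrow> real"
  assumes K: "integrable lborel K" "\<And>s. \<bar>K s\<bar> \<le> B"
  shows "integrable lborel (\<lambda>s. (K s)\<^sup>2)"
proof (rule Bochner_Integration.integrable_bound[of _ "\<lambda>s. B * K s"])
  show "integrable lborel (\<lambda>s. B * K s)" using K by simp
  show "(\<lambda>s. (K s)\<^sup>2) \<in> borel_measurable lborel" using borel_measurable_integrable[OF K(1)] by simp
  have "(K s)\<^sup>2 \<le> \<bar>B\<bar> * \<bar>K s\<bar>" for s
  proof -
    have "(K s)\<^sup>2 = \<bar>K s\<bar> * \<bar>K s\<bar>" by (simp add: power2_eq_square)
    also have "\<dots> \<le> \<bar>B\<bar> * \<bar>K s\<bar>" using K(2)[of s] by (intro mult_right_mono) auto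
    finally show ?thesis .
  qed
  then show "AE s in lborel. norm ((K s)\<^sup>2) \<le> norm (B * K s)" by (simp add: abs_mult)
qed

lemma carleman_log:
  assumes N: "N \<ge> 1"
    and F: "integrable lborel F" "\<And>s. \<bar>F s\<bar> \<le> b" and G: "integrable lborel G" "\<And>s. \<bar>G s\<bar> \<le> b"
    and H: "\<And>u. H u = (\<integral>s. same_side_kernel N (u - s) * F s \<partial>lborel) + (\<integral>s. opposite_kernel N (u - s) * G s \<partial>lborel)"
    and Hc: "continuous_on UNIV H"
  shows "integrable lborel (\<lambda>u. (H u)\<^sup>2)"
    and "(\<integral>u. (H u)\<^sup>2 \<partial>lborel) \<le> 242 / real N * ((\<integral>s. (F s)\<^sup>2 \<partial>lborel) + (\<integral>s. (G s)\<^sup>2 \<partial>lborel))"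
proof -
  have [measurable]: "F \<in> borel_measurable borel" "G \<in> borel_measurable borel"
    using borel_measurable_integrable[OF F(1)] borel_measurable_integrable[OF G(1)] by simp_all
  have b: "b \<ge> 0" using F(2)[of 0] by linarith
  note ksi = same_side_kernel_ft(1)[OF N] and koi = opposite_kernel_ft(1)[OF N]
  have Heq: "H = (\<lambda>u. (\<integral>s. same_side_kernel N (u - s) * F s \<partial>lborel) + (\<integral>s. opposite_kernel N (u - s) * G s \<partial>lborel))" using H by auto
  have Hi: "integrable lborel H" unfolding Heq
    by (intro Bochner_Integration.integrable_add fourier_real_convolution(1) ksi koi F(1) G(1))
  have cb: "\<bar>\<integral>s. k (u - s) * K s \<partial>lborel\<bar> \<le> b * (\<integral>s. \<bar>k s\<bar> \<partial>lborel)"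
    if k: "integrable lborel k" and K: "K \<in> borel_measurable borel" "\<And>s. \<bar>K s\<bar> \<le> b" for k K :: "real \<Rightarrow> real" and u :: real
  proof -
    have km [measurable]: "k \<in> borel_measurable borel" using borel_measurable_integrable[OF k] by simp
    have "(\<integral>\<^sup>+s. ennreal \<bar>k (u - s)\<bar> \<partial>lborel) = (\<integral>\<^sup>+s. ennreal \<bar>k s\<bar> \<partial>lborel)"
      using nn_integral_real_affine[of "\<lambda>s. ennreal \<bar>k s\<bar>" "-1" u] by simp
    also have "\<dots> = ennreal (\<integral>s. \<bar>k s\<bar> \<partial>lborel)" using k by (intro nn_integral_eq_integral) auto
    finally have "(\<integral>\<^sup>+s. ennreal \<bar>k (u - s)\<bar> \<partial>lborel) \<le> ennreal (\<integral>s. \<bar>k s\<bar> \<partial>lborel)" by simp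
    from integral_bounded_factor(2)[OF K(2) K(1) _ this] show ?thesis by (simp add: mult.commute)
  qed
  define BH where "BH = b * (\<integral>s. \<bar>same_side_kernel N s\<bar> \<partial>lborel) + b * (\<integral>s. \<bar>opposite_kernel N s\<bar> \<partial>lborel)"
  have Hb: "\<bar>H u\<bar> \<le> BH" for u
    unfolding H BH_def using cb[of "same_side_kernel N" F u, OF ksi _ F(2)] cb[of "opposite_kernel N" G u, OF koi _ G(2)] by simp
  show "integrable lborel (\<lambda>u. (H u)\<^sup>2)" by (rule integrable_square_bounded[OF Hi Hb])
  show "(\<integral>u. (H u)\<^sup>2 \<partial>lborel) \<le> 242 / real N * ((\<integral>s. (F s)\<^sup>2 \<partial>lborel) + (\<integral>s. (G s)\<^sup>2 \<partial>lborel))"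
  proof (rule fourier_multiplier_L2[OF Hi Hc Hb F(1) integrable_square_bounded[OF F] G(1) integrable_square_bounded[OF G]])
    fix \<eta>
    define x where "x = norm (fourier_real F \<eta>)"
    define y where "y = norm (fourier_real G \<eta>)"
    have xy: "x \<ge> 0" "y \<ge> 0" by (simp_all add: x_def y_def)
    have "fourier_real H \<eta> = fourier_real (same_side_kernel N) \<eta> * fourier_real F \<eta> + fourier_real (opposite_kernel N) \<eta> * fourier_real G \<eta>"
      unfolding Heq by (subst fourier_real_add) (auto intro: fourier_real_convolution(1) ksi koi F(1) G(1) simp: fourier_real_convolution(2)[OF ksi F(1)] fourier_real_convolution(2)[OF koi G(1)])
    then have "norm (fourier_real H \<eta>) \<le> norm (fourier_real (same_side_kernel N) \<eta>) * x + norm (fourier_real (opposite_kernel N) \<eta>) * y"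
      by (metis norm_mult norm_triangle_ineq x_def y_def)
    also have "\<dots> \<le> 11 / sqrt (real N) * x + 11 / sqrt (real N) * y"
    proof (intro add_mono mult_right_mono xy)
      show "norm (fourier_real (same_side_kernel N) \<eta>) \<le> 11 / sqrt (real N)" by (rule same_side_kernel_ft(2)[OF N])
      have "8 / sqrt (real N) \<le> 11 / sqrt (real N)" by (intro divide_right_mono) auto
      then show "norm (fourier_real (opposite_kernel N) \<eta>) \<le> 11 / sqrt (real N)" using opposite_kernel_ft(2)[OF N, of \<eta>] by linarith
    qed
    also have "\<dots> = 11 / sqrt (real N) * (x + y)" by (simp only: distrib_left)
    finally have "(norm (fourier_real H \<eta>))\<^sup>2 \<le> (11 / sqrt (real N) * (x + y))\<^sup>2" by (intro power_mono) auto
    also have "\<dots> = 121 / real N * (x + y)\<^sup>2" unfolding power_mult_distrib power_divide by simp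
    also have "\<dots> \<le> 121 / real N * (2 * (x\<^sup>2 + y\<^sup>2))"
      using zero_le_power2[of "x - y"] by (intro mult_left_mono) (auto simp: power2_eq_square algebra_simps)
    finally show "(norm (fourier_real H \<eta>))\<^sup>2 \<le> 242 / real N * ((norm (fourier_real F \<eta>))\<^sup>2 + (norm (fourier_real G \<eta>))\<^sup>2)"
      by (simp add: x_def y_def)
  qed simp
qed

section \<open>The Carleman inequality on the line\<close>

lemma range_exp_real: "range (exp :: real \<Rightarrow> real) = {0<..}"
proof (intro equalityI subsetI)
  fix y :: real assume "y \<in> {0<..}"
  then have "y = exp (ln y)" by simp
  then show "y \<in> range exp" by blast
qed auto

lemma exp_subst:
  fixes g :: "real \<Rightarrow> real"
  assumes [measurable]: "g \<in> borel_measurable borel"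
  shows "integrable lborel (\<lambda>s. exp s * g (exp s)) \<longleftrightarrow> integrable lborel (\<lambda>y. indicator {0<..} y * g y)"
    and "(\<integral>s. exp s * g (exp s) \<partial>lborel) = (\<integral>y. indicator {0<..} y * g y \<partial>lborel)"
proof -
  have cov: "((\<lambda>x. \<bar>exp x\<bar> *\<^sub>R g (exp x)) absolutely_integrable_on UNIV \<and> integral UNIV (\<lambda>x. \<bar>exp x\<bar> *\<^sub>R g (exp x)) = b)
      \<longleftrightarrow> (g absolutely_integrable_on {0<..} \<and> integral {0<..} g = b)" for b
  proof -
    have "inj_on (exp :: real \<Rightarrow> real) UNIV" by (auto simp: inj_on_def)
    then show ?thesis
      using has_absolute_integral_change_of_variables_1'[of UNIV exp exp g b]
      unfolding range_exp_real by (auto intro: DERIV_subset[OF DERIV_exp])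
  qed
  have a1: "(\<lambda>x. \<bar>exp x\<bar> *\<^sub>R g (exp x)) absolutely_integrable_on UNIV \<longleftrightarrow> integrable lborel (\<lambda>s. exp s * g (exp s))"
    unfolding set_integrable_def by (simp add: integrable_completion)
  have a2: "g absolutely_integrable_on {0<..} \<longleftrightarrow> integrable lborel (\<lambda>y. indicator {0<..} y * g y)"
    unfolding set_integrable_def by (simp add: integrable_completion)
  show iff: "integrable lborel (\<lambda>s. exp s * g (exp s)) \<longleftrightarrow> integrable lborel (\<lambda>y. indicator {0<..} y * g y)"
    using cov a1 a2 by blast
  show "(\<integral>s. exp s * g (exp s) \<partial>lborel) = (\<integral>y. indicator {0<..} y * g y \<partial>lborel)"
  proof (cases "integrable lborel (\<lambda>s. exp s * g (exp s))")
    case True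
    have b1: "integral UNIV (\<lambda>x. \<bar>exp x\<bar> *\<^sub>R g (exp x)) = (\<integral>s. exp s * g (exp s) \<partial>lborel)"
      using set_lebesgue_integral_eq_integral(2)[OF a1[THEN iffD2, OF True]]
      unfolding set_lebesgue_integral_def by (simp add: integral_completion)
    have b2: "integral {0<..} g = (\<integral>y. indicator {0<..} y * g y \<partial>lborel)"
      using set_lebesgue_integral_eq_integral(2)[OF a2[THEN iffD2, OF iff[THEN iffD1, OF True]]]
      unfolding set_lebesgue_integral_def by (simp add: integral_completion)
    show ?thesis using cov[of "integral UNIV (\<lambda>x. \<bar>exp x\<bar> *\<^sub>R g (exp x))"] a1 True b1 b2 by metis
  next
    case False
    then show ?thesis using iff by (simp add: not_integrable_integral_eq)
  qed
qed

lemma half_line_split: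
  fixes h :: "real \<Rightarrow> real"
  assumes [measurable]: "h \<in> borel_measurable borel"
    and p: "integrable lborel (\<lambda>y. indicator {0<..} y * h y)" and n: "integrable lborel (\<lambda>y. indicator {0<..} y * h (- y))"
  shows "integrable lborel h" "(\<integral>y. h y \<partial>lborel) = (\<integral>y. indicator {0<..} y * h y \<partial>lborel) + (\<integral>y. indicator {0<..} y * h (- y) \<partial>lborel)"
proof -
  have n': "has_bochner_integral lborel (\<lambda>y. indicator {0<..} (- y) * h (- (- y))) (\<integral>y. indicator {0<..} y * h (- y) \<partial>lborel)"
    using has_bochner_integral_reflect[OF has_bochner_integral_integrable[OF n]] .
  have s: "has_bochner_integral lborel (\<lambda>y. indicator {0<..} y * h y + indicator {0<..} (- y) * h (- (- y)))
     ((\<integral>y. indicator {0<..} y * h y \<partial>lborel) + (\<integral>y. indicator {0<..} y * h (- y) \<partial>lborel))"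
    by (rule has_bochner_integral_add[OF has_bochner_integral_integrable[OF p] n'])
  have ae: "AE y in lborel. indicator {0<..} y * h y + indicator {0<..} (- y) * h (- (- y)) = h y"
    using AE_lborel_singleton[of 0] by eventually_elim (auto simp: indicator_def)
  have "has_bochner_integral lborel h ((\<integral>y. indicator {0<..} y * h y \<partial>lborel) + (\<integral>y. indicator {0<..} y * h (- y) \<partial>lborel))"
    by (rule has_bochner_integralI_AE[OF s _ ae]) measurable
  then show "integrable lborel h" "(\<integral>y. h y \<partial>lborel) = (\<integral>y. indicator {0<..} y * h y \<partial>lborel) + (\<integral>y. indicator {0<..} y * h (- y) \<partial>lborel)"
    by (auto simp: has_bochner_integral_iff)
qed

lemma exp_weight_integrable:
  fixes f :: "real \<Rightarrow> real"
  assumes f: "\<And>y. \<bar>f y\<bar> \<le> b" and [measurable]: "f \<in> borel_measurable borel" and z: "\<And>y. 0 < y \<Longrightarrow> y < r \<Longrightarrow> f y = 0" and r: "r > 0" and c: "c > 0"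
  shows "integrable lborel (\<lambda>s. exp (- c * s) * f (exp s))" "\<bar>exp (- c * s) * f (exp s)\<bar> \<le> b * exp (- c * ln r)"
proof -
  have b: "b \<ge> 0" using f[of 0] by linarith
  have bd: "\<bar>exp (- c * s) * f (exp s)\<bar> \<le> b * exp (- c * ln r)" for s
  proof (cases "exp s < r")
    case False
    then have "ln r \<le> s" using r by (metis exp_gt_zero ln_exp ln_le_cancel_iff not_less)
    then have "exp (- c * s) \<le> exp (- c * ln r)" using c by simp
    then have "exp (- c * s) * \<bar>f (exp s)\<bar> \<le> exp (- c * ln r) * b" using f by (intro mult_mono) auto
    then show ?thesis by (simp add: abs_mult mult.commute)
  qed (use z b in simp)
  then show "\<bar>exp (- c * s) * f (exp s)\<bar> \<le> b * exp (- c * ln r)" .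
  define a where "a = ln r - 1"
  have "integrable lborel (\<lambda>s. exp_tail c (- a + 1 * s))"
    using lborel_integrable_real_affine[OF integrable.intros[OF exp_tail_integral[OF c]], of 1 "- a"] by simp
  then have i: "integrable lborel (\<lambda>s. b * exp (- c * a) * exp_tail c (- a + 1 * s))" by simp
  show "integrable lborel (\<lambda>s. exp (- c * s) * f (exp s))"
  proof (rule Bochner_Integration.integrable_bound[OF i])
    show "AE s in lborel. norm (exp (- c * s) * f (exp s)) \<le> norm (b * exp (- c * a) * exp_tail c (- a + 1 * s))"
    proof (intro AE_I2)
      fix s
      show "norm (exp (- c * s) * f (exp s)) \<le> norm (b * exp (- c * a) * exp_tail c (- a + 1 * s))"
      proof (cases "exp s < r")
        case False
        then have "ln r \<le> s" using r by (metis exp_gt_zero ln_exp ln_le_cancel_iff not_less)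
        then have "exp_tail c (- a + 1 * s) = exp (- c * (s - a))" by (simp add: exp_tail_def pos_powr_def a_def)
        then have "exp (- c * a) * exp_tail c (- a + 1 * s) = exp (- c * s)"
          by (simp add: exp_add[symmetric] algebra_simps)
        then have "norm (b * exp (- c * a) * exp_tail c (- a + 1 * s)) = b * exp (- c * s)" using b by (simp add: abs_mult mult.assoc)
        moreover have "norm (exp (- c * s) * f (exp s)) \<le> b * exp (- c * s)"
          using mult_left_mono[OF f[of "exp s"], of "exp (- c * s)"] by (simp add: abs_mult mult.commute)
        ultimately show ?thesis by linarith
      qed (use z in simp)
    qed
  qed measurable
qed

text \<open>The weights are chosen such that the substitutions \<open>x = exp u\<close>, \<open>y = \<plusminus> exp s\<close> turn both sides
  into unweighted \<open>L\<^sup>2\<close> norms: the exponent \<open>N - 1/2\<close> belongs to \<open>dx / x ^ (2 * N)\<close>, and \<open>c = N - 1\<close>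
  to \<open>dy / \<bar>y\<bar> ^ (2 * N - 1)\<close>.\<close>

lemma carleman_half:
  fixes f :: "real \<Rightarrow> real"
  assumes f: "\<And>y. \<bar>f y\<bar> \<le> b" and fm [measurable]: "f \<in> borel_measurable borel" and z: "\<And>y. \<bar>y\<bar> < r \<Longrightarrow> f y = 0" and r: "r > 0"
    and N: "N \<ge> 2" and T: "\<And>x. T x = (\<integral>y. \<bar>y\<bar> powr (-1/2) * inv_sqrt_rem N (x / y) * f y \<partial>lborel)"
    and Tc: "continuous_on {0<..} T"
  shows "integrable lborel (\<lambda>x. indicator {0<..} x * ((T x)\<^sup>2 / x ^ (2 * N)))"
    and "integrable lborel (\<lambda>y. (f y)\<^sup>2 / \<bar>y\<bar> ^ (2 * N - 1))"
    and "(\<integral>x. indicator {0<..} x * ((T x)\<^sup>2 / x ^ (2 * N)) \<partial>lborel) \<le> 242 / real N * (\<integral>y. (f y)\<^sup>2 / \<bar>y\<bar> ^ (2 * N - 1) \<partial>lborel)"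
proof -
  define c where "c = real N - 1"
  have c: "c > 0" using N by (simp add: c_def)
  have N1: "N \<ge> 1" using N by simp
  define F where "F = (\<lambda>s. exp (- c * s) * f (exp s))"
  define G where "G = (\<lambda>s. exp (- c * s) * f (- exp s))"
  have b: "b \<ge> 0" using f[of 0] by linarith
  define B where "B = b * exp (- c * ln r)"
  have F: "integrable lborel F" "\<And>s. \<bar>F s\<bar> \<le> B"
    unfolding F_def B_def by (rule exp_weight_integrable[OF f fm _ r c]; use z in auto)+
  have G: "integrable lborel G" "\<And>s. \<bar>G s\<bar> \<le> B"
    unfolding G_def B_def
    using exp_weight_integrable[of "\<lambda>y. f (- y)" b r c] f fm z r c by auto
  define H where "H = (\<lambda>u. exp (- (real N - 1/2) * u) * T (exp u))"
  have Hc: "continuous_on UNIV H"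
    unfolding H_def by (intro continuous_intros continuous_on_compose2[OF Tc]) auto
  have ki: "integrable lborel (\<lambda>s. k (u - s) * K s)" if k: "integrable lborel k" and K: "K \<in> borel_measurable borel" "\<And>s. \<bar>K s\<bar> \<le> B"
    for k K :: "real \<Rightarrow> real" and u :: real
  proof (rule Bochner_Integration.integrable_bound)
    have [measurable]: "k \<in> borel_measurable borel" using borel_measurable_integrable[OF k] by simp
    show "integrable lborel (\<lambda>s. B * k (u + (-1) * s))"
      using lborel_integrable_real_affine[OF k, of "-1" u] by simp
    show "AE s in lborel. norm (k (u - s) * K s) \<le> norm (B * k (u + (-1) * s))"
    proof (intro AE_I2)
      fix s
      have "\<bar>K s\<bar> \<le> \<bar>B\<bar>" using K(2)[of s] by linarith
      then have "\<bar>k (u - s)\<bar> * \<bar>K s\<bar> \<le> \<bar>k (u - s)\<bar> * \<bar>B\<bar>" by (intro mult_left_mono) auto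
      then show "norm (k (u - s) * K s) \<le> norm (B * k (u + (-1) * s))" by (simp add: abs_mult mult.commute)
    qed
    show "(\<lambda>s. k (u - s) * K s) \<in> borel_measurable lborel" using K(1) by measurable
  qed
  have Fm: "F \<in> borel_measurable borel" "G \<in> borel_measurable borel" unfolding F_def G_def by measurable
  have H: "H u = (\<integral>s. same_side_kernel N (u - s) * F s \<partial>lborel) + (\<integral>s. opposite_kernel N (u - s) * G s \<partial>lborel)" for u
  proof -
    define h where "h = (\<lambda>y. \<bar>y\<bar> powr (-1/2) * inv_sqrt_rem N (exp u / y) * f y)"
    have [measurable]: "h \<in> borel_measurable borel" unfolding h_def by measurable
    define E where "E = exp ((real N - 1/2) * u)"
    \<comment> \<open>The factor \<open>exp s\<close> is the Jacobian; the exponents on the right add up to \<open>s / 2\<close>.\<close>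
    have ex: "exp s * exp s powr (-1/2) = E * (exp (- (real N - 1/2) * (u - s)) * exp (- c * s))" for s
    proof -
      have "exp s * exp s powr (-1/2) = exp (s / 2)" by (simp add: powr_def exp_add[symmetric])
      also have "s / 2 = (real N - 1/2) * u + (- (real N - 1/2) * (u - s) + - c * s)" by (simp add: c_def field_simps)
      finally show ?thesis unfolding exp_add E_def .
    qed
    have hp: "exp s * h (exp s) = E * (same_side_kernel N (u - s) * F s)" for s
    proof -
      have "exp s * h (exp s) = (exp s * exp s powr (-1/2)) * (inv_sqrt_rem N (exp (u - s)) * f (exp s))"
        unfolding h_def by (simp add: exp_diff)
      then show ?thesis unfolding ex same_side_kernel_def F_def by (simp only: mult_ac)
    qed
    have hn: "exp s * h (- exp s) = E * (opposite_kernel N (u - s) * G s)" for s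
    proof -
      have "exp s * h (- exp s) = (exp s * exp s powr (-1/2)) * (inv_sqrt_rem N (- exp (u - s)) * f (- exp s))"
        unfolding h_def by (simp add: exp_diff)
      then show ?thesis unfolding ex opposite_kernel_def G_def by (simp only: mult_ac)
    qed
    have ip: "integrable lborel (\<lambda>y. indicator {0<..} y * h y)"
      by (rule exp_subst(1)[THEN iffD1]) (auto simp: hp intro!: integrable_mult_right ki same_side_kernel_ft(1)[OF N1] Fm F)
    have "(\<lambda>y. h (- y)) \<in> borel_measurable borel" by measurable
    note hnm = this
    have im: "integrable lborel (\<lambda>y. indicator {0<..} y * h (- y))"
      by (rule exp_subst(1)[OF hnm, THEN iffD1]) (auto simp: hn intro!: integrable_mult_right ki opposite_kernel_ft(1)[OF N1] Fm G)
    have "T (exp u) = (\<integral>y. h y \<partial>lborel)" unfolding T h_def ..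
    also have "\<dots> = (\<integral>y. indicator {0<..} y * h y \<partial>lborel) + (\<integral>y. indicator {0<..} y * h (- y) \<partial>lborel)"
      by (rule half_line_split(2)[OF _ ip im]) measurable
    also have "(\<integral>y. indicator {0<..} y * h y \<partial>lborel) = (\<integral>s. exp s * h (exp s) \<partial>lborel)"
      by (rule exp_subst(2)[symmetric]) measurable
    also have "(\<integral>y. indicator {0<..} y * h (- y) \<partial>lborel) = (\<integral>s. exp s * h (- exp s) \<partial>lborel)"
      by (rule exp_subst(2)[OF hnm, symmetric])
    finally have "T (exp u) = E * ((\<integral>s. same_side_kernel N (u - s) * F s \<partial>lborel) + (\<integral>s. opposite_kernel N (u - s) * G s \<partial>lborel))"
      unfolding hp hn by (simp only: integral_mult_right_zero distrib_left)
    moreover have "exp (- (real N - 1/2) * u) * E = 1" unfolding E_def exp_add[symmetric] by (simp add: algebra_simps)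
    ultimately show ?thesis unfolding H_def by (simp only: mult.assoc[symmetric]) simp
  qed
  note cl = carleman_log[OF N1 F G H Hc]
  have Tm [measurable]: "T \<in> borel_measurable borel"
  proof -
    have "T = (\<lambda>x. \<integral>y. \<bar>y\<bar> powr (-1/2) * inv_sqrt_rem N (x / y) * f y \<partial>lborel)" using T by auto
    then show ?thesis by simp
  qed
  have He: "(H u)\<^sup>2 = exp u * ((T (exp u))\<^sup>2 / exp u ^ (2 * N))" for u
  proof -
    have "exp (- (real N - 1/2) * u) ^ 2 = exp u / exp u ^ (2 * N)"
      unfolding exp_of_nat_mult[symmetric] exp_diff[symmetric] by (simp add: algebra_simps)
    then show ?thesis unfolding H_def power_mult_distrib by simp
  qed
  have pe: "exp (- c * s) ^ 2 = exp s * (1 / \<bar>exp s\<bar> ^ (2 * N - 1))" for s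
  proof -
    have "exp (- c * s) ^ 2 = exp s / exp s ^ (2 * N - 1)"
      unfolding exp_of_nat_mult[symmetric] exp_diff[symmetric] using N by (simp add: c_def of_nat_diff algebra_simps)
    then show ?thesis by simp
  qed
  define q where "q = (\<lambda>y. (f y)\<^sup>2 / \<bar>y\<bar> ^ (2 * N - 1))"
  have [measurable]: "q \<in> borel_measurable borel" unfolding q_def by measurable
  have qm: "(\<lambda>y. q (- y)) \<in> borel_measurable borel" by measurable
  have Fe: "(F s)\<^sup>2 = exp s * q (exp s)" and Ge: "(G s)\<^sup>2 = exp s * q (- exp s)" for s
    unfolding F_def G_def q_def power_mult_distrib pe by simp_all
  have qp: "integrable lborel (\<lambda>y. indicator {0<..} y * q y)"
    by (rule exp_subst(1)[THEN iffD1]) (use integrable_square_bounded[OF F] in \<open>simp_all add: Fe\<close>)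
  have qn: "integrable lborel (\<lambda>y. indicator {0<..} y * q (- y))"
    by (rule exp_subst(1)[OF qm, THEN iffD1]) (use integrable_square_bounded[OF G] in \<open>simp_all add: Ge\<close>)
  have "q \<in> borel_measurable borel" by measurable
  note qs = half_line_split[OF this qp qn]
  show "integrable lborel (\<lambda>y. (f y)\<^sup>2 / \<bar>y\<bar> ^ (2 * N - 1))" using qs(1) by (simp add: q_def)
  have tm: "(\<lambda>x. (T x)\<^sup>2 / x ^ (2 * N)) \<in> borel_measurable borel" by measurable
  show "integrable lborel (\<lambda>x. indicator {0<..} x * ((T x)\<^sup>2 / x ^ (2 * N)))"
    by (rule exp_subst(1)[OF tm, THEN iffD1]) (use cl(1) in \<open>simp add: He\<close>)
  have "(\<integral>x. indicator {0<..} x * ((T x)\<^sup>2 / x ^ (2 * N)) \<partial>lborel) = (\<integral>u. (H u)\<^sup>2 \<partial>lborel)"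
    unfolding He by (rule exp_subst(2)[OF tm, symmetric])
  also have "\<dots> \<le> 242 / real N * ((\<integral>s. (F s)\<^sup>2 \<partial>lborel) + (\<integral>s. (G s)\<^sup>2 \<partial>lborel))" by (rule cl(2))
  also have "(\<integral>s. (F s)\<^sup>2 \<partial>lborel) = (\<integral>y. indicator {0<..} y * q y \<partial>lborel)"
    unfolding Fe by (rule exp_subst(2)) measurable
  also have "(\<integral>s. (G s)\<^sup>2 \<partial>lborel) = (\<integral>y. indicator {0<..} y * q (- y) \<partial>lborel)"
    unfolding Ge by (rule exp_subst(2)[OF qm])
  finally show "(\<integral>x. indicator {0<..} x * ((T x)\<^sup>2 / x ^ (2 * N)) \<partial>lborel) \<le> 242 / real N * (\<integral>y. (f y)\<^sup>2 / \<bar>y\<bar> ^ (2 * N - 1) \<partial>lborel)"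
    using qs(2) by (simp add: q_def)
qed

lemma reflect_integral:
  fixes h :: "real \<Rightarrow> real"
  shows "(\<integral>y. h (- y) \<partial>lborel) = (\<integral>y. h y \<partial>lborel)"
  by (subst (2) lborel_integral_real_affine[of "-1" _ 0]) auto

text \<open>The Carleman inequality for the Riesz potential after removal of the Taylor polynomial at \<open>0\<close>.
  The factor \<open>1 / N\<close> is what permits absorption of a potential of size \<open>M\<close> for \<open>N\<close> of order
  \<open>M\<^sup>2\<close>.\<close>

theorem carleman:
  fixes f :: "real \<Rightarrow> real"
  assumes f: "\<And>y. \<bar>f y\<bar> \<le> b" and fm [measurable]: "f \<in> borel_measurable borel" and z: "\<And>y. \<bar>y\<bar> < r \<Longrightarrow> f y = 0" and r: "r > 0"
    and N: "N \<ge> 2" and T: "\<And>x. T x = (\<integral>y. \<bar>y\<bar> powr (-1/2) * inv_sqrt_rem N (x / y) * f y \<partial>lborel)"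
    and Tc: "continuous_on UNIV T"
  shows "integrable lborel (\<lambda>x. (T x)\<^sup>2 / x ^ (2 * N))"
    and "integrable lborel (\<lambda>y. (f y)\<^sup>2 / \<bar>y\<bar> ^ (2 * N - 1))"
    and "(\<integral>x. (T x)\<^sup>2 / x ^ (2 * N) \<partial>lborel) \<le> 484 / real N * (\<integral>y. (f y)\<^sup>2 / \<bar>y\<bar> ^ (2 * N - 1) \<partial>lborel)"
proof -
  have Tc1: "continuous_on {0<..} T" by (rule continuous_on_subset[OF Tc]) auto
  have Tc2: "continuous_on {0<..} (\<lambda>x. T (- x))"
    by (intro continuous_on_compose2[OF Tc] continuous_intros) auto
  have T2: "T (- x) = (\<integral>y. \<bar>y\<bar> powr (-1/2) * inv_sqrt_rem N (x / y) * f (- y) \<partial>lborel)" for x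
    unfolding T by (subst reflect_integral[symmetric]) simp
  note c1 = carleman_half[OF f fm z r N T Tc1]
  have neg: "integrable lborel (\<lambda>x. indicator {0<..} x * ((T (- x))\<^sup>2 / x ^ (2 * N)))"
    "(\<integral>x. indicator {0<..} x * ((T (- x))\<^sup>2 / x ^ (2 * N)) \<partial>lborel) \<le> 242 / real N * (\<integral>y. (f (- y))\<^sup>2 / \<bar>y\<bar> ^ (2 * N - 1) \<partial>lborel)"
    using carleman_half[of "\<lambda>y. f (- y)" b r N "\<lambda>x. T (- x)"] f z r N T2 Tc2 by auto
  have fr: "(\<integral>y. (f (- y))\<^sup>2 / \<bar>y\<bar> ^ (2 * N - 1) \<partial>lborel) = (\<integral>y. (f y)\<^sup>2 / \<bar>y\<bar> ^ (2 * N - 1) \<partial>lborel)"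
    using reflect_integral[of "\<lambda>y. (f y)\<^sup>2 / \<bar>y\<bar> ^ (2 * N - 1)"] by simp
  have [measurable]: "T \<in> borel_measurable borel" by (rule borel_measurable_continuous_onI[OF Tc])
  have tm: "(\<lambda>x. (T x)\<^sup>2 / x ^ (2 * N)) \<in> borel_measurable borel" by measurable
  have neg': "integrable lborel (\<lambda>x. indicator {0<..} x * ((T (- x))\<^sup>2 / (- x) ^ (2 * N)))" using neg(1) by simp
  note s = half_line_split[OF tm c1(1) neg']
  show "integrable lborel (\<lambda>x. (T x)\<^sup>2 / x ^ (2 * N))" by (rule s(1))
  show "integrable lborel (\<lambda>y. (f y)\<^sup>2 / \<bar>y\<bar> ^ (2 * N - 1))" by (rule c1(2))
  have "(\<integral>x. (T x)\<^sup>2 / x ^ (2 * N) \<partial>lborel) \<le> 242 / real N * (\<integral>y. (f y)\<^sup>2 / \<bar>y\<bar> ^ (2 * N - 1) \<partial>lborel) + 242 / real N * (\<integral>y. (f y)\<^sup>2 / \<bar>y\<bar> ^ (2 * N - 1) \<partial>lborel)"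
  proof -
    have "(\<integral>x. (T x)\<^sup>2 / x ^ (2 * N) \<partial>lborel) = (\<integral>x. indicator {0<..} x * ((T x)\<^sup>2 / x ^ (2 * N)) \<partial>lborel)
       + (\<integral>x. indicator {0<..} x * ((T (- x))\<^sup>2 / x ^ (2 * N)) \<partial>lborel)"
      using s(2) by simp
    then show ?thesis using c1(3) neg(2)[unfolded fr] by linarith
  qed
  then show "(\<integral>x. (T x)\<^sup>2 / x ^ (2 * N) \<partial>lborel) \<le> 484 / real N * (\<integral>y. (f y)\<^sup>2 / \<bar>y\<bar> ^ (2 * N - 1) \<partial>lborel)"
    by simp
qed

section \<open>Polynomial coefficients from values at equidistant points\<close>

text \<open>The weighted \<open>\<ell>\<^sup>1\<close> norm of the first \<open>n\<close> coefficients. It is submultiplicative on linear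
  factors, which is how Lagrange basis polynomials are estimated.\<close>

definition coeff_norm :: "nat \<Rightarrow> real \<Rightarrow> real poly \<Rightarrow> real" where
  "coeff_norm n l Q = (\<Sum>k<n. \<bar>coeff Q k\<bar> * l ^ k)"

lemma coeff_norm_nonneg: "l \<ge> 0 \<Longrightarrow> coeff_norm n l Q \<ge> 0" unfolding coeff_norm_def by (intro sum_nonneg) auto

lemma coeff_norm_add: "l \<ge> 0 \<Longrightarrow> coeff_norm n l (P + Q) \<le> coeff_norm n l P + coeff_norm n l Q"
  unfolding coeff_norm_def sum.distrib[symmetric]
  by (intro sum_mono) (auto simp: distrib_right[symmetric] intro!: mult_right_mono abs_triangle_ineq)

lemma coeff_norm_smult: "coeff_norm n l (smult a Q) = \<bar>a\<bar> * coeff_norm n l Q"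
  unfolding coeff_norm_def by (simp add: abs_mult sum_distrib_left mult.assoc)

lemma coeff_norm_pCons0:
  assumes l: "l \<ge> 0"
  shows "coeff_norm n l (pCons 0 Q) \<le> l * coeff_norm n l Q"
proof (cases n)
  case (Suc m)
  have "coeff_norm n l (pCons 0 Q) = (\<Sum>k<m. \<bar>coeff Q k\<bar> * l ^ Suc k)"
    unfolding coeff_norm_def Suc by (subst sum.lessThan_Suc_shift) simp
  also have "\<dots> = l * (\<Sum>k<m. \<bar>coeff Q k\<bar> * l ^ k)" by (simp add: sum_distrib_left mult_ac)
  also have "\<dots> \<le> l * coeff_norm n l Q" unfolding coeff_norm_def Suc using l by (intro mult_left_mono) auto
  finally show ?thesis .
qed (simp add: coeff_norm_def)

lemma coeff_norm_linear:
  assumes l: "l \<ge> 0"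
  shows "coeff_norm n l ([:- a, 1:] * Q) \<le> (l + \<bar>a\<bar>) * coeff_norm n l Q"
proof -
  have e: "[:- a, 1:] * Q = pCons 0 Q + smult (- a) Q" by simp
  have "coeff_norm n l ([:- a, 1:] * Q) \<le> coeff_norm n l (pCons 0 Q) + coeff_norm n l (smult (- a) Q)" unfolding e by (rule coeff_norm_add[OF l])
  also have "\<dots> \<le> l * coeff_norm n l Q + \<bar>a\<bar> * coeff_norm n l Q" using coeff_norm_pCons0[OF l, of n Q] unfolding coeff_norm_smult by simp
  finally show ?thesis by (simp add: distrib_right)
qed

lemma coeff_norm_1: "coeff_norm n l 1 \<le> 1"
proof (cases n)
  case (Suc m)
  have "coeff_norm n l 1 = (\<Sum>k<n. if k = 0 then 1 else 0)" unfolding coeff_norm_def by (intro sum.cong) auto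
  then show ?thesis using Suc by simp
qed (simp add: coeff_norm_def)

lemma coeff_norm_prod:
  assumes l: "l \<ge> 0" and I: "finite I"
  shows "coeff_norm n l (\<Prod>i\<in>I. smult (c i) [:- a i, 1:]) \<le> (\<Prod>i\<in>I. \<bar>c i\<bar> * (l + \<bar>a i\<bar>))"
  using I
proof (induction I rule: finite_induct)
  case empty then show ?case by (simp add: coeff_norm_1)
next
  case (insert i I)
  let ?P = "\<Prod>i\<in>I. smult (c i) [:- a i, 1:]"
  have "coeff_norm n l (\<Prod>i\<in>insert i I. smult (c i) [:- a i, 1:]) = coeff_norm n l (smult (c i) ([:- a i, 1:] * ?P))"
    using insert by (simp only: prod.insert[OF insert.hyps] mult_smult_left)
  also have "\<dots> \<le> \<bar>c i\<bar> * ((l + \<bar>a i\<bar>) * coeff_norm n l ?P)"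
    unfolding coeff_norm_smult by (intro mult_left_mono coeff_norm_linear l) auto
  also have "\<dots> \<le> \<bar>c i\<bar> * ((l + \<bar>a i\<bar>) * (\<Prod>i\<in>I. \<bar>c i\<bar> * (l + \<bar>a i\<bar>)))"
    using l by (intro mult_left_mono insert.IH) auto
  also have "\<dots> = (\<Prod>i\<in>insert i I. \<bar>c i\<bar> * (l + \<bar>a i\<bar>))"
    using insert by simp
  finally show ?case .
qed

lemma lagrange_denominator:
  assumes j: "j < m"
  shows "(\<Prod>i\<in>{..<m} - {j}. \<bar>real j - real i\<bar>) = fact j * fact (m - 1 - j)"
proof -
  have s: "{..<m} - {j} = {..<j} \<union> {Suc j..<m}" using j by auto
  have "(\<Prod>i\<in>{..<m} - {j}. \<bar>real j - real i\<bar>) = (\<Prod>i<j. \<bar>real j - real i\<bar>) * (\<Prod>i\<in>{Suc j..<m}. \<bar>real j - real i\<bar>)"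
    unfolding s by (rule prod.union_disjoint) auto
  also have "(\<Prod>i<j. \<bar>real j - real i\<bar>) = (\<Prod>i<j. real (Suc i))"
    by (subst prod.nat_diff_reindex[symmetric]) (intro prod.cong, auto simp: of_nat_diff)
  also have "\<dots> = fact j" by (simp add: fact_prod_Suc lessThan_atLeast0)
  also have "(\<Prod>i\<in>{Suc j..<m}. \<bar>real j - real i\<bar>) = (\<Prod>i<m - 1 - j. real (Suc i))"
    by (rule prod.reindex_bij_witness[of _ "\<lambda>i. i + Suc j" "\<lambda>i. i - Suc j"]) (use j in auto)
  also have "\<dots> = fact (m - 1 - j)" by (simp add: fact_prod_Suc lessThan_atLeast0)
  finally show ?thesis .
qed

lemma lagrange_numerator:
  assumes j: "j < m"
  shows "(\<Prod>i\<in>{..<m} - {j}. real m + real i) * fact m \<le> fact (2 * m - 1)"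
proof -
  have m: "m > 0" using j by simp
  have "(real m + real j) * (\<Prod>i\<in>{..<m} - {j}. real m + real i) = (\<Prod>i<m. real m + real i)"
    using j by (subst prod.remove[of "{..<m}" j]) auto
  also have "\<dots> * fact (m - 1) = fact (2 * m - 1)"
  proof -
    have "(\<Prod>i<n. real m + real i) * fact (m - 1) = fact (m + n - 1)" for n
    proof (induction n)
      case (Suc n)
      have "(\<Prod>i<Suc n. real m + real i) * fact (m - 1) = (real m + real n) * ((\<Prod>i<n. real m + real i) * fact (m - 1))" by simp
      also have "\<dots> = real (m + n) * fact (m + n - 1)" by (simp only: Suc of_nat_add)
      also have "\<dots> = fact (m + n)" using m by (subst (2) fact_reduce) auto
      finally show ?case by simp
    qed simp
    from this[of m] show ?thesis by (simp add: mult_2)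
  qed
  finally have "(real m + real j) * ((\<Prod>i\<in>{..<m} - {j}. real m + real i) * fact (m - 1)) = fact (2 * m - 1)"
    by (simp add: mult.assoc)
  moreover have "real m * ((\<Prod>i\<in>{..<m} - {j}. real m + real i) * fact (m - 1)) \<le> (real m + real j) * ((\<Prod>i\<in>{..<m} - {j}. real m + real i) * fact (m - 1))"
    by (intro mult_right_mono mult_nonneg_nonneg prod_nonneg) auto
  moreover have "(fact m :: real) = real m * fact (m - 1)" using m by (rule fact_reduce)
  ultimately show ?thesis by (simp add: mult_ac)
qed

lemma lagrange_basis_bound:
  assumes j: "j < m"
  shows "(\<Prod>i\<in>{..<m} - {j}. \<bar>1 / (real j - real i)\<bar> * (real m + \<bar>real i\<bar>)) \<le> real ((2 * m - 1) choose m) * real ((m - 1) choose j)"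
proof -
  have "(\<Prod>i\<in>{..<m} - {j}. \<bar>1 / (real j - real i)\<bar> * (real m + \<bar>real i\<bar>))
     = (\<Prod>i\<in>{..<m} - {j}. (real m + real i) / \<bar>real j - real i\<bar>)"
    by (intro prod.cong) auto
  also have "\<dots> = (\<Prod>i\<in>{..<m} - {j}. real m + real i) / (fact j * fact (m - 1 - j))"
    unfolding prod_dividef lagrange_denominator[OF j] ..
  also have "\<dots> \<le> (fact (2 * m - 1) / fact m) / (fact j * fact (m - 1 - j))"
    using lagrange_numerator[OF j] by (intro divide_right_mono) (auto simp: pos_le_divide_eq)
  also have "\<dots> = (fact (2 * m - 1) / (fact m * fact (m - 1))) * (fact (m - 1) / (fact j * fact (m - 1 - j)))"
    by simp
  also have "(fact (m - 1) / (fact j * fact (m - 1 - j)) :: real) = real ((m - 1) choose j)"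
    using j by (subst binomial_fact) auto
  also have "(fact (2 * m - 1) / (fact m * fact (m - 1)) :: real) = real ((2 * m - 1) choose m)"
  proof -
    have "2 * m - 1 - m = m - 1" by simp
    moreover have "m \<le> 2 * m - 1" using j by simp
    ultimately show ?thesis using binomial_fact[of m "2 * m - 1", where 'a=real] by simp
  qed
  finally show ?thesis .
qed

text \<open>The polynomial is rescaled so that the nodes become \<open>0, \<dots>, m - 1\<close> and the radius \<open>\<rho>\<close> becomes
  \<open>m\<close>, and is expanded in the Lagrange basis. The coefficient norms of the basis polynomials are
  products of two binomial coefficients, whose sum is at most \<open>4\<^sup>m * 2\<^sup>m\<close>.\<close>

lemma coefficient_bound:
  fixes p :: "nat \<Rightarrow> real"
  assumes m: "m > 0" and \<rho>: "\<rho> > 0" and \<delta>: "\<delta> \<ge> 0"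
    and v: "\<And>j. j < m \<Longrightarrow> \<bar>\<Sum>k<m. p k * (\<rho> * real j / real m) ^ k\<bar> \<le> \<delta>"
  shows "(\<Sum>k<m. \<bar>p k\<bar> * \<rho> ^ k) \<le> 8 ^ m * \<delta>"
proof -
  \<comment> \<open>In the variable of \<open>Q\<close> the nodes are the integers below \<open>m\<close>.\<close>
  define Q where "Q = (\<Sum>k<m. monom (p k * (\<rho> / real m) ^ k) k)"
  have cQ: "coeff Q k = (if k < m then p k * (\<rho> / real m) ^ k else 0)" for k
    unfolding Q_def coeff_sum by (simp add: sum.If_cases Int_def)
  have pQ: "poly Q (real j) = (\<Sum>k<m. p k * (\<rho> * real j / real m) ^ k)" for j
    unfolding Q_def poly_sum by (intro sum.cong refl) (simp add: poly_monom power_mult_distrib power_divide)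
  define L where "L = (\<lambda>j. \<Prod>i\<in>{..<m} - {j}. smult (1 / (real j - real i)) [:- real i, 1:])"
  have degL: "degree (L j) \<le> m - 1" if "j < m" for j
  proof -
    have "degree (L j) \<le> (\<Sum>i\<in>{..<m} - {j}. degree (smult (1 / (real j - real i)) [:- real i, 1:]))"
      unfolding L_def by (rule degree_prod_sum_le[unfolded comp_def]) simp
    also have "\<dots> \<le> (\<Sum>i\<in>{..<m} - {j}. 1)" by (intro sum_mono) auto
    also have "\<dots> = m - 1" using that by simp
    finally show ?thesis .
  qed
  have pL: "poly (L j) (real i) = (if i = j then 1 else 0)" if "i < m" "j < m" for i j
  proof (cases "i = j")
    case True
    then show ?thesis unfolding L_def poly_prod by (auto intro!: prod.neutral simp: divide_simps)
  next
    case False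
    then show ?thesis unfolding L_def poly_prod using that by (auto intro!: prod_zero)
  qed
  have QL: "Q = (\<Sum>j<m. smult (poly Q (real j)) (L j))"
  proof (rule poly_eqI_degree[of "real ` {..<m}"])
    have c: "card (real ` {..<m}) = m" by (subst card_image) auto
    have "degree Q \<le> m - 1" by (rule degree_le) (use m in \<open>auto simp: cQ\<close>)
    then show "degree Q < card (real ` {..<m})" using m c by simp
    have "degree (\<Sum>j<m. smult (poly Q (real j)) (L j)) \<le> m - 1"
      by (rule degree_sum_le) (use degL in \<open>auto intro!: order_trans[OF degree_smult_le]\<close>)
    then show "degree (\<Sum>j<m. smult (poly Q (real j)) (L j)) < card (real ` {..<m})" using m c by simp
    fix x assume "x \<in> real ` {..<m}"
    then obtain i where i: "i < m" "x = real i" by auto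
    have "poly (\<Sum>j<m. smult (poly Q (real j)) (L j)) (real i) = (\<Sum>j<m. if i = j then poly Q (real j) else 0)"
      unfolding poly_sum poly_smult using i by (intro sum.cong) (auto simp: pL)
    then show "poly Q x = poly (\<Sum>j<m. smult (poly Q (real j)) (L j)) x" using i by simp
  qed
  have sumle: "coeff_norm m l (\<Sum>j\<in>J. A j) \<le> (\<Sum>j\<in>J. coeff_norm m l (A j))" if "finite J" "l \<ge> 0" for J l and A :: "nat \<Rightarrow> real poly"
    using that(1)
  proof (induction J rule: finite_induct)
    case empty then show ?case by (simp add: coeff_norm_def)
  next
    case (insert j J)
    then show ?case using coeff_norm_add[OF that(2), of m "A j" "\<Sum>j\<in>J. A j"] by simp
  qed
  have "(\<Sum>k<m. \<bar>p k\<bar> * \<rho> ^ k) = coeff_norm m (real m) Q"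
    unfolding coeff_norm_def cQ using m \<rho> by (intro sum.cong refl) (simp add: abs_mult power_divide)
  also have "\<dots> \<le> (\<Sum>j<m. coeff_norm m (real m) (smult (poly Q (real j)) (L j)))"
    by (subst QL) (rule sumle, auto)
  also have "\<dots> \<le> (\<Sum>j<m. \<delta> * (real ((2 * m - 1) choose m) * real ((m - 1) choose j)))"
  proof (intro sum_mono)
    fix j assume j: "j \<in> {..<m}"
    have "coeff_norm m (real m) (L j) \<le> (\<Prod>i\<in>{..<m} - {j}. \<bar>1 / (real j - real i)\<bar> * (real m + \<bar>real i\<bar>))"
      unfolding L_def by (rule coeff_norm_prod) auto
    also have "\<dots> \<le> real ((2 * m - 1) choose m) * real ((m - 1) choose j)"
      by (rule lagrange_basis_bound) (use j in simp)
    finally have "coeff_norm m (real m) (L j) \<le> real ((2 * m - 1) choose m) * real ((m - 1) choose j)" .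
    moreover have "\<bar>poly Q (real j)\<bar> \<le> \<delta>" unfolding pQ using v j by simp
    ultimately show "coeff_norm m (real m) (smult (poly Q (real j)) (L j)) \<le> \<delta> * (real ((2 * m - 1) choose m) * real ((m - 1) choose j))"
      unfolding coeff_norm_smult using \<delta> by (intro mult_mono coeff_norm_nonneg) auto
  qed
  also have "\<dots> = \<delta> * (real ((2 * m - 1) choose m) * (\<Sum>j<m. real ((m - 1) choose j)))"
    by (simp only: sum_distrib_left)
  also have "(\<Sum>j<m. real ((m - 1) choose j)) = 2 ^ (m - 1)"
  proof -
    have "{..<m} = {..m - 1}" using m by auto
    then have "(\<Sum>j<m. real ((m - 1) choose j)) = real (\<Sum>j\<le>m - 1. (m - 1) choose j)" by simp
    then show ?thesis by (simp only: choose_row_sum) simp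
  qed
  also have "\<delta> * (real ((2 * m - 1) choose m) * 2 ^ (m - 1)) \<le> \<delta> * (2 ^ (2 * m) * 2 ^ m)"
  proof (intro mult_left_mono mult_mono \<delta>)
    have "(2 * m - 1) choose m \<le> 2 ^ (2 * m - 1)" by (rule binomial_le_pow2)
    also have "\<dots> \<le> 2 ^ (2 * m)" by (rule power_increasing) auto
    finally show "real ((2 * m - 1) choose m) \<le> 2 ^ (2 * m)" by (metis of_nat_le_iff of_nat_numeral of_nat_power)
    show "(2::real) ^ (m - 1) \<le> 2 ^ m" by (rule power_increasing) auto
  qed auto
  also have "\<dots> = 8 ^ m * \<delta>" by (simp add: power_mult power_mult_distrib[symmetric])
  finally show ?thesis .
qed

section \<open>Near and far parts of the Riesz potential\<close>

lemma fundamental_const_pos: "fundamental_const > 0" unfolding fundamental_const_def using riesz_const_pos laplace_const_pos beta_const_pos by simp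

text \<open>The constant in the Hoelder estimate of the Riesz potential of a bounded function.\<close>

definition riesz_diff_mass :: real where "riesz_diff_mass = (\<integral>y. \<bar>riesz_diff 0 1 y\<bar> \<partial>lborel)"

lemma riesz_diff_mass_nonneg: "riesz_diff_mass \<ge> 0" unfolding riesz_diff_mass_def by simp

lemma riesz_diff_integrable: "integrable lborel (riesz_diff x x')"
  using riesz_fubini(1)[of "\<lambda>_. 1" 1 x x'] by simp

lemma riesz_diff_mass_scaling: "(\<integral>y. \<bar>riesz_diff x x' y\<bar> \<partial>lborel) = sqrt \<bar>x - x'\<bar> * riesz_diff_mass"
proof (cases "x = x'")
  case False
  define h where "h = x' - x"
  have h: "h \<noteq> 0" using False by (simp add: h_def)
  have sc: "\<bar>riesz_diff x x' (x + h * t)\<bar> = \<bar>h\<bar> powr (-1/2) * \<bar>riesz_diff 0 1 t\<bar>" for t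
  proof -
    have e: "x + h * t - x' = h * (t - 1)" "x + h * t - x = h * (t - 0)" by (simp_all add: h_def algebra_simps)
    have "riesz_diff x x' (x + h * t) = \<bar>h\<bar> powr (-1/2) * riesz_diff 0 1 t"
    proof -
      have pm: "\<bar>h * u\<bar> powr a = \<bar>h\<bar> powr a * \<bar>u\<bar> powr a" for u a by (simp add: abs_mult powr_mult)
      show ?thesis unfolding riesz_diff_def e pm by (rule right_diff_distrib[symmetric])
    qed
    then show ?thesis by (simp add: abs_mult)
  qed
  have "(\<integral>y. \<bar>riesz_diff x x' y\<bar> \<partial>lborel) = \<bar>h\<bar> * (\<integral>t. \<bar>riesz_diff x x' (x + h * t)\<bar> \<partial>lborel)"
    using h by (subst lborel_integral_real_affine[of h _ x]) auto
  also have "(\<integral>t. \<bar>riesz_diff x x' (x + h * t)\<bar> \<partial>lborel) = \<bar>h\<bar> powr (-1/2) * riesz_diff_mass"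
    unfolding sc riesz_diff_mass_def by (rule integral_mult_right_zero)
  also have "\<bar>h\<bar> * (\<bar>h\<bar> powr (-1/2) * riesz_diff_mass) = (\<bar>h\<bar> / sqrt \<bar>h\<bar>) * riesz_diff_mass"
    using h by (simp add: powr_minus_divide powr_half_sqrt)
  also have "\<bar>h\<bar> / sqrt \<bar>h\<bar> = sqrt \<bar>h\<bar>" by (rule real_div_sqrt) simp
  finally show ?thesis by (simp add: h_def abs_minus_commute)
qed (simp add: riesz_diff_def)

lemma continuous_of_hoelder_half:
  fixes w :: "real \<Rightarrow> real"
  assumes h: "\<And>x x'. \<bar>w x - w x'\<bar> \<le> a * sqrt \<bar>x - x'\<bar>"
  shows "continuous_on UNIV w"
proof -
  have "isCont w x" for x
  proof -
    have "((\<lambda>z. w z - w x) \<longlongrightarrow> 0) (at x)"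
    proof (rule Lim_null_comparison)
      show "eventually (\<lambda>z. norm (w z - w x) \<le> a * sqrt \<bar>z - x\<bar>) (at x)"
        using h by (intro always_eventually allI) simp
      have "((\<lambda>z. a * sqrt \<bar>z - x\<bar>) \<longlongrightarrow> a * sqrt \<bar>x - x\<bar>) (at x)" by (intro tendsto_intros)
      then show "((\<lambda>z. a * sqrt \<bar>z - x\<bar>) \<longlongrightarrow> 0) (at x)" by simp
    qed
    then show ?thesis by (simp add: isCont_def LIM_zero_iff)
  qed
  then show ?thesis by (simp add: continuous_at_imp_continuous_on)
qed

lemma riesz_hoelder:
  fixes f :: "real \<Rightarrow> real"
  assumes f: "\<And>y. \<bar>f y\<bar> \<le> b" and [measurable]: "f \<in> borel_measurable borel"
  shows "\<bar>\<integral>y. f y * riesz_diff x x' y \<partial>lborel\<bar> \<le> b * (sqrt \<bar>x - x'\<bar> * riesz_diff_mass)"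
proof (rule integral_bounded_factor(2)[OF f])
  have "(\<integral>\<^sup>+y. ennreal \<bar>riesz_diff x x' y\<bar> \<partial>lborel) = ennreal (\<integral>y. \<bar>riesz_diff x x' y\<bar> \<partial>lborel)"
    using riesz_diff_integrable by (intro nn_integral_eq_integral) auto
  then show "(\<integral>\<^sup>+y. ennreal \<bar>riesz_diff x x' y\<bar> \<partial>lborel) \<le> ennreal (sqrt \<bar>x - x'\<bar> * riesz_diff_mass)" by (simp add: riesz_diff_mass_scaling)
qed (auto simp: riesz_diff_mass_nonneg)

lemma abs_powr_tail:
  fixes a c :: real
  assumes "a < -1" "c > 0"
  shows "has_bochner_integral lborel (\<lambda>y. indicator {y. \<bar>y\<bar> \<ge> c} y * \<bar>y\<bar> powr a) (2 * (c powr (a + 1) / (- (a + 1))))"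
proof -
  have "(\<integral>\<^sup>+t. ennreal (t powr a) * indicator {c..} t \<partial>lborel) = ennreal (0 - c powr (a + 1) / (a + 1))"
  proof (rule nn_integral_FTC_atLeast)
    show "((\<lambda>t. t powr (a + 1) / (a + 1)) \<longlongrightarrow> 0) at_top"
      using assms by real_asymp
    show "((\<lambda>t. t powr (a + 1) / (a + 1)) has_real_derivative t powr a) (at t)" if "c \<le> t" for t
      using that assms by (auto intro!: derivative_eq_intros)
  qed auto
  moreover have "ennreal (indicator {c..} t * t powr a) = ennreal (t powr a) * indicator {c..} t" for t
    by (auto simp: indicator_def)
  moreover have "0 - c powr (a + 1) / (a + 1) = c powr (a + 1) / (- (a + 1))" by (simp only: diff_0 minus_divide_right)
  ultimately have "(\<integral>\<^sup>+t. ennreal (indicator {c..} t * t powr a) \<partial>lborel) = ennreal (c powr (a + 1) / (- (a + 1)))"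
    by (simp only:)
  then have h: "has_bochner_integral lborel (\<lambda>t. indicator {c..} t * t powr a) (c powr (a + 1) / (- (a + 1)))"
    by (intro has_bochner_integral_nn_integral) (use assms in \<open>auto simp: divide_nonneg_pos\<close>)
  have "has_bochner_integral lborel (\<lambda>t. indicator {c..} t * t powr a + indicator {c..} (- t) * (- t) powr a)
     (c powr (a + 1) / (- (a + 1)) + c powr (a + 1) / (- (a + 1)))"
    by (intro has_bochner_integral_add h has_bochner_integral_reflect[OF h])
  moreover have "indicator {c..} t * t powr a + indicator {c..} (- t) * (- t) powr a = indicator {y. \<bar>y\<bar> \<ge> c} t * \<bar>t\<bar> powr a" for t
    using assms by (auto simp: indicator_def abs_if)
  ultimately show ?thesis by simp
qed

definition local_riesz_mass :: real where "local_riesz_mass = (\<integral>y. indicator {-1..1} y * \<bar>y\<bar> powr (-1/2) \<partial>lborel)"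
definition local_riesz_const :: real where "local_riesz_const = 2 * local_riesz_mass + 2"

lemma local_riesz_mass_integrable: "integrable lborel (\<lambda>y::real. indicator {-1..1} y * \<bar>y\<bar> powr (-1/2))"
proof -
  have i: "integrable lborel (\<lambda>t. pos_powr (-1/2) t * indicator {..1} t)" by (rule integrable_pos_powr_at_0) simp
  have "integrable lborel (\<lambda>t. pos_powr (-1/2) t * indicator {..1} t + pos_powr (-1/2) (- t) * indicator {..1} (- t))"
    using i has_bochner_integral_reflect[OF has_bochner_integral_integrable[OF i]]
    by (intro Bochner_Integration.integrable_add) (auto simp: has_bochner_integral_iff)
  moreover have "pos_powr (-1/2) t * indicator {..1} t + pos_powr (-1/2) (- t) * indicator {..1} (- t) = indicator {-1..1} t * \<bar>t\<bar> powr (-1/2)" for t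
    by (auto simp: pos_powr_def indicator_def abs_if)
  ultimately show ?thesis by simp
qed

lemma local_riesz_const_pos: "local_riesz_const > 0" unfolding local_riesz_const_def local_riesz_mass_def by (intro add_nonneg_pos mult_nonneg_nonneg) auto

text \<open>For \<open>f\<close> supported in \<open>[-1, 1]\<close> the two singularities can be estimated separately, uniformly
  in \<open>x\<close>: at distance more than \<open>1\<close> from \<open>x\<close> the kernel \<open>\<bar>y - x\<bar> powr (-1/2)\<close> is at most \<open>1\<close>.\<close>

lemma local_part_bound:
  fixes f :: "real \<Rightarrow> real"
  assumes f: "\<And>y. \<bar>f y\<bar> \<le> b" and [measurable]: "f \<in> borel_measurable borel" and z: "\<And>y. \<bar>y\<bar> > 1 \<Longrightarrow> f y = 0"
  shows "\<bar>\<integral>y. f y * riesz_diff x 0 y \<partial>lborel\<bar> \<le> b * local_riesz_const"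
proof -
  have b: "b \<ge> 0" using f[of 0] by linarith
  define k where "k = (\<lambda>y::real. indicator {-1..1} y * \<bar>y\<bar> powr (-1/2))"
  have ki: "integrable lborel k" "integrable lborel (\<lambda>y. k (- x + 1 * y))"
    using local_riesz_mass_integrable lborel_integrable_real_affine[OF local_riesz_mass_integrable, of 1 "-x"] by (auto simp: k_def)
  have kx: "(\<integral>y. k (- x + 1 * y) \<partial>lborel) = local_riesz_mass"
    unfolding local_riesz_mass_def k_def[symmetric] using lborel_integral_real_affine[of 1 k "-x"] by (simp add: k_def)
  have ii: "integrable lborel (\<lambda>y. b * (k (- x + 1 * y) + indicator {-1..1} y + k y))"
    using ki by auto
  have "\<bar>\<integral>y. f y * riesz_diff x 0 y \<partial>lborel\<bar> \<le> (\<integral>y. b * (k (- x + 1 * y) + indicator {-1..1} y + k y) \<partial>lborel)"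
  proof (rule integral_abs_bound_integral[OF riesz_fubini(1)[OF f] ii])
    fix y
    show "\<bar>f y * riesz_diff x 0 y\<bar> \<le> b * (k (- x + 1 * y) + indicator {-1..1} y + k y)"
    proof (cases "\<bar>y\<bar> > 1")
      case True then show ?thesis using z[of y] b by (simp add: k_def)
    next
      case False
      have "\<bar>y - x\<bar> powr (-1/2) \<le> k (- x + 1 * y) + 1"
      proof (cases "\<bar>y - x\<bar> \<le> 1")
        case True
        then have "- x + y \<in> {-1..1}" by auto
        then show ?thesis by (simp add: k_def)
      next
        case False
        then have "\<bar>y - x\<bar> powr (-1/2) \<le> 1 powr (-1/2)" by (intro powr_mono2') auto
        moreover have "k (- x + 1 * y) \<ge> 0" by (simp add: k_def)
        ultimately show ?thesis by simp
      qed
      moreover have "y \<in> {-1..1}" using False by auto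
      then have "\<bar>y\<bar> powr (-1/2) = k y" "indicator {-1..1} y = (1::real)" by (simp_all add: k_def)
      moreover have "\<bar>riesz_diff x 0 y\<bar> \<le> \<bar>y - x\<bar> powr (-1/2) + \<bar>y\<bar> powr (-1/2)"
        unfolding riesz_diff_def by (rule order_trans[OF abs_triangle_ineq4]) simp
      ultimately have "\<bar>riesz_diff x 0 y\<bar> \<le> k (- x + 1 * y) + indicator {-1..1} y + k y" by linarith
      then show ?thesis unfolding abs_mult using f b by (intro mult_mono) auto
    qed
  qed measurable
  also have "\<dots> = b * (local_riesz_mass + 2 + local_riesz_mass)"
  proof -
    have kk: "(\<integral>y. k y \<partial>lborel) = local_riesz_mass" by (simp only: local_riesz_mass_def k_def)
    show ?thesis using ki kx kk by simp
  qed
  finally show ?thesis by (simp add: local_riesz_const_def)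
qed

lemma far_coefficient_integrable:
  fixes f :: "real \<Rightarrow> real"
  assumes f: "\<And>y. \<bar>f y\<bar> \<le> b" and [measurable]: "f \<in> borel_measurable borel" and z: "\<And>y. \<bar>y\<bar> < r \<Longrightarrow> f y = 0" and r: "r > 0" and k: "k \<ge> 1"
  shows "integrable lborel (\<lambda>y. \<bar>y\<bar> powr (-1/2) * (f y / y ^ k))"
proof (rule Bochner_Integration.integrable_bound)
  have a: "-1/2 - real k < -1" using k by simp
  show "integrable lborel (\<lambda>y. b * (indicator {y. \<bar>y\<bar> \<ge> r} y * \<bar>y\<bar> powr (-1/2 - real k)))"
    using integrable.intros[OF abs_powr_tail[OF a r]] by simp
  have b: "b \<ge> 0" using f[of 0] by linarith
  have "\<bar>\<bar>y\<bar> powr (-1/2) * (f y / y ^ k)\<bar> \<le> b * (indicator {y. \<bar>y\<bar> \<ge> r} y * \<bar>y\<bar> powr (-1/2 - real k))" for y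
  proof (cases "\<bar>y\<bar> < r")
    case True then show ?thesis using z b by simp
  next
    case False
    then have y: "y \<noteq> 0" using r by auto
    have "\<bar>\<bar>y\<bar> powr (-1/2) * (f y / y ^ k)\<bar> = \<bar>f y\<bar> * (\<bar>y\<bar> powr (-1/2) * (1 / \<bar>y\<bar> ^ k))"
      by (simp add: abs_mult power_abs)
    also have "1 / \<bar>y\<bar> ^ k = \<bar>y\<bar> powr (- real k)" using y by (simp add: powr_minus_divide powr_realpow)
    also have "\<bar>y\<bar> powr (-1/2) * \<bar>y\<bar> powr (- real k) = \<bar>y\<bar> powr (-1/2 - real k)" by (simp add: powr_add[symmetric])
    finally show ?thesis using False f[of y] by (simp add: mult_right_mono)
  qed
  then show "AE y in lborel. norm (\<bar>y\<bar> powr (-1/2) * (f y / y ^ k)) \<le> norm (b * (indicator {y. \<bar>y\<bar> \<ge> r} y * \<bar>y\<bar> powr (-1/2 - real k)))"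
    using b by (intro AE_I2) (simp add: abs_mult)
qed measurable

text \<open>When \<open>f\<close> vanishes near \<open>0\<close>, the kernel can be expanded in powers of \<open>x / y\<close> under the
  integral. The term of order \<open>0\<close> cancels against the base point \<open>0\<close> of the difference kernel,
  and the other coefficients converge since \<open>\<bar>y\<bar> powr (-1/2) / \<bar>y\<bar>\<^sup>k\<close> is integrable at infinity for
  \<open>k \<ge> 1\<close>.\<close>

lemma far_taylor:
  fixes f :: "real \<Rightarrow> real"
  assumes f: "\<And>y. \<bar>f y\<bar> \<le> b" and fm [measurable]: "f \<in> borel_measurable borel" and z: "\<And>y. \<bar>y\<bar> < r \<Longrightarrow> f y = 0" and r: "r > 0" and N: "N \<ge> 1"
  shows "(\<integral>y. f y * riesz_diff x 0 y \<partial>lborel) = (\<Sum>k\<in>{1..<N}. (inv_sqrt_coeff k * (\<integral>y. \<bar>y\<bar> powr (-1/2) * (f y / y ^ k) \<partial>lborel)) * x ^ k)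
     + (\<integral>y. \<bar>y\<bar> powr (-1/2) * inv_sqrt_rem N (x / y) * f y \<partial>lborel)"
proof -
  define g where "g = (\<lambda>k y. \<bar>y\<bar> powr (-1/2) * (f y / y ^ k))"
  have gi: "integrable lborel (g k)" if "k \<in> {1..<N}" for k
    unfolding g_def by (rule far_coefficient_integrable[OF f fm z r]) (use that in auto)
  have pt: "\<bar>y\<bar> powr (-1/2) * inv_sqrt_rem N (x / y) * f y = f y * riesz_diff x 0 y - (\<Sum>k\<in>{1..<N}. (inv_sqrt_coeff k * x ^ k) * g k y)" if y: "y \<noteq> 0" for y
  proof -
    have "\<bar>y - x\<bar> = \<bar>y\<bar> * \<bar>1 - x / y\<bar>" using y by (simp add: abs_mult[symmetric] right_diff_distrib)
    then have 1: "\<bar>y - x\<bar> powr (-1/2) = \<bar>y\<bar> powr (-1/2) * \<bar>1 - x / y\<bar> powr (-1/2)" by (simp only: powr_mult abs_ge_zero)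
    have "(\<Sum>k<N. inv_sqrt_coeff k * (x / y) ^ k) = 1 + (\<Sum>k\<in>{1..<N}. inv_sqrt_coeff k * (x / y) ^ k)"
      using N by (simp add: lessThan_atLeast0 sum.atLeast_Suc_lessThan)
    moreover have "\<bar>y\<bar> powr (-1/2) * (\<Sum>k\<in>{1..<N}. inv_sqrt_coeff k * (x / y) ^ k) * f y = (\<Sum>k\<in>{1..<N}. (inv_sqrt_coeff k * x ^ k) * g k y)"
      unfolding g_def sum_distrib_left sum_distrib_right by (intro sum.cong refl) (simp add: power_divide)
    ultimately show ?thesis unfolding inv_sqrt_rem_def riesz_diff_def 1 by (simp add: algebra_simps)
  qed
  have "AE y in lborel. \<bar>y\<bar> powr (-1/2) * inv_sqrt_rem N (x / y) * f y = f y * riesz_diff x 0 y - (\<Sum>k\<in>{1..<N}. (inv_sqrt_coeff k * x ^ k) * g k y)"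
    using AE_lborel_singleton[of 0] by eventually_elim (rule pt)
  then have "(\<integral>y. \<bar>y\<bar> powr (-1/2) * inv_sqrt_rem N (x / y) * f y \<partial>lborel) = (\<integral>y. f y * riesz_diff x 0 y - (\<Sum>k\<in>{1..<N}. (inv_sqrt_coeff k * x ^ k) * g k y) \<partial>lborel)"
    by (rule integral_cong_AE[rotated 2]) (unfold g_def, measurable)
  also have "\<dots> = (\<integral>y. f y * riesz_diff x 0 y \<partial>lborel) - (\<integral>y. (\<Sum>k\<in>{1..<N}. (inv_sqrt_coeff k * x ^ k) * g k y) \<partial>lborel)"
    by (intro Bochner_Integration.integral_diff riesz_fubini(1)[OF f fm] Bochner_Integration.integrable_sum integrable_mult_right gi)
  also have "(\<integral>y. (\<Sum>k\<in>{1..<N}. (inv_sqrt_coeff k * x ^ k) * g k y) \<partial>lborel) = (\<Sum>k\<in>{1..<N}. (inv_sqrt_coeff k * x ^ k) * (\<integral>y. g k y \<partial>lborel))"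
    by (subst Bochner_Integration.integral_sum) (auto intro!: integrable_mult_right gi)
  finally show ?thesis by (simp add: g_def mult_ac)
qed

lemma far_remainder_small:
  fixes f :: "real \<Rightarrow> real"
  assumes f: "\<And>y. \<bar>f y\<bar> \<le> b" and fm [measurable]: "f \<in> borel_measurable borel" and z: "\<And>y. \<bar>y\<bar> < r \<Longrightarrow> f y = 0"
    and r: "r > 0" "r \<le> 1" and m: "m \<ge> 1" and x: "\<bar>x\<bar> \<le> r / 2"
  shows "\<bar>\<integral>y. \<bar>y\<bar> powr (-1/2) * inv_sqrt_rem m (x / y) * f y \<partial>lborel\<bar> \<le> 8 * b * (\<bar>x\<bar> / r) ^ m"
proof -
  have b: "b \<ge> 0" using f[of 0] by linarith
  have a: "-1/2 - real m < -1" using m by simp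
  note t = abs_powr_tail[OF a r(1)]
  have bd: "\<bar>\<bar>y\<bar> powr (-1/2) * inv_sqrt_rem m (x / y) * f y\<bar> \<le> 2 * b * \<bar>x\<bar> ^ m * (indicator {y. \<bar>y\<bar> \<ge> r} y * \<bar>y\<bar> powr (-1/2 - real m))" for y
  proof (cases "\<bar>y\<bar> < r")
    case True then show ?thesis using z b by simp
  next
    case False
    then have y: "y \<noteq> 0" "\<bar>y\<bar> \<ge> r" using r by auto
    have "\<bar>x / y\<bar> \<le> 1/2" using x y r(1) by (simp add: field_simps)
    then have "\<bar>inv_sqrt_rem m (x / y)\<bar> \<le> 2 * \<bar>x / y\<bar> ^ m" by (rule inv_sqrt_rem_small)
    then have "\<bar>\<bar>y\<bar> powr (-1/2) * inv_sqrt_rem m (x / y) * f y\<bar> \<le> \<bar>y\<bar> powr (-1/2) * (2 * \<bar>x / y\<bar> ^ m) * b"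
      unfolding abs_mult using f b by (intro mult_mono) auto
    also have "\<dots> = 2 * b * \<bar>x\<bar> ^ m * (\<bar>y\<bar> powr (-1/2) * (1 / \<bar>y\<bar> ^ m))" by (simp add: power_divide)
    also have "1 / \<bar>y\<bar> ^ m = \<bar>y\<bar> powr (- real m)" using y by (simp add: powr_minus_divide powr_realpow)
    also have "\<bar>y\<bar> powr (-1/2) * \<bar>y\<bar> powr (- real m) = \<bar>y\<bar> powr (-1/2 - real m)" by (simp add: powr_add[symmetric])
    finally show ?thesis using y by simp
  qed
  have i2: "integrable lborel (\<lambda>y. 2 * b * \<bar>x\<bar> ^ m * (indicator {y. \<bar>y\<bar> \<ge> r} y * \<bar>y\<bar> powr (-1/2 - real m)))"
    using integrable.intros[OF t] by (rule integrable_mult_right)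
  have i1: "integrable lborel (\<lambda>y. \<bar>y\<bar> powr (-1/2) * inv_sqrt_rem m (x / y) * f y)"
  proof (rule Bochner_Integration.integrable_bound[OF i2])
    show "AE y in lborel. norm (\<bar>y\<bar> powr (-1/2) * inv_sqrt_rem m (x / y) * f y) \<le> norm (2 * b * \<bar>x\<bar> ^ m * (indicator {y. \<bar>y\<bar> \<ge> r} y * \<bar>y\<bar> powr (-1/2 - real m)))"
      unfolding real_norm_def by (intro AE_I2 order_trans[OF bd abs_ge_self])
  qed measurable
  have "\<bar>\<integral>y. \<bar>y\<bar> powr (-1/2) * inv_sqrt_rem m (x / y) * f y \<partial>lborel\<bar> \<le> (\<integral>y. 2 * b * \<bar>x\<bar> ^ m * (indicator {y. \<bar>y\<bar> \<ge> r} y * \<bar>y\<bar> powr (-1/2 - real m)) \<partial>lborel)"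
    by (rule integral_abs_bound_integral[OF i1 i2 bd])
  also have "\<dots> = 2 * b * \<bar>x\<bar> ^ m * (2 * (r powr (-1/2 - real m + 1) / (- (-1/2 - real m + 1))))"
    by (simp only: integral_mult_right_zero has_bochner_integral_integral_eq[OF t])
  also have "\<dots> \<le> 2 * b * \<bar>x\<bar> ^ m * (2 * (r powr (- real m) / (1/2)))"
    using r m b by (intro mult_left_mono frac_le powr_mono') auto
  also have "r powr (- real m) = 1 / r ^ m" using r by (simp add: powr_minus_divide powr_realpow)
  finally show ?thesis by (simp add: power_divide)
qed

section \<open>The order of vanishing of a Riesz potential\<close>

text \<open>The source is split at \<open>\<bar>y\<bar> = r\<close>, which gives \<open>w = P + T + g\<close> with a polynomial \<open>P\<close> of degree
  below \<open>N\<close>, a Carleman remainder \<open>T\<close> and the contribution \<open>g\<close> of the ball where \<open>w\<close> is small.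
  The polynomial is controlled by its values near \<open>0\<close>. The remainder is controlled by the
  weighted norm of \<open>f\<close>, hence of \<open>w\<close>, and for \<open>N\<close> of order \<open>M\<^sup>2\<close> half of the left-hand side
  absorbs it. The weight on the right has one power of \<open>\<bar>y\<bar>\<close> less than on the left, which on
  \<open>\<bar>y\<bar> \<le> 8\<close> costs a factor \<open>8\<close>; the region \<open>\<bar>y\<bar> > 8\<close> contributes \<open>64 powr (- N)\<close>.\<close>

lemma weighted_estimate:
  fixes w f :: "real \<Rightarrow> real"
  assumes w: "\<And>y. \<bar>w y\<bar> \<le> C0" and wm [measurable]: "w \<in> borel_measurable borel"
    and fw: "\<And>y. \<bar>f y\<bar> \<le> M * \<bar>w y\<bar>" and fm [measurable]: "f \<in> borel_measurable borel" and M: "M \<ge> 1"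
    and rep: "\<And>x x'. w x - w x' = fundamental_const * (\<integral>y. f y * riesz_diff x x' y \<partial>lborel)"
    and r: "r > 0" "r \<le> 1" and \<epsilon>: "\<And>x. \<bar>x\<bar> < r \<Longrightarrow> \<bar>w x\<bar> \<le> \<epsilon>"
    and N: "N \<ge> 2" "real N \<ge> 23232 * fundamental_const\<^sup>2 * M\<^sup>2" and mN: "m \<ge> N"
    and \<delta>: "\<delta> = (1 + fundamental_const * local_riesz_const * M) * \<epsilon> + 8 * fundamental_const * (M * C0) * (1/64) ^ m"
  shows "(\<integral>x. indicator {x. r \<le> \<bar>x\<bar> \<and> \<bar>x\<bar> \<le> 8} x * ((w x)\<^sup>2 / x ^ (2 * N)) \<partial>lborel)
     \<le> 192 * ((8 ^ m * \<delta>)\<^sup>2 / (r / 64) ^ (2 * N)) + 8 * C0\<^sup>2 / 64 ^ N"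
proof -
  define \<rho> where "\<rho> = r / 64"
  have \<rho>: "\<rho> > 0" "\<rho> \<le> r" using r by (auto simp: \<rho>_def)
  define b where "b = M * C0"
  have C0: "C0 \<ge> 0" using w[of 0] by linarith
  have eps0: "\<epsilon> \<ge> 0" using \<epsilon>[of 0] r by (auto intro: order_trans[OF abs_ge_zero])
  have b0: "b \<ge> 0" using C0 M by (simp add: b_def)
  have fb: "\<bar>f y\<bar> \<le> b" for y
    unfolding b_def using M by (intro order_trans[OF fw mult_left_mono[OF w]]) simp
  \<comment> \<open>The source inside and outside the ball on which \<open>w\<close> is small.\<close>
  define fi where "fi = (\<lambda>y. if \<bar>y\<bar> < r then f y else 0)"
  define fo where "fo = (\<lambda>y. if \<bar>y\<bar> < r then 0 else f y)"
  have [measurable]: "fi \<in> borel_measurable borel" "fo \<in> borel_measurable borel" unfolding fi_def fo_def by measurable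
  have fib: "\<bar>fi y\<bar> \<le> M * \<epsilon>" for y
  proof (cases "\<bar>y\<bar> < r")
    case True
    have "\<bar>f y\<bar> \<le> M * \<epsilon>" using M by (intro order_trans[OF fw mult_left_mono[OF \<epsilon>[OF True]]]) simp
    then show ?thesis using True by (simp add: fi_def)
  qed (use M eps0 in \<open>simp add: fi_def\<close>)
  have fob: "\<bar>fo y\<bar> \<le> b" for y using fb[of y] b0 by (simp add: fo_def)
  have foz: "fo y = 0" if "\<bar>y\<bar> < r" for y using that by (simp add: fo_def)
  define g where "g = (\<lambda>x. fundamental_const * (\<integral>y. fi y * riesz_diff x 0 y \<partial>lborel))"
  have gb: "\<bar>g x\<bar> \<le> fundamental_const * local_riesz_const * M * \<epsilon>" for x
  proof -
    have "\<bar>\<integral>y. fi y * riesz_diff x 0 y \<partial>lborel\<bar> \<le> M * \<epsilon> * local_riesz_const"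
      by (rule local_part_bound[OF fib]) (use r in \<open>auto simp: fi_def\<close>)
    then have "fundamental_const * \<bar>\<integral>y. fi y * riesz_diff x 0 y \<partial>lborel\<bar> \<le> fundamental_const * (M * \<epsilon> * local_riesz_const)" using fundamental_const_pos by (intro mult_left_mono) auto
    then show ?thesis using fundamental_const_pos by (simp add: g_def abs_mult mult_ac)
  qed
  define T where "T = (\<lambda>n x. \<integral>y. \<bar>y\<bar> powr (-1/2) * inv_sqrt_rem n (x / y) * fo y \<partial>lborel)"
  define q where "q = (\<lambda>k. if k = 0 then w 0 else fundamental_const * (inv_sqrt_coeff k * (\<integral>y. \<bar>y\<bar> powr (-1/2) * (fo y / y ^ k) \<partial>lborel)))"
  define P where "P = (\<lambda>n x. \<Sum>k<n. q k * x ^ k)"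
  have dec: "w x = P n x + fundamental_const * T n x + g x" if n: "n \<ge> 1" for n x
  proof -
    have "w x - w 0 = fundamental_const * (\<integral>y. fi y * riesz_diff x 0 y + fo y * riesz_diff x 0 y \<partial>lborel)"
      unfolding rep[of x 0] by (intro arg_cong2[where f="(*)"] Bochner_Integration.integral_cong refl) (simp add: fi_def fo_def)
    also have "\<dots> = fundamental_const * ((\<integral>y. fi y * riesz_diff x 0 y \<partial>lborel) + (\<integral>y. fo y * riesz_diff x 0 y \<partial>lborel))"
      by (subst Bochner_Integration.integral_add) (auto intro: riesz_fubini(1)[OF fib] riesz_fubini(1)[OF fob])
    also have "\<dots> = g x + fundamental_const * ((\<Sum>k\<in>{1..<n}. (inv_sqrt_coeff k * (\<integral>y. \<bar>y\<bar> powr (-1/2) * (fo y / y ^ k) \<partial>lborel)) * x ^ k) + T n x)"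
      unfolding g_def T_def distrib_left by (subst far_taylor[OF fob _ foz r(1) n]) (auto simp: distrib_left)
    also have "\<dots> = g x + (\<Sum>k\<in>{1..<n}. q k * x ^ k) + fundamental_const * T n x"
      unfolding distrib_left sum_distrib_left by (simp add: q_def mult.assoc)
    finally have "w x = (w 0 + (\<Sum>k\<in>{1..<n}. q k * x ^ k)) + fundamental_const * T n x + g x" by simp
    also have "w 0 + (\<Sum>k\<in>{1..<n}. q k * x ^ k) = P n x"
      unfolding P_def using n by (simp add: lessThan_atLeast0 sum.atLeast_Suc_lessThan q_def)
    finally show ?thesis .
  qed
  have m1: "m \<ge> 1" using mN N by simp
  have \<delta>0: "\<delta> \<ge> 0" unfolding \<delta> using eps0 fundamental_const_pos local_riesz_const_pos M C0 by simp
  have g\<delta>: "\<bar>g x\<bar> \<le> \<delta>" for x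
  proof -
    have "(1 + fundamental_const * local_riesz_const * M) * \<epsilon> \<ge> fundamental_const * local_riesz_const * M * \<epsilon>" using eps0 by (simp add: distrib_right)
    moreover have "8 * fundamental_const * (M * C0) * (1/64) ^ m \<ge> 0" using fundamental_const_pos M C0 by simp
    ultimately show ?thesis using gb[of x] unfolding \<delta> by linarith
  qed
  \<comment> \<open>At the nodes \<open>x \<le> r / 64\<close> the polynomial of degree below \<open>m\<close> differs from \<open>w\<close> by \<open>g\<close> and a remainder of size \<open>64 powr (- m)\<close>.\<close>
  have coef: "(\<Sum>k<m. \<bar>q k\<bar> * \<rho> ^ k) \<le> 8 ^ m * \<delta>"
  proof (rule coefficient_bound[OF _ \<rho>(1) \<delta>0])
    fix j assume j: "j < m"
    define x where "x = \<rho> * real j / real m"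
    have "\<rho> * real j \<le> \<rho> * real m" using j \<rho> by (intro mult_left_mono) auto
    then have x: "0 \<le> x" "x \<le> \<rho>" using j \<rho> by (auto simp: x_def divide_le_eq)
    have xr: "\<bar>x\<bar> < r" "\<bar>x\<bar> \<le> r / 2" "\<bar>x\<bar> / r \<le> 1/64" using x r by (auto simp: \<rho>_def field_simps)
    have "\<bar>T m x\<bar> \<le> 8 * b * (\<bar>x\<bar> / r) ^ m"
      unfolding T_def by (rule far_remainder_small[OF fob _ foz r m1 xr(2)]) auto
    also have "\<dots> \<le> 8 * b * (1/64) ^ m" using xr(3) r b0 by (intro mult_left_mono power_mono) auto
    finally have "fundamental_const * \<bar>T m x\<bar> \<le> fundamental_const * (8 * b * (1/64) ^ m)" using fundamental_const_pos by (intro mult_left_mono) auto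
    then have Tb: "\<bar>fundamental_const * T m x\<bar> \<le> 8 * fundamental_const * (M * C0) * (1/64) ^ m" using fundamental_const_pos by (simp add: abs_mult b_def mult_ac)
    have "P m x = w x - fundamental_const * T m x - g x" using dec[OF m1, of x] by simp
    then have "\<bar>P m x\<bar> \<le> \<bar>w x\<bar> + \<bar>fundamental_const * T m x\<bar> + \<bar>g x\<bar>" by linarith
    also have "\<dots> \<le> \<delta>" using \<epsilon>[OF xr(1)] Tb gb[of x] unfolding \<delta> by (simp add: distrib_right)
    finally show "\<bar>\<Sum>k<m. q k * (\<rho> * real j / real m) ^ k\<bar> \<le> \<delta>" by (simp add: P_def x_def)
  qed (use m1 in simp)
  \<comment> \<open>The coefficients do not depend on the order of the expansion, so those with \<open>k < N\<close> are among the ones just bounded.\<close>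
  have Pb: "\<bar>P N x\<bar> \<le> 8 ^ m * \<delta> * (\<bar>x\<bar> / \<rho>) ^ (N - 1)" if x: "\<bar>x\<bar> \<ge> \<rho>" for x
  proof -
    have y1: "1 \<le> \<bar>x\<bar> / \<rho>" using x \<rho> by simp
    have "\<bar>P N x\<bar> \<le> (\<Sum>k<N. \<bar>q k * x ^ k\<bar>)" unfolding P_def by (rule sum_abs)
    also have "\<dots> \<le> (\<Sum>k<N. (\<bar>q k\<bar> * \<rho> ^ k) * (\<bar>x\<bar> / \<rho>) ^ (N - 1))"
    proof (intro sum_mono)
      fix k assume k: "k \<in> {..<N}"
      have "\<bar>q k * x ^ k\<bar> = (\<bar>q k\<bar> * \<rho> ^ k) * (\<bar>x\<bar> / \<rho>) ^ k"
        using \<rho> by (simp add: abs_mult power_abs power_divide)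
      also have "\<dots> \<le> (\<bar>q k\<bar> * \<rho> ^ k) * (\<bar>x\<bar> / \<rho>) ^ (N - 1)"
        using k y1 \<rho> by (intro mult_left_mono power_increasing) auto
      finally show "\<bar>q k * x ^ k\<bar> \<le> (\<bar>q k\<bar> * \<rho> ^ k) * (\<bar>x\<bar> / \<rho>) ^ (N - 1)" .
    qed
    also have "\<dots> = (\<Sum>k<N. \<bar>q k\<bar> * \<rho> ^ k) * (\<bar>x\<bar> / \<rho>) ^ (N - 1)" by (simp only: sum_distrib_right)
    also have "\<dots> \<le> (\<Sum>k<m. \<bar>q k\<bar> * \<rho> ^ k) * (\<bar>x\<bar> / \<rho>) ^ (N - 1)"
      using mN \<rho> by (intro mult_right_mono sum_mono2) auto
    also have "\<dots> \<le> (8 ^ m * \<delta>) * (\<bar>x\<bar> / \<rho>) ^ (N - 1)" using \<rho> by (intro mult_right_mono coef) auto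
    finally show ?thesis .
  qed
  define EE where "EE = (8 ^ m * \<delta>)\<^sup>2 / \<rho> ^ (2 * N)"
  define D where "D = {x::real. r \<le> \<bar>x\<bar> \<and> \<bar>x\<bar> \<le> 8}"
  have Dm [measurable]: "D \<in> sets borel" unfolding D_def by measurable
  have Dsub: "D \<subseteq> {-8..8}" by (auto simp: D_def)
  have ev: "x ^ (2 * N) = \<bar>x\<bar> ^ (2 * N)" for x :: real by (simp add: power_even_abs)
  have P2: "(P N x)\<^sup>2 / x ^ (2 * N) \<le> EE" if "x \<in> D" for x
  proof -
    have x: "\<bar>x\<bar> \<ge> r" "\<bar>x\<bar> \<ge> \<rho>" "\<bar>x\<bar> > 0" using that r \<rho> by (auto simp: D_def)
    have "(P N x)\<^sup>2 = \<bar>P N x\<bar>\<^sup>2" by simp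
    also have "\<dots> \<le> (8 ^ m * \<delta> * (\<bar>x\<bar> / \<rho>) ^ (N - 1))\<^sup>2" by (intro power_mono Pb x) auto
    also have "\<dots> \<le> (8 ^ m * \<delta> * (\<bar>x\<bar> / \<rho>) ^ N)\<^sup>2"
      using x \<rho> \<delta>0 by (intro power_mono mult_left_mono power_increasing) auto
    also have "\<dots> = (8 ^ m * \<delta>)\<^sup>2 * (\<bar>x\<bar> ^ (2 * N) / \<rho> ^ (2 * N))"
      by (simp add: power_mult_distrib power_divide power_mult[symmetric] mult.commute)
    finally show ?thesis unfolding ev[of x] EE_def using x by (simp add: pos_divide_le_eq)
  qed
  have g2: "(g x)\<^sup>2 / x ^ (2 * N) \<le> EE" if "x \<in> D" for x
  proof -
    have x: "\<bar>x\<bar> \<ge> \<rho>" "\<bar>x\<bar> > 0" using that r \<rho> by (auto simp: D_def)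
    have "1 * \<delta> \<le> 8 ^ m * \<delta>" using \<delta>0 by (intro mult_right_mono) auto
    then have "\<bar>g x\<bar> \<le> 8 ^ m * \<delta>" using g\<delta>[of x] by linarith
    then have "\<bar>g x\<bar>\<^sup>2 \<le> (8 ^ m * \<delta>)\<^sup>2" by (intro power_mono) auto
    then have "(g x)\<^sup>2 \<le> (8 ^ m * \<delta>)\<^sup>2" by simp
    then show ?thesis unfolding ev[of x] EE_def by (rule frac_le[OF _ _ _ power_mono, rotated]) (use x \<rho> in auto)
  qed
  have wc: "continuous_on UNIV (T N)"
  proof -
    have N1: "N \<ge> 1" using N by simp
    define I where "I = (\<lambda>x. \<integral>y. fo y * riesz_diff x 0 y \<partial>lborel)"
    have Id: "I x - I x' = (\<integral>y. fo y * riesz_diff x x' y \<partial>lborel)" for x x'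
    proof -
      have "I x - I x' = (\<integral>y. fo y * riesz_diff x 0 y - fo y * riesz_diff x' 0 y \<partial>lborel)"
        unfolding I_def by (rule Bochner_Integration.integral_diff[symmetric]) (auto intro: riesz_fubini(1)[OF fob])
      then show ?thesis by (simp add: riesz_diff_def algebra_simps)
    qed
    have Ic: "continuous_on UNIV I"
    proof (rule continuous_of_hoelder_half)
      show "\<bar>I x - I x'\<bar> \<le> (b * riesz_diff_mass) * sqrt \<bar>x - x'\<bar>" for x x'
        unfolding Id using riesz_hoelder[OF fob, where x = x and x' = x'] by (simp add: mult_ac)
    qed
    have "T N = (\<lambda>x. I x - (\<Sum>k\<in>{1..<N}. (inv_sqrt_coeff k * (\<integral>y. \<bar>y\<bar> powr (-1/2) * (fo y / y ^ k) \<partial>lborel)) * x ^ k))"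
      unfolding I_def T_def by (subst far_taylor[OF fob _ foz r(1) N1]) auto
    then show ?thesis using Ic by (auto intro!: continuous_intros)
  qed
  have fom: "fo \<in> borel_measurable borel" by measurable
  have Teq: "T N x = (\<integral>y. \<bar>y\<bar> powr (-1/2) * inv_sqrt_rem N (x / y) * fo y \<partial>lborel)" for x by (simp only: T_def)
  note car = carleman[OF fob fom foz r(1) N(1) Teq wc]
  define X where "X = (\<integral>x. indicator D x * ((w x)\<^sup>2 / x ^ (2 * N)) \<partial>lborel)"
  have iX: "integrable lborel (\<lambda>x. indicator D x * ((w x)\<^sup>2 / x ^ (2 * N)))"
  proof (rule Bochner_Integration.integrable_bound)
    show "integrable lborel (\<lambda>x. C0\<^sup>2 / r ^ (2 * N) * indicator {-8..8::real} x)" by simp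
    have "(w x)\<^sup>2 / x ^ (2 * N) \<le> C0\<^sup>2 / r ^ (2 * N)" if "x \<in> D" for x
    proof -
      have "(w x)\<^sup>2 \<le> C0\<^sup>2" using power_mono[OF w[of x], of 2] by simp
      then show ?thesis unfolding ev[of x]
        by (rule frac_le[OF _ _ _ power_mono, rotated]) (use that r in \<open>auto simp: D_def\<close>)
    qed
    then show "AE x in lborel. norm (indicator D x * ((w x)\<^sup>2 / x ^ (2 * N))) \<le> norm (C0\<^sup>2 / r ^ (2 * N) * indicator {-8..8::real} x)"
      using Dsub r by (intro AE_I2) (auto simp: indicator_def)
  qed measurable
  have X1: "X \<le> 96 * EE + 3 * fundamental_const\<^sup>2 * (\<integral>x. (T N x)\<^sup>2 / x ^ (2 * N) \<partial>lborel)"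
  proof -
    have i2: "integrable lborel (\<lambda>x. 6 * EE * indicator {-8..8::real} x + 3 * fundamental_const\<^sup>2 * ((T N x)\<^sup>2 / x ^ (2 * N)))"
      by (intro Bochner_Integration.integrable_add integrable_mult_right car(1)) simp
    have EE0: "EE \<ge> 0" unfolding EE_def using \<rho> by simp
    have "X \<le> (\<integral>x. 6 * EE * indicator {-8..8::real} x + 3 * fundamental_const\<^sup>2 * ((T N x)\<^sup>2 / x ^ (2 * N)) \<partial>lborel)"
      unfolding X_def
    proof (rule integral_mono[OF iX i2])
      fix x :: real
      have Tn: "0 \<le> 3 * fundamental_const\<^sup>2 * ((T N x)\<^sup>2 / x ^ (2 * N))" by simp
      show "indicator D x * ((w x)\<^sup>2 / x ^ (2 * N)) \<le> 6 * EE * indicator {-8..8::real} x + 3 * fundamental_const\<^sup>2 * ((T N x)\<^sup>2 / x ^ (2 * N))"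
      proof (cases "x \<in> D")
        case True
        define a c where "a = P N x" and "c = fundamental_const * T N x"
        have wx: "w x = a + c + g x" using dec[of N x] N by (simp add: a_def c_def)
        have "(a + c + g x)\<^sup>2 \<le> 3 * (a\<^sup>2 + c\<^sup>2 + (g x)\<^sup>2)"
          using zero_le_power2[of "a - c"] zero_le_power2[of "a - g x"] zero_le_power2[of "c - g x"]
          by (simp add: power2_eq_square algebra_simps)
        then have "(w x)\<^sup>2 / x ^ (2 * N) \<le> 3 * (a\<^sup>2 + c\<^sup>2 + (g x)\<^sup>2) / x ^ (2 * N)"
          unfolding wx ev[of x] by (intro divide_right_mono) auto
        also have "\<dots> = 3 * (a\<^sup>2 / x ^ (2 * N)) + 3 * fundamental_const\<^sup>2 * ((T N x)\<^sup>2 / x ^ (2 * N)) + 3 * ((g x)\<^sup>2 / x ^ (2 * N))"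
          by (simp add: c_def power_mult_distrib add_divide_distrib distrib_left)
        also have "\<dots> \<le> 3 * EE + 3 * fundamental_const\<^sup>2 * ((T N x)\<^sup>2 / x ^ (2 * N)) + 3 * EE"
          using P2[OF True] g2[OF True] by (simp add: a_def)
        finally show ?thesis using True Dsub by (auto simp: indicator_def)
      next
        case False
        then show ?thesis using Tn EE0 by (simp add: add_nonneg_nonneg)
      qed
    qed
    also have "\<dots> = (\<integral>x. 6 * EE * indicator {-8..8::real} x \<partial>lborel) + (\<integral>x. 3 * fundamental_const\<^sup>2 * ((T N x)\<^sup>2 / x ^ (2 * N)) \<partial>lborel)"
      by (intro Bochner_Integration.integral_add integrable_mult_right[OF car(1)]) simp
    also have "\<dots> = 6 * EE * 16 + 3 * fundamental_const\<^sup>2 * (\<integral>x. (T N x)\<^sup>2 / x ^ (2 * N) \<partial>lborel)"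
      by (simp only: integral_mult_right_zero) simp
    finally show ?thesis by simp
  qed
  have a8: "1 - 2 * real N < -1" using N by simp
  have F1: "(\<integral>y. (fo y)\<^sup>2 / \<bar>y\<bar> ^ (2 * N - 1) \<partial>lborel) \<le> 8 * M\<^sup>2 * X + M\<^sup>2 * C0\<^sup>2 * (64 / 64 ^ N)"
  proof -
    define tl where "tl = (\<lambda>y::real. indicator {y. \<bar>y\<bar> \<ge> 8} y * \<bar>y\<bar> powr (1 - 2 * real N))"
    have tl: "has_bochner_integral lborel tl (2 * (8 powr (1 - 2 * real N + 1) / (- (1 - 2 * real N + 1))))"
      unfolding tl_def by (rule abs_powr_tail[OF a8]) simp
    have i2: "integrable lborel (\<lambda>y. 8 * M\<^sup>2 * (indicator D y * ((w y)\<^sup>2 / y ^ (2 * N))) + M\<^sup>2 * C0\<^sup>2 * tl y)"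
      by (intro Bochner_Integration.integrable_add integrable_mult_right iX integrable.intros[OF tl])
    have "(\<integral>y. (fo y)\<^sup>2 / \<bar>y\<bar> ^ (2 * N - 1) \<partial>lborel) \<le> (\<integral>y. 8 * M\<^sup>2 * (indicator D y * ((w y)\<^sup>2 / y ^ (2 * N))) + M\<^sup>2 * C0\<^sup>2 * tl y \<partial>lborel)"
    proof (rule integral_mono[OF car(2) i2])
      fix y :: real
      have nn: "0 \<le> 8 * M\<^sup>2 * (indicator D y * ((w y)\<^sup>2 / y ^ (2 * N)))" by simp
      have tn: "0 \<le> M\<^sup>2 * C0\<^sup>2 * tl y" by (simp add: tl_def)
      have f2: "(f y)\<^sup>2 \<le> M\<^sup>2 * (w y)\<^sup>2" using power_mono[OF fw[of y], of 2] by (simp add: power_mult_distrib)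
      consider "\<bar>y\<bar> < r" | "y \<in> D" | "\<bar>y\<bar> > 8" "\<bar>y\<bar> \<ge> r"
        by (cases "\<bar>y\<bar> < r"; cases "\<bar>y\<bar> \<le> 8") (auto simp: D_def)
      then show "(fo y)\<^sup>2 / \<bar>y\<bar> ^ (2 * N - 1) \<le> 8 * M\<^sup>2 * (indicator D y * ((w y)\<^sup>2 / y ^ (2 * N))) + M\<^sup>2 * C0\<^sup>2 * tl y"
      proof cases
        case 1
        then show ?thesis using nn tn by (simp add: foz)
      next
        case 2
        then have y: "\<bar>y\<bar> > 0" "\<bar>y\<bar> \<le> 8" "\<not> \<bar>y\<bar> < r" using r by (auto simp: D_def)
        have pw: "\<bar>y\<bar> ^ (2 * N) = \<bar>y\<bar> * \<bar>y\<bar> ^ (2 * N - 1)" using N by (subst power_Suc[symmetric]) (simp add: Suc_diff_le)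
        have "(fo y)\<^sup>2 / \<bar>y\<bar> ^ (2 * N - 1) \<le> M\<^sup>2 * (w y)\<^sup>2 / \<bar>y\<bar> ^ (2 * N - 1)"
          using f2 y by (simp add: fo_def divide_right_mono)
        also have "\<dots> = \<bar>y\<bar> * (M\<^sup>2 * ((w y)\<^sup>2 / \<bar>y\<bar> ^ (2 * N)))" unfolding pw using y by simp
        also have "\<dots> \<le> 8 * (M\<^sup>2 * ((w y)\<^sup>2 / \<bar>y\<bar> ^ (2 * N)))" using y by (intro mult_right_mono) auto
        finally show ?thesis using 2 tn unfolding ev[of y] by simp
      next
        case 3
        have "(f y)\<^sup>2 \<le> M\<^sup>2 * C0\<^sup>2" using f2 power_mono[OF w[of y], of 2] by (simp add: order_trans mult_left_mono)
        then have "(fo y)\<^sup>2 / \<bar>y\<bar> ^ (2 * N - 1) \<le> M\<^sup>2 * C0\<^sup>2 * (1 / \<bar>y\<bar> ^ (2 * N - 1))"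
          using 3 by (simp add: fo_def divide_right_mono)
        also have "1 / \<bar>y\<bar> ^ (2 * N - 1) = \<bar>y\<bar> powr (- real (2 * N - 1))"
          using 3 by (simp add: powr_minus_divide powr_realpow)
        also have "- real (2 * N - 1) = 1 - 2 * real N" using N by (simp add: of_nat_diff)
        finally have "(fo y)\<^sup>2 / \<bar>y\<bar> ^ (2 * N - 1) \<le> M\<^sup>2 * C0\<^sup>2 * tl y" using 3 by (simp add: tl_def)
        then show ?thesis using nn by linarith
      qed
    qed
    also have "\<dots> = (\<integral>y. 8 * M\<^sup>2 * (indicator D y * ((w y)\<^sup>2 / y ^ (2 * N))) \<partial>lborel) + (\<integral>y. M\<^sup>2 * C0\<^sup>2 * tl y \<partial>lborel)"
      by (intro Bochner_Integration.integral_add integrable_mult_right iX integrable.intros[OF tl])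
    also have "\<dots> = 8 * M\<^sup>2 * X + M\<^sup>2 * C0\<^sup>2 * (2 * (8 powr (1 - 2 * real N + 1) / (- (1 - 2 * real N + 1))))"
      unfolding X_def integral_mult_right_zero has_bochner_integral_integral_eq[OF tl] by (rule refl)
    also have "\<dots> \<le> 8 * M\<^sup>2 * X + M\<^sup>2 * C0\<^sup>2 * (64 / 64 ^ N)"
    proof (intro add_left_mono mult_left_mono)
      have "8 powr (1 - 2 * real N + 1) = 8 powr 2 * 8 powr (- real (2 * N))" unfolding powr_add[symmetric] by simp
      also have "\<dots> = 64 / 8 ^ (2 * N)" by (simp only: powr_minus_divide powr_realpow) (simp add: powr_realpow[symmetric])
      also have "(8::real) ^ (2 * N) = 64 ^ N" by (simp add: power_mult)
      finally have e: "(8::real) powr (1 - 2 * real N + 1) = 64 / 64 ^ N" .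
      have "2 * (64 / 64 ^ N / (- (1 - 2 * real N + 1))) \<le> 2 * (64 / 64 ^ N / 2)"
        using N by (intro mult_left_mono divide_left_mono) auto
      then show "2 * (8 powr (1 - 2 * real N + 1) / (- (1 - 2 * real N + 1))) \<le> 64 / 64 ^ N" unfolding e by simp
    qed auto
    finally show ?thesis .
  qed
  have X0: "X \<ge> 0" unfolding X_def by (intro integral_nonneg_AE AE_I2) simp
  have Npos: "real N > 0" using N by simp
  have "X \<le> 96 * EE + 3 * fundamental_const\<^sup>2 * (484 / real N * (8 * M\<^sup>2 * X + M\<^sup>2 * C0\<^sup>2 * (64 / 64 ^ N)))"
  proof -
    have "(\<integral>x. (T N x)\<^sup>2 / x ^ (2 * N) \<partial>lborel) \<le> 484 / real N * (8 * M\<^sup>2 * X + M\<^sup>2 * C0\<^sup>2 * (64 / 64 ^ N))"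
    proof -
      have "0 \<le> 484 / real N" using Npos by (intro divide_nonneg_nonneg) linarith+
      then show ?thesis using car(3) F1 by (meson mult_left_mono order_trans)
    qed
    then have "3 * fundamental_const\<^sup>2 * (\<integral>x. (T N x)\<^sup>2 / x ^ (2 * N) \<partial>lborel) \<le> 3 * fundamental_const\<^sup>2 * (484 / real N * (8 * M\<^sup>2 * X + M\<^sup>2 * C0\<^sup>2 * (64 / 64 ^ N)))"
      by (rule mult_left_mono) simp
    then show ?thesis using X1 by linarith
  qed
  also have "3 * fundamental_const\<^sup>2 * (484 / real N * (8 * M\<^sup>2 * X + M\<^sup>2 * C0\<^sup>2 * (64 / 64 ^ N))) = (1452 * fundamental_const\<^sup>2 * M\<^sup>2 / real N) * (8 * X + C0\<^sup>2 * (64 / 64 ^ N))"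
    by (simp add: algebra_simps)
  \<comment> \<open>Absorption: \<open>23232 = 16 * 1452\<close> and \<open>1452 = 3 * 484\<close>, so that at most \<open>X / 2\<close> stays on the right.\<close>
  also have "\<dots> \<le> (1/16) * (8 * X + C0\<^sup>2 * (64 / 64 ^ N))"
    using N(2) Npos X0 by (intro mult_right_mono) (auto simp: divide_le_eq)
  finally have "X \<le> 96 * EE + X / 2 + 4 * (C0\<^sup>2 / 64 ^ N)" by (simp add: add_divide_distrib)
  then have "X \<le> 192 * EE + 8 * (C0\<^sup>2 / 64 ^ N)" by linarith
  then show ?thesis by (simp add: X_def EE_def \<rho>_def D_def)
qed

text \<open>On \<open>\<bar>x\<bar> \<le> 3\<close> the weight \<open>1 / x ^ (2 * N)\<close> is at least \<open>9 powr (- N)\<close>. This loss is smaller than the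
  gain \<open>64 powr (- N)\<close> from the far region.\<close>

lemma mass_splitting:
  fixes w :: "real \<Rightarrow> real"
  assumes w: "\<And>y. \<bar>w y\<bar> \<le> C0" and wm [measurable]: "w \<in> borel_measurable borel"
    and r: "r > 0" "r \<le> 1/2" and \<epsilon>: "\<And>x. \<bar>x\<bar> < r \<Longrightarrow> \<bar>w x\<bar> \<le> \<epsilon>"
  shows "(\<integral>x. indicator {-3..3} x * (w x)\<^sup>2 \<partial>lborel)
     \<le> \<epsilon>\<^sup>2 + 9 ^ N * (\<integral>x. indicator {x. r \<le> \<bar>x\<bar> \<and> \<bar>x\<bar> \<le> 8} x * ((w x)\<^sup>2 / x ^ (2 * N)) \<partial>lborel)"
proof -
  define D where "D = {x::real. r \<le> \<bar>x\<bar> \<and> \<bar>x\<bar> \<le> 8}"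
  have Dm [measurable]: "D \<in> sets borel" unfolding D_def by measurable
  have ev: "x ^ (2 * N) = \<bar>x\<bar> ^ (2 * N)" for x :: real by (simp add: power_even_abs)
  have w2: "(w x)\<^sup>2 \<le> C0\<^sup>2" for x using power_mono[OF w[of x], of 2] by simp
  have iX: "integrable lborel (\<lambda>x. indicator D x * ((w x)\<^sup>2 / x ^ (2 * N)))"
  proof (rule Bochner_Integration.integrable_bound)
    show "integrable lborel (\<lambda>x. C0\<^sup>2 / r ^ (2 * N) * indicator {-8..8::real} x)" by simp
    have "(w x)\<^sup>2 / x ^ (2 * N) \<le> C0\<^sup>2 / r ^ (2 * N)" if "x \<in> D" for x
      unfolding ev[of x] by (rule frac_le[OF _ w2 _ power_mono]) (use that r in \<open>auto simp: D_def\<close>)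
    then show "AE x in lborel. norm (indicator D x * ((w x)\<^sup>2 / x ^ (2 * N))) \<le> norm (C0\<^sup>2 / r ^ (2 * N) * indicator {-8..8::real} x)"
      using r by (intro AE_I2) (auto simp: indicator_def D_def)
  qed measurable
  have i1: "integrable lborel (\<lambda>x. indicator {-3..3} x * (w x)\<^sup>2)"
  proof (rule Bochner_Integration.integrable_bound)
    show "integrable lborel (\<lambda>x. C0\<^sup>2 * indicator {-3..3::real} x)" by simp
    show "AE x in lborel. norm (indicator {-3..3} x * (w x)\<^sup>2) \<le> norm (C0\<^sup>2 * indicator {-3..3::real} x)"
      using w2 by (intro AE_I2) (auto simp: indicator_def)
  qed measurable
  have i2: "integrable lborel (\<lambda>x. \<epsilon>\<^sup>2 * indicator {-r..r} x + 9 ^ N * (indicator D x * ((w x)\<^sup>2 / x ^ (2 * N))))"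
    using r by (intro Bochner_Integration.integrable_add integrable_mult_right iX) simp
  have "(\<integral>x. indicator {-3..3} x * (w x)\<^sup>2 \<partial>lborel) \<le> (\<integral>x. \<epsilon>\<^sup>2 * indicator {-r..r} x + 9 ^ N * (indicator D x * ((w x)\<^sup>2 / x ^ (2 * N))) \<partial>lborel)"
  proof (rule integral_mono[OF i1 i2])
    fix x :: real
    have nn: "0 \<le> 9 ^ N * (indicator D x * ((w x)\<^sup>2 / x ^ (2 * N)))" by simp
    consider "\<not> \<bar>x\<bar> \<le> 3" | "\<bar>x\<bar> < r" | "x \<in> D" "\<bar>x\<bar> \<le> 3"
      by (cases "\<bar>x\<bar> \<le> 3"; cases "\<bar>x\<bar> < r") (auto simp: D_def)
    then show "indicator {-3..3} x * (w x)\<^sup>2 \<le> \<epsilon>\<^sup>2 * indicator {-r..r} x + 9 ^ N * (indicator D x * ((w x)\<^sup>2 / x ^ (2 * N)))"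
    proof cases
      case 1
      then have "x \<notin> {-3..3}" by auto
      then have "indicator {-3..3} x = (0::real)" by simp
      then show ?thesis using nn by (simp add: add_nonneg_nonneg)
    next
      case 2
      then have "x \<in> {-r..r}" by auto
      moreover have "(w x)\<^sup>2 \<le> \<epsilon>\<^sup>2" using power_mono[OF \<epsilon>[OF 2], of 2] by simp
      moreover have "indicator {-3..3} x * (w x)\<^sup>2 \<le> 1 * (w x)\<^sup>2" by (intro mult_right_mono) (auto simp: indicator_def)
      moreover have "\<epsilon>\<^sup>2 * indicator {-r..r} x = \<epsilon>\<^sup>2" using \<open>x \<in> {-r..r}\<close> by simp
      ultimately show ?thesis using nn by linarith
    next
      case 3
      have x0: "\<bar>x\<bar> > 0" using 3 r by (auto simp: D_def)
      have "\<bar>x\<bar> ^ (2 * N) \<le> 3 ^ (2 * N)" using 3 by (intro power_mono) auto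
      also have "(3::real) ^ (2 * N) = 9 ^ N" by (simp add: power_mult)
      finally have "(w x)\<^sup>2 * \<bar>x\<bar> ^ (2 * N) \<le> (w x)\<^sup>2 * 9 ^ N" by (intro mult_left_mono) auto
      then have "(w x)\<^sup>2 \<le> 9 ^ N * ((w x)\<^sup>2 / \<bar>x\<bar> ^ (2 * N))" using x0 by (simp add: pos_le_divide_eq mult.commute)
      moreover have "indicator {-3..3} x * (w x)\<^sup>2 \<le> 1 * (w x)\<^sup>2" by (intro mult_right_mono) (auto simp: indicator_def)
      moreover have "0 \<le> \<epsilon>\<^sup>2 * indicator {-r..r} x" by simp
      moreover have "9 ^ N * (indicator D x * ((w x)\<^sup>2 / x ^ (2 * N))) = 9 ^ N * ((w x)\<^sup>2 / \<bar>x\<bar> ^ (2 * N))"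
        using 3(1) unfolding ev[of x] by simp
      ultimately show ?thesis by linarith
    qed
  qed
  also have "\<dots> = (\<integral>x. \<epsilon>\<^sup>2 * indicator {-r..r} x \<partial>lborel) + (\<integral>x. 9 ^ N * (indicator D x * ((w x)\<^sup>2 / x ^ (2 * N))) \<partial>lborel)"
    by (intro Bochner_Integration.integral_add integrable_mult_right iX integrable_real_indicator) (simp_all add: emeasure_lborel_Icc_eq)
  also have "\<dots> = \<epsilon>\<^sup>2 * (2 * r) + 9 ^ N * (\<integral>x. indicator D x * ((w x)\<^sup>2 / x ^ (2 * N)) \<partial>lborel)"
    unfolding integral_mult_right_zero using r by simp
  also have "\<dots> \<le> \<epsilon>\<^sup>2 * 1 + 9 ^ N * (\<integral>x. indicator D x * ((w x)\<^sup>2 / x ^ (2 * N)) \<partial>lborel)"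
    using r by (intro add_right_mono mult_left_mono) auto
  finally show ?thesis by (simp add: D_def)
qed

text \<open>The number \<open>N\<close> is of order \<open>1 + M\<^sup>2 + \<bar>ln K\<bar>\<close>, so that absorption is possible and the far
  region costs at most a quarter of \<open>K\<^sup>2\<close>. If \<open>\<epsilon> < K / 2\<close>, what remains is
  \<open>2 \<le> Z * 8\<^sup>m * (\<epsilon> + 64 powr (- m))\<close> with \<open>Z\<close> of size \<open>r powr (- k)\<close>, where \<open>k\<close> is a multiple of \<open>N\<close>. Taking \<open>8\<^sup>m\<close> comparable to \<open>Z\<close> makes
  the term with \<open>64 powr (- m)\<close> at most \<open>1\<close>, and \<open>\<epsilon> \<ge> 1 / (8 Z\<^sup>2)\<close> follows.\<close>

lemma choice_of_parameters:
  fixes A B K M r \<epsilon> C0 :: real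
  assumes A: "A \<ge> 1" and B: "B \<ge> 2 + 32 * C0\<^sup>2" and K: "0 < K" "K \<le> 1" and M: "M \<ge> 1" and r: "0 < r" "r < 1/64" and \<epsilon>: "\<epsilon> \<ge> 0"
    and H: "\<And>N m. N \<ge> 2 \<Longrightarrow> real N \<ge> B * M\<^sup>2 \<Longrightarrow> m \<ge> N \<Longrightarrow>
       K\<^sup>2 \<le> \<epsilon>\<^sup>2 + 9 ^ N * (192 * ((8 ^ m * (A * M * (\<epsilon> + (1/64) ^ m)))\<^sup>2 / (r / 64) ^ (2 * N)) + 8 * C0\<^sup>2 / 64 ^ N)"
  shows "\<epsilon> \<ge> 1 / (12800 * A\<^sup>2) * r powr ((6 * (B + 1) + 2) * (1 + M\<^sup>2 + \<bar>ln K\<bar>))"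
proof -
  define L where "L = 1 + M\<^sup>2 + \<bar>ln K\<bar>"
  have L: "L \<ge> 1" "\<bar>ln K\<bar> \<le> L" "M\<^sup>2 \<le> L" by (auto simp: L_def)
  have B2: "B \<ge> 2" using B by (smt (verit) zero_le_power2)
  have lnK: "ln K = - \<bar>ln K\<bar>" using K by (simp add: ln_le_zero_iff)
  have Kexp: "K = exp (- \<bar>ln K\<bar>)" using K lnK by (metis exp_ln)
  define N where "N = nat \<lceil>B * L\<rceil>"
  have BL: "B * L \<ge> 2" using mult_mono[of 2 B 1 L] B2 L by simp
  have N1: "real N \<ge> B * L" unfolding N_def by (rule real_nat_ceiling_ge)
  have N2: "real N \<le> (B + 1) * L"
  proof -
    have "real N \<le> B * L + 1" unfolding N_def using BL of_int_ceiling_le_add_one[of "B * L"] by simp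
    then show ?thesis using L by (simp add: distrib_right)
  qed
  have Nge2: "N \<ge> 2" using N1 BL by linarith
  have NM: "real N \<ge> B * M\<^sup>2" using N1 mult_left_mono[OF L(3), of B] B2 by linarith
  have lr: "ln r \<le> -1"
  proof -
    have "r \<le> exp (-1)"
    proof -
      have "exp 1 \<le> (3::real)" by (rule exp_le)
      then have "1/3 \<le> exp (-1::real)" by (simp add: exp_minus field_simps)
      then show ?thesis using r by simp
    qed
    then have "ln r \<le> ln (exp (-1))" using r by (subst ln_le_cancel_iff) auto
    then show ?thesis by simp
  qed
  have Kr: "K \<ge> r powr \<bar>ln K\<bar>"
  proof -
    have "\<bar>ln K\<bar> * ln r \<le> \<bar>ln K\<bar> * (-1)" by (intro mult_left_mono lr) auto
    then have "exp (\<bar>ln K\<bar> * ln r) \<le> exp (- \<bar>ln K\<bar>)" by simp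
    then show ?thesis using Kexp r by (simp add: powr_def)
  qed
  have A2: "1 / (12800 * A\<^sup>2) \<le> 1/2"
  proof -
    have "A\<^sup>2 \<ge> 1" by (rule one_le_power[OF A])
    then have "2 \<le> 12800 * A\<^sup>2" by linarith
    then show ?thesis by (intro frac_le) auto
  qed
  \<comment> \<open>The final bound is \<open>1 / Z\<^sup>2\<close>: there \<open>K\<^sup>2\<close> costs \<open>2 * \<bar>ln K\<bar>\<close> in the exponent, \<open>\<rho> ^ (2 * N)\<close> costs \<open>4 * N\<close>, and \<open>9\<^sup>N\<close> and \<open>M\<^sup>2\<close> cost \<open>N\<close> each.\<close>
  have goalexp: "r powr ((6 * (B + 1) + 2) * L) \<le> r powr (6 * real N + 2 * \<bar>ln K\<bar>)"
  proof (rule powr_mono')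
    show "6 * real N + 2 * \<bar>ln K\<bar> \<le> (6 * (B + 1) + 2) * L"
      using N2 L(2) by (simp add: algebra_simps)
  qed (use r in auto)
  show ?thesis unfolding L_def[symmetric]
  proof (cases "\<epsilon> \<ge> K / 2")
    case True
    have "1 / (12800 * A\<^sup>2) * r powr ((6 * (B + 1) + 2) * L) \<le> 1/2 * r powr \<bar>ln K\<bar>"
    proof (intro mult_mono A2 powr_mono')
      have "1 * L \<le> (6 * (B + 1) + 2) * L" using B2 L by (intro mult_right_mono) auto
      then show "\<bar>ln K\<bar> \<le> (6 * (B + 1) + 2) * L" using L(2) by linarith
    qed (use r A in auto)
    also have "\<dots> \<le> 1/2 * K" using Kr by simp
    finally show "1 / (12800 * A\<^sup>2) * r powr ((6 * (B + 1) + 2) * L) \<le> \<epsilon>" using True by simp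
  next
    case False
    then have e2: "\<epsilon>\<^sup>2 \<le> K\<^sup>2 / 4" using power_mono[of \<epsilon> "K/2" 2] \<epsilon> by (simp add: power_divide)
    have tail: "9 ^ N * (8 * C0\<^sup>2 / 64 ^ N) \<le> K\<^sup>2 / 4"
    proof -
      have "(9/64::real) \<le> exp (-1)"
      proof -
        have "exp 1 \<le> (3::real)" by (rule exp_le)
        then have "1/3 \<le> exp (-1::real)" by (simp add: exp_minus field_simps)
        then show ?thesis by simp
      qed
      then have "(9/64::real) ^ N \<le> exp (-1) ^ N" by (intro power_mono) auto
      also have "\<dots> = exp (- real N)" by (simp add: exp_of_nat_mult[symmetric])
      also have "\<dots> \<le> exp (- 32 * C0\<^sup>2 + - 2 * \<bar>ln K\<bar>)"
      proof -
        have "(2 + 32 * C0\<^sup>2) * L \<le> B * L" using B L by (intro mult_right_mono) auto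
        moreover have "32 * C0\<^sup>2 * 1 \<le> 32 * C0\<^sup>2 * L" using L by (intro mult_left_mono) auto
        ultimately have "32 * C0\<^sup>2 + 2 * \<bar>ln K\<bar> \<le> real N" using N1 L(2) by (simp add: algebra_simps)
        then show ?thesis by simp
      qed
      also have "\<dots> = exp (- (32 * C0\<^sup>2)) * K\<^sup>2"
      proof -
        have "K\<^sup>2 = exp (- 2 * \<bar>ln K\<bar>)" by (subst Kexp) (simp add: exp_of_nat_mult[symmetric])
        then show ?thesis by (simp only: exp_add) simp
      qed
      finally have q: "(9/64::real) ^ N \<le> exp (- (32 * C0\<^sup>2)) * K\<^sup>2" .
      have "9 ^ N * (8 * C0\<^sup>2 / 64 ^ N) = 8 * C0\<^sup>2 * (9/64) ^ N" by (simp add: power_divide)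
      also have "\<dots> \<le> 8 * C0\<^sup>2 * (exp (- (32 * C0\<^sup>2)) * K\<^sup>2)" by (intro mult_left_mono q) auto
      also have "\<dots> = (32 * C0\<^sup>2 * exp (- (32 * C0\<^sup>2))) * (K\<^sup>2 / 4)" by simp
      also have "\<dots> \<le> 1 * (K\<^sup>2 / 4)" by (intro mult_right_mono power_exp_bounds) auto
      finally show ?thesis by simp
    qed
    define \<rho> where "\<rho> = r / 64"
    have \<rho>: "\<rho> > 0" "\<rho> \<le> 1" using r by (auto simp: \<rho>_def)
    \<comment> \<open>The factor \<open>40\<close> is twice the \<open>20\<close> that bounds the square root of \<open>384\<close>.\<close>
    define Z where "Z = 40 * 3 ^ N * A * M / (K * \<rho> ^ N)"
    have Zpos: "Z > 0" unfolding Z_def using A M K \<rho> by simp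
    have Z64: "Z \<ge> 64 ^ N"
    proof -
      have "(64::real) ^ N \<le> (1 / \<rho>) ^ N" using r by (intro power_mono) (auto simp: \<rho>_def field_simps)
      also have "\<dots> = 1 / (1 * \<rho> ^ N)" by (simp add: power_divide)
      also have "\<dots> \<le> 40 * 3 ^ N * A * M / (K * \<rho> ^ N)"
      proof (intro frac_le mult_mono)
        have "1 * 1 * 1 * 1 \<le> 40 * 3 ^ N * A * M" using A M by (intro mult_mono) auto
        then show "1 \<le> 40 * 3 ^ N * A * M" by simp
      qed (use \<rho> K A M in auto)
      finally show ?thesis by (simp add: Z_def)
    qed
    have Z1: "Z \<ge> 1" using Z64 one_le_power[of "64::real" N] by linarith
    define m where "m = nat \<lceil>log 8 Z\<rceil>"
    have lZ: "log 8 Z \<ge> 0" using Z1 by simp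
    have m1: "8 ^ m \<ge> Z"
    proof -
      have "Z = 8 powr (log 8 Z)" using Zpos by simp
      also have "\<dots> \<le> 8 powr real m" unfolding m_def by (intro powr_mono real_nat_ceiling_ge) auto
      finally show ?thesis by (simp add: powr_realpow)
    qed
    have m2: "8 ^ m \<le> 8 * Z"
    proof -
      have "real m \<le> 1 + log 8 Z" unfolding m_def using lZ by linarith
      then have "8 powr real m \<le> 8 powr (1 + log 8 Z)" by (intro powr_mono) auto
      then show ?thesis using Zpos by (simp add: powr_realpow powr_add)
    qed
    have mN: "m \<ge> N"
    proof -
      have "(8::real) ^ N \<le> 64 ^ N" by (intro power_mono) auto
      also have "\<dots> \<le> 8 ^ m" using Z64 m1 by linarith
      finally show ?thesis by (simp add: power_increasing_iff)
    qed
    define S where "S = 8 ^ m * (A * M * (\<epsilon> + (1/64) ^ m))"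
    have S0: "S \<ge> 0" unfolding S_def using A M \<epsilon> by simp
    have "K\<^sup>2 \<le> \<epsilon>\<^sup>2 + 9 ^ N * (192 * (S\<^sup>2 / \<rho> ^ (2 * N)) + 8 * C0\<^sup>2 / 64 ^ N)"
      unfolding S_def \<rho>_def by (rule H[OF Nge2 NM mN])
    also have "\<dots> = \<epsilon>\<^sup>2 + 192 * (3 ^ N * S / \<rho> ^ N)\<^sup>2 + 9 ^ N * (8 * C0\<^sup>2 / 64 ^ N)"
    proof -
      have "(3 ^ N * S / \<rho> ^ N)\<^sup>2 = 9 ^ N * (S\<^sup>2 / \<rho> ^ (2 * N))"
        by (simp add: power_divide power_mult_distrib power_mult[symmetric] mult.commute[of N 2]) (simp add: power_mult)
      then show ?thesis by (simp add: distrib_left)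
    qed
    finally have "K\<^sup>2 \<le> 384 * (3 ^ N * S / \<rho> ^ N)\<^sup>2" using e2 tail by linarith
    also have "\<dots> \<le> (20 * (3 ^ N * S / \<rho> ^ N))\<^sup>2"
      unfolding power_mult_distrib[of 20] by (intro mult_right_mono) auto
    finally have "K \<le> 20 * (3 ^ N * S / \<rho> ^ N)"
      by (rule power2_le_imp_le) (use S0 \<rho> in auto)
    also have "\<dots> = K / 2 * (Z * (8 ^ m * (\<epsilon> + (1/64) ^ m)))"
      using K \<rho> by (simp add: Z_def S_def field_simps)
    finally have "K / 2 * 2 \<le> K / 2 * (Z * (8 ^ m * (\<epsilon> + (1/64) ^ m)))" by simp
    then have "2 \<le> Z * (8 ^ m * (\<epsilon> + (1/64) ^ m))" using K by (subst (asm) mult_le_cancel_left_pos) auto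
    also have "\<dots> = Z * (8 ^ m * \<epsilon>) + Z * (8 ^ m * (1/64) ^ m)" by (simp add: distrib_left)
    also have "8 ^ m * (1/64) ^ m = (1 / 8 ^ m :: real)"
    proof -
      have "(8::real) ^ m * (1/64) ^ m = (8 * (1/64)) ^ m" by (simp only: power_mult_distrib)
      then show ?thesis by (simp add: power_divide)
    qed
    also have "Z * (1 / 8 ^ m) \<le> 1" using m1 by (simp add: divide_le_eq)
    finally have "1 \<le> Z * (8 ^ m * \<epsilon>)" by linarith
    also have "\<dots> \<le> Z * (8 * Z * \<epsilon>)" using m2 \<epsilon> Zpos by (intro mult_left_mono mult_right_mono) auto
    finally have "1 / (8 * Z\<^sup>2) \<le> \<epsilon>" using Zpos by (simp add: divide_le_eq power2_eq_square mult_ac)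
    moreover have "1 / (12800 * A\<^sup>2) * r powr ((6 * (B + 1) + 2) * L) \<le> 1 / (8 * Z\<^sup>2)"
    proof -
      have e1: "1 / (8 * Z\<^sup>2) = 1 / (12800 * A\<^sup>2) * (K\<^sup>2 * (\<rho> ^ N)\<^sup>2 * (1 / 3 ^ N)\<^sup>2 * (1 / M)\<^sup>2)"
        using A M K \<rho> by (simp add: Z_def power_mult_distrib power_divide)
      have f1: "r powr (2 * \<bar>ln K\<bar>) \<le> K\<^sup>2"
      proof -
        have "(r powr \<bar>ln K\<bar>)\<^sup>2 \<le> K\<^sup>2" using Kr by (intro power_mono) auto
        then show ?thesis by (simp add: power2_eq_square powr_add[symmetric])
      qed
      have f2: "r ^ (4 * N) \<le> (\<rho> ^ N)\<^sup>2"
      proof -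
        have "r * r \<le> r * (1/64)" using r by (intro mult_left_mono) auto
        then have "r\<^sup>2 \<le> \<rho>" by (simp add: \<rho>_def power2_eq_square)
        then have "(r\<^sup>2) ^ (2 * N) \<le> \<rho> ^ (2 * N)" by (intro power_mono) auto
        then show ?thesis by (simp add: power_mult[symmetric] mult.commute)
      qed
      have f3: "r ^ N \<le> (1 / 3 ^ N)\<^sup>2"
      proof -
        have "r ^ N \<le> (1/9) ^ N" using r by (intro power_mono) auto
        also have "\<dots> = (1 / 3 ^ N)\<^sup>2" by (simp add: power_divide power_mult[symmetric] mult.commute[of N 2]) (simp add: power_mult)
        finally show ?thesis .
      qed
      have f4: "r ^ N \<le> (1 / M)\<^sup>2"
      proof -
        have "M\<^sup>2 \<le> B * M\<^sup>2" using B2 by (simp add: mult_le_cancel_right1)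
        then have "M\<^sup>2 \<le> real N" using NM by linarith
        also have "real N \<le> 2 ^ N" by (simp add: less_imp_le of_nat_less_two_power)
        finally have "1 / 2 ^ N \<le> 1 / M\<^sup>2" using M by (intro divide_left_mono) auto
        moreover have "r ^ N \<le> (1/2) ^ N" using r by (intro power_mono) auto
        ultimately show ?thesis by (simp add: power_divide)
      qed
      have "r powr (6 * real N + 2 * \<bar>ln K\<bar>) = r powr (2 * \<bar>ln K\<bar>) * r ^ (4 * N) * r ^ N * r ^ N"
      proof -
        have "r powr (6 * real N + 2 * \<bar>ln K\<bar>) = r powr (2 * \<bar>ln K\<bar>) * r powr (real (6 * N))"
          unfolding powr_add[symmetric] by (simp add: add.commute)
        also have "r powr (real (6 * N)) = r ^ (6 * N)" using r by (intro powr_realpow) auto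
        also have "r ^ (6 * N) = r ^ (4 * N) * r ^ N * r ^ N" unfolding power_add[symmetric] by (intro arg_cong[where f="\<lambda>k. r ^ k"]) simp
        finally show ?thesis by (simp add: mult.assoc)
      qed
      also have "\<dots> \<le> K\<^sup>2 * (\<rho> ^ N)\<^sup>2 * (1 / 3 ^ N)\<^sup>2 * (1 / M)\<^sup>2"
        using r by (intro mult_mono f1 f2 f3 f4 mult_nonneg_nonneg) auto
      finally have "r powr ((6 * (B + 1) + 2) * L) \<le> K\<^sup>2 * (\<rho> ^ N)\<^sup>2 * (1 / 3 ^ N)\<^sup>2 * (1 / M)\<^sup>2" using goalexp by linarith
      then show ?thesis unfolding e1 by (intro mult_left_mono) auto
    qed
    ultimately show "1 / (12800 * A\<^sup>2) * r powr ((6 * (B + 1) + 2) * L) \<le> \<epsilon>" by linarith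
  qed
qed

lemma vanishing_order:
  fixes C0 :: real
  assumes C0: "C0 > 0"
  defines "A \<equiv> 1 + fundamental_const * local_riesz_const + 8 * fundamental_const * C0"
  defines "B \<equiv> 2 + 32 * C0\<^sup>2 + 23232 * fundamental_const\<^sup>2"
  assumes w: "\<And>y. \<bar>w y\<bar> \<le> C0" and wm: "w \<in> borel_measurable borel"
    and fw: "\<And>y. \<bar>f y\<bar> \<le> M * \<bar>w y\<bar>" and fm: "f \<in> borel_measurable borel" and M: "M \<ge> 1"
    and rep: "\<And>x x'. w x - w x' = fundamental_const * (\<integral>y. f y * riesz_diff x x' y \<partial>lborel)"
    and K: "0 < K" "K \<le> 1" "K\<^sup>2 \<le> (\<integral>x. indicator {-3..3} x * (w x)\<^sup>2 \<partial>lborel)"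
    and r: "0 < r" "r < 1/64" and \<epsilon>: "\<And>x. \<bar>x\<bar> < r \<Longrightarrow> \<bar>w x\<bar> \<le> \<epsilon>"
  shows "\<epsilon> \<ge> 1 / (12800 * A\<^sup>2) * r powr ((6 * (B + 1) + 2) * (1 + M\<^sup>2 + \<bar>ln K\<bar>))"
proof (rule choice_of_parameters[where ?C0.0 = C0])
  have cg: "fundamental_const * local_riesz_const \<ge> 0" "fundamental_const * C0 \<ge> 0" using fundamental_const_pos local_riesz_const_pos C0 by auto
  then show "A \<ge> 1" unfolding A_def by simp
  show "B \<ge> 2 + 32 * C0\<^sup>2" unfolding B_def by simp
  show eps0: "\<epsilon> \<ge> 0" using \<epsilon>[of 0] r by (auto intro: order_trans[OF abs_ge_zero])
  fix N m :: nat assume N: "N \<ge> 2" "real N \<ge> B * M\<^sup>2" and mN: "m \<ge> N"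
  have N': "real N \<ge> 23232 * fundamental_const\<^sup>2 * M\<^sup>2"
  proof -
    have "23232 * fundamental_const\<^sup>2 * M\<^sup>2 \<le> B * M\<^sup>2" unfolding B_def by (intro mult_right_mono) auto
    then show ?thesis using N by linarith
  qed
  define \<delta> where "\<delta> = (1 + fundamental_const * local_riesz_const * M) * \<epsilon> + 8 * fundamental_const * (M * C0) * (1/64) ^ m"
  have r1: "r \<le> 1" "r \<le> 1/2" using r by auto
  have d0: "\<delta> \<ge> 0" unfolding \<delta>_def using eps0 M cg C0 fundamental_const_pos local_riesz_const_pos by simp
  have dle: "\<delta> \<le> A * M * (\<epsilon> + (1/64) ^ m)"
  proof -
    have "1 + fundamental_const * local_riesz_const * M \<le> A * M"
    proof -
      have "0 \<le> 8 * (fundamental_const * C0) * M" using cg M by simp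
      moreover have "A * M = M + fundamental_const * local_riesz_const * M + 8 * (fundamental_const * C0) * M" unfolding A_def by (simp add: algebra_simps)
      ultimately show ?thesis using M by linarith
    qed
    then have a: "(1 + fundamental_const * local_riesz_const * M) * \<epsilon> \<le> A * M * \<epsilon>" using eps0 by (intro mult_right_mono)
    have "8 * fundamental_const * (M * C0) \<le> A * M"
    proof -
      have "0 \<le> (1 + fundamental_const * local_riesz_const) * M" using cg M by simp
      moreover have "A * M = (1 + fundamental_const * local_riesz_const) * M + 8 * fundamental_const * (M * C0)" unfolding A_def by (simp add: algebra_simps)
      ultimately show ?thesis by linarith
    qed
    then have b: "8 * fundamental_const * (M * C0) * (1/64) ^ m \<le> A * M * (1/64) ^ m" by (intro mult_right_mono) auto
    show ?thesis using a b unfolding \<delta>_def by (simp add: distrib_left)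
  qed
  define X where "X = (\<integral>x. indicator {x. r \<le> \<bar>x\<bar> \<and> \<bar>x\<bar> \<le> 8} x * ((w x)\<^sup>2 / x ^ (2 * N)) \<partial>lborel)"
  have "X \<le> 192 * ((8 ^ m * \<delta>)\<^sup>2 / (r / 64) ^ (2 * N)) + 8 * C0\<^sup>2 / 64 ^ N"
    unfolding X_def by (rule weighted_estimate[OF w wm fw fm M rep r(1) r1(1) \<epsilon> N(1) N' mN \<delta>_def])
  also have "\<dots> \<le> 192 * ((8 ^ m * (A * M * (\<epsilon> + (1/64) ^ m)))\<^sup>2 / (r / 64) ^ (2 * N)) + 8 * C0\<^sup>2 / 64 ^ N"
    using d0 r dle by (intro add_right_mono mult_left_mono divide_right_mono power_mono) auto
  finally have X: "9 ^ N * X \<le> 9 ^ N * (192 * ((8 ^ m * (A * M * (\<epsilon> + (1/64) ^ m)))\<^sup>2 / (r / 64) ^ (2 * N)) + 8 * C0\<^sup>2 / 64 ^ N)"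
    by (intro mult_left_mono) auto
  have "K\<^sup>2 \<le> \<epsilon>\<^sup>2 + 9 ^ N * X"
    unfolding X_def using K(3) mass_splitting[OF w wm r(1) r1(2) \<epsilon>, of N] by linarith
  then show "K\<^sup>2 \<le> \<epsilon>\<^sup>2 + 9 ^ N * (192 * ((8 ^ m * (A * M * (\<epsilon> + (1/64) ^ m)))\<^sup>2 / (r / 64) ^ (2 * N)) + 8 * C0\<^sup>2 / 64 ^ N)"
    using X by linarith
qed (use K M r in auto)

section \<open>Bounded distributional solutions\<close>

lemma Linf_norm_AE:
  assumes f: "f \<in> borel_measurable (lebesgue_on A)" and b: "Linf_norm A f \<le> ereal b"
  shows "AE x in lebesgue_on A. \<bar>f x\<bar> \<le> b"
proof -
  have "AE x in lebesgue_on A. ereal \<bar>f x\<bar> \<le> Linf_norm A f"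
    unfolding Linf_norm_def by (rule esssup_AE)
  then show ?thesis
  proof eventually_elim
    case (elim x)
    then have "ereal \<bar>f x\<bar> \<le> ereal b" using b by (rule order_trans)
    then show ?case by simp
  qed
qed

lemma Linf_measurable: "f \<in> Linf UNIV \<Longrightarrow> f \<in> borel_measurable lebesgue"
  by (simp add: Linf_def lebesgue_on_UNIV_eq)

lemma bounded_borel_version:
  assumes f: "f \<in> Linf UNIV" and b: "Linf_norm UNIV f \<le> ereal b" and b0: "b \<ge> 0"
  obtains g where "g \<in> borel_measurable borel" "\<And>x. \<bar>g x\<bar> \<le> b" "AE x in lborel. f x = g x"
proof -
  have m: "f \<in> borel_measurable lebesgue" by (rule Linf_measurable[OF f])
  then obtain g where g: "g \<in> borel_measurable lborel" "AE x in lborel. f x = g x"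
    using completion_ex_borel_measurable_real by blast
  have "f \<in> borel_measurable (lebesgue_on UNIV)" using m unfolding lebesgue_on_UNIV_eq .
  from Linf_norm_AE[OF this b] have "AE x in lebesgue. \<bar>f x\<bar> \<le> b" unfolding lebesgue_on_UNIV_eq .
  then have ae: "AE x in lborel. \<bar>f x\<bar> \<le> b" by (simp add: AE_completion_iff)
  define h where "h = (\<lambda>x. max (- b) (min b (g x)))"
  show ?thesis
  proof (rule that)
    show "h \<in> borel_measurable borel" unfolding h_def using g(1) by simp
    show "\<bar>h x\<bar> \<le> b" for x using b0 by (auto simp: h_def)
    show "AE x in lborel. f x = h x" using g(2) ae by eventually_elim (auto simp: h_def)
  qed
qed

text \<open>The distributional pairing is a Lebesgue integral, while the estimates use Borel functions and
  \<open>lborel\<close>. Changing to Borel representatives leaves the pairing unchanged.\<close>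

lemma dist_of_eq:
  assumes ae: "AE x in lborel. f x = g x" and fm: "f \<in> borel_measurable lebesgue"
    and [measurable]: "g \<in> borel_measurable borel" "\<phi> \<in> borel_measurable borel"
  shows "dist_of f \<phi> = (LINT x|lborel. complex_of_real (g x) * \<phi> x)"
proof -
  have m: "(\<lambda>x. complex_of_real (g x) * \<phi> x) \<in> borel_measurable lborel" by measurable
  have p: "\<phi> \<in> borel_measurable lebesgue" by (rule measurable_completion) simp
  have fl: "(\<lambda>x. complex_of_real (f x) * \<phi> x) \<in> borel_measurable lebesgue" using fm p by measurable
  have "dist_of f \<phi> = (LINT x|lebesgue. complex_of_real (g x) * \<phi> x)"
    unfolding dist_of_def
    by (rule integral_cong_AE[OF fl measurable_completion[OF m]]) (use AE_completion[OF ae] in eventually_elim, simp)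
  then show ?thesis by (simp add: integral_completion[OF m])
qed

lemma schwartz_measurable: "schwartz \<phi> \<Longrightarrow> \<phi> \<in> borel_measurable borel"
proof -
  assume "schwartz \<phi>"
  then have "\<forall>x. (vderiv ^^ 0) \<phi> differentiable (at x)" unfolding schwartz_def by blast
  then have "continuous_on UNIV \<phi>"
    by (intro continuous_at_imp_continuous_on) (auto intro: differentiable_imp_continuous_within)
  then show ?thesis by (rule borel_measurable_continuous_onI)
qed

text \<open>The source is rewritten with \<open>w\<close> in place of \<open>v\<close>, so that \<open>\<bar>f y\<bar> \<le> M * \<bar>w y\<bar>\<close> holds at every
  point and not only almost everywhere.\<close>

lemma solution_representation:
  fixes q v :: "real \<Rightarrow> real"
  assumes M: "M \<ge> 0" and C0: "C0 > 0" and q: "q \<in> Linf UNIV" "Linf_norm UNIV q \<le> ereal M" and v: "v \<in> Linf UNIV" "Linf_norm UNIV v \<le> ereal C0"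
    and S: "solves q v"
  obtains w f where "\<And>x. \<bar>w x\<bar> \<le> C0" "w \<in> borel_measurable borel" "AE x in lborel. w x = v x"
    "f \<in> borel_measurable borel" "\<And>y. \<bar>f y\<bar> \<le> M * \<bar>w y\<bar>" "\<And>x x'. w x - w x' = fundamental_const * (\<integral>y. f y * riesz_diff x x' y \<partial>lborel)"
proof -
  obtain q' where q': "q' \<in> borel_measurable borel" "\<And>x. \<bar>q' x\<bar> \<le> M" "AE x in lborel. q x = q' x"
    using bounded_borel_version[OF q M] by blast
  obtain v' where v': "v' \<in> borel_measurable borel" "\<And>x. \<bar>v' x\<bar> \<le> C0" "AE x in lborel. v x = v' x"
    using bounded_borel_version[OF v] C0 by auto
  note [measurable] = q'(1) v'(1)
  have qm: "q \<in> borel_measurable lebesgue" "v \<in> borel_measurable lebesgue" using q v by (simp_all add: Linf_measurable)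
  define f where "f = (\<lambda>y. - (q' y * v' y))"
  have fm [measurable]: "f \<in> borel_measurable borel" unfolding f_def by measurable
  have fb: "\<bar>f y\<bar> \<le> M * C0" for y unfolding f_def using q'(2)[of y] v'(2)[of y] M by (simp add: abs_mult mult_mono)
  have E: "(LINT x|lborel. complex_of_real (v' x) * frac_lap \<phi> x) = (LINT x|lborel. complex_of_real (f x) * \<phi> x)"
    if sch: "schwartz \<phi>" and fl: "frac_lap \<phi> \<in> borel_measurable borel" for \<phi>
  proof -
    have pm [measurable]: "\<phi> \<in> borel_measurable borel" by (rule schwartz_measurable[OF sch])
    have qv: "AE x in lborel. q x * v x = q' x * v' x" using q'(3) v'(3) by eventually_elim simp
    have qvm: "(\<lambda>x. q x * v x) \<in> borel_measurable lebesgue" using qm by measurable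
    have qvb: "(\<lambda>x. q' x * v' x) \<in> borel_measurable borel" by measurable
    have "(LINT x|lborel. complex_of_real (v' x) * frac_lap \<phi> x) + (LINT x|lborel. complex_of_real (q' x * v' x) * \<phi> x) = 0"
      using S sch unfolding solves_def frac_lap_dist_def
      using dist_of_eq[OF v'(3) qm(2) v'(1) fl] dist_of_eq[OF qv qvm qvb pm] by auto
    then have "(LINT x|lborel. complex_of_real (v' x) * frac_lap \<phi> x) = - (LINT x|lborel. complex_of_real (q' x * v' x) * \<phi> x)"
      by (simp only: add_eq_0_iff2)
    also have "\<dots> = (LINT x|lborel. - (complex_of_real (q' x * v' x) * \<phi> x))" by (rule Bochner_Integration.integral_minus[symmetric])
    finally show ?thesis by (simp add: f_def)
  qed
  obtain w where w: "\<And>x. \<bar>w x\<bar> \<le> C0" "\<And>x x'. w x - w x' = fundamental_const * (\<integral>y. f y * riesz_diff x x' y \<partial>lborel)"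
    "w \<in> borel_measurable borel" "AE x in lborel. w x = v' x"
    using riesz_representation[OF v'(2) fb v'(1) fm E] by blast
  note [measurable] = w(3)
  define f2 where "f2 = (\<lambda>y. - (q' y * w y))"
  have f2m [measurable]: "f2 \<in> borel_measurable borel" unfolding f2_def by measurable
  show ?thesis
  proof (rule that[OF w(1) w(3) _ f2m])
    show "AE x in lborel. w x = v x" using w(4) v'(3) by eventually_elim simp
    show "\<bar>f2 y\<bar> \<le> M * \<bar>w y\<bar>" for y unfolding f2_def using q'(2)[of y] by (simp add: abs_mult mult_right_mono)
    show "w x - w x' = fundamental_const * (\<integral>y. f2 y * riesz_diff x x' y \<partial>lborel)" for x x'
    proof -
      have "AE y in lborel. f y * riesz_diff x x' y = f2 y * riesz_diff x x' y" using w(4) by eventually_elim (simp add: f_def f2_def)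
      then have "(\<integral>y. f y * riesz_diff x x' y \<partial>lborel) = (\<integral>y. f2 y * riesz_diff x x' y \<partial>lborel)"
        by (rule integral_cong_AE[rotated 2]) measurable
      then show ?thesis using w(2)[of x x'] by simp
    qed
  qed
qed

lemma solution_hoelder:
  assumes M: "M \<ge> 0" and w: "\<And>x. \<bar>w x\<bar> \<le> C0"
    and fm: "f \<in> borel_measurable borel" and f: "\<And>y. \<bar>f y\<bar> \<le> M * \<bar>w y\<bar>" and rep: "\<And>x x'. w x - w x' = fundamental_const * (\<integral>y. f y * riesz_diff x x' y \<partial>lborel)"
  shows "\<bar>w x - w x'\<bar> \<le> fundamental_const * (M * C0 * (sqrt \<bar>x - x'\<bar> * riesz_diff_mass))" "continuous_on UNIV w"
proof -
  have fb: "\<bar>f y\<bar> \<le> M * C0" for y using M by (intro order_trans[OF f mult_left_mono[OF w]])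
  have h: "\<bar>w x - w x'\<bar> \<le> fundamental_const * (M * C0 * (sqrt \<bar>x - x'\<bar> * riesz_diff_mass))" for x x'
    unfolding rep abs_mult using fundamental_const_pos riesz_hoelder[OF fb fm, of x x'] by (simp add: mult_left_mono)
  show "\<bar>w x - w x'\<bar> \<le> fundamental_const * (M * C0 * (sqrt \<bar>x - x'\<bar> * riesz_diff_mass))" by (rule h)
  show "continuous_on UNIV w"
    by (rule continuous_of_hoelder_half[where a = "fundamental_const * (M * C0 * riesz_diff_mass)"])
      (use h in \<open>simp add: mult_ac\<close>)
qed

lemma AE_continuous_bound:
  fixes w :: "real \<Rightarrow> real"
  assumes c: "continuous_on UNIV w" and ae: "AE x in lborel. \<bar>x\<bar> < r \<longrightarrow> \<bar>w x\<bar> \<le> e" and x: "\<bar>x\<bar> < r"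
  shows "\<bar>w x\<bar> \<le> e"
proof (rule ccontr)
  assume "\<not> \<bar>w x\<bar> \<le> e"
  let ?S = "{x. e < \<bar>w x\<bar>} \<inter> {-r<..<r}"
  have op: "open ?S" using c by (intro open_Int open_Collect_less) (auto intro!: continuous_intros)
  have "AE x in lebesgue. x \<notin> ?S" using AE_completion[OF ae] by eventually_elim auto
  then have "?S \<in> null_sets lebesgue" using op by (subst (asm) AE_iff_null_sets[symmetric]) auto
  then have "negligible ?S" by (simp add: negligible_iff_null_sets)
  then have "?S = {}" using op open_not_negligible by blast
  moreover have "x \<in> ?S" using x \<open>\<not> \<bar>w x\<bar> \<le> e\<close> by auto
  ultimately show False by blast
qed

text \<open>By Hoelder continuity \<open>\<bar>w\<bar> \<ge> c0 / 2\<close> on an interval of length \<open>(c0 / (2 \<Lambda>))\<^sup>2 \<le> 1\<close> to the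
  right of the point, which is contained in \<open>[-3, 3]\<close>.\<close>

lemma mass_from_point_value:
  fixes w :: "real \<Rightarrow> real"
  assumes wm [measurable]: "w \<in> borel_measurable borel" and b: "\<And>y. \<bar>w y\<bar> \<le> C0" and h: "\<And>x x'. \<bar>w x - w x'\<bar> \<le> \<Lambda> * sqrt \<bar>x - x'\<bar>" and \<Lambda>: "\<Lambda> \<ge> 1"
    and c0: "0 < c0" "c0 \<le> 1" and xs: "\<bar>xs\<bar> \<le> 2" "\<bar>w xs\<bar> \<ge> c0"
  shows "(c0\<^sup>2 / (4 * \<Lambda>))\<^sup>2 \<le> (\<integral>x. indicator {-3..3} x * (w x)\<^sup>2 \<partial>lborel)"
proof -
  define d where "d = (c0 / (2 * \<Lambda>))\<^sup>2"
  have q: "c0 / (2 * \<Lambda>) \<le> 1" "0 < c0 / (2 * \<Lambda>)" using c0 \<Lambda> by (auto simp: divide_le_eq)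
  have d: "0 < d" "d \<le> 1" using q by (auto simp: d_def intro!: power_le_one)
  have sd: "sqrt d = c0 / (2 * \<Lambda>)" unfolding d_def real_sqrt_abs using q(2) by (simp only: abs_of_pos)
  have i1: "integrable lborel (\<lambda>x. indicator {-3..3} x * (w x)\<^sup>2)"
  proof (rule Bochner_Integration.integrable_bound)
    show "integrable lborel (\<lambda>x. C0\<^sup>2 * indicator {-3..3::real} x)" by simp
    have "(w x)\<^sup>2 \<le> C0\<^sup>2" for x using power_mono[OF b[of x], of 2] by simp
    then show "AE x in lborel. norm (indicator {-3..3} x * (w x)\<^sup>2) \<le> norm (C0\<^sup>2 * indicator {-3..3::real} x)"
      by (intro AE_I2) (auto simp: indicator_def)
  qed measurable
  have i2: "integrable lborel (\<lambda>x. (c0 / 2)\<^sup>2 * indicator {xs..xs + d} x)" using d by simp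
  have "(c0\<^sup>2 / (4 * \<Lambda>))\<^sup>2 = (\<integral>x. (c0 / 2)\<^sup>2 * indicator {xs..xs + d} x \<partial>lborel)"
    using d \<Lambda> by (simp add: d_def power2_eq_square field_simps)
  also have "\<dots> \<le> (\<integral>x. indicator {-3..3} x * (w x)\<^sup>2 \<partial>lborel)"
  proof (rule integral_mono[OF i2 i1])
    fix x :: real
    show "(c0 / 2)\<^sup>2 * indicator {xs..xs + d} x \<le> indicator {-3..3} x * (w x)\<^sup>2"
    proof (cases "x \<in> {xs..xs + d}")
      case True
      then have x3: "x \<in> {-3..3}" using xs d by auto
      have "sqrt \<bar>x - xs\<bar> \<le> sqrt d" using True by simp
      then have "\<Lambda> * sqrt \<bar>x - xs\<bar> \<le> \<Lambda> * (c0 / (2 * \<Lambda>))" unfolding sd using \<Lambda> by (intro mult_left_mono) auto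
      also have "\<dots> = c0 / 2" using \<Lambda> by simp
      finally have "\<bar>w x\<bar> \<ge> c0 / 2" using h[of x xs] xs by linarith
      then have "(c0 / 2)\<^sup>2 \<le> \<bar>w x\<bar>\<^sup>2" using c0 by (intro power_mono) auto
      then show ?thesis using True x3 by simp
    next
      case False
      then have "indicator {xs..xs + d} x = (0::real)" by (rule indicator_simps(2))
      then show ?thesis by simp
    qed
  qed
  finally show ?thesis .
qed

text \<open>If the essential supremum were below \<open>X\<close>, continuity would give \<open>\<bar>w\<bar> \<le> X\<close> on the whole
  interval and hence \<open>2 * X \<le> X\<close>; the factor \<open>2\<close> provides the strict inequality.\<close>

lemma Linf_norm_lower:
  fixes v w :: "real \<Rightarrow> real"
  assumes vm: "v \<in> Linf UNIV" and wv: "AE x in lborel. w x = v x" and wc: "continuous_on UNIV w"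
    and low: "\<And>e. (\<And>x. \<bar>x\<bar> < r \<Longrightarrow> \<bar>w x\<bar> \<le> e) \<Longrightarrow> 2 * X \<le> e" and X: "X > 0"
  shows "Linf_norm {-r<..<r} v \<ge> ereal X"
proof (rule ccontr)
  assume "\<not> Linf_norm {-r<..<r} v \<ge> ereal X"
  then have lt: "Linf_norm {-r<..<r} v \<le> ereal X" by simp
  have m: "v \<in> borel_measurable lebesgue" by (rule Linf_measurable[OF vm])
  have "AE x in lebesgue_on {-r<..<r}. \<bar>v x\<bar> \<le> X"
    by (rule Linf_norm_AE[OF _ lt]) (use m in \<open>simp add: measurable_restrict_space1\<close>)
  then have "AE x in lebesgue. x \<in> {-r<..<r} \<longrightarrow> \<bar>v x\<bar> \<le> X"
    by (subst (asm) AE_restrict_space_iff) auto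
  then have "AE x in lborel. x \<in> {-r<..<r} \<longrightarrow> \<bar>v x\<bar> \<le> X" by (simp only: AE_completion_iff)
  then have "AE x in lborel. \<bar>x\<bar> < r \<longrightarrow> \<bar>w x\<bar> \<le> X" using wv by eventually_elim auto
  then have "\<bar>w x\<bar> \<le> X" if "\<bar>x\<bar> < r" for x using AE_continuous_bound[OF wc _ that] by blast
  then have "2 * X \<le> X" by (rule low)
  then show False using X by simp
qed

lemma L2_norm_on_mass:
  fixes v w :: "real \<Rightarrow> real"
  assumes vm: "v \<in> Linf UNIV" and wv: "AE x in lborel. w x = v x" and [measurable]: "w \<in> borel_measurable borel" and wb: "\<And>x. \<bar>w x\<bar> \<le> C0"
    and K: "K \<ge> 0" "L2_norm_on {-2<..<2} v \<ge> K"
  shows "K\<^sup>2 \<le> (\<integral>x. indicator {-3..3} x * (w x)\<^sup>2 \<partial>lborel)"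
proof -
  have m: "v \<in> borel_measurable lebesgue" by (rule Linf_measurable[OF vm])
  have iA: "integrable lborel (\<lambda>x. indicator A x * (w x)\<^sup>2)" if A: "A \<in> sets borel" "A \<subseteq> {-3..3}" for A
  proof (rule Bochner_Integration.integrable_bound)
    show "integrable lborel (\<lambda>x. C0\<^sup>2 * indicator {-3..3::real} x)" by simp
    have "(w x)\<^sup>2 \<le> C0\<^sup>2" for x using power_mono[OF wb[of x], of 2] by simp
    then show "AE x in lborel. norm (indicator A x * (w x)\<^sup>2) \<le> norm (C0\<^sup>2 * indicator {-3..3::real} x)"
      using A(2) by (intro AE_I2) (auto simp: indicator_def)
  qed (use A(1) in measurable)
  have wm: "(\<lambda>x. indicator {-2<..<2} x * (w x)\<^sup>2) \<in> borel_measurable lborel" by measurable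
  have "(LINT x:{-2<..<2}|lebesgue. (v x)\<^sup>2) = (LINT x|lebesgue. indicator {-2<..<2} x * (w x)\<^sup>2)"
    unfolding set_lebesgue_integral_def
  proof (rule integral_cong_AE)
    have i2: "indicator {-2<..<2::real} \<in> borel_measurable lebesgue" by (rule measurable_completion) simp
    show "(\<lambda>x. indicator {-2<..<2} x *\<^sub>R (v x)\<^sup>2) \<in> borel_measurable lebesgue" using m i2 by measurable
    show "(\<lambda>x. indicator {-2<..<2} x * (w x)\<^sup>2) \<in> borel_measurable lebesgue" by (rule measurable_completion[OF wm])
    show "AE x in lebesgue. indicator {-2<..<2} x *\<^sub>R (v x)\<^sup>2 = indicator {-2<..<2} x * (w x)\<^sup>2"
      using AE_completion[OF wv] by eventually_elim simp
  qed
  also have "\<dots> = (\<integral>x. indicator {-2<..<2} x * (w x)\<^sup>2 \<partial>lborel)" by (rule integral_completion[OF wm])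
  also have "\<dots> \<le> (\<integral>x. indicator {-3..3} x * (w x)\<^sup>2 \<partial>lborel)"
    by (rule integral_mono[OF iA iA]) (auto simp: indicator_def)
  finally have le: "(LINT x:{-2<..<2}|lebesgue. (v x)\<^sup>2) \<le> (\<integral>x. indicator {-3..3} x * (w x)\<^sup>2 \<partial>lborel)" .
  have nn: "0 \<le> (LINT x:{-2<..<2}|lebesgue. (v x)\<^sup>2)" unfolding set_lebesgue_integral_def by (intro integral_nonneg_AE AE_I2) simp
  have "K\<^sup>2 \<le> (sqrt (LINT x:{-2<..<2}|lebesgue. (v x)\<^sup>2))\<^sup>2" using K unfolding L2_norm_on_def by (intro power_mono) auto
  also have "\<dots> = (LINT x:{-2<..<2}|lebesgue. (v x)\<^sup>2)" using nn by simp
  finally show ?thesis using le by linarith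
qed

theorem theorem15p6:
  fixes C0 :: real
  assumes "C0 > 0"
  shows "\<exists>r0 c C :: real. r0 > 0 \<and> c > 0 \<and> C > 0 \<and>
    (\<forall>(M::real) (q :: real \<Rightarrow> real) (v :: real \<Rightarrow> real).
       M \<ge> 0 \<and> q \<in> Linf UNIV \<and> v \<in> Linf UNIV \<and> solves q v \<and>
       Linf_norm UNIV q \<le> ereal M \<and> Linf_norm UNIV v \<le> ereal C0 \<longrightarrow>
       (\<forall>c0::real. 0 < c0 \<and> c0 \<le> 1 \<and> (\<exists>xs::real. \<bar>xs\<bar> \<le> 2 \<and> \<bar>cont_rep v xs\<bar> \<ge> c0) \<longrightarrow>
          (\<forall>r. 0 < r \<and> r < r0 \<longrightarrow>
             Linf_norm {-r<..<r} v \<ge> ereal (c * r powr (C * (1 + M\<^sup>2 + \<bar>ln c0\<bar>))))) \<and>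
       (\<forall>K::real. 0 < K \<and> K \<le> 1 \<and> L2_norm_on {-2<..<2} v \<ge> K \<longrightarrow>
          (\<forall>r. 0 < r \<and> r < r0 \<longrightarrow>
             Linf_norm {-r<..<r} v \<ge> ereal (c * r powr (C * (1 + M\<^sup>2 + \<bar>ln K\<bar>))))))"
proof -
  define A where "A = 1 + fundamental_const * local_riesz_const + 8 * fundamental_const * C0"
  define B where "B = 2 + 32 * C0\<^sup>2 + 23232 * fundamental_const\<^sup>2"
  define E where "E = 6 * (B + 1) + 2"
  define a where "a = fundamental_const * C0 * riesz_diff_mass"
  define c where "c = 1 / (25600 * A\<^sup>2)"
  define C where "C = E * (5 + 2 * a)"
  have a0: "a \<ge> 0" unfolding a_def using fundamental_const_pos riesz_diff_mass_nonneg assms by simp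
  have A1: "A > 0" unfolding A_def using fundamental_const_pos local_riesz_const_pos assms by (intro add_pos_nonneg) auto
  have E0: "E > 0" unfolding E_def B_def by (intro add_nonneg_pos mult_nonneg_nonneg add_nonneg_nonneg) auto
  have cpos: "c > 0" unfolding c_def using A1 by simp
  have Cpos: "C > 0" unfolding C_def using E0 a0 by simp
  have main: "Linf_norm {-r<..<r} v \<ge> ereal (c * r powr (C * (1 + M\<^sup>2 + \<bar>ln k\<bar>)))"
    if M: "M \<ge> 0" and w: "\<And>x. \<bar>w x\<bar> \<le> C0" "w \<in> borel_measurable borel" "AE x in lborel. w x = v x" "continuous_on UNIV w"
      and f: "f \<in> borel_measurable borel" "\<And>y. \<bar>f y\<bar> \<le> M * \<bar>w y\<bar>" "\<And>x x'. w x - w x' = fundamental_const * (\<integral>y. f y * riesz_diff x x' y \<partial>lborel)"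
      and v: "v \<in> Linf UNIV"
      and K: "0 < K" "K \<le> 1" "K\<^sup>2 \<le> (\<integral>x. indicator {-3..3} x * (w x)\<^sup>2 \<partial>lborel)"
      and r: "0 < r" "r < 1/64"
      and k: "1 + (M + 1)\<^sup>2 + \<bar>ln K\<bar> \<le> (5 + 2 * a) * (1 + M\<^sup>2 + \<bar>ln k\<bar>)"
    for M r k K w f and v :: "real \<Rightarrow> real"
  proof (rule Linf_norm_lower[OF v w(3) w(4)])
    show "0 < c * r powr (C * (1 + M\<^sup>2 + \<bar>ln k\<bar>))" using cpos r by simp
    fix e assume e: "\<And>x. \<bar>x\<bar> < r \<Longrightarrow> \<bar>w x\<bar> \<le> e"
    \<comment> \<open>The estimates are applied with \<open>M + 1\<close>, which is at least \<open>1\<close>; this only changes the constants.\<close>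
    have fM: "\<bar>f y\<bar> \<le> (M + 1) * \<bar>w y\<bar>" for y using f(2)[of y] by (simp add: distrib_right)
    have M1: "M + 1 \<ge> 1" using M by simp
    have "1 / (12800 * A\<^sup>2) * r powr (E * (1 + (M + 1)\<^sup>2 + \<bar>ln K\<bar>)) \<le> e"
      unfolding A_def B_def E_def by (rule vanishing_order[OF assms w(1,2) fM f(1) M1 f(3) K r e])
    moreover have "2 * (c * r powr (C * (1 + M\<^sup>2 + \<bar>ln k\<bar>))) = 1 / (12800 * A\<^sup>2) * r powr (C * (1 + M\<^sup>2 + \<bar>ln k\<bar>))"
      by (simp add: c_def)
    moreover have "1 / (12800 * A\<^sup>2) * r powr (C * (1 + M\<^sup>2 + \<bar>ln k\<bar>)) \<le> 1 / (12800 * A\<^sup>2) * r powr (E * (1 + (M + 1)\<^sup>2 + \<bar>ln K\<bar>))"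
    proof (intro mult_left_mono powr_mono')
      have "E * (1 + (M + 1)\<^sup>2 + \<bar>ln K\<bar>) \<le> E * ((5 + 2 * a) * (1 + M\<^sup>2 + \<bar>ln k\<bar>))" using E0 k by (intro mult_left_mono) auto
      then show "E * (1 + (M + 1)\<^sup>2 + \<bar>ln K\<bar>) \<le> C * (1 + M\<^sup>2 + \<bar>ln k\<bar>)" by (simp add: C_def mult.assoc)
    qed (use r in auto)
    ultimately show "2 * (c * r powr (C * (1 + M\<^sup>2 + \<bar>ln k\<bar>))) \<le> e" by linarith
  qed
  have M2: "(M + 1)\<^sup>2 \<le> 2 * M\<^sup>2 + 2" "M \<le> 1 + M\<^sup>2" for M :: real
    using zero_le_power2[of "M - 1"] abs_le_1_square[of M] by (simp_all add: power2_eq_square algebra_simps)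
  show ?thesis
  proof (rule exI[of _ "1/64"], rule exI[of _ c], rule exI[of _ C], intro conjI cpos Cpos allI impI)
    fix M :: real and q v :: "real \<Rightarrow> real" and c0 r :: real
    assume "M \<ge> 0 \<and> q \<in> Linf UNIV \<and> v \<in> Linf UNIV \<and> solves q v \<and> Linf_norm UNIV q \<le> ereal M \<and> Linf_norm UNIV v \<le> ereal C0"
    then have H: "M \<ge> 0" "q \<in> Linf UNIV" "v \<in> Linf UNIV" "solves q v" "Linf_norm UNIV q \<le> ereal M" "Linf_norm UNIV v \<le> ereal C0" by auto
    assume "0 < c0 \<and> c0 \<le> 1 \<and> (\<exists>xs::real. \<bar>xs\<bar> \<le> 2 \<and> \<bar>cont_rep v xs\<bar> \<ge> c0)"
    then obtain xs where c0: "0 < c0" "c0 \<le> 1" and xs: "\<bar>xs\<bar> \<le> 2" "\<bar>cont_rep v xs\<bar> \<ge> c0" by auto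
    assume r: "0 < r \<and> r < 1/64"
    obtain w f where w: "\<And>x. \<bar>w x\<bar> \<le> C0" "w \<in> borel_measurable borel" "AE x in lborel. w x = v x"
      and f: "f \<in> borel_measurable borel" "\<And>y. \<bar>f y\<bar> \<le> M * \<bar>w y\<bar>" "\<And>x x'. w x - w x' = fundamental_const * (\<integral>y. f y * riesz_diff x x' y \<partial>lborel)"
      using solution_representation[OF H(1) assms H(2,5,3,6,4)] by blast
    note wh = solution_hoelder[OF H(1) w(1) f]
    have cr: "cont_rep v = w" by (rule cont_rep_eq[OF wh(2) AE_completion[OF w(3)]])
    define L where "L = 1 + a * M"
    have L1: "L \<ge> 1" using a0 H(1) by (simp add: L_def)
    have hL: "\<bar>w x - w x'\<bar> \<le> L * sqrt \<bar>x - x'\<bar>" for x x'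
    proof -
      have "fundamental_const * (M * C0 * (sqrt \<bar>x - x'\<bar> * riesz_diff_mass)) = (a * M) * sqrt \<bar>x - x'\<bar>" by (simp add: a_def mult_ac)
      also have "\<dots> \<le> L * sqrt \<bar>x - x'\<bar>" by (intro mult_right_mono) (auto simp: L_def)
      finally show ?thesis using wh(1)[of x x'] by linarith
    qed
    \<comment> \<open>The point value becomes a lower bound for the mass. The Hoelder constant \<open>L\<close> grows linearly in \<open>M\<close> but enters the exponent only through its logarithm.\<close>
    define K where "K = c0\<^sup>2 / (4 * L)"
    have K0: "0 < K" "K \<le> 1"
    proof -
      show "0 < K" using c0 L1 by (simp add: K_def)
      have "c0\<^sup>2 \<le> 1" using c0 by (simp add: power_le_one)
      then show "K \<le> 1" using L1 by (simp add: K_def divide_le_eq)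
    qed
    have K2: "K\<^sup>2 \<le> (\<integral>x. indicator {-3..3} x * (w x)\<^sup>2 \<partial>lborel)"
      unfolding K_def by (rule mass_from_point_value[OF w(2) w(1) hL L1 c0 xs(1)]) (use xs(2) cr in simp)
    have k: "1 + (M + 1)\<^sup>2 + \<bar>ln K\<bar> \<le> (5 + 2 * a) * (1 + M\<^sup>2 + \<bar>ln c0\<bar>)"
    proof -
      have "ln K = 2 * ln c0 - (ln 4 + ln L)" using c0 L1 by (simp add: K_def ln_div ln_mult ln_realpow)
      moreover have "ln c0 \<le> 0" using c0 by simp
      moreover have "0 \<le> ln L" "ln L \<le> a * M" using L1 ln_le_minus_one[of L] by (auto simp: L_def)
      moreover have "0 \<le> ln (4::real)" "ln (4::real) \<le> 2"
      proof -
        have "ln (4::real) = 2 * ln 2" using ln_realpow[of 2 2] by simp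
        then show "0 \<le> ln (4::real)" "ln (4::real) \<le> 2" using ln_2_less_1 by auto
      qed
      ultimately have "\<bar>ln K\<bar> \<le> 2 * \<bar>ln c0\<bar> + 2 + a * M" by linarith
      moreover have "a * M \<le> a * (1 + M\<^sup>2)" using M2(2) a0 by (intro mult_left_mono)
      ultimately have "1 + (M + 1)\<^sup>2 + \<bar>ln K\<bar> \<le> 5 + 2 * M\<^sup>2 + 2 * \<bar>ln c0\<bar> + a * (1 + M\<^sup>2)" using M2(1)[of M] by linarith
      also have "\<dots> \<le> (5 + 2 * a) * (1 + M\<^sup>2 + \<bar>ln c0\<bar>)"
      proof -
        have "0 \<le> 3 * M\<^sup>2 + 3 * \<bar>ln c0\<bar> + a * (1 + M\<^sup>2) + 2 * a * \<bar>ln c0\<bar>" using a0 by simp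
        then show ?thesis by (simp add: algebra_simps)
      qed
      finally show ?thesis .
    qed
    show "Linf_norm {-r<..<r} v \<ge> ereal (c * r powr (C * (1 + M\<^sup>2 + \<bar>ln c0\<bar>)))"
      by (rule main[OF H(1) w wh(2) f H(3) K0 K2 _ _ k]) (use r in auto)
  next
    fix M :: real and q v :: "real \<Rightarrow> real" and K r :: real
    assume "M \<ge> 0 \<and> q \<in> Linf UNIV \<and> v \<in> Linf UNIV \<and> solves q v \<and> Linf_norm UNIV q \<le> ereal M \<and> Linf_norm UNIV v \<le> ereal C0"
    then have H: "M \<ge> 0" "q \<in> Linf UNIV" "v \<in> Linf UNIV" "solves q v" "Linf_norm UNIV q \<le> ereal M" "Linf_norm UNIV v \<le> ereal C0" by auto
    assume "0 < K \<and> K \<le> 1 \<and> L2_norm_on {-2<..<2} v \<ge> K"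
    then have K: "0 < K" "K \<le> 1" "L2_norm_on {-2<..<2} v \<ge> K" by auto
    assume r: "0 < r \<and> r < 1/64"
    obtain w f where w: "\<And>x. \<bar>w x\<bar> \<le> C0" "w \<in> borel_measurable borel" "AE x in lborel. w x = v x"
      and f: "f \<in> borel_measurable borel" "\<And>y. \<bar>f y\<bar> \<le> M * \<bar>w y\<bar>" "\<And>x x'. w x - w x' = fundamental_const * (\<integral>y. f y * riesz_diff x x' y \<partial>lborel)"
      using solution_representation[OF H(1) assms H(2,5,3,6,4)] by blast
    note wh = solution_hoelder[OF H(1) w(1) f]
    have K2: "K\<^sup>2 \<le> (\<integral>x. indicator {-3..3} x * (w x)\<^sup>2 \<partial>lborel)"
      by (rule L2_norm_on_mass[OF H(3) w(3) w(2) w(1)]) (use K in auto)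
    have k: "1 + (M + 1)\<^sup>2 + \<bar>ln K\<bar> \<le> (5 + 2 * a) * (1 + M\<^sup>2 + \<bar>ln K\<bar>)"
    proof -
      have "0 \<le> 2 + 3 * M\<^sup>2 + 4 * \<bar>ln K\<bar> + 2 * a * (1 + M\<^sup>2 + \<bar>ln K\<bar>)" using a0 by simp
      then show ?thesis using M2(1)[of M] by (simp add: algebra_simps)
    qed
    show "Linf_norm {-r<..<r} v \<ge> ereal (c * r powr (C * (1 + M\<^sup>2 + \<bar>ln K\<bar>)))"
      by (rule main[OF H(1) w wh(2) f H(3) K(1,2) K2 _ _ k]) (use r in auto)
  qed simp
qed

end
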